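(* Let $\mu_P$ be the Parisi measure and let $S$ be its support. Let $(X(s))_{0\le s\le1}$ satisfy the stochastic differential equation $$X(s)=h+\int_0^s\alpha_{\mu_P}(w)\zeta(w)\partial_x\Phi_{\mu_P}(w,X(w))\,dw+\int_0^s\zeta(w)^{1/2}\,dB(w),\qquad \forall s\in[0,1].$$ Then for all $q\in S$, $$\mathbb{E}\,\partial_x\Phi_{\mu_P}(q,X(q))^2=q\qquad\text{and}\qquad \zeta(q)\,\mathbb{E}\,\partial_{xx}\Phi_{\mu_P}(q,X(q))^2\le1 .$$
   Context: Let $\beta>0$, $h\in\mathbb{R}$, and let $(\gamma_p)_{p\ge2}$ be a nonnegative sequence, not identically zero, decaying fast enough (e.g. $\sum_{p\ge2}2^p\gamma_p^2<\infty$). Set $\xi(s)=\sum_{p\ge2}\beta^2\gamma_p^2s^p$ for $s\in[-1,1]$ and $\zeta=\xi''$. Let $\mathcal{M}$ be the set of all Borel probability measures on $[0,1]$; for $\mu\in\mathcal{M}$ let $\alpha_\mu(s)=\mu([0,s])$. For $\mu\in\mathcal{M}$, $\Phi_\mu$ denotes the (weak) solution on $[0,1]\times\mathbb{R}$ of the Parisi PDE $$\partial_s\Phi_\mu(s,x)=-\frac{\xi''(s)}{2}\Bigl(\partial_{xx}\Phi_\mu(s,x)+\alpha_\mu(s)(\partial_x\Phi_\mu(s,x))^2\Bigr),\qquad \Phi_\mu(1,x)=\log\cosh x.$$ (For $\mu$ with finitely many atoms it is explicit by the Hopf-Cole transformation: if $\alpha_\mu=m$ on $[a,b)$, then $\Phi_\mu(s,x)=\frac1m\log\mathbb{E}\exp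 m\Phi_\mu(b,x+z\sqrt{\xi'(b)-\xi'(s)})$ for $s\in[a,b)$ with $z$ standard Gaussian, read as $\mathbb{E}\Phi_\mu(b,\cdot)$ if $m=0$; for general $\mu$ it is the limit along atomic measures $\mu_n$ with $\int_0^1|\alpha_{\mu_n}-\alpha_\mu|ds\to0$.) The derivatives $\partial_x\Phi_\mu,\partial_{xx}\Phi_\mu$ exist and $|\partial_x\Phi_\mu|\le1$. The Parisi functional is $\mathcal{P}(\mu)=\log2+\Phi_\mu(0,h)-\frac12\int_0^1\alpha_\mu(s)s\xi''(s)\,ds$. It is strictly convex on $\mathcal{M}$ and has a unique minimizer, called the Parisi measure and denoted $\mu_P$. $B$ is a standard Brownian motion on a filtered probability space satisfying the usual conditions. *)

theory Defs
  imports "HOL-Probability.Probability"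
begin

text \<open>
  Throughout, \<open>\<xi>\<close> is the mixture function; its derivatives \<open>\<xi>'\<close> and \<open>\<xi>''\<close> are
  \<open>deriv \<xi>\<close> and \<open>deriv (deriv \<xi>)\<close>.
\<close>

definition mixture :: "real \<Rightarrow> (nat \<Rightarrow> real) \<Rightarrow> real \<Rightarrow> real" where
  "mixture \<beta> \<gamma> s = (\<Sum>p. \<beta>\<^sup>2 * (\<gamma> (p + 2))\<^sup>2 * s ^ (p + 2))"

text \<open>Probability measures on \<open>[0,1]\<close> are rendered as Borel probability measures on the real line
  that are concentrated on \<open>[0,1]\<close>.\<close>

definition prob_measures_01 :: "real measure set" where
  "prob_measures_01 = {\<mu>. real_distribution \<mu> \<and> measure \<mu> {0..1} = 1}"

definition alpha :: "real measure \<Rightarrow> real \<Rightarrow> real" where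
  "alpha \<mu> s = measure \<mu> {0..s}"

definition support :: "real measure \<Rightarrow> real set" where
  "support \<mu> = {q. \<forall>U. open U \<and> q \<in> U \<longrightarrow> measure \<mu> U > 0}"

definition finitely_atomic :: "real measure \<Rightarrow> bool" where
  "finitely_atomic \<mu> \<longleftrightarrow> (\<exists>A. finite A \<and> measure \<mu> A = 1)"


subsection \<open>The solution of the Parisi PDE\<close>

text \<open>
  The Parisi PDE is
  \<open>\<partial>\<^sub>s \<Phi> = - \<xi>''(s)/2 (\<partial>\<^sub>x\<^sub>x \<Phi> + \<alpha>\<^sub>\<mu>(s) (\<partial>\<^sub>x \<Phi>)\<^sup>2)\<close> on \<open>[0,1] \<times> \<real>\<close> with
  \<open>\<Phi>(1,x) = log cosh x\<close>.  On an interval \<open>[a,b)\<close> where \<open>\<alpha>\<^sub>\<mu>\<close> is a constant \<open>m\<close> it is solved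
  by the Hopf-Cole transformation, \<open>\<Phi>(s,\<cdot>) = hopf_cole m (\<xi>'(b) - \<xi>'(s)) \<Phi>(b,\<cdot>)\<close>.
\<close>

definition hopf_cole :: "real \<Rightarrow> real \<Rightarrow> (real \<Rightarrow> real) \<Rightarrow> real \<Rightarrow> real" where
  "hopf_cole m v f x =
     (if m = 0 then (LINT z|std_normal_distribution. f (x + z * sqrt v))
      else ln (LINT z|std_normal_distribution. exp (m * f (x + z * sqrt v))) / m)"

text \<open>Backward iteration along an increasing list of breakpoints that ends in 1.\<close>

fun hopf_cole_iter :: "(real \<Rightarrow> real) \<Rightarrow> real measure \<Rightarrow> real list \<Rightarrow> real \<Rightarrow> real" where
  "hopf_cole_iter \<xi> \<mu> (a # b # bs) =
     hopf_cole (alpha \<mu> a) (deriv \<xi> b - deriv \<xi> a) (hopf_cole_iter \<xi> \<mu> (b # bs))"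
| "hopf_cole_iter \<xi> \<mu> _ = (\<lambda>x. ln (cosh x))"

text \<open>For \<open>s \<in> [0,1]\<close> the breakpoints are \<open>s\<close>, the atoms in \<open>(s,1)\<close> and \<open>1\<close>; between consecutive
  ones \<open>\<alpha>\<^sub>\<mu>\<close> is constant.\<close>

definition Phi_atomic :: "(real \<Rightarrow> real) \<Rightarrow> real measure \<Rightarrow> real \<Rightarrow> real \<Rightarrow> real" where
  "Phi_atomic \<xi> \<mu> s =
     hopf_cole_iter \<xi> \<mu>
       (sorted_list_of_set ({s, 1} \<union> {a. s < a \<and> a < 1 \<and> measure \<mu> {a} > 0}))"

definition Phi :: "(real \<Rightarrow> real) \<Rightarrow> real measure \<Rightarrow> real \<Rightarrow> real \<Rightarrow> real" where
  "Phi \<xi> \<mu> s x =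
     (THE l. \<forall>\<nu>. (\<forall>n. \<nu> n \<in> prob_measures_01 \<and> finitely_atomic (\<nu> n)) \<and>
                 (\<lambda>n. LBINT t:{0..1}. \<bar>alpha (\<nu> n) t - alpha \<mu> t\<bar>) \<longlonglongrightarrow> 0 \<longrightarrow>
                 (\<lambda>n. Phi_atomic \<xi> (\<nu> n) s x) \<longlonglongrightarrow> l)"

definition dx_Phi :: "(real \<Rightarrow> real) \<Rightarrow> real measure \<Rightarrow> real \<Rightarrow> real \<Rightarrow> real" where
  "dx_Phi \<xi> \<mu> s = deriv (Phi \<xi> \<mu> s)"

definition dxx_Phi :: "(real \<Rightarrow> real) \<Rightarrow> real measure \<Rightarrow> real \<Rightarrow> real \<Rightarrow> real" where
  "dxx_Phi \<xi> \<mu> s = deriv (dx_Phi \<xi> \<mu> s)"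


subsection \<open>The Parisi functional and the Parisi measure\<close>

definition parisi_functional :: "(real \<Rightarrow> real) \<Rightarrow> real \<Rightarrow> real measure \<Rightarrow> real" where
  "parisi_functional \<xi> h \<mu> =
     ln 2 + Phi \<xi> \<mu> 0 h - 1/2 * (LBINT s:{0..1}. alpha \<mu> s * s * deriv (deriv \<xi>) s)"

definition is_parisi_measure :: "(real \<Rightarrow> real) \<Rightarrow> real \<Rightarrow> real measure \<Rightarrow> bool" where
  "is_parisi_measure \<xi> h \<mu> \<longleftrightarrow>
     is_arg_min (parisi_functional \<xi> h) (\<lambda>\<nu>. \<nu> \<in> prob_measures_01) \<mu>"


subsection \<open>Brownian motion and the stochastic differential equation\<close>

definition usual_filtration :: "'a measure \<Rightarrow> (real \<Rightarrow> 'a measure) \<Rightarrow> bool" where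
  "usual_filtration M F \<longleftrightarrow>
     (\<forall>t\<ge>0. subalgebra M (F t)) \<and>
     (\<forall>s t. 0 \<le> s \<and> s \<le> t \<longrightarrow> sets (F s) \<subseteq> sets (F t)) \<and>
     (\<forall>t\<ge>0. sets (F t) = (\<Inter>u\<in>{t<..}. sets (F u))) \<and>
     (\<forall>N\<in>null_sets M. \<forall>A. A \<subseteq> N \<longrightarrow> A \<in> sets (F 0))"

text \<open>\<open>normal_density\<close> takes the standard deviation as its second argument.\<close>

definition brownian_motion ::
    "'a measure \<Rightarrow> (real \<Rightarrow> 'a measure) \<Rightarrow> (real \<Rightarrow> 'a \<Rightarrow> real) \<Rightarrow> bool" where
  "brownian_motion M F B \<longleftrightarrow>
     (\<forall>t\<ge>0. B t \<in> borel_measurable (F t)) \<and>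
     (AE \<omega> in M. B 0 \<omega> = 0) \<and>
     (AE \<omega> in M. continuous_on {0..} (\<lambda>t. B t \<omega>)) \<and>
     (\<forall>s t. 0 \<le> s \<and> s < t \<longrightarrow>
        distributed M lborel (\<lambda>\<omega>. B t \<omega> - B s \<omega>) (normal_density 0 (sqrt (t - s))) \<and>
        prob_space.indep_set M (sets (F s))
          {(\<lambda>\<omega>. B t \<omega> - B s \<omega>) -` A \<inter> space M | A. A \<in> sets borel})"

text \<open>
  The stochastic integral of a deterministic integrand \<open>f\<close> over \<open>[0,t]\<close>: the \<open>L\<^sup>2\<close>-limit of the
  elementary integrals of step functions converging to \<open>f\<close> in \<open>L\<^sup>2[0,t]\<close>.  A list of triples
  \<open>(c,a,b)\<close> stands for the step function \<open>\<Sum> c 1\<^bsub>(a,b]\<^esub>\<close>.  By the isometry the limit does not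
  depend on the approximating sequence, up to null sets.
\<close>

definition step_fun :: "(real \<times> real \<times> real) list \<Rightarrow> real \<Rightarrow> real" where
  "step_fun S w = (\<Sum>(c, a, b)\<leftarrow>S. c * indicator {a<..b} w)"

definition step_integral ::
    "(real \<Rightarrow> 'a \<Rightarrow> real) \<Rightarrow> (real \<times> real \<times> real) list \<Rightarrow> 'a \<Rightarrow> real" where
  "step_integral B S \<omega> = (\<Sum>(c, a, b)\<leftarrow>S. c * (B b \<omega> - B a \<omega>))"

definition is_stochastic_integral ::
    "'a measure \<Rightarrow> (real \<Rightarrow> 'a \<Rightarrow> real) \<Rightarrow> (real \<Rightarrow> real) \<Rightarrow> real \<Rightarrow> ('a \<Rightarrow> real) \<Rightarrow> bool" where
  "is_stochastic_integral M B f t J \<longleftrightarrow>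
     set_borel_measurable borel {0..t} f \<and> J \<in> borel_measurable M \<and>
     (\<exists>S. (\<forall>n. \<forall>(c, a, b)\<in>set (S n). 0 \<le> a \<and> a \<le> b \<and> b \<le> t) \<and>
          (\<lambda>n. \<integral>\<^sup>+w\<in>{0..t}. ennreal ((step_fun (S n) w - f w)\<^sup>2) \<partial>lborel) \<longlonglongrightarrow> 0 \<and>
          (\<lambda>n. \<integral>\<^sup>+\<omega>. ennreal ((step_integral B (S n) \<omega> - J \<omega>)\<^sup>2) \<partial>M) \<longlonglongrightarrow> 0)"

text \<open>\<open>X\<close> is a continuous adapted solution on \<open>[0,1]\<close> of
  \<open>dX = \<alpha>\<^sub>\<mu> \<xi>'' \<partial>\<^sub>x\<Phi>\<^sub>\<mu>(\<cdot>,X) dw + \<surd>\<xi>'' dB\<close>, \<open>X(0) = h\<close>; \<open>J\<close> is the continuous version of the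
  stochastic integral process.\<close>

definition solves_parisi_sde ::
    "'a measure \<Rightarrow> (real \<Rightarrow> 'a measure) \<Rightarrow> (real \<Rightarrow> 'a \<Rightarrow> real) \<Rightarrow> (real \<Rightarrow> real) \<Rightarrow> real \<Rightarrow>
     real measure \<Rightarrow> (real \<Rightarrow> 'a \<Rightarrow> real) \<Rightarrow> bool" where
  "solves_parisi_sde M F B \<xi> h \<mu> X \<longleftrightarrow>
     (\<forall>s\<in>{0..1}. X s \<in> borel_measurable (F s)) \<and>
     (AE \<omega> in M. continuous_on {0..1} (\<lambda>s. X s \<omega>)) \<and>
     (\<exists>J. (\<forall>s\<in>{0..1}. is_stochastic_integral M B (\<lambda>w. sqrt (deriv (deriv \<xi>) w)) s (J s)) \<and>
          (AE \<omega> in M. continuous_on {0..1} (\<lambda>s. J s \<omega>)) \<and>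
          (AE \<omega> in M. \<forall>s\<in>{0..1}. X s \<omega> =
             h + (LBINT w:{0..s}. alpha \<mu> w * deriv (deriv \<xi>) w * dx_Phi \<xi> \<mu> w (X w \<omega>))
               + J s \<omega>))"

end

theory Submission
  imports Defs
begin

text \<open>
  Write \<open>u = \<partial>\<^sub>x \<Phi>\<^sub>\<mu>\<close>, \<open>\<psi>(s) = E u(s, X(s))\<^sup>2\<close> and \<open>\<Gamma>(q)\<close> for the integral of \<open>\<zeta>(s) (\<psi>(s) - s)\<close> over
  \<open>[q,1]\<close>.  Ito's formula for \<open>\<Phi>\<^sub>\<nu>(s, X(s))\<close>, with \<open>\<nu>\<close> a mixture of \<open>\<mu>\<close> and another measure, gives
  the derivative of the Parisi functional at \<open>\<mu>\<close> in the direction \<open>\<nu> - \<mu>\<close>: half the integral of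
  \<open>\<zeta>(s) (\<alpha>\<^sub>\<nu>(s) - \<alpha>\<^sub>\<mu>(s)) (\<psi>(s) - s)\<close>.  At a minimizer it is nonnegative.  Dirac masses \<open>\<nu>\<close> then show
  that \<open>\<Gamma>\<close> is at least its own \<open>\<mu>\<close>-average, so every point of the support minimizes \<open>\<Gamma>\<close>.  As \<open>\<zeta> > 0\<close> on
  \<open>(0,1]\<close> and \<open>0 \<le> \<psi> \<le> 1\<close>, a minimum of \<open>\<Gamma>\<close> at \<open>q\<close> forces \<open>\<psi>(q) = q\<close>.  Moreover \<open>u(s, X(s))\<close> is a
  martingale with noise coefficient \<open>\<zeta>\<^sup>1\<^sup>/\<^sup>2 \<partial>\<^sub>x\<^sub>x \<Phi>\<^sub>\<mu>\<close>, so \<open>\<psi>\<close> has right derivative at least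
  \<open>\<zeta>(q) E \<partial>\<^sub>x\<^sub>x\<Phi>\<^sub>\<mu>(q, X(q))\<^sup>2\<close> at \<open>q\<close>; if this exceeded 1, \<open>\<psi>(s) > s\<close> just to the right of \<open>q\<close>, and \<open>\<Gamma>\<close>
  would decrease there.  At \<open>q = 1\<close> one uses \<open>0 \<le> \<partial>\<^sub>x\<^sub>x\<Phi> \<le> 1 - (\<partial>\<^sub>x\<Phi>)\<^sup>2\<close> instead.

  Neither the PDE nor a stochastic calculus is needed: over a time step of length \<open>d\<close> the Hopf-Cole
  formula yields the PDE up to an error of order \<open>d\<^sup>4\<^sup>/\<^sup>3\<close>, uniformly in the atomic measure, and Ito's formula
  for expectations follows by adding up time steps.
\<close>

subsection \<open>Gaussian integrals\<close>

text \<open>\<open>Phi\<close> is defined only as a limit along atomic measures, so no regularity is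
  given: every estimate is proved for finitely many atoms, with constants that depend on the bound K
  for \<zeta> and not on the number of atoms, and then passes to the limit. The hard invariant is a
  Lipschitz bound in x for the second derivative. A Hopf-Cole step of variance v enlarges it only by
  a term of order v, because the unwanted terms are covariances of Lipschitz functions under a
  tilted Gaussian.

  The exponent 4/3 comes from interpolation: \<Phi> is Lipschitz in time and its second space
  derivative is Lipschitz in space, so the first and second space derivatives are Hoelder in time
  with exponents 2/3 and 1/3. Freezing them over a step of length d costs at most d * d^(1/3), and
  about 1/d steps leave d^(1/3).

  Three facts about an increment \<Delta> of the stochastic integral over [s,t] enter: \<Delta> has
  mean zero and \<Delta>^2 has mean \<open>\<xi>' t - \<xi>' s\<close>, both also against bounded
  variables known at time s, and the fourth moment is at most three times the squared
  variance.\<close>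

abbreviation "gauss \<equiv> std_normal_distribution"

lemma gauss_prob_space: "prob_space gauss"
  by (rule prob_space_normal_density) simp

lemma gauss_integrable_iff:
  fixes g :: "real \<Rightarrow> real"
  assumes "g \<in> borel_measurable borel"
  shows "integrable gauss g \<longleftrightarrow> integrable lborel (\<lambda>z. std_normal_density z * g z)"
  using assms by (subst integrable_density) auto

lemma gauss_integral:
  fixes g :: "real \<Rightarrow> real"
  assumes "g \<in> borel_measurable borel"
  shows "(\<integral>z. g z \<partial>gauss) = (\<integral>z. std_normal_density z * g z \<partial>lborel)"
  using assms by (subst integral_density) auto

text \<open>Completing the square: against the standard density, \<open>exp (c * z)\<close> is a
  constant times the normal density with mean c.\<close>

lemma gauss_exp: "integrable gauss (\<lambda>z. exp (c * z))"
proof -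
  have "std_normal_density z * exp (c * z) = exp (c\<^sup>2 / 2) * normal_density c 1 z" for z
    by (simp add: normal_density_def mult_exp_exp power2_eq_square) (simp add: field_simps)
  then show ?thesis
    by (subst gauss_integrable_iff) auto
qed

lemma gauss_exp_abs: "integrable gauss (\<lambda>z. exp (c * \<bar>z\<bar>))"
proof (rule Bochner_Integration.integrable_bound)
  show "integrable gauss (\<lambda>z. exp (c * z) + exp (-c * z))"
    by (intro Bochner_Integration.integrable_add gauss_exp)
  have "exp (c * \<bar>z\<bar>) \<le> exp (c * z) + exp (- c * z)" for z :: real
    by (cases "z \<ge> 0") auto
  then show "AE z in gauss. norm (exp (c * \<bar>z\<bar>)) \<le> norm (exp (c * z) + exp (- c * z))"
    by (intro AE_I2) (auto intro: order_trans[OF _ abs_ge_self])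
qed auto

text \<open>One term of the exponential series dominates the polynomial, (1 + |z|)^k \<le> k! exp (1
  + |z|), at the price of raising c by 1.\<close>

lemma gauss_poly_exp: "integrable gauss (\<lambda>z. (1 + \<bar>z\<bar>) ^ k * exp (c * \<bar>z\<bar>))"
proof (rule Bochner_Integration.integrable_bound)
  show "integrable gauss (\<lambda>z. fact k * exp 1 * exp ((c + 1) * \<bar>z\<bar>))"
    by (intro integrable_mult_right gauss_exp_abs)
  have "(1 + \<bar>z\<bar>) ^ k \<le> fact k * exp (1 + \<bar>z\<bar>)" for z :: real
  proof -
    have "(\<Sum>n\<in>{k}. (1 + \<bar>z\<bar>) ^ n /\<^sub>R fact n) \<le> (\<Sum>n. (1 + \<bar>z\<bar>) ^ n /\<^sub>R fact n)"
      by (intro sum_le_suminf summable_exp_generic) auto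
    then have "(1 + \<bar>z\<bar>) ^ k /\<^sub>R fact k \<le> exp (1 + \<bar>z\<bar>)"
      by (simp add: exp_def)
    then show ?thesis
      by (simp add: field_simps)
  qed
  then have "(1 + \<bar>z\<bar>) ^ k * exp (c * \<bar>z\<bar>) \<le> fact k * exp (1 + \<bar>z\<bar>) * exp (c * \<bar>z\<bar>)" for z :: real
    by (intro mult_right_mono) auto
  then have "(1 + \<bar>z\<bar>) ^ k * exp (c * \<bar>z\<bar>) \<le> fact k * exp 1 * exp ((c + 1) * \<bar>z\<bar>)" for z :: real
    by (simp add: exp_add ring_distribs mult_ac)
  then show "AE z in gauss. norm ((1 + \<bar>z\<bar>) ^ k * exp (c * \<bar>z\<bar>))
      \<le> norm (fact k * exp 1 * exp ((c + 1) * \<bar>z\<bar>))"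
    by (auto intro!: AE_I2 simp: abs_mult)
qed auto

lemma gauss_mean: "integrable gauss (\<lambda>z. z)" "(\<integral>z. z \<partial>gauss) = 0"
  using integrable_std_normal_moment[of 1] integral_std_normal_moment_odd[of 0]
  by (simp_all add: gauss_integrable_iff gauss_integral)

lemma gauss_variance: "integrable gauss (\<lambda>z. z\<^sup>2)" "(\<integral>z. z\<^sup>2 \<partial>gauss) = 1"
  using integrable_std_normal_moment[of 2] integral_std_normal_moment_even[of 1]
  by (simp_all add: gauss_integrable_iff gauss_integral)

text \<open>The variance v may have any sign: the real \<open>sqrt\<close> is odd, so the modulus of
  \<open>sqrt v\<close> is \<open>sqrt \<bar>v\<bar>\<close>. Evaluating the growth bound at 0 gives
  the sign of C.\<close>

lemma gauss_shift_bound: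
  fixes G :: "real \<Rightarrow> real"
  assumes "\<And>y. \<bar>G y\<bar> \<le> C * exp (k * \<bar>y\<bar>)" "0 \<le> k"
  shows "\<bar>G (x + z * sqrt v)\<bar> \<le> C * exp (k * \<bar>x\<bar>) * exp (k * sqrt \<bar>v\<bar> * \<bar>z\<bar>)"
proof -
  have "0 \<le> C * exp (k * \<bar>0\<bar>)"
    using assms(1)[of 0] abs_ge_zero order_trans by blast
  then have C: "0 \<le> C"
    by simp
  have "\<bar>sqrt v\<bar> = sqrt \<bar>v\<bar>"
    by (simp add: real_sqrt_abs2 abs_if real_sqrt_minus)
  then have "\<bar>x + z * sqrt v\<bar> \<le> \<bar>x\<bar> + sqrt \<bar>v\<bar> * \<bar>z\<bar>"
    by (metis abs_mult abs_triangle_ineq mult.commute)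
  then have "k * \<bar>x + z * sqrt v\<bar> \<le> k * (\<bar>x\<bar> + sqrt \<bar>v\<bar> * \<bar>z\<bar>)"
    using assms(2) by (rule mult_left_mono)
  then have "C * exp (k * \<bar>x + z * sqrt v\<bar>) \<le> C * exp (k * \<bar>x\<bar> + k * sqrt \<bar>v\<bar> * \<bar>z\<bar>)"
    using C by (intro mult_left_mono) (auto simp: algebra_simps)
  then show ?thesis
    using assms(1)[of "x + z * sqrt v"] by (simp add: exp_add mult.assoc)
qed

lemma gauss_integrable:
  fixes G :: "real \<Rightarrow> real"
  assumes "G \<in> borel_measurable borel" "\<And>y. \<bar>G y\<bar> \<le> C * exp (k * \<bar>y\<bar>)" "0 \<le> k"
  shows "integrable gauss (\<lambda>z. G (x + z * sqrt v))"
proof (rule Bochner_Integration.integrable_bound)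
  show "integrable gauss (\<lambda>z. C * exp (k * \<bar>x\<bar>) * exp (k * sqrt \<bar>v\<bar> * \<bar>z\<bar>))"
    by (intro integrable_mult_right gauss_exp_abs)
  show "AE z in gauss. norm (G (x + z * sqrt v)) \<le> norm (C * exp (k * \<bar>x\<bar>) * exp (k * sqrt \<bar>v\<bar> * \<bar>z\<bar>))"
    using gauss_shift_bound[OF assms(2,3)] by (auto intro!: AE_I2 intro: order_trans[OF _ abs_ge_self])
qed (use assms(1) in auto)

text \<open>A derivative is a limit of difference quotients of a continuous function, so it is
  measurable even where it is discontinuous. This covers the third derivatives below, of which only
  boundedness is known.\<close>

lemma derivative_borel_measurable:
  fixes G G' :: "real \<Rightarrow> real"
  assumes "\<And>x. (G has_real_derivative G' x) (at x)"
  shows "G' \<in> borel_measurable borel"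
proof (rule borel_measurable_LIMSEQ_real)
  show "(\<lambda>n. (G (x + inverse (real (Suc n))) - G x) / inverse (real (Suc n))) \<longlonglongrightarrow> G' x" for x
  proof -
    have "((\<lambda>h. (G (x + h) - G x) / h) \<longlongrightarrow> G' x) (at 0)"
      using assms[of x] by (simp add: DERIV_def)
    moreover have "filterlim (\<lambda>n. inverse (real (Suc n))) (at 0) sequentially"
      by (rule filterlim_atI[OF LIMSEQ_inverse_real_of_nat]) auto
    ultimately show ?thesis
      by (rule filterlim_compose)
  qed
  have "continuous_on UNIV G"
    using assms by (meson DERIV_isCont continuous_at_imp_continuous_on)
  then have [measurable]: "G \<in> borel_measurable borel"
    by (rule borel_measurable_continuous_onI)
  show "(\<lambda>x. (G (x + inverse (real (Suc n))) - G x) / inverse (real (Suc n))) \<in> borel_measurable borel" for n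
    by measurable
qed

lemma deriv_imp_measurable:
  fixes G G' :: "real \<Rightarrow> real"
  assumes "\<And>x. (G has_real_derivative G' x) (at x)"
  shows "G \<in> borel_measurable borel"
  using assms by (meson DERIV_isCont continuous_at_imp_continuous_on borel_measurable_continuous_onI)

text \<open>Dominated convergence along sequences: a convergent sequence stays in some [-R,R], where
  the mean value theorem bounds the difference quotients by the growth bound for G', and exponential
  growth is integrable against the Gaussian.\<close>

lemma gauss_deriv:
  fixes G G' :: "real \<Rightarrow> real"
  assumes d: "\<And>y. (G has_real_derivative G' y) (at y)"
    and b: "\<And>y. \<bar>G y\<bar> \<le> C * exp (k * \<bar>y\<bar>)" "\<And>y. \<bar>G' y\<bar> \<le> C * exp (k * \<bar>y\<bar>)" "0 \<le> k"
  shows "((\<lambda>x. \<integral>z. G (x + z * sqrt v) \<partial>gauss) has_real_derivative (\<integral>z. G' (x + z * sqrt v) \<partial>gauss)) (at x)"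
proof -
  note [measurable] = deriv_imp_measurable[OF d] derivative_borel_measurable[OF d]
  have int: "integrable gauss (\<lambda>z. G (y + z * sqrt v))" for y
    by (rule gauss_integrable[OF _ b(1,3)]) simp
  have C: "0 \<le> C"
    using order_trans[OF abs_ge_zero b(1)[of 0]] by simp
  show ?thesis
    unfolding has_field_derivative_iff tendsto_at_iff_sequentially
  proof (intro allI impI)
      fix X :: "nat \<Rightarrow> real"
      assume X: "\<forall>i. X i \<in> UNIV - {x}" "X \<longlonglongrightarrow> x"
      have "Bseq X"
        using X(2) convergent_def convergent_imp_Bseq by blast
      then obtain R where R: "\<And>i. \<bar>X i\<bar> \<le> R"
        by (auto simp: Bseq_def)
      have xR: "\<bar>x\<bar> \<le> R"
        by (rule LIMSEQ_le_const2[OF tendsto_rabs[OF X(2)]]) (use R in auto)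
      have "(\<lambda>i. \<integral>z. (G (X i + z * sqrt v) - G (x + z * sqrt v)) / (X i - x) \<partial>gauss)
          \<longlonglongrightarrow> (\<integral>z. G' (x + z * sqrt v) \<partial>gauss)"
      proof (rule integral_dominated_convergence[where w="\<lambda>z. C * exp (k * R) * exp (k * sqrt \<bar>v\<bar> * \<bar>z\<bar>)"])
        show "integrable gauss (\<lambda>z. C * exp (k * R) * exp (k * sqrt \<bar>v\<bar> * \<bar>z\<bar>))"
          by (intro integrable_mult_right gauss_exp_abs)
        show "AE z in gauss. (\<lambda>i. (G (X i + z * sqrt v) - G (x + z * sqrt v)) / (X i - x))
            \<longlonglongrightarrow> G' (x + z * sqrt v)"
        proof (rule AE_I2)
          fix z
          have "((\<lambda>y. (G y - G (x + z * sqrt v)) / (y - (x + z * sqrt v))) \<longlongrightarrow> G' (x + z * sqrt v))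
            (at (x + z * sqrt v))"
            using d by (simp add: has_field_derivative_iff)
          moreover have "filterlim (\<lambda>i. X i + z * sqrt v) (at (x + z * sqrt v)) sequentially"
            using X by (intro filterlim_atI tendsto_intros) auto
          ultimately show "(\<lambda>i. (G (X i + z * sqrt v) - G (x + z * sqrt v)) / (X i - x))
              \<longlonglongrightarrow> G' (x + z * sqrt v)"
            using filterlim_compose[of "\<lambda>y. (G y - G (x + z * sqrt v)) / (y - (x + z * sqrt v))"] by fastforce
        qed
        show "AE z in gauss. norm ((G (X i + z * sqrt v) - G (x + z * sqrt v)) / (X i - x))
            \<le> C * exp (k * R) * exp (k * sqrt \<bar>v\<bar> * \<bar>z\<bar>)" for i
        proof (rule AE_I2)
          fix z
          let ?B = "C * exp (k * R) * exp (k * sqrt \<bar>v\<bar> * \<bar>z\<bar>)"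
          have "norm (G (X i + z * sqrt v) - G (x + z * sqrt v)) \<le> ?B * norm ((X i + z * sqrt v) - (x + z * sqrt v))"
          proof (rule field_differentiable_bound[where S="{-R + z * sqrt v..R + z * sqrt v}" and f'=G'])
            fix y assume y: "y \<in> {-R + z * sqrt v..R + z * sqrt v}"
            have "\<bar>G' ((y - z * sqrt v) + z * sqrt v)\<bar> \<le> C * exp (k * \<bar>y - z * sqrt v\<bar>) * exp (k * sqrt \<bar>v\<bar> * \<bar>z\<bar>)"
              by (rule gauss_shift_bound[OF b(2,3)])
            also have "\<dots> \<le> ?B"
              using y C b(3) by (intro mult_right_mono mult_left_mono) (auto simp: abs_if intro: mult_left_mono)
            finally show "norm (G' y) \<le> ?B" by simp
          next
            show "X i + z * sqrt v \<in> {-R + z * sqrt v..R + z * sqrt v}" "x + z * sqrt v \<in> {-R + z * sqrt v..R + z * sqrt v}"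
              using R[of i] xR by (auto simp: abs_le_iff)
          qed (use d in \<open>auto intro: has_field_derivative_at_within\<close>)
          then show "norm ((G (X i + z * sqrt v) - G (x + z * sqrt v)) / (X i - x)) \<le> ?B"
            using X(1)[rule_format, of i] by (simp add: abs_mult divide_le_eq)
        qed
      qed auto
      moreover have "(\<integral>z. (G (X i + z * sqrt v) - G (x + z * sqrt v)) / (X i - x) \<partial>gauss)
          = ((\<integral>z. G (X i + z * sqrt v) \<partial>gauss) - (\<integral>z. G (x + z * sqrt v) \<partial>gauss)) / (X i - x)" for i
        using int by simp
      ultimately show "((\<lambda>y. ((\<integral>z. G (y + z * sqrt v) \<partial>gauss) - (\<integral>z. G (x + z * sqrt v) \<partial>gauss)) / (y - x)) \<circ> X)
        \<longlonglongrightarrow> (\<integral>z. G' (x + z * sqrt v) \<partial>gauss)"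
        unfolding comp_def by (simp only:)
  qed
qed

text \<open>Two independent Gaussians of variances v and w add up to one of variance v + w. Zero
  variances are split off because \<open>normal_density\<close> needs a positive standard
  deviation.\<close>

lemma gauss_semigroup:
  fixes G :: "real \<Rightarrow> real"
  assumes [measurable]: "G \<in> borel_measurable borel"
    and b: "\<And>y. \<bar>G y\<bar> \<le> C * exp (k * \<bar>y\<bar>)" "0 \<le> k" and v: "0 \<le> v" "0 \<le> w"
  shows "(\<integral>z. (\<integral>y. G ((x + z * sqrt v) + y * sqrt w) \<partial>gauss) \<partial>gauss) = (\<integral>z. G (x + z * sqrt (v + w)) \<partial>gauss)"
proof (cases "v = 0 \<or> w = 0")
  case True
  interpret prob_space gauss by (rule gauss_prob_space)
  show ?thesis using True prob_space by auto
next
  case False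
  with v have v: "0 < v" "0 < w" by auto
  \<comment> \<open>The two coordinates on the product of \<open>gauss\<close> with itself serve as
    the independent variables.\<close>
  interpret P: prob_space gauss by (rule gauss_prob_space)
  interpret PP: pair_prob_space gauss gauss ..
  have f: "distr (gauss \<Otimes>\<^sub>M gauss) borel fst = gauss"
    using P.distr_pair_fst[of gauss] by (subst distr_cong[of _ _ borel gauss _ fst]) auto
  have s: "distr (gauss \<Otimes>\<^sub>M gauss) borel snd = gauss"
  proof (rule measure_eqI)
    fix A assume "A \<in> sets (distr (gauss \<Otimes>\<^sub>M gauss) borel snd)"
    then have A: "A \<in> sets borel" by simp
    have "snd -` A \<inter> space (gauss \<Otimes>\<^sub>M gauss) = UNIV \<times> A"
      by (auto simp: space_pair_measure)
    then have "emeasure (distr (gauss \<Otimes>\<^sub>M gauss) borel snd) A = emeasure gauss UNIV * emeasure gauss A"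
      using A by (subst emeasure_distr) (auto simp: P.emeasure_pair_measure_Times)
    then show "emeasure (distr (gauss \<Otimes>\<^sub>M gauss) borel snd) A = emeasure gauss A"
      using P.emeasure_space_1 by simp
  qed simp
  have i: "PP.indep_var borel fst borel snd"
  proof (subst PP.indep_var_distribution_eq, intro conjI)
    show "distr (gauss \<Otimes>\<^sub>M gauss) borel fst \<Otimes>\<^sub>M distr (gauss \<Otimes>\<^sub>M gauss) borel snd =
        distr (gauss \<Otimes>\<^sub>M gauss) (borel \<Otimes>\<^sub>M borel) (\<lambda>x. (fst x, snd x))"
      unfolding f s using distr_id2[of "borel \<Otimes>\<^sub>M borel" "gauss \<Otimes>\<^sub>M gauss"]
      by (simp cong: sets_pair_measure_cong)
  qed auto
  have 1: "distributed (gauss \<Otimes>\<^sub>M gauss) lborel fst std_normal_density"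
    "distributed (gauss \<Otimes>\<^sub>M gauss) lborel snd std_normal_density"
    using f s distr_cong[OF refl sets_lborel, of "gauss \<Otimes>\<^sub>M gauss" fst fst]
      distr_cong[OF refl sets_lborel, of "gauss \<Otimes>\<^sub>M gauss" snd snd]
    unfolding distributed_def by simp_all
  have 2: "distributed (gauss \<Otimes>\<^sub>M gauss) lborel (\<lambda>p. 0 + sqrt v * fst p) (normal_density (0 + sqrt v * 0) (\<bar>sqrt v\<bar> * 1))"
    "distributed (gauss \<Otimes>\<^sub>M gauss) lborel (\<lambda>p. 0 + sqrt w * snd p) (normal_density (0 + sqrt w * 0) (\<bar>sqrt w\<bar> * 1))"
    using v by (intro PP.normal_density_affine 1; force)+
  have 3: "PP.indep_var borel ((\<lambda>a. 0 + sqrt v * a) \<circ> fst) borel ((\<lambda>a. 0 + sqrt w * a) \<circ> snd)"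
    by (rule PP.indep_var_compose[OF i]) auto
  have 4: "distributed (gauss \<Otimes>\<^sub>M gauss) lborel (\<lambda>p. (0 + sqrt v * fst p) + (0 + sqrt w * snd p))
      (normal_density ((0 + sqrt v * 0) + (0 + sqrt w * 0)) (sqrt ((\<bar>sqrt v\<bar> * 1)\<^sup>2 + (\<bar>sqrt w\<bar> * 1)\<^sup>2)))"
    using v by (intro PP.add_indep_normal 3[unfolded comp_def] 2) auto
  have 5: "distributed gauss lborel (\<lambda>z. 0 + sqrt (v + w) * z) (normal_density (0 + sqrt (v + w) * 0) (\<bar>sqrt (v + w)\<bar> * 1))"
    using v by (intro P.normal_density_affine) (simp_all add: distributed_def distr_id2)
  have 6: "integrable (gauss \<Otimes>\<^sub>M gauss) (\<lambda>p. G (x + (sqrt v * fst p + sqrt w * snd p)))"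
    using gauss_integrable[OF assms(1) b, of x "v + w"] v
      distributed_integrable[OF 4, of "\<lambda>z. G (x + z)"] distributed_integrable[OF 5, of "\<lambda>z. G (x + z)"]
    by (simp add: mult.commute)
  have "(\<integral>z. (\<integral>y. G ((x + z * sqrt v) + y * sqrt w) \<partial>gauss) \<partial>gauss)
      = (\<integral>p. G (x + (sqrt v * fst p + sqrt w * snd p)) \<partial>(gauss \<Otimes>\<^sub>M gauss))"
    by (subst PP.integral_fst'[OF 6, symmetric]) (simp add: algebra_simps)
  also have "\<dots> = (\<integral>z. normal_density 0 (sqrt (v + w)) z * G (x + z) \<partial>lborel)"
    using distributed_integral[OF 4, of "\<lambda>z. G (x + z)"] v by simp
  also have "\<dots> = (\<integral>z. G (x + z * sqrt (v + w)) \<partial>gauss)"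
    using distributed_integral[OF 5, of "\<lambda>z. G (x + z)"] v by (simp add: mult.commute)
  finally show ?thesis .
qed

subsection \<open>Exponential tilting\<close>

text \<open>Subtracting the constants a0 and b0 does not change a covariance. The mean of the
  product is then at most \<alpha> \<beta> E w^2, and the product of the means at most \<alpha>
  \<beta> (E w)^2, which is no larger.\<close>

lemma (in prob_space) covariance_bound:
  fixes a b w :: "'a \<Rightarrow> real"
  assumes [measurable]: "a \<in> borel_measurable M" "b \<in> borel_measurable M" "w \<in> borel_measurable M"
    and w: "integrable M (\<lambda>x. (w x)\<^sup>2)" "\<And>x. 0 \<le> w x"
    and a: "\<And>x. \<bar>a x - a0\<bar> \<le> \<alpha> * w x" "0 \<le> \<alpha>" and b: "\<And>x. \<bar>b x - b0\<bar> \<le> \<beta> * w x" "0 \<le> \<beta>"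
  shows "\<bar>expectation (\<lambda>x. a x * b x) - expectation a * expectation b\<bar> \<le> 2 * \<alpha> * \<beta> * expectation (\<lambda>x. (w x)\<^sup>2)"
proof -
  have wi: "integrable M w"
    using square_integrable_imp_integrable[OF _ w(1)] by simp
  have ai: "integrable M (\<lambda>x. a x - a0)"
    by (rule Bochner_Integration.integrable_bound[of M "\<lambda>x. \<alpha> * w x"]) (use wi a w(2) in \<open>auto simp: abs_mult\<close>)
  have bi: "integrable M (\<lambda>x. b x - b0)"
    by (rule Bochner_Integration.integrable_bound[of M "\<lambda>x. \<beta> * w x"]) (use wi b w(2) in \<open>auto simp: abs_mult\<close>)
  have ab: "\<bar>(a x - a0) * (b x - b0)\<bar> \<le> \<alpha> * \<beta> * (w x)\<^sup>2" for x
    using mult_mono[OF a(1)[of x] b(1)[of x]] a(2) w(2)[of x] by (simp add: abs_mult power2_eq_square mult_ac)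
  have abi: "integrable M (\<lambda>x. (a x - a0) * (b x - b0))"
    by (rule Bochner_Integration.integrable_bound[of M "\<lambda>x. \<alpha> * \<beta> * (w x)\<^sup>2"])
      (use w(1) ab in \<open>auto intro: order_trans[OF _ abs_ge_self]\<close>)
  have ai': "integrable M a" and bi': "integrable M b"
    using Bochner_Integration.integrable_add[OF ai integrable_const[of a0]]
      Bochner_Integration.integrable_add[OF bi integrable_const[of b0]] by simp_all
  have "(\<lambda>x. a x * b x) = (\<lambda>x. (a x - a0) * (b x - b0) + a0 * b x + b0 * a x - a0 * b0)"
    by (auto simp: algebra_simps)
  then have "expectation (\<lambda>x. a x * b x) = expectation (\<lambda>x. (a x - a0) * (b x - b0) + a0 * b x + b0 * a x - a0 * b0)"
    by simp
  also have "\<dots> = expectation (\<lambda>x. (a x - a0) * (b x - b0)) + a0 * expectation b + b0 * expectation a - a0 * b0"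
    using abi ai' bi' by (simp add: prob_space)
  finally have eq: "expectation (\<lambda>x. a x * b x) - expectation a * expectation b
      = expectation (\<lambda>x. (a x - a0) * (b x - b0)) - expectation (\<lambda>x. a x - a0) * expectation (\<lambda>x. b x - b0)"
    using ai' bi' by (simp add: prob_space algebra_simps)
  have "\<bar>expectation (\<lambda>x. (a x - a0) * (b x - b0))\<bar> \<le> expectation (\<lambda>x. \<alpha> * \<beta> * (w x)\<^sup>2)"
    using w(1) abi ab by (intro order_trans[OF integral_abs_bound] integral_mono) auto
  moreover have "\<bar>expectation (\<lambda>x. a x - a0)\<bar> \<le> expectation (\<lambda>x. \<alpha> * w x)"
    using wi ai a by (intro order_trans[OF integral_abs_bound] integral_mono) auto
  moreover have "\<bar>expectation (\<lambda>x. b x - b0)\<bar> \<le> expectation (\<lambda>x. \<beta> * w x)"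
    using wi bi b by (intro order_trans[OF integral_abs_bound] integral_mono) auto
  moreover have "0 \<le> expectation w"
    using w(2) by simp
  ultimately have "\<bar>expectation (\<lambda>x. a x * b x) - expectation a * expectation b\<bar>
      \<le> \<alpha> * \<beta> * expectation (\<lambda>x. (w x)\<^sup>2) + (\<alpha> * expectation w) * (\<beta> * expectation w)"
    unfolding eq using wi w(1) a(2) b(2)
    by (intro order_trans[OF abs_triangle_ineq4] add_mono) (auto simp: abs_mult intro!: mult_mono)
  moreover have "(expectation w)\<^sup>2 \<le> expectation (\<lambda>x. (w x)\<^sup>2)"
    using variance_eq[OF wi w(1)] variance_positive[of w] by simp
  then have "\<alpha> * \<beta> * (expectation w)\<^sup>2 \<le> \<alpha> * \<beta> * expectation (\<lambda>x. (w x)\<^sup>2)"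
    using a(2) b(2) by (intro mult_left_mono) auto
  ultimately show ?thesis
    by (simp add: power2_eq_square mult_ac)
qed

text \<open>The Gibbs average with weight \<open>exp (m * f)\<close>, which is what differentiating
  a Hopf-Cole transform produces.\<close>

definition tilt :: "real \<Rightarrow> real \<Rightarrow> (real \<Rightarrow> real) \<Rightarrow> (real \<Rightarrow> real) \<Rightarrow> real \<Rightarrow> real" where
  "tilt m v f g x = (\<integral>z. g (x + z * sqrt v) * exp (m * f (x + z * sqrt v)) \<partial>gauss)
    / (\<integral>z. exp (m * f (x + z * sqrt v)) \<partial>gauss)"

text \<open>A law for the noise z rather than for the shifted point, so that moments of |z| can be
  bounded uniformly in x.\<close>

definition tilted :: "real \<Rightarrow> real \<Rightarrow> (real \<Rightarrow> real) \<Rightarrow> real \<Rightarrow> real measure" where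
  "tilted m v f x = density gauss (\<lambda>z. ennreal (exp (m * f (x + z * sqrt v)) / (\<integral>z. exp (m * f (x + z * sqrt v)) \<partial>gauss)))"

text \<open>For 1-Lipschitz f, 0 \<le> m \<le> 1 and v \<le> V, the weight
  \<open>exp (m * (f (x + z * sqrt v) - f x))\<close> lies between the two exponentials used here;
  the quotient is the resulting bound for tilted moments.\<close>

definition tilt_const :: "real \<Rightarrow> real" where
  "tilt_const V = (\<integral>z. (1 + \<bar>z\<bar>) ^ 3 * exp (sqrt V * \<bar>z\<bar>) \<partial>gauss) / (\<integral>z. exp (- sqrt V * \<bar>z\<bar>) \<partial>gauss)"

lemma gauss_integral_pos:
  fixes g :: "real \<Rightarrow> real"
  assumes "integrable gauss g" "\<And>z. 0 < g z"
  shows "0 < (\<integral>z. g z \<partial>gauss)"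
proof -
  interpret prob_space gauss by (rule gauss_prob_space)
  have "(\<integral>z. g z \<partial>gauss) \<noteq> 0"
  proof
    assume "(\<integral>z. g z \<partial>gauss) = 0"
    then have "AE z in gauss. g z = 0"
      using integral_nonneg_eq_0_iff_AE[OF assms(1)] assms(2) by (auto simp: less_imp_le)
    moreover have "g z \<noteq> 0" for z using assms(2)[of z] by simp
    ultimately show False by simp
  qed
  moreover have "0 \<le> (\<integral>z. g z \<partial>gauss)"
    using assms(2) by (intro integral_nonneg_AE AE_I2) (auto simp: less_imp_le)
  ultimately show ?thesis by simp
qed

lemma exp_lipschitz_bound:
  fixes f :: "real \<Rightarrow> real"
  assumes "\<And>x y. \<bar>f x - f y\<bar> \<le> \<bar>x - y\<bar>" "0 \<le> m" "m \<le> 1"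
  shows "\<bar>exp (m * f y)\<bar> \<le> exp \<bar>f 0\<bar> * exp (1 * \<bar>y\<bar>)"
proof -
  have "m * f y \<le> 1 * (\<bar>f 0\<bar> + \<bar>y\<bar>)"
  proof (rule order_trans[OF mult_left_mono[of "f y" "\<bar>f 0\<bar> + \<bar>y\<bar>"] mult_right_mono])
    show "f y \<le> \<bar>f 0\<bar> + \<bar>y\<bar>" using assms(1)[of y 0] by (auto simp: abs_le_iff)
  qed (use assms in auto)
  then show ?thesis by (simp flip: exp_add)
qed

locale lip_tilt =
  fixes f :: "real \<Rightarrow> real" and m v :: real
  assumes lip: "\<bar>f x - f y\<bar> \<le> \<bar>x - y\<bar>" and m: "0 \<le> m" "m \<le> 1" and v: "0 \<le> v"
begin

lemma f_continuous: "continuous_on UNIV f"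
  by (intro continuous_at_imp_continuous_on ballI)
    (auto simp: continuous_at_eps_delta dist_real_def intro: le_less_trans[OF lip])

lemma f_measurable [measurable]: "f \<in> borel_measurable borel"
  by (rule borel_measurable_continuous_onI[OF f_continuous])

lemma growth: "\<bar>f y\<bar> \<le> (\<bar>f 0\<bar> + 1) * exp (1 * \<bar>y\<bar>)"
proof -
  have "\<bar>f y\<bar> \<le> \<bar>f 0\<bar> + \<bar>y\<bar>" using lip[of y 0] by simp
  also have "\<dots> \<le> \<bar>f 0\<bar> * exp \<bar>y\<bar> + exp \<bar>y\<bar>"
    using order_trans[OF _ exp_ge_add_one_self[of "\<bar>y\<bar>"], of "\<bar>y\<bar>"] mult_left_mono[of 1 "exp \<bar>y\<bar>" "\<bar>f 0\<bar>"]
    by (intro add_mono) auto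
  finally show ?thesis by (simp add: ring_distribs)
qed

lemma weight_integrable: "integrable gauss (\<lambda>z. exp (m * f (x + z * sqrt v)))"
  by (rule gauss_integrable[of "\<lambda>y. exp (m * f y)", OF _ exp_lipschitz_bound[OF lip m]]) auto

lemma weight_pos: "0 < (\<integral>z. exp (m * f (x + z * sqrt v)) \<partial>gauss)"
  by (rule gauss_integral_pos[OF weight_integrable]) simp

lemma tilted_sets [measurable_cong, simp]: "sets (tilted m v f x) = sets borel"
  by (simp add: tilted_def)

lemma tilted_prob_space: "prob_space (tilted m v f x)"
proof
  have "(\<integral>\<^sup>+z. ennreal (exp (m * f (x + z * sqrt v)) / (\<integral>z. exp (m * f (x + z * sqrt v)) \<partial>gauss)) \<partial>gauss) = 1"
    using weight_pos[of x] by (subst nn_integral_eq_integral) (auto intro: weight_integrable less_imp_le)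
  then show "emeasure (tilted m v f x) (space (tilted m v f x)) = 1"
    unfolding tilted_def by (subst emeasure_density) auto
qed

lemma tilted_integral:
  fixes g :: "real \<Rightarrow> real"
  assumes [measurable]: "g \<in> borel_measurable borel"
  shows "(\<integral>z. g z \<partial>tilted m v f x) = (\<integral>z. g z * exp (m * f (x + z * sqrt v)) \<partial>gauss) / (\<integral>z. exp (m * f (x + z * sqrt v)) \<partial>gauss)"
  unfolding tilted_def
  by (subst integral_density) (use weight_pos[of x] in \<open>auto simp: less_imp_le mult.commute\<close>)

lemma tilted_integrable_iff:
  fixes g :: "real \<Rightarrow> real"
  assumes [measurable]: "g \<in> borel_measurable borel"
  shows "integrable (tilted m v f x) g \<longleftrightarrow> integrable gauss (\<lambda>z. g z * exp (m * f (x + z * sqrt v)))"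
proof -
  let ?Z = "\<integral>z. exp (m * f (x + z * sqrt v)) \<partial>gauss"
  have "integrable (tilted m v f x) g \<longleftrightarrow> integrable gauss (\<lambda>z. (exp (m * f (x + z * sqrt v)) / ?Z) * g z)"
    unfolding tilted_def using weight_pos[of x] by (subst integrable_density) (auto simp: less_imp_le)
  also have "(\<lambda>z. (exp (m * f (x + z * sqrt v)) / ?Z) * g z) = (\<lambda>z. (g z * exp (m * f (x + z * sqrt v))) * inverse ?Z)"
    by (simp add: divide_inverse mult_ac)
  also have "integrable gauss \<dots> \<longleftrightarrow> integrable gauss (\<lambda>z. g z * exp (m * f (x + z * sqrt v)))"
    using weight_pos[of x] by simp
  finally show ?thesis .
qed

lemma tilt_eq:
  assumes [measurable]: "g \<in> borel_measurable borel"
  shows "tilt m v f g x = (\<integral>z. g (x + z * sqrt v) \<partial>tilted m v f x)"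
  by (subst tilted_integral) (auto simp: tilt_def)

lemma shift_lip: "\<bar>f (x + z * sqrt v) - f x\<bar> \<le> sqrt v * \<bar>z\<bar>"
  using lip[of "x + z * sqrt v" x] v by (simp add: abs_mult mult.commute)

text \<open>Numerator and denominator are multiplied by exp (- m f(x)), so that only increments of f
  occur. These are at most sqrt V |z|, hence a bound that is free of f, m and x.\<close>

lemma
  assumes "v \<le> V" "k \<le> 3"
  shows tilted_moment: "(\<integral>z. (1 + \<bar>z\<bar>) ^ k \<partial>tilted m v f x) \<le> tilt_const V"
    and tilted_moment_integrable: "integrable (tilted m v f x) (\<lambda>z. (1 + \<bar>z\<bar>) ^ k)"
proof -
  have fb: "\<bar>m * (f (x + z * sqrt v) - f x)\<bar> \<le> sqrt V * \<bar>z\<bar>" for z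
  proof -
    have "\<bar>m * (f (x + z * sqrt v) - f x)\<bar> \<le> 1 * (sqrt v * \<bar>z\<bar>)"
      using m shift_lip unfolding abs_mult by (intro mult_mono) auto
    also have "\<dots> \<le> sqrt V * \<bar>z\<bar>" using assms by (auto intro!: mult_right_mono)
    finally show ?thesis .
  qed
  have 1: "(1 + \<bar>z\<bar>) ^ k * exp (m * (f (x + z * sqrt v) - f x)) \<le> (1 + \<bar>z\<bar>) ^ 3 * exp (sqrt V * \<bar>z\<bar>)" for z
    using fb[of z] assms(2) by (intro mult_mono power_increasing) auto
  have i1: "integrable gauss (\<lambda>z. (1 + \<bar>z\<bar>) ^ k * exp (m * (f (x + z * sqrt v) - f x)))"
  proof (rule Bochner_Integration.integrable_bound)
    show "integrable gauss (\<lambda>z. (1 + \<bar>z\<bar>) ^ 3 * exp (sqrt V * \<bar>z\<bar>))" by (rule gauss_poly_exp)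
  qed (use 1 in \<open>auto intro!: AE_I2\<close>)
  have i2: "integrable gauss (\<lambda>z. exp (m * (f (x + z * sqrt v) - f x)))"
    using integrable_mult_left[OF weight_integrable[of x], of "exp (- m * f x)"]
    by (simp add: ring_distribs exp_diff exp_minus divide_inverse)
  have e: "exp (m * (f (x + z * sqrt v) - f x)) = exp (m * f (x + z * sqrt v)) * exp (- m * f x)" for z
    by (simp add: ring_distribs exp_diff exp_minus divide_inverse)
  have "integrable gauss (\<lambda>z. ((1 + \<bar>z\<bar>) ^ k * exp (m * (f (x + z * sqrt v) - f x))) * exp (m * f x))"
    by (rule integrable_mult_left) (rule i1)
  then show "integrable (tilted m v f x) (\<lambda>z. (1 + \<bar>z\<bar>) ^ k)"
    by (subst tilted_integrable_iff) (auto simp: e exp_minus mult.assoc)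
  have "(\<integral>z. (1 + \<bar>z\<bar>) ^ k \<partial>tilted m v f x)
      = (\<integral>z. (1 + \<bar>z\<bar>) ^ k * exp (m * (f (x + z * sqrt v) - f x)) \<partial>gauss) / (\<integral>z. exp (m * (f (x + z * sqrt v) - f x)) \<partial>gauss)"
    by (subst tilted_integral) (auto simp: e mult.assoc[symmetric])
  also have "\<dots> \<le> tilt_const V"
    unfolding tilt_const_def
  proof (rule frac_le)
    show "(\<integral>z. (1 + \<bar>z\<bar>) ^ k * exp (m * (f (x + z * sqrt v) - f x)) \<partial>gauss) \<le> (\<integral>z. (1 + \<bar>z\<bar>) ^ 3 * exp (sqrt V * \<bar>z\<bar>) \<partial>gauss)"
      using 1 by (intro integral_mono i1 gauss_poly_exp)
    show "0 < (\<integral>z. exp (- sqrt V * \<bar>z\<bar>) \<partial>gauss)"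
      by (rule gauss_integral_pos[OF gauss_exp_abs]) simp
    show "(\<integral>z. exp (- sqrt V * \<bar>z\<bar>) \<partial>gauss) \<le> (\<integral>z. exp (m * (f (x + z * sqrt v) - f x)) \<partial>gauss)"
    proof (intro integral_mono i2 gauss_exp_abs)
      show "exp (- sqrt V * \<bar>z\<bar>) \<le> exp (m * (f (x + z * sqrt v) - f x))" for z
        using fb[of z] by (auto simp: abs_le_iff)
    qed
    show "0 \<le> (\<integral>z. (1 + \<bar>z\<bar>) ^ 3 * exp (sqrt V * \<bar>z\<bar>) \<partial>gauss)"
      by (rule integral_nonneg_AE) auto
  qed
  finally show "(\<integral>z. (1 + \<bar>z\<bar>) ^ k \<partial>tilted m v f x) \<le> tilt_const V" .
qed

lemma tilted_integrable_bounded: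
  fixes g :: "real \<Rightarrow> real"
  assumes "g \<in> borel_measurable borel" "\<And>y. \<bar>g y\<bar> \<le> B"
  shows "integrable (tilted m v f x) (\<lambda>z. g (x + z * sqrt v))"
proof -
  interpret prob_space "tilted m v f x" by (rule tilted_prob_space)
  show ?thesis
    by (rule integrable_const_bound[of _ B]) (use assms in auto)
qed

lemma tilt_mono:
  assumes "g \<in> borel_measurable borel" "\<And>y. \<bar>g y\<bar> \<le> B" "h \<in> borel_measurable borel" "\<And>y. \<bar>h y\<bar> \<le> C"
    "\<And>y. g y \<le> h y"
  shows "tilt m v f g x \<le> tilt m v f h x"
  using assms tilted_integrable_bounded[of g B x] tilted_integrable_bounded[of h C x]
  by (simp add: tilt_eq integral_mono)

lemma tilt_const_fun [simp]: "tilt m v f (\<lambda>_. c) x = c"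
  using weight_pos[of x] by (simp add: tilt_def)

lemma tilt_abs_le:
  assumes "g \<in> borel_measurable borel" "\<And>y. \<bar>g y\<bar> \<le> B"
  shows "\<bar>tilt m v f g x\<bar> \<le> B"
proof -
  have "g y \<le> B" "- B \<le> g y" for y
    using assms(2)[of y] by auto
  then have "tilt m v f g x \<le> tilt m v f (\<lambda>_. B) x \<and> tilt m v f (\<lambda>_. - B) x \<le> tilt m v f g x"
    by (intro conjI; intro tilt_mono[where B="\<bar>B\<bar>" and C="\<bar>B\<bar>"]; use assms in \<open>auto intro: order_trans[OF _ abs_ge_self]\<close>)
  then show ?thesis by (simp add: abs_le_iff)
qed

text \<open>Nonnegativity of a variance; this is what keeps the second derivative of a Hopf-Cole
  transform nonnegative.\<close>

lemma tilt_variance_nonneg: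
  assumes "g \<in> borel_measurable borel" "\<And>y. \<bar>g y\<bar> \<le> B"
  shows "(tilt m v f g x)\<^sup>2 \<le> tilt m v f (\<lambda>y. g y * g y) x"
proof -
  interpret prob_space "tilted m v f x" by (rule tilted_prob_space)
  have "\<bar>g y * g y\<bar> \<le> B * B" for y
    using mult_mono'[OF assms(2)[of y] assms(2)[of y]] by (simp add: abs_mult)
  then have "variance (\<lambda>z. g (x + z * sqrt v)) = expectation (\<lambda>z. (g (x + z * sqrt v))\<^sup>2) - (expectation (\<lambda>z. g (x + z * sqrt v)))\<^sup>2"
    using assms tilted_integrable_bounded[of "\<lambda>y. g y * g y" "B * B" x]
    by (intro variance_eq tilted_integrable_bounded) (auto simp: power2_eq_square)
  then show ?thesis
    using variance_positive[of "\<lambda>z. g (x + z * sqrt v)"] assms by (simp add: tilt_eq power2_eq_square)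
qed

text \<open>Both functions differ from their values at x by a multiple of sqrt v (1 + |z|), so the
  covariance is of order v. Errors linear in v stay summable over arbitrarily many Hopf-Cole steps,
  since the variances add up to a bounded total.\<close>

lemma tilt_covariance:
  assumes [measurable]: "g \<in> borel_measurable borel" "h \<in> borel_measurable borel"
    and "\<And>x y. \<bar>g x - g y\<bar> \<le> A * \<bar>x - y\<bar>" "\<And>x y. \<bar>h x - h y\<bar> \<le> B * \<bar>x - y\<bar>" "0 \<le> A" "0 \<le> B" "v \<le> V"
  shows "\<bar>tilt m v f (\<lambda>y. g y * h y) x - tilt m v f g x * tilt m v f h x\<bar> \<le> 2 * A * B * v * tilt_const V"
proof -
  interpret prob_space "tilted m v f x" by (rule tilted_prob_space)
  have s: "\<bar>sqrt v\<bar> = sqrt v" using v by simp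
  have "\<bar>expectation (\<lambda>z. g (x + z * sqrt v) * h (x + z * sqrt v)) - expectation (\<lambda>z. g (x + z * sqrt v)) * expectation (\<lambda>z. h (x + z * sqrt v))\<bar>
    \<le> 2 * (A * sqrt v) * (B * sqrt v) * expectation (\<lambda>z. (1 + \<bar>z\<bar>)\<^sup>2)"
  proof (rule covariance_bound)
    show "integrable (tilted m v f x) (\<lambda>z. (1 + \<bar>z\<bar>)\<^sup>2)"
      by (rule tilted_moment_integrable[OF order_refl]) simp
    fix z
    show "\<bar>g (x + z * sqrt v) - g x\<bar> \<le> A * sqrt v * (1 + \<bar>z\<bar>)"
      using assms(3)[of "x + z * sqrt v" x] assms(5) v
      by (auto simp: abs_mult s algebra_simps intro: order_trans[OF _ add_increasing[OF _ order_refl]])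
    show "\<bar>h (x + z * sqrt v) - h x\<bar> \<le> B * sqrt v * (1 + \<bar>z\<bar>)"
      using assms(4)[of "x + z * sqrt v" x] assms(6) v
      by (auto simp: abs_mult s algebra_simps intro: order_trans[OF _ add_increasing[OF _ order_refl]])
  qed (use assms v in auto)
  also have "\<dots> = 2 * A * B * v * expectation (\<lambda>z. (1 + \<bar>z\<bar>)\<^sup>2)"
    using v by simp
  also have "\<dots> \<le> 2 * A * B * v * tilt_const V"
    using assms v by (intro mult_left_mono tilted_moment) auto
  finally show ?thesis by (simp add: tilt_eq)
qed

text \<open>Quotient rule: differentiating the weight brings down m f', and together with the
  normalization this gives m times a tilted covariance with f'.\<close>

lemma tilt_deriv:
  assumes f: "\<And>x. (f has_real_derivative f1 x) (at x)" and g: "\<And>x. (g has_real_derivative g1 x) (at x)"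
    and b: "\<And>y. \<bar>f1 y\<bar> \<le> 1" "\<And>y. \<bar>g y\<bar> \<le> B" "\<And>y. \<bar>g1 y\<bar> \<le> B"
  shows "(tilt m v f g has_real_derivative
    tilt m v f g1 x + m * (tilt m v f (\<lambda>y. g y * f1 y) x - tilt m v f g x * tilt m v f f1 x)) (at x)"
proof -
  note [measurable] = deriv_imp_measurable[OF g] derivative_borel_measurable[OF f] derivative_borel_measurable[OF g]
  let ?E = "\<lambda>g x. \<integral>z. g (x + z * sqrt v) * exp (m * f (x + z * sqrt v)) \<partial>gauss"
  let ?Z = "\<lambda>x. \<integral>z. exp (m * f (x + z * sqrt v)) \<partial>gauss"
  have eb: "\<bar>a * exp (m * f y)\<bar> \<le> (C * exp \<bar>f 0\<bar>) * exp (1 * \<bar>y\<bar>)" if "\<bar>a\<bar> \<le> C" for a y C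
    using mult_mono[OF that exp_lipschitz_bound[OF lip m, of y]] that by (simp add: abs_mult mult.assoc)
  have B: "0 \<le> B" using b(2)[of 0] by simp
  have mf: "\<bar>m * f1 y\<bar> \<le> 1" for y
    using mult_mono[OF m(2) b(1)[of y]] m by (simp add: abs_mult)
  have int: "integrable gauss (\<lambda>z. h (x + z * sqrt v) * exp (m * f (x + z * sqrt v)))"
    if "h \<in> borel_measurable borel" "\<And>y. \<bar>h y\<bar> \<le> C" for h C x
    by (rule gauss_integrable[of "\<lambda>y. h y * exp (m * f y)", OF _ eb]) (use that in auto)
  have gf: "\<bar>g y * (m * f1 y)\<bar> \<le> B" for y
    using mult_mono[OF b(2)[of y] mf[of y]] B by (simp add: abs_mult)
  have "((\<lambda>x. ?E g x) has_real_derivative (\<integral>z. (g1 (x + z * sqrt v) + g (x + z * sqrt v) * (m * f1 (x + z * sqrt v))) * exp (m * f (x + z * sqrt v)) \<partial>gauss)) (at x)"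
  proof (rule gauss_deriv[of "\<lambda>y. g y * exp (m * f y)" "\<lambda>y. (g1 y + g y * (m * f1 y)) * exp (m * f y)" "2 * B * exp \<bar>f 0\<bar>" 1])
    show "((\<lambda>y. g y * exp (m * f y)) has_real_derivative (g1 y + g y * (m * f1 y)) * exp (m * f y)) (at y)" for y
      by (auto intro!: derivative_eq_intros f g simp: algebra_simps)
    show "\<bar>g y * exp (m * f y)\<bar> \<le> 2 * B * exp \<bar>f 0\<bar> * exp (1 * \<bar>y\<bar>)" for y
      by (rule eb) (use b(2)[of y] B in auto)
    show "\<bar>(g1 y + g y * (m * f1 y)) * exp (m * f y)\<bar> \<le> 2 * B * exp \<bar>f 0\<bar> * exp (1 * \<bar>y\<bar>)" for y
      by (rule eb) (use gf[of y] b(3)[of y] in auto)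
  qed simp
  also have "(\<integral>z. (g1 (x + z * sqrt v) + g (x + z * sqrt v) * (m * f1 (x + z * sqrt v))) * exp (m * f (x + z * sqrt v)) \<partial>gauss)
      = (\<integral>z. g1 (x + z * sqrt v) * exp (m * f (x + z * sqrt v)) + m * ((g (x + z * sqrt v) * f1 (x + z * sqrt v)) * exp (m * f (x + z * sqrt v))) \<partial>gauss)"
    by (intro Bochner_Integration.integral_cong) (auto simp: algebra_simps)
  also have "\<dots> = ?E g1 x + m * ?E (\<lambda>y. g y * f1 y) x"
  proof -
    have "\<bar>g y * f1 y\<bar> \<le> B * 1" for y
      using mult_mono[OF b(2)[of y] b(1)[of y]] B by (simp add: abs_mult)
    then show ?thesis
      using int[of g1 B x] int[of "\<lambda>y. g y * f1 y" "B * 1" x] b by simp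
  qed
  finally have 1: "((\<lambda>x. ?E g x) has_real_derivative ?E g1 x + m * ?E (\<lambda>y. g y * f1 y) x) (at x)" .
  have "((\<lambda>x. ?Z x) has_real_derivative (\<integral>z. (m * f1 (x + z * sqrt v)) * exp (m * f (x + z * sqrt v)) \<partial>gauss)) (at x)"
  proof (rule gauss_deriv[of "\<lambda>y. exp (m * f y)" "\<lambda>y. (m * f1 y) * exp (m * f y)" "1 * exp \<bar>f 0\<bar>" 1])
    show "((\<lambda>y. exp (m * f y)) has_real_derivative (m * f1 y) * exp (m * f y)) (at y)" for y
      by (auto intro!: derivative_eq_intros f simp: algebra_simps)
    show "\<bar>exp (m * f y)\<bar> \<le> 1 * exp \<bar>f 0\<bar> * exp (1 * \<bar>y\<bar>)" for y
      using eb[of 1 1 y] by simp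
    show "\<bar>(m * f1 y) * exp (m * f y)\<bar> \<le> 1 * exp \<bar>f 0\<bar> * exp (1 * \<bar>y\<bar>)" for y
      by (rule eb[OF mf])
  qed simp
  then have 2: "(?Z has_real_derivative m * ?E f1 x) (at x)"
    by (simp add: mult.assoc)
  show ?thesis
    unfolding tilt_def
    by (rule derivative_eq_intros 1 2 refl | use weight_pos[of x] in \<open>simp add: field_simps power2_eq_square\<close>)+
qed

text \<open>At m = 0 the weight is 1 and \<open>tilt\<close> is the plain Gaussian average, so the
  two branches of \<open>hopf_cole\<close> share one formula.\<close>

lemma hopf_cole_deriv:
  assumes f: "\<And>x. (f has_real_derivative f1 x) (at x)" and b: "\<And>y. \<bar>f1 y\<bar> \<le> 1"
  shows "(hopf_cole m v f has_real_derivative tilt m v f f1 x) (at x)"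
proof (cases "m = 0")
  case True
  interpret prob_space gauss by (rule gauss_prob_space)
  have "((\<lambda>x. \<integral>z. f (x + z * sqrt v) \<partial>gauss) has_real_derivative (\<integral>z. f1 (x + z * sqrt v) \<partial>gauss)) (at x)"
  proof (rule gauss_deriv[OF f, of "\<bar>f 0\<bar> + 1" 1])
    fix y
    show "\<bar>f y\<bar> \<le> (\<bar>f 0\<bar> + 1) * exp (1 * \<bar>y\<bar>)" by (rule growth)
    have "1 \<le> (\<bar>f 0\<bar> + 1) * exp \<bar>y\<bar>" using mult_mono[of 1 "\<bar>f 0\<bar> + 1" 1 "exp \<bar>y\<bar>"] by simp
    then show "\<bar>f1 y\<bar> \<le> (\<bar>f 0\<bar> + 1) * exp (1 * \<bar>y\<bar>)" using b[of y] by simp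
  qed simp
  moreover have "hopf_cole 0 v f = (\<lambda>x. \<integral>z. f (x + z * sqrt v) \<partial>gauss)"
    by (auto simp: hopf_cole_def)
  ultimately show ?thesis
    using True prob_space by (simp add: tilt_def)
next
  case False
  let ?E = "\<lambda>g x. \<integral>z. g (x + z * sqrt v) * exp (m * f (x + z * sqrt v)) \<partial>gauss"
  let ?Z = "\<lambda>x. \<integral>z. exp (m * f (x + z * sqrt v)) \<partial>gauss"
  have mf: "\<bar>m * f1 y\<bar> \<le> 1" for y
    using mult_mono[OF m(2) b(1)[of y]] m by (simp add: abs_mult)
  have "((\<lambda>x. ?Z x) has_real_derivative (\<integral>z. (m * f1 (x + z * sqrt v)) * exp (m * f (x + z * sqrt v)) \<partial>gauss)) (at x)"
  proof (rule gauss_deriv[of "\<lambda>y. exp (m * f y)" "\<lambda>y. (m * f1 y) * exp (m * f y)" "exp \<bar>f 0\<bar>" 1])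
    show "((\<lambda>y. exp (m * f y)) has_real_derivative (m * f1 y) * exp (m * f y)) (at y)" for y
      by (auto intro!: derivative_eq_intros f simp: algebra_simps)
    show e: "\<bar>exp (m * f y)\<bar> \<le> exp \<bar>f 0\<bar> * exp (1 * \<bar>y\<bar>)" for y
      by (rule exp_lipschitz_bound[OF lip m])
    show "\<bar>(m * f1 y) * exp (m * f y)\<bar> \<le> exp \<bar>f 0\<bar> * exp (1 * \<bar>y\<bar>)" for y
      using mult_mono[OF mf[of y] e[of y]] by (simp add: abs_mult)
  qed simp
  then have 2: "(?Z has_real_derivative m * ?E f1 x) (at x)"
    by (simp add: mult.assoc)
  have eq: "hopf_cole m v f = (\<lambda>x. ln (?Z x) / m)"
    using False by (auto simp: hopf_cole_def)
  show ?thesis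
    unfolding eq tilt_def
    by (rule derivative_eq_intros 2 refl | use weight_pos[of x] False in \<open>simp add: field_simps\<close>)+
qed

end

subsection \<open>Regularity and short-time expansion of the Hopf-Cole transformation\<close>

text \<open>The bound \<open>f'' \<le> 1 - f'\<^sup>2\<close> is an equality for \<open>ln cosh\<close> and survives every Hopf-Cole transformation
  with \<open>0 \<le> m \<le> 1\<close>.\<close>

definition smooth3 :: "real \<Rightarrow> (real \<Rightarrow> real) \<Rightarrow> bool" where
  "smooth3 L f \<longleftrightarrow> (\<exists>f1 f2 f3. (\<forall>x. (f has_real_derivative f1 x) (at x) \<and> (f1 has_real_derivative f2 x) (at x) \<and>
     (f2 has_real_derivative f3 x) (at x) \<and> 0 \<le> f2 x \<and> f2 x \<le> 1 - (f1 x)\<^sup>2 \<and> \<bar>f3 x\<bar> \<le> L))"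

lemma lipschitz_from_deriv:
  fixes f f1 :: "real \<Rightarrow> real"
  assumes "\<And>x. (f has_real_derivative f1 x) (at x)" "\<And>x. \<bar>f1 x\<bar> \<le> B"
  shows "\<bar>f x - f y\<bar> \<le> B * \<bar>x - y\<bar>"
  using field_differentiable_bound[of UNIV f f1 B x y] assms by auto

text \<open>Let T be the tilted average and C the tilted covariance. The first two derivatives of
  the transform are T f1 and T f2 + m C f1 f1. Since f2 \<le> 1 - f1^2 and m \<le> 1, the second is
  at most T (1 - f1^2) plus the variance of f1, which equals 1 - (T f1)^2. In the third derivative
  everything beyond T f3 is built from covariances of Lipschitz functions, hence of order v.\<close>

lemma hopf_cole_smooth3:
  assumes "smooth3 L f" "0 \<le> m" "m \<le> 1" "0 \<le> v" "v \<le> V"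
  shows "smooth3 (L + 8 * tilt_const V * (L + 1) * v) (hopf_cole m v f)"
proof -
  obtain f1 f2 f3 where f: "\<And>x. (f has_real_derivative f1 x) (at x)" "\<And>x. (f1 has_real_derivative f2 x) (at x)"
    "\<And>x. (f2 has_real_derivative f3 x) (at x)" and f2: "\<And>x. 0 \<le> f2 x" "\<And>x. f2 x \<le> 1 - (f1 x)\<^sup>2" and f3: "\<And>x. \<bar>f3 x\<bar> \<le> L"
    using assms(1) unfolding smooth3_def by metis
  have b1: "\<bar>f1 x\<bar> \<le> 1" for x
    using f2[of x] by (simp add: abs_square_le_1[symmetric])
  have b2: "\<bar>f2 x\<bar> \<le> 1" for x
    using f2[of x] zero_le_power2[of "f1 x"] by linarith
  have L: "0 \<le> L" using f3[of 0] by simp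
  interpret lip_tilt f m v
    by unfold_locales (use lipschitz_from_deriv[OF f(1) b1] assms in auto)
  note [measurable] = deriv_imp_measurable[OF f(2)] deriv_imp_measurable[OF f(3)] derivative_borel_measurable[OF f(3)]
  define T where "T = tilt m v f"
  define C where "C g h x = T (\<lambda>y. g y * h y) x - T g x * T h x" for g h x
  define t2 where "t2 x = T f2 x + m * C f1 f1 x" for x
  define t3 where "t3 x = (T f3 x + m * C f2 f1 x) + m * ((T (\<lambda>y. 2 * f1 y * f2 y) x + m * C (\<lambda>y. f1 y * f1 y) f1 x) - 2 * T f1 x * t2 x)" for x
  have b11: "\<bar>f1 y * f1 y\<bar> \<le> 1" for y
    using mult_mono[OF b1[of y] b1[of y]] by (simp add: abs_mult)
  have b11': "\<bar>f1 y * f1 y\<bar> \<le> 2" for y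
    using b11[of y] by linarith
  have b12: "\<bar>2 * f1 y * f2 y\<bar> \<le> 2" for y
    using mult_mono[OF b1[of y] b2[of y]] by (simp add: abs_mult)
  have d0: "(hopf_cole m v f has_real_derivative T f1 x) (at x)" for x
    unfolding T_def by (rule hopf_cole_deriv[OF f(1) b1])
  have d1: "(T f1 has_real_derivative t2 x) (at x)" for x
    unfolding T_def t2_def C_def by (rule tilt_deriv[OF f(1,2) b1 b1 b2])
  have d2: "(T f2 has_real_derivative T f3 x + m * C f2 f1 x) (at x)" for x
    unfolding T_def C_def
    by (rule tilt_deriv[OF f(1,3) b1, of "1 + L"]) (use b2 f3 L in \<open>auto intro: order_trans add_increasing add_increasing2\<close>)
  have d3: "(T (\<lambda>y. f1 y * f1 y) has_real_derivative T (\<lambda>y. 2 * f1 y * f2 y) x + m * C (\<lambda>y. f1 y * f1 y) f1 x) (at x)" for x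
    unfolding T_def C_def
    by (rule tilt_deriv[OF f(1) _ b1, of _ _ 2])
      (use b11' in \<open>auto intro!: derivative_eq_intros f(2) b12 simp del: abs_mult_self_eq\<close>)
  have d4: "(t2 has_real_derivative t3 x) (at x)" for x
    unfolding t2_def C_def
    by (rule derivative_eq_intros d1 d2 d3 refl | simp add: t3_def C_def t2_def algebra_simps)+
  have lin: "T (\<lambda>y. 1 - f1 y * f1 y) x = 1 - T (\<lambda>y. f1 y * f1 y) x" "T (\<lambda>y. 2 * f1 y * f2 y) x = 2 * T (\<lambda>y. f2 y * f1 y) x" for x
  proof -
    interpret prob_space "tilted m v f x" by (rule tilted_prob_space)
    show "T (\<lambda>y. 1 - f1 y * f1 y) x = 1 - T (\<lambda>y. f1 y * f1 y) x"
      using tilted_integrable_bounded[of "\<lambda>y. f1 y * f1 y" 1 x, OF _ b11] prob_space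
      unfolding T_def by (simp add: tilt_eq)
    show "T (\<lambda>y. 2 * f1 y * f2 y) x = 2 * T (\<lambda>y. f2 y * f1 y) x"
      unfolding T_def by (simp add: tilt_eq mult_ac)
  qed
  have var: "0 \<le> C f1 f1 x" for x
    using tilt_variance_nonneg[of f1 1 x] b1 by (simp add: C_def T_def power2_eq_square)
  have "0 \<le> t2 x" for x
  proof -
    have "tilt m v f (\<lambda>_. 0) x \<le> T f2 x"
      unfolding T_def by (rule tilt_mono[where B=0 and C=1]) (use f2 b2 in auto)
    then show ?thesis using var[of x] assms(2) by (simp add: t2_def)
  qed
  moreover have "t2 x \<le> 1 - (T f1 x)\<^sup>2" for x
  proof -
    have sq: "- 1 \<le> f1 y * f1 y" for y
      using zero_le_square[of "f1 y"] by linarith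
    have "T f2 x \<le> T (\<lambda>y. 1 - f1 y * f1 y) x"
      unfolding T_def by (rule tilt_mono[where B=1 and C=2]) (use f2 b2 b11 sq in \<open>auto simp: power2_eq_square abs_le_iff\<close>)
    \<comment> \<open>The place where m \<le> 1 preserves the upper bound: the full variance turns T
      (f1^2) into (T f1)^2.\<close>
    moreover have "m * C f1 f1 x \<le> 1 * C f1 f1 x" using var assms by (intro mult_right_mono) auto
    ultimately show ?thesis using lin(1)[of x] by (simp add: t2_def C_def power2_eq_square)
  qed
  moreover have "\<bar>t3 x\<bar> \<le> L + 8 * tilt_const V * (L + 1) * v" for x
  proof -
    have l1: "\<bar>f1 x - f1 y\<bar> \<le> 1 * \<bar>x - y\<bar>" for x y by (rule lipschitz_from_deriv[OF f(2) b2])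
    have l2: "\<bar>f2 x - f2 y\<bar> \<le> L * \<bar>x - y\<bar>" for x y by (rule lipschitz_from_deriv[OF f(3) f3])
    have l11: "\<bar>f1 x * f1 x - f1 y * f1 y\<bar> \<le> 2 * \<bar>x - y\<bar>" for x y
      by (rule lipschitz_from_deriv[of _ "\<lambda>y. 2 * f1 y * f2 y"]) (auto intro!: derivative_eq_intros f(2) b12)
    have c21: "\<bar>C f2 f1 x\<bar> \<le> 2 * L * 1 * v * tilt_const V"
      unfolding C_def T_def by (rule tilt_covariance[OF _ _ l2 l1]) (use L assms in auto)
    have c11: "\<bar>C f1 f1 x\<bar> \<le> 2 * 1 * 1 * v * tilt_const V"
      unfolding C_def T_def by (rule tilt_covariance[OF _ _ l1 l1]) (use L assms in auto)
    have c111: "\<bar>C (\<lambda>y. f1 y * f1 y) f1 x\<bar> \<le> 2 * 2 * 1 * v * tilt_const V"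
      unfolding C_def T_def by (rule tilt_covariance[OF _ _ l11 l1]) (use L assms in auto)
    have t1: "\<bar>T f1 x\<bar> \<le> 1" unfolding T_def by (rule tilt_abs_le[OF _ b1]) simp
    have t3': "\<bar>T f3 x\<bar> \<le> L" unfolding T_def by (rule tilt_abs_le[OF _ f3]) simp
    have mm: "\<bar>m * a\<bar> \<le> \<bar>a\<bar>" for a using assms(2,3) by (simp add: abs_mult mult_left_le_one_le)
    \<comment> \<open>The covariance of f2 and f1 occurs three times: once from T f2, and twice from
      the derivative of T (f1^2) - (T f1)^2, where 2 T (f1 f2) pairs with 2 (T f1) (T f2).\<close>
    have eq: "t3 x = T f3 x + 3 * (m * C f2 f1 x) + m * (m * (C (\<lambda>y. f1 y * f1 y) f1 x - 2 * (T f1 x * C f1 f1 x)))"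
      unfolding t3_def t2_def lin C_def by (simp add: algebra_simps)
    have "\<bar>T f1 x * C f1 f1 x\<bar> \<le> 1 * \<bar>C f1 f1 x\<bar>"
      unfolding abs_mult by (intro mult_right_mono t1) simp
    moreover have "\<bar>m * (m * (C (\<lambda>y. f1 y * f1 y) f1 x - 2 * (T f1 x * C f1 f1 x)))\<bar>
        \<le> \<bar>C (\<lambda>y. f1 y * f1 y) f1 x - 2 * (T f1 x * C f1 f1 x)\<bar>"
      by (intro order_trans[OF mm] mm)
    \<comment> \<open>The excess over L is (6 L + 8) v times the \<open>tilt_const\<close>, below
      the 8 (L + 1) of the claim.\<close>
    ultimately have "\<bar>t3 x\<bar> \<le> L + 3 * (2 * L * v * tilt_const V) + (4 * v * tilt_const V + 2 * (2 * v * tilt_const V))"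
      unfolding eq using c21 c11 c111 t3' mm[of "C f2 f1 x"] by argo
    moreover have "0 \<le> L * v * tilt_const V"
    proof -
      have "0 \<le> tilt_const V"
        unfolding tilt_const_def by (intro divide_nonneg_nonneg integral_nonneg_AE) auto
      then show ?thesis using L assms by simp
    qed
    ultimately show ?thesis by (simp add: algebra_simps)
  qed
  ultimately show ?thesis
    unfolding smooth3_def using d0 d1 d4
    by (intro exI[of _ "T f1"] exI[of _ t2] exI[of _ t3]) auto
qed

text \<open>A Lipschitz bound on the second derivative survives pointwise limits, where a third
  derivative may be lost. The derivatives are arguments so that limits of derivatives can be named
  before they are known to be derivatives of the limit.\<close>

definition smooth2 :: "real \<Rightarrow> (real \<Rightarrow> real) \<Rightarrow> (real \<Rightarrow> real) \<Rightarrow> (real \<Rightarrow> real) \<Rightarrow> bool" where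
  "smooth2 L f f1 f2 \<longleftrightarrow> (\<forall>x. (f has_real_derivative f1 x) (at x) \<and> (f1 has_real_derivative f2 x) (at x) \<and>
     0 \<le> f2 x \<and> f2 x \<le> 1 - (f1 x)\<^sup>2) \<and> (\<forall>x y. \<bar>f2 x - f2 y\<bar> \<le> L * \<bar>x - y\<bar>)"

lemma smooth3_imp_smooth2:
  assumes "smooth3 L f"
  obtains f1 f2 where "smooth2 L f f1 f2"
  using assms lipschitz_from_deriv unfolding smooth3_def smooth2_def by metis

section \<open>Taylor estimates for functions with Lipschitz second derivative\<close>

context
  fixes L f f1 f2
  assumes S: "smooth2 L f f1 f2"
begin

lemma smooth2D:
  shows "(f has_real_derivative f1 x) (at x)" "(f1 has_real_derivative f2 x) (at x)"
    "0 \<le> f2 x" "f2 x \<le> 1 - (f1 x)\<^sup>2" "\<bar>f2 x - f2 y\<bar> \<le> L * \<bar>x - y\<bar>"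
  using S unfolding smooth2_def by blast+

lemma smooth2_bounds: "\<bar>f1 x\<bar> \<le> 1" "\<bar>f2 x\<bar> \<le> 1"
proof -
  show "\<bar>f1 x\<bar> \<le> 1"
    using smooth2D(3,4)[of x] by (simp add: abs_square_le_1[symmetric])
  show "\<bar>f2 x\<bar> \<le> 1"
    using smooth2D(3,4)[of x] zero_le_power2[of "f1 x"] by linarith
qed

lemma smooth2_L_nonneg: "0 \<le> L"
  using smooth2D(5)[of 1 0] by simp

lemma smooth2_lip: "\<bar>f x - f y\<bar> \<le> \<bar>x - y\<bar>" "\<bar>f1 x - f1 y\<bar> \<le> \<bar>x - y\<bar>"
  using lipschitz_from_deriv[OF smooth2D(1) smooth2_bounds(1)] lipschitz_from_deriv[OF smooth2D(2) smooth2_bounds(2)]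
  by simp_all

lemma smooth2_taylor1: "\<bar>f1 (x + h) - f1 x - f2 x * h\<bar> \<le> L * h\<^sup>2"
proof -
  have "norm ((f1 (x + h) - f2 x * (x + h)) - (f1 x - f2 x * x)) \<le> (L * \<bar>h\<bar>) * norm ((x + h) - x)"
  proof (rule field_differentiable_bound[where S="{x - \<bar>h\<bar>..x + \<bar>h\<bar>}" and f'="\<lambda>y. f2 y - f2 x"])
    show "((\<lambda>y. f1 y - f2 x * y) has_real_derivative f2 y - f2 x) (at y within {x - \<bar>h\<bar>..x + \<bar>h\<bar>})" for y
      by (auto intro!: derivative_eq_intros has_field_derivative_at_within[OF smooth2D(2)])
    show "norm (f2 y - f2 x) \<le> L * \<bar>h\<bar>" if "y \<in> {x - \<bar>h\<bar>..x + \<bar>h\<bar>}" for y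
      using order_trans[OF smooth2D(5)[of y x] mult_left_mono[OF _ smooth2_L_nonneg, of "\<bar>y - x\<bar>" "\<bar>h\<bar>"]] that
      by auto
  qed auto
  then show ?thesis by (simp add: power2_eq_square algebra_simps abs_mult_self_eq)
qed

text \<open>The remainder, as a function of the increment k, has derivative f1 (x + k) - f1 x - f2 x
  * k, which \<open>smooth2_taylor1\<close> bounds.\<close>

lemma smooth2_taylor2: "\<bar>f (x + h) - f x - f1 x * h - f2 x * h\<^sup>2 / 2\<bar> \<le> L * \<bar>h\<bar> ^ 3"
proof -
  let ?g = "\<lambda>k. f (x + k) - f1 x * k - f2 x * k\<^sup>2 / 2"
  have "norm (?g h - ?g 0) \<le> (L * h\<^sup>2) * norm (h - 0)"
  proof (rule field_differentiable_bound[where S="{- \<bar>h\<bar>..\<bar>h\<bar>}" and f'="\<lambda>k. f1 (x + k) - f1 x - f2 x * k"])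
    show "(?g has_real_derivative f1 (x + k) - f1 x - f2 x * k) (at k within {- \<bar>h\<bar>..\<bar>h\<bar>})" for k
    proof -
      have *: "((\<lambda>k. f (x + k)) has_real_derivative f1 (x + k)) (at k)"
        using smooth2D(1)[of "x + k"] DERIV_shift[of f "f1 (x + k)" k x] by (simp add: add.commute)
      have "(?g has_real_derivative f1 (x + k) - f1 x - f2 x * k) (at k)"
        by (rule derivative_eq_intros * refl | simp)+
      then show ?thesis
        by (rule has_field_derivative_at_within)
    qed
    show "norm (f1 (x + k) - f1 x - f2 x * k) \<le> L * h\<^sup>2" if "k \<in> {- \<bar>h\<bar>..\<bar>h\<bar>}" for k
    proof -
      have "k\<^sup>2 \<le> h\<^sup>2" using that by (intro abs_le_square_iff[THEN iffD1]) auto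
      then have "L * k\<^sup>2 \<le> L * h\<^sup>2"
        by (rule mult_left_mono[OF _ smooth2_L_nonneg])
      with smooth2_taylor1[of x k] show ?thesis
        unfolding real_norm_def by (rule order_trans)
    qed
  qed auto
  moreover have "(L * h\<^sup>2) * \<bar>h\<bar> = L * \<bar>h\<bar> ^ 3"
    by (simp add: power3_eq_cube power2_eq_square)
  moreover have "?g h - ?g 0 = f (x + h) - f x - f1 x * h - f2 x * h\<^sup>2 / 2"
    by simp
  ultimately show ?thesis by (simp only: real_norm_def diff_0_right)
qed

text \<open>The constant is 1 rather than L because the second derivative itself is bounded by
  1.\<close>

lemma smooth2_taylor0: "\<bar>f (x + h) - f x - f1 x * h\<bar> \<le> h\<^sup>2"
proof -
  have "norm ((f (x + h) - f1 x * (x + h)) - (f x - f1 x * x)) \<le> (\<bar>h\<bar>) * norm ((x + h) - x)"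
  proof (rule field_differentiable_bound[where S="{x - \<bar>h\<bar>..x + \<bar>h\<bar>}" and f'="\<lambda>y. f1 y - f1 x"])
    show "((\<lambda>y. f y - f1 x * y) has_real_derivative f1 y - f1 x) (at y within {x - \<bar>h\<bar>..x + \<bar>h\<bar>})" for y
      by (auto intro!: derivative_eq_intros has_field_derivative_at_within[OF smooth2D(1)])
    show "norm (f1 y - f1 x) \<le> \<bar>h\<bar>" if "y \<in> {x - \<bar>h\<bar>..x + \<bar>h\<bar>}" for y
      using order_trans[OF smooth2_lip(2)[of y x], of "\<bar>h\<bar>"] that by auto
  qed auto
  then show ?thesis by (simp add: power2_eq_square algebra_simps abs_mult_self_eq)
qed

end

section \<open>Interpolation: closeness of functions gives closeness of their derivatives\<close>

lemma central_differences:
  fixes p q r A B \<delta> e :: real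
  assumes "\<bar>p - q - A - B / 2\<bar> \<le> e" "\<bar>r - q + A - B / 2\<bar> \<le> e" "\<bar>p\<bar> \<le> \<delta>" "\<bar>q\<bar> \<le> \<delta>" "\<bar>r\<bar> \<le> \<delta>"
  shows "\<bar>A\<bar> \<le> \<delta> + e" "\<bar>B\<bar> \<le> 4 * \<delta> + 2 * e"
proof -
  note d = assms[THEN abs_le_D1] assms[THEN abs_le_D2]
  show "\<bar>A\<bar> \<le> \<delta> + e"
    using d by (intro abs_leI; linarith)
  show "\<bar>B\<bar> \<le> 4 * \<delta> + 2 * e"
    using d by (intro abs_leI; linarith)
qed

lemma four_term_difference:
  fixes a b c d a' b' c' d' e :: real
  assumes "\<bar>a - b - c - d\<bar> \<le> e" "\<bar>a' - b' - c' - d'\<bar> \<le> e"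
  shows "\<bar>(a - a') - (b - b') - (c - c') - (d - d')\<bar> \<le> 2 * e"
  using assms by linarith

text \<open>An interpolation inequality of Landau type. The Taylor expansions of f and g at x + h
  and x - h are subtracted; their difference and their sum isolate the first and the second order
  terms. The parameter h balances the sup distance against the Taylor remainder.\<close>

lemma smooth2_interpolate:
  assumes S: "smooth2 L f f1 f2" and S': "smooth2 L g g1 g2" and d: "\<And>x. \<bar>f x - g x\<bar> \<le> \<delta>" and h: "0 < h"
  shows "\<bar>f1 x - g1 x\<bar> \<le> \<delta> / h + 2 * L * h\<^sup>2" "\<bar>f2 x - g2 x\<bar> \<le> 4 * \<delta> / h\<^sup>2 + 4 * L * h"
proof -
  define E where "E = L * h ^ 3"
  define A where "A = (f1 x - g1 x) * h"
  define B where "B = (f2 x - g2 x) * h\<^sup>2"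
  have t: "\<bar>f (x + h) - f x - f1 x * h - f2 x * h\<^sup>2 / 2\<bar> \<le> E" "\<bar>f (x - h) - f x + f1 x * h - f2 x * h\<^sup>2 / 2\<bar> \<le> E"
    using smooth2_taylor2[OF S, of x h] smooth2_taylor2[OF S, of x "- h"] h by (simp_all add: E_def)
  have t': "\<bar>g (x + h) - g x - g1 x * h - g2 x * h\<^sup>2 / 2\<bar> \<le> E" "\<bar>g (x - h) - g x + g1 x * h - g2 x * h\<^sup>2 / 2\<bar> \<le> E"
    using smooth2_taylor2[OF S', of x h] smooth2_taylor2[OF S', of x "- h"] h by (simp_all add: E_def)
  have AB: "A = f1 x * h - g1 x * h" "B = f2 x * h\<^sup>2 - g2 x * h\<^sup>2"
    by (simp_all add: A_def B_def left_diff_distrib)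
  have 1: "\<bar>(f (x + h) - g (x + h)) - (f x - g x) - A - B / 2\<bar> \<le> 2 * E"
    using four_term_difference[OF t(1) t'(1)] unfolding AB by (simp add: diff_divide_distrib)
  have 2: "\<bar>(f (x - h) - g (x - h)) - (f x - g x) + A - B / 2\<bar> \<le> 2 * E"
    using four_term_difference[of _ _ "- (f1 x * h)", simplified, OF t(2), of _ _ "- (g1 x * h)", simplified, OF t'(2)]
    unfolding AB by (simp add: diff_divide_distrib)
  have A: "\<bar>A\<bar> \<le> \<delta> + 2 * E" and B: "\<bar>B\<bar> \<le> 4 * \<delta> + 2 * (2 * E)"
    using central_differences[OF 1 2 d d d] by auto
  have "\<bar>f1 x - g1 x\<bar> = \<bar>A\<bar> / h" "\<bar>f2 x - g2 x\<bar> = \<bar>B\<bar> / h\<^sup>2"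
    using h by (simp_all add: A_def B_def abs_mult)
  moreover have "\<bar>A\<bar> / h \<le> (\<delta> + 2 * E) / h" "\<bar>B\<bar> / h\<^sup>2 \<le> (4 * \<delta> + 2 * (2 * E)) / h\<^sup>2"
    using A B h by (simp_all add: divide_right_mono)
  moreover have "(\<delta> + 2 * E) / h = \<delta> / h + 2 * L * h\<^sup>2" "(4 * \<delta> + 2 * (2 * E)) / h\<^sup>2 = 4 * \<delta> / h\<^sup>2 + 4 * L * h"
    using h by (simp_all add: E_def add_divide_distrib power3_eq_cube power2_eq_square)
  ultimately show "\<bar>f1 x - g1 x\<bar> \<le> \<delta> / h + 2 * L * h\<^sup>2" "\<bar>f2 x - g2 x\<bar> \<le> 4 * \<delta> / h\<^sup>2 + 4 * L * h"
    by simp_all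
qed

section \<open>Semigroup, monotonicity and contraction properties of the Hopf-Cole
  transformation\<close>

lemma hopf_cole_semigroup:
  assumes "\<And>x y. \<bar>f x - f y\<bar> \<le> \<bar>x - y\<bar>" "0 \<le> m" "m \<le> 1" "0 \<le> v" "0 \<le> w"
  shows "hopf_cole m v (hopf_cole m w f) = hopf_cole m (v + w) f"
proof
  fix x
  interpret lip_tilt f m w by unfold_locales (use assms in auto)
  show "hopf_cole m v (hopf_cole m w f) x = hopf_cole m (v + w) f x"
  proof (cases "m = 0")
    case True
    have "(\<integral>z. (\<integral>y. f ((x + z * sqrt v) + y * sqrt w) \<partial>gauss) \<partial>gauss) = (\<integral>z. f (x + z * sqrt (v + w)) \<partial>gauss)"
      by (rule gauss_semigroup[OF _ growth]) (use assms in auto)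
    then show ?thesis by (simp add: hopf_cole_def True)
  next
    case False
    have "(\<integral>z. (\<integral>y. exp (m * f ((x + z * sqrt v) + y * sqrt w)) \<partial>gauss) \<partial>gauss) = (\<integral>z. exp (m * f (x + z * sqrt (v + w))) \<partial>gauss)"
      by (rule gauss_semigroup[of "\<lambda>y. exp (m * f y)", OF _ exp_lipschitz_bound[OF lip]]) (use assms in auto)
    moreover have "exp (m * (ln (\<integral>y. exp (m * f (y' + y * sqrt w)) \<partial>gauss) / m)) = (\<integral>y. exp (m * f (y' + y * sqrt w)) \<partial>gauss)" for y'
      using False weight_pos[of y'] by simp
    ultimately show ?thesis using False by (simp add: hopf_cole_def)
  qed
qed

lemma hopf_cole_mono:
  assumes f: "\<And>x y. \<bar>f x - f y\<bar> \<le> \<bar>x - y\<bar>" and g: "\<And>x y. \<bar>g x - g y\<bar> \<le> \<bar>x - y\<bar>"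
    and m: "0 \<le> m" "m \<le> 1" and v: "0 \<le> v" and d: "\<And>x. f x \<le> g x + \<delta>"
  shows "hopf_cole m v f x \<le> hopf_cole m v g x + \<delta>"
proof -
  interpret f: lip_tilt f m v by unfold_locales (use assms in auto)
  interpret g: lip_tilt g m v by unfold_locales (use assms in auto)
  interpret prob_space gauss by (rule gauss_prob_space)
  show ?thesis
  proof (cases "m = 0")
    case True
    have i: "integrable gauss (\<lambda>z. f (x + z * sqrt v))" "integrable gauss (\<lambda>z. g (x + z * sqrt v))"
      using gauss_integrable[OF _ f.growth] gauss_integrable[OF _ g.growth] by auto
    have "(\<integral>z. f (x + z * sqrt v) \<partial>gauss) \<le> (\<integral>z. g (x + z * sqrt v) + \<delta> \<partial>gauss)"
      using i d by (intro integral_mono) auto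
    then show ?thesis using True i prob_space by (simp add: hopf_cole_def)
  next
    case False
    with m have mp: "0 < m" by simp
    have "(\<integral>z. exp (m * f (x + z * sqrt v)) \<partial>gauss) \<le> (\<integral>z. exp (m * g (x + z * sqrt v)) * exp (m * \<delta>) \<partial>gauss)"
      using d mp by (intro integral_mono f.weight_integrable integrable_mult_left[OF g.weight_integrable])
        (simp flip: exp_add distrib_left)
    then have "ln (\<integral>z. exp (m * f (x + z * sqrt v)) \<partial>gauss) \<le> ln ((\<integral>z. exp (m * g (x + z * sqrt v)) \<partial>gauss) * exp (m * \<delta>))"
      using f.weight_pos[of x] g.weight_pos[of x] by (subst ln_le_cancel_iff) auto
    also have "\<dots> = ln (\<integral>z. exp (m * g (x + z * sqrt v)) \<partial>gauss) + m * \<delta>"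
      using g.weight_pos[of x] by (subst ln_mult) auto
    finally show ?thesis using mp by (simp add: hopf_cole_def divide_le_eq ring_distribs mult.commute)
  qed
qed

text \<open>A monotone map that commutes with adding constants is a contraction in the sup norm;
  \<open>hopf_cole_mono\<close> contains both properties.\<close>

lemma hopf_cole_contraction:
  assumes f: "\<And>x y. \<bar>f x - f y\<bar> \<le> \<bar>x - y\<bar>" and g: "\<And>x y. \<bar>g x - g y\<bar> \<le> \<bar>x - y\<bar>"
    and m: "0 \<le> m" "m \<le> 1" and v: "0 \<le> v" and d: "\<And>x. \<bar>f x - g x\<bar> \<le> \<delta>"
  shows "\<bar>hopf_cole m v f x - hopf_cole m v g x\<bar> \<le> \<delta>"
proof -
  have "f x \<le> g x + \<delta>" "g x \<le> f x + \<delta>" for x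
    using d[of x] by auto
  then have "hopf_cole m v f x \<le> hopf_cole m v g x + \<delta>" "hopf_cole m v g x \<le> hopf_cole m v f x + \<delta>"
    using hopf_cole_mono[OF f g m v] hopf_cole_mono[OF g f m v] by auto
  then show ?thesis by auto
qed

section \<open>Short-time expansion, uniformly in m\<close>

lemma exp_taylor2: "\<bar>exp y - 1 - y - y\<^sup>2 / 2\<bar> \<le> \<bar>y\<bar> ^ 3 * exp \<bar>y\<bar>" for y :: real
proof -
  obtain t where t: "\<bar>t\<bar> \<le> \<bar>y\<bar>" "exp y = (\<Sum>k<3. y ^ k / fact k) + exp t / fact 3 * y ^ 3"
    using Maclaurin_exp_le[of y 3] by blast
  have "(\<Sum>k<3. y ^ k / fact k) = 1 + y + y\<^sup>2 / 2"
    by (simp add: numeral_eq_Suc lessThan_Suc)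
  then have "exp y - 1 - y - y\<^sup>2 / 2 = exp t / 6 * y ^ 3"
    using t(2) by (simp add: fact_numeral)
  then have "\<bar>exp y - 1 - y - y\<^sup>2 / 2\<bar> = exp t / 6 * \<bar>y\<bar> ^ 3"
    by (simp only:) (simp add: abs_mult power_abs)
  also have "\<dots> \<le> exp \<bar>y\<bar> * \<bar>y\<bar> ^ 3"
  proof (rule mult_right_mono)
    have "exp t \<le> exp \<bar>y\<bar>" using t(1) by simp
    then show "exp t / 6 \<le> exp \<bar>y\<bar>" using exp_gt_zero[of t] by linarith
  qed simp
  finally show ?thesis by (simp add: mult.commute)
qed

text \<open>With Y the increment of f and W = E exp (m Y), the transform changes f by ln W / m.
  Every error in W therefore has to carry a factor m, or the division would destroy uniformity as m
  tends to 0.\<close>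

lemma hopf_cole_one_step:
  "\<exists>C\<ge>0. \<forall>f f1 f2 m v x. smooth2 L f f1 f2 \<and> 0 \<le> m \<and> m \<le> 1 \<and> 0 \<le> v \<and> v \<le> V \<longrightarrow>
    \<bar>hopf_cole m v f x - f x - v / 2 * (f2 x + m * (f1 x)\<^sup>2)\<bar> \<le> C * (v * sqrt v)"
proof -
  \<comment> \<open>\<open>c1\<close> bounds the error integrals and \<open>c0\<close> bounds W from
    below; both depend on V only.\<close>
  define c1 where "c1 = (\<integral>z. (1 + \<bar>z\<bar>) ^ 3 * exp (sqrt V * \<bar>z\<bar>) \<partial>gauss)"
  define c0 where "c0 = (\<integral>z. exp (- sqrt V * \<bar>z\<bar>) \<partial>gauss)"
  define D where "D = c1 * (\<bar>L\<bar> + 2)"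
  define E where "E = 1 + sqrt \<bar>V\<bar> * D"
  define C where "C = D + sqrt \<bar>V\<bar> * E\<^sup>2 / c0"
  interpret prob_space gauss by (rule gauss_prob_space)
  have c0: "0 < c0" unfolding c0_def by (rule gauss_integral_pos[OF gauss_exp_abs]) simp
  have c1: "0 \<le> c1" unfolding c1_def by (rule integral_nonneg_AE) auto
  have D: "0 \<le> D" unfolding D_def using c1 by simp
  have dom: "integrable gauss g \<and> \<bar>\<integral>z. g z \<partial>gauss\<bar> \<le> B * c1"
    if [measurable]: "g \<in> borel_measurable borel" and "\<And>z. \<bar>g z\<bar> \<le> B * ((1 + \<bar>z\<bar>) ^ 3 * exp (sqrt V * \<bar>z\<bar>))" "0 \<le> B" for g B
  proof
    have i: "integrable gauss (\<lambda>z. B * ((1 + \<bar>z\<bar>) ^ 3 * exp (sqrt V * \<bar>z\<bar>)))"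
      by (intro integrable_mult_right gauss_poly_exp)
    show g: "integrable gauss g"
      by (rule Bochner_Integration.integrable_bound[OF i])
        (use that(2) in \<open>auto intro!: AE_I2 intro: order_trans[OF _ abs_ge_self]\<close>)
    have "\<bar>\<integral>z. g z \<partial>gauss\<bar> \<le> (\<integral>z. B * ((1 + \<bar>z\<bar>) ^ 3 * exp (sqrt V * \<bar>z\<bar>)) \<partial>gauss)"
      using that(2) by (intro order_trans[OF integral_abs_bound] integral_mono integrable_abs g i)
    then show "\<bar>\<integral>z. g z \<partial>gauss\<bar> \<le> B * c1" unfolding c1_def by simp
  qed
  show ?thesis
  proof (intro exI[of _ C] conjI allI impI, goal_cases)
    case 1
    show ?case unfolding C_def using D c0 by simp
  next
    case (2 f f1 f2 m v x)
    then have S: "smooth2 L f f1 f2" and m: "0 \<le> m" "m \<le> 1" and vV: "0 \<le> v" "v \<le> V" by auto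
    interpret lip_tilt f m v by unfold_locales (use smooth2_lip[OF S] m vV in auto)
    note v = vV
    define s where "s = sqrt v"
    have s: "0 \<le> s" "s\<^sup>2 = v" "s \<le> sqrt V" using v by (auto simp: s_def)
    have sV: "0 \<le> sqrt V" using s by linarith
    have L: "0 \<le> L" "\<bar>L\<bar> = L" "\<bar>V\<bar> = V" using smooth2_L_nonneg[OF S] v by auto
    define Y where "Y z = f (x + z * s) - f x" for z
    have Ym [measurable]: "Y \<in> borel_measurable borel" unfolding Y_def by measurable
    have Y: "\<bar>Y z\<bar> \<le> s * \<bar>z\<bar>" for z using shift_lip[of x z] by (simp add: Y_def s_def)
    have z3: "\<bar>z\<bar> ^ 3 \<le> (1 + \<bar>z\<bar>) ^ 3 * exp (sqrt V * \<bar>z\<bar>)" for z :: real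
    proof -
      have "\<bar>z\<bar> ^ 3 * 1 \<le> (1 + \<bar>z\<bar>) ^ 3 * exp (sqrt V * \<bar>z\<bar>)"
        using sV by (intro mult_mono power_mono) auto
      then show ?thesis by simp
    qed
    \<comment> \<open>The linear Taylor term has mean zero and z^2 has mean 1, which leaves f2 v / 2
      up to order v^(3/2).\<close>
    have EY: "integrable gauss Y \<and> \<bar>(\<integral>z. Y z \<partial>gauss) - f2 x * v / 2\<bar> \<le> L * s ^ 3 * c1"
    proof -
      have "\<bar>Y z - f1 x * s * z - f2 x * v / 2 * z\<^sup>2\<bar> \<le> L * s ^ 3 * ((1 + \<bar>z\<bar>) ^ 3 * exp (sqrt V * \<bar>z\<bar>))" for z
      proof -
        have "\<bar>Y z - f1 x * s * z - f2 x * v / 2 * z\<^sup>2\<bar> \<le> L * \<bar>z * s\<bar> ^ 3"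
          using smooth2_taylor2[OF S, of x "z * s"] s by (simp add: Y_def power_mult_distrib mult_ac)
        also have "\<dots> = L * s ^ 3 * \<bar>z\<bar> ^ 3" using s by (simp add: abs_mult power_mult_distrib)
        also have "\<dots> \<le> L * s ^ 3 * ((1 + \<bar>z\<bar>) ^ 3 * exp (sqrt V * \<bar>z\<bar>))"
          using L s by (intro mult_left_mono z3) auto
        finally show ?thesis .
      qed
      then have r: "integrable gauss (\<lambda>z. Y z - f1 x * s * z - f2 x * v / 2 * z\<^sup>2) \<and>
        \<bar>\<integral>z. Y z - f1 x * s * z - f2 x * v / 2 * z\<^sup>2 \<partial>gauss\<bar> \<le> L * s ^ 3 * c1"
        using L s by (intro dom) auto
      have "integrable gauss (\<lambda>z. (Y z - f1 x * s * z - f2 x * v / 2 * z\<^sup>2) + (f1 x * s * z + f2 x * v / 2 * z\<^sup>2))"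
        using r gauss_mean gauss_variance by (intro Bochner_Integration.integrable_add integrable_mult_right) auto
      then have Yi: "integrable gauss Y" by simp
      then show ?thesis using r gauss_mean gauss_variance by simp
    qed
    \<comment> \<open>Difference of squares: one factor is a first order Taylor remainder, of size
      s^2, and the other is of size s.\<close>
    have EY2: "integrable gauss (\<lambda>z. (Y z)\<^sup>2) \<and> \<bar>(\<integral>z. (Y z)\<^sup>2 \<partial>gauss) - (f1 x)\<^sup>2 * v\<bar> \<le> 2 * s ^ 3 * c1"
    proof -
      have "\<bar>(Y z)\<^sup>2 - (f1 x)\<^sup>2 * v * z\<^sup>2\<bar> \<le> 2 * s ^ 3 * ((1 + \<bar>z\<bar>) ^ 3 * exp (sqrt V * \<bar>z\<bar>))" for z
      proof -
        have "(Y z)\<^sup>2 - (f1 x)\<^sup>2 * v * z\<^sup>2 = (Y z - f1 x * (z * s)) * (Y z + f1 x * (z * s))"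
          unfolding s(2)[symmetric] by (simp add: power2_eq_square algebra_simps)
        also have "\<bar>\<dots>\<bar> \<le> (z * s)\<^sup>2 * (2 * (s * \<bar>z\<bar>))"
        proof -
          have "\<bar>f1 x * (z * s)\<bar> \<le> 1 * (s * \<bar>z\<bar>)"
            using mult_mono[OF smooth2_bounds(1)[OF S, of x] order_refl, of "s * \<bar>z\<bar>"] s
            by (simp add: abs_mult mult_ac)
          then have "\<bar>Y z + f1 x * (z * s)\<bar> \<le> 2 * (s * \<bar>z\<bar>)" using Y[of z] by linarith
          moreover have "\<bar>Y z - f1 x * (z * s)\<bar> \<le> (z * s)\<^sup>2"
            using smooth2_taylor0[OF S, of x "z * s"] by (simp add: Y_def)
          ultimately show ?thesis unfolding abs_mult by (intro mult_mono) auto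
        qed
        also have "\<dots> = 2 * s ^ 3 * \<bar>z\<bar> ^ 3"
        proof -
          have "(z * s)\<^sup>2 = (s * \<bar>z\<bar>)\<^sup>2" by (simp add: power_mult_distrib)
          then show ?thesis by (simp only:) (simp add: power3_eq_cube power2_eq_square)
        qed
        also have "\<dots> \<le> 2 * s ^ 3 * ((1 + \<bar>z\<bar>) ^ 3 * exp (sqrt V * \<bar>z\<bar>))"
          using s by (intro mult_left_mono z3) auto
        finally show ?thesis .
      qed
      then have r: "integrable gauss (\<lambda>z. (Y z)\<^sup>2 - (f1 x)\<^sup>2 * v * z\<^sup>2) \<and>
        \<bar>\<integral>z. (Y z)\<^sup>2 - (f1 x)\<^sup>2 * v * z\<^sup>2 \<partial>gauss\<bar> \<le> 2 * s ^ 3 * c1"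
        using s by (intro dom) auto
      have "integrable gauss (\<lambda>z. ((Y z)\<^sup>2 - (f1 x)\<^sup>2 * v * z\<^sup>2) + ((f1 x)\<^sup>2 * v * z\<^sup>2))"
        using r gauss_variance by (intro Bochner_Integration.integrable_add integrable_mult_right) auto
      then have Yi: "integrable gauss (\<lambda>z. (Y z)\<^sup>2)" by simp
      then show ?thesis using r gauss_variance by simp
    qed
    have s3: "s ^ 3 = v * sqrt v" using s by (simp add: power3_eq_cube power2_eq_square[symmetric] s_def)
    have c1L: "L * s ^ 3 * c1 \<le> D * (v * sqrt v)"
    proof -
      have "(s ^ 3 * c1) * L \<le> (s ^ 3 * c1) * (L + 2)" using s c1 by (intro mult_left_mono) auto
      then show ?thesis by (simp add: D_def s3[symmetric] L mult_ac)
    qed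
    have DC: "D * (v * sqrt v) \<le> C * (v * sqrt v)"
      unfolding C_def using v c0 by (intro mult_right_mono) auto
    show ?case
    proof (cases "m = 0")
      case True
      have "hopf_cole m v f x - f x = (\<integral>z. Y z \<partial>gauss)"
      proof -
        have "integrable gauss (\<lambda>z. f (x + z * s))" using gauss_integrable[OF _ growth] by (auto simp: s_def)
        then show ?thesis using True prob_space by (simp add: hopf_cole_def Y_def s_def)
      qed
      then show ?thesis using EY True c1L DC by (simp add: mult.commute)
    next
      case False
      with m have mp: "0 < m" by simp
      define W where "W = (\<integral>z. exp (m * Y z) \<partial>gauss)"
      define A where "A = v / 2 * (f2 x + m * (f1 x)\<^sup>2)"
      have ml: "\<bar>k * a - k * b\<bar> \<le> k * c" if "\<bar>a - b\<bar> \<le> c" "0 \<le> k" for k a b c :: real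
        using mult_left_mono[OF that] that(2) by (simp add: abs_mult flip: right_diff_distrib)
      have mY: "\<bar>m * Y z\<bar> \<le> m * (s * \<bar>z\<bar>)" "m * (s * \<bar>z\<bar>) \<le> sqrt V * \<bar>z\<bar>" for z
      proof -
        show "\<bar>m * Y z\<bar> \<le> m * (s * \<bar>z\<bar>)" using Y[of z] mp by (simp add: abs_mult)
        have "m * (s * \<bar>z\<bar>) \<le> 1 * (sqrt V * \<bar>z\<bar>)" using m s v by (intro mult_mono mult_right_mono) auto
        then show "m * (s * \<bar>z\<bar>) \<le> sqrt V * \<bar>z\<bar>" by simp
      qed
      have Wi: "integrable gauss (\<lambda>z. exp (m * Y z))"
        using integrable_mult_left[OF weight_integrable[of x], of "exp (- m * f x)"]
        by (simp add: Y_def s_def ring_distribs exp_diff exp_minus divide_inverse)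
      have hW: "hopf_cole m v f x - f x = ln W / m"
      proof -
        have "(\<integral>z. exp (m * f (x + z * sqrt v)) \<partial>gauss) = (\<integral>z. exp (m * Y z) * exp (m * f x) \<partial>gauss)"
          by (simp add: Y_def s_def flip: exp_add) (simp add: ring_distribs)
        also have "\<dots> = W * exp (m * f x)" unfolding W_def by simp
        finally have "ln (\<integral>z. exp (m * f (x + z * sqrt v)) \<partial>gauss) = ln W + m * f x"
          using gauss_integral_pos[OF Wi] by (simp add: W_def ln_mult)
        then show ?thesis using False by (simp add: hopf_cole_def field_simps)
      qed
      have W0: "c0 \<le> W"
        unfolding c0_def W_def
      proof (intro integral_mono gauss_exp_abs Wi)
        show "exp (- sqrt V * \<bar>z\<bar>) \<le> exp (m * Y z)" for z
          using order_trans[OF mY] by (auto simp: abs_le_iff) (metis minus_le_iff)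
      qed
      \<comment> \<open>The cubic remainder of the exponential carries m^3 \<le> m, so one factor m
        is left for the final division.\<close>
      have "\<bar>W - 1 - m * (\<integral>z. Y z \<partial>gauss) - m\<^sup>2 / 2 * (\<integral>z. (Y z)\<^sup>2 \<partial>gauss)\<bar> \<le> m * s ^ 3 * c1"
      proof -
        have "\<bar>exp (m * Y z) - 1 - m * Y z - (m * Y z)\<^sup>2 / 2\<bar> \<le> m * s ^ 3 * ((1 + \<bar>z\<bar>) ^ 3 * exp (sqrt V * \<bar>z\<bar>))" for z
        proof -
          have "\<bar>exp (m * Y z) - 1 - m * Y z - (m * Y z)\<^sup>2 / 2\<bar> \<le> \<bar>m * Y z\<bar> ^ 3 * exp \<bar>m * Y z\<bar>"
            by (rule exp_taylor2)
          also have "\<dots> \<le> (m * (s * \<bar>z\<bar>)) ^ 3 * exp (sqrt V * \<bar>z\<bar>)"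
            using mY[of z] by (intro mult_mono power_mono) auto
          also have "\<dots> = m ^ 3 * (s ^ 3 * (\<bar>z\<bar> ^ 3 * exp (sqrt V * \<bar>z\<bar>)))"
            by (simp add: power_mult_distrib)
          also have "\<dots> \<le> m * (s ^ 3 * ((1 + \<bar>z\<bar>) ^ 3 * exp (sqrt V * \<bar>z\<bar>)))"
            using m s power_decreasing[of 1 3 m] by (intro mult_mono mult_left_mono mult_right_mono power_mono) auto
          finally show ?thesis by (simp add: mult_ac)
        qed
        then have r: "integrable gauss (\<lambda>z. exp (m * Y z) - 1 - m * Y z - (m * Y z)\<^sup>2 / 2) \<and>
            \<bar>\<integral>z. exp (m * Y z) - 1 - m * Y z - (m * Y z)\<^sup>2 / 2 \<partial>gauss\<bar> \<le> m * s ^ 3 * c1"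
          using m s by (intro dom) auto
        then show ?thesis using EY EY2 Wi prob_space by (simp add: W_def power_mult_distrib)
      qed
      moreover have "\<bar>m * (\<integral>z. Y z \<partial>gauss) - m * (f2 x * v / 2)\<bar> \<le> m * (L * s ^ 3 * c1)"
        using EY mp by (intro ml) auto
      moreover have "\<bar>m\<^sup>2 / 2 * (\<integral>z. (Y z)\<^sup>2 \<partial>gauss) - m\<^sup>2 / 2 * ((f1 x)\<^sup>2 * v)\<bar> \<le> m * (s ^ 3 * c1)"
      proof -
        have "\<bar>m\<^sup>2 / 2 * (\<integral>z. (Y z)\<^sup>2 \<partial>gauss) - m\<^sup>2 / 2 * ((f1 x)\<^sup>2 * v)\<bar> \<le> m\<^sup>2 / 2 * (2 * s ^ 3 * c1)"
          using EY2 by (intro ml) auto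
        also have "\<dots> = m\<^sup>2 * (s ^ 3 * c1)" by simp
        also have "\<dots> \<le> m * (s ^ 3 * c1)"
          using m s c1 power_decreasing[of 1 2 m] by (intro mult_right_mono) auto
        finally show ?thesis .
      qed
      moreover have "m * A = m * (f2 x * v / 2) + m\<^sup>2 / 2 * ((f1 x)\<^sup>2 * v)"
        by (simp add: A_def power2_eq_square field_simps)
      moreover have "m * (D * s ^ 3) = m * s ^ 3 * c1 + m * (L * s ^ 3 * c1) + m * (s ^ 3 * c1)"
        using L by (simp add: D_def algebra_simps)
      ultimately have WA: "\<bar>W - 1 - m * A\<bar> \<le> m * (D * s ^ 3)"
        unfolding abs_le_iff by linarith
      have A: "\<bar>A\<bar> \<le> v"
      proof -
        have "m * (f1 x)\<^sup>2 \<le> 1 * 1" using smooth2_bounds(1)[OF S, of x] m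
          by (intro mult_mono) (auto simp: abs_square_le_1)
        moreover have "0 \<le> m * (f1 x)\<^sup>2" using m by simp
        ultimately have "\<bar>f2 x + m * (f1 x)\<^sup>2\<bar> \<le> 2" using smooth2_bounds(2)[OF S, of x] by linarith
        then have "\<bar>A\<bar> \<le> v / 2 * 2" unfolding A_def abs_mult using v by (intro mult_mono) auto
        then show ?thesis by simp
      qed
      have W1: "\<bar>W - 1\<bar> \<le> m * (v * E)"
      proof -
        have "\<bar>m * A\<bar> \<le> m * v" using A mp by (simp add: abs_mult)
        moreover have "s ^ 3 * D \<le> v * (sqrt V * D)"
          using s D v unfolding s3 by (simp add: mult.assoc mult_left_mono mult_right_mono)
        then have "m * (D * s ^ 3) \<le> m * (v * (sqrt V * D))" using mp by (simp add: mult.commute)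
        moreover have "m * (v * E) = m * v + m * (v * (sqrt V * D))" by (simp add: E_def L algebra_simps)
        ultimately show ?thesis using WA by linarith
      qed
      \<comment> \<open>Two-sided control of the logarithm from \<open>ln y \<le> y - 1\<close>,
        taken at W and at 1 / W. The gap (W - 1)^2 / W between the two bounds is of order m
        v^(3/2).\<close>
      have up: "ln W \<le> W - 1" using W0 c0 by (intro ln_le_minus_one) auto
      have lo: "W - 1 - (W - 1)\<^sup>2 / W \<le> ln W"
      proof -
        have "ln (inverse W) \<le> inverse W - 1" using W0 c0 by (intro ln_le_minus_one) auto
        then have "1 - 1 / W \<le> ln W" using W0 c0 by (simp add: ln_inverse divide_inverse)
        moreover have "W - 1 - (W - 1)\<^sup>2 / W = 1 - 1 / W" using W0 c0 by (simp add: field_simps power2_eq_square)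
        ultimately show ?thesis by simp
      qed
      have sq: "(W - 1)\<^sup>2 / W \<le> m * (sqrt V * E\<^sup>2 / c0 * s ^ 3)"
      proof -
        have "(W - 1)\<^sup>2 / W \<le> (m * (v * E))\<^sup>2 / c0"
          using W0 c0 W1 power_mono[OF W1, of 2] by (intro frac_le) auto
        also have "\<dots> = m\<^sup>2 * ((v * v) * E\<^sup>2) / c0" by (simp add: power2_eq_square mult_ac)
        also have "\<dots> \<le> m * ((sqrt V * s ^ 3) * E\<^sup>2) / c0"
        proof -
          have m2: "m\<^sup>2 \<le> m" using m power_decreasing[of 1 2 m] by auto
          have "v * v = s * s ^ 3" by (simp add: s(2)[symmetric] power2_eq_square power3_eq_cube)
          also have "\<dots> \<le> sqrt V * s ^ 3" using s by (intro mult_right_mono) auto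
          finally have vv: "v * v * E\<^sup>2 \<le> sqrt V * s ^ 3 * E\<^sup>2" by (rule mult_right_mono) simp
          show ?thesis
            by (intro divide_right_mono mult_mono[OF m2 vv]) (use m s v c0 in auto)
        qed
        finally show ?thesis by (simp add: mult_ac)
      qed
      have "\<bar>ln W - m * A\<bar> \<le> m * (D * s ^ 3) + m * (sqrt V * E\<^sup>2 / c0 * s ^ 3)"
      proof -
        have "0 \<le> (W - 1)\<^sup>2 / W" using W0 c0 by simp
        then show ?thesis using up lo sq WA by argo
      qed
      also have "\<dots> = m * (C * s ^ 3)" by (simp add: C_def L algebra_simps)
      finally have "\<bar>ln W / m - A\<bar> \<le> C * s ^ 3"
        using mp by (simp add: abs_le_iff field_simps)
      then show ?thesis unfolding hW A_def[symmetric] s3[symmetric] .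
    qed
  qed
qed

subsection \<open>Integrals over subintervals of the unit interval\<close>

text \<open>Integrands that may be added and multiplied freely and integrated over any subinterval.
  Measurability is asked for on [0,1] only, because \<zeta> and the expectations along X are
  controlled only there.\<close>

definition bdd_meas :: "(real \<Rightarrow> real) \<Rightarrow> bool" where
  "bdd_meas f \<longleftrightarrow> set_borel_measurable lborel {0..1} f \<and> (\<exists>B. \<forall>t\<in>{0..1}. \<bar>f t\<bar> \<le> B)"

lemma bdd_measI:
  assumes "set_borel_measurable lborel {0..1} f" "\<And>t. 0 \<le> t \<Longrightarrow> t \<le> 1 \<Longrightarrow> \<bar>f t\<bar> \<le> B"
  shows "bdd_meas f"
  unfolding bdd_meas_def using assms by (intro conjI exI[of _ B]) auto

lemma bdd_meas_const [simp, intro]: "bdd_meas (\<lambda>_. c)"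
  by (rule bdd_measI[of _ "\<bar>c\<bar>"]) (auto simp: set_borel_measurable_def)

lemma bdd_meas_add [intro]: "bdd_meas f \<Longrightarrow> bdd_meas g \<Longrightarrow> bdd_meas (\<lambda>t. f t + g t)"
proof -
  assume fg: "bdd_meas f" "bdd_meas g"
  obtain A B where AB: "\<And>t. t \<in> {0..1} \<Longrightarrow> \<bar>f t\<bar> \<le> A" "\<And>t. t \<in> {0..1} \<Longrightarrow> \<bar>g t\<bar> \<le> B"
    using fg unfolding bdd_meas_def by blast
  have "\<bar>f t + g t\<bar> \<le> A + B" if "t \<in> {0..1}" for t
    using AB[OF that] by linarith
  then show ?thesis
    using fg by (intro bdd_measI[of _ "A + B"]) (auto simp: bdd_meas_def set_borel_measurable_def distrib_left)
qed

lemma bdd_meas_mult [intro]: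
  assumes "bdd_meas f" "bdd_meas g"
  shows "bdd_meas (\<lambda>t. f t * g t)"
proof -
  obtain A B where AB: "\<And>t. t \<in> {0..1} \<Longrightarrow> \<bar>f t\<bar> \<le> A" "\<And>t. t \<in> {0..1} \<Longrightarrow> \<bar>g t\<bar> \<le> B"
    using assms unfolding bdd_meas_def by blast
  have "(\<lambda>t. (indicator {0..1} t *\<^sub>R f t) * (indicator {0..1} t *\<^sub>R g t)) \<in> borel_measurable lborel"
    using assms unfolding bdd_meas_def set_borel_measurable_def by (intro borel_measurable_times) auto
  also have "(\<lambda>t. (indicator {0..1} t *\<^sub>R f t) * (indicator {0..1} t *\<^sub>R g t)) = (\<lambda>t. indicator {0..1} t *\<^sub>R (f t * g t))"
    by (auto simp: indicator_def)
  finally show ?thesis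
    by (intro bdd_measI[of _ "A * B"]) (auto simp: set_borel_measurable_def abs_mult intro!: mult_mono' AB)
qed

lemma bdd_meas_diff [intro]: "bdd_meas f \<Longrightarrow> bdd_meas g \<Longrightarrow> bdd_meas (\<lambda>t. f t - g t)"
  using bdd_meas_add[of f "\<lambda>t. - 1 * g t"] bdd_meas_mult[of "\<lambda>_. - 1" g] by auto

lemma bdd_meas_abs [intro]:
  assumes "bdd_meas f"
  shows "bdd_meas (\<lambda>t. \<bar>f t\<bar>)"
proof -
  have "(\<lambda>t. \<bar>indicator {0..1} t *\<^sub>R f t\<bar>) \<in> borel_measurable lborel"
    using assms unfolding bdd_meas_def set_borel_measurable_def by auto
  also have "(\<lambda>t. \<bar>indicator {0..1} t *\<^sub>R f t\<bar>) = (\<lambda>t. indicator {0..1} t *\<^sub>R \<bar>f t\<bar>)"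
    by (auto simp: indicator_def)
  finally show ?thesis
    using assms unfolding bdd_meas_def set_borel_measurable_def by auto
qed

lemma bdd_meas_continuous:
  assumes "continuous_on {0..1} f"
  shows "bdd_meas f"
proof -
  have "bounded (f ` {0..1})"
    using assms compact_Icc by (intro compact_imp_bounded compact_continuous_image)
  then obtain B where "\<And>t. t \<in> {0..1} \<Longrightarrow> \<bar>f t\<bar> \<le> B"
    unfolding bounded_iff real_norm_def by blast
  then show ?thesis
    using borel_measurable_continuous_on_indicator[OF _ assms]
    by (intro bdd_measI) (auto simp: set_borel_measurable_def)
qed

lemma bdd_meas_borel:
  assumes "f \<in> borel_measurable borel" "\<And>t. 0 \<le> t \<Longrightarrow> t \<le> 1 \<Longrightarrow> \<bar>f t\<bar> \<le> B"
  shows "bdd_meas f"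
  using assms by (intro bdd_measI[of _ B]) (auto simp: set_borel_measurable_def)

lemma bdd_meas_integrable:
  assumes "bdd_meas f" "0 \<le> a" "b \<le> 1"
  shows "set_integrable lborel {a..b} f"
proof -
  obtain B where B: "\<And>t. t \<in> {0..1} \<Longrightarrow> \<bar>f t\<bar> \<le> B"
    using assms unfolding bdd_meas_def by blast
  have "set_integrable lborel {0..1} f"
    unfolding set_integrable_def
  proof (rule Bochner_Integration.integrable_bound)
    show "integrable lborel (\<lambda>t. indicator {0..1::real} t * B)"
      by (intro integrable_mult_left integrable_real_indicator) auto
    show "AE t in lborel. norm (indicator {0..1} t *\<^sub>R f t) \<le> norm (indicator {0..1} t * B)"
      using B by (intro AE_I2) (auto simp: indicator_def intro: order_trans[OF _ abs_ge_self])
  qed (use assms in \<open>simp add: bdd_meas_def set_borel_measurable_def\<close>)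
  then show ?thesis
    by (rule set_integrable_subset) (use assms in auto)
qed

lemma LBINT_split:
  assumes "bdd_meas f" "0 \<le> a" "a \<le> b" "b \<le> c" "c \<le> 1"
  shows "(LBINT t:{a..c}. f t) = (LBINT t:{a..b}. f t) + (LBINT t:{b..c}. f t)"
proof -
  have "{a..c} = {a..b} \<union> {b..c}" using assms by auto
  moreover have "(LBINT t:{a..b} \<union> {b..c}. f t) = (LBINT t:{a..b}. f t) + (LBINT t:{b..c}. f t)"
  proof (rule set_integral_Un_AE)
    have "AE t in lborel. t \<noteq> b" by (rule AE_lborel_singleton)
    then show "AE t in lborel. \<not> (t \<in> {a..b} \<and> t \<in> {b..c})" by eventually_elim auto
  qed (use assms bdd_meas_integrable in auto)
  ultimately show ?thesis by simp
qed

lemma LBINT_const: "(a::real) \<le> b \<Longrightarrow> (LBINT t:{a..b}. (c::real)) = (b - a) * c"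
  by (simp add: set_lebesgue_integral_def)

lemma LBINT_mono:
  assumes "bdd_meas f" "bdd_meas g" "0 \<le> a" "b \<le> 1" "\<And>t. a \<le> t \<Longrightarrow> t \<le> b \<Longrightarrow> f t \<le> g t"
  shows "(LBINT t:{a..b}. f t) \<le> (LBINT t:{a..b}. g t)"
  using assms by (intro set_integral_mono bdd_meas_integrable) auto

lemma LBINT_abs_le:
  assumes "bdd_meas f" "bdd_meas g" "0 \<le> a" "b \<le> 1" "\<And>t. a \<le> t \<Longrightarrow> t \<le> b \<Longrightarrow> \<bar>f t\<bar> \<le> g t"
  shows "\<bar>LBINT t:{a..b}. f t\<bar> \<le> (LBINT t:{a..b}. g t)"
proof -
  have "\<bar>LBINT t:{a..b}. f t\<bar> \<le> (LBINT t:{a..b}. \<bar>f t\<bar>)"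
    unfolding set_lebesgue_integral_def
    by (intro order_trans[OF integral_abs_bound] order_eq_refl Bochner_Integration.integral_cong) (auto simp: indicator_def)
  also have "\<dots> \<le> (LBINT t:{a..b}. g t)"
    using assms by (intro LBINT_mono bdd_meas_abs) auto
  finally show ?thesis .
qed

lemma LBINT_bound:
  assumes "bdd_meas f" "0 \<le> a" "a \<le> b" "b \<le> 1" "\<And>t. a \<le> t \<Longrightarrow> t \<le> b \<Longrightarrow> \<bar>f t\<bar> \<le> B"
  shows "\<bar>LBINT t:{a..b}. f t\<bar> \<le> B * (b - a)"
  using LBINT_abs_le[OF assms(1) bdd_meas_const assms(2,4,5)] LBINT_const[OF assms(3), of B] by (simp add: mult.commute)

lemma LBINT_nonneg:
  fixes f :: "real \<Rightarrow> real"
  assumes "\<And>t. a \<le> t \<Longrightarrow> t \<le> b \<Longrightarrow> 0 \<le> (f t :: real)"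
  shows "0 \<le> (LBINT t:{a..b}. f t)"
  unfolding set_lebesgue_integral_def by (rule integral_nonneg_AE) (use assms in \<open>auto simp: indicator_def\<close>)

text \<open>The right endpoint is a null set. Between two atoms \<alpha> is constant on the
  half-open interval and may jump at its right end, so this is the form in which it is replaced by
  its value.\<close>

lemma LBINT_cong_Ico:
  fixes f g :: "real \<Rightarrow> real"
  assumes "\<And>t. a \<le> t \<Longrightarrow> t < b \<Longrightarrow> f t = (g t :: real)" "set_borel_measurable lborel {a..b} f" "set_borel_measurable lborel {a..b} g"
  shows "(LBINT t:{a..b}. f t) = (LBINT t:{a..b}. g t)"
  unfolding set_lebesgue_integral_def
proof (rule integral_cong_AE)
  have "AE t in lborel. t \<noteq> b" by (rule AE_lborel_singleton)
  then show "AE t in lborel. indicator {a..b} t *\<^sub>R f t = indicator {a..b} t *\<^sub>R g t"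
  proof eventually_elim
    fix t assume "t \<noteq> b"
    then consider "t < b" | "b < t" by linarith
    then show "indicator {a..b} t *\<^sub>R f t = indicator {a..b} t *\<^sub>R g t"
      using assms(1)[of t] by cases (auto simp: indicator_def)
  qed
qed (use assms in \<open>simp_all add: set_borel_measurable_def\<close>)

lemma bdd_meas_sub:
  assumes "bdd_meas f" "0 \<le> a" "b \<le> 1"
  shows "set_borel_measurable lborel {a..b} f"
  using bdd_meas_integrable[OF assms] unfolding set_integrable_def set_borel_measurable_def
  by (rule borel_measurable_integrable)

text \<open>The error \<open>(t - s) * w (t - s)\<close> vanishes when summed over a fine partition.\<close>

lemma increasing_up_to_small_error:
  fixes D w :: "real \<Rightarrow> real"
  assumes "a \<le> b" and D: "\<And>s t. a \<le> s \<Longrightarrow> s < t \<Longrightarrow> t \<le> b \<Longrightarrow> D s \<le> D t + (t - s) * w (t - s)"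
    and w: "(w \<longlongrightarrow> 0) (at_right 0)"
  shows "D a \<le> D b"
proof (cases "a = b")
  case False
  with assms(1) have ab: "a < b" by simp
  let ?d = "\<lambda>n. (b - a) / real (Suc n)"
  have "D a \<le> D (a + real k * ?d n) + real k * (?d n * w (?d n))" if "k \<le> Suc n" for n k
    using that
  proof (induction k)
    case (Suc k)
    define p q where "p = a + real k * ?d n" and "q = a + real (Suc k) * ?d n"
    have d: "0 < ?d n" using ab by simp
    have "real (Suc k) * ?d n \<le> real (Suc n) * ?d n"
      using Suc.prems ab by (intro mult_right_mono) auto
    then have "q \<le> b" using ab by (simp add: q_def)
    moreover have pq: "q - p = ?d n"
      by (simp add: p_def q_def add_divide_distrib diff_divide_distrib ring_distribs)
    moreover have "p < q" using d pq by linarith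
    moreover have "a \<le> p" unfolding p_def using ab by simp
    ultimately have "D p \<le> D q + ?d n * w (?d n)"
      using D[of p q] by simp
    then have "D (a + real k * ?d n) \<le> D (a + real (Suc k) * ?d n) + ?d n * w (?d n)"
      by (simp only: p_def q_def)
    moreover have "D a \<le> D (a + real k * ?d n) + real k * (?d n * w (?d n))"
      using Suc by simp
    moreover have "real (Suc k) * (?d n * w (?d n)) = real k * (?d n * w (?d n)) + ?d n * w (?d n)"
      by (simp only: of_nat_Suc) (simp only: distrib_right mult_1)
    ultimately show ?case by linarith
  qed simp
  from this[of "Suc n" n for n] have "D a \<le> D b + (b - a) * w (?d n)" for n
    using ab by simp
  moreover have "(\<lambda>n. D b + (b - a) * w (?d n)) \<longlonglongrightarrow> D b + (b - a) * 0"
  proof (intro tendsto_intros filterlim_compose[OF w])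
    have "?d \<longlonglongrightarrow> 0"
      using LIMSEQ_Suc[OF lim_const_over_n[of "b - a"]] by simp
    then show "filterlim ?d (at_right 0) sequentially"
      using ab by (auto simp: filterlim_at intro!: always_eventually)
  qed
  ultimately have "D a \<le> D b + (b - a) * 0"
    by (intro LIMSEQ_le_const[of _ _ "D a"]) auto
  then show ?thesis by simp
qed simp

subsection \<open>Measures on the unit interval\<close>

lemma prob_measures_01D:
  assumes "\<mu> \<in> prob_measures_01"
  shows "prob_space \<mu>" "real_distribution \<mu>" "sets \<mu> = sets borel" "space \<mu> = UNIV" "measure \<mu> {0..1} = 1"
proof -
  show r: "real_distribution \<mu>" and "measure \<mu> {0..1} = 1"
    using assms by (simp_all add: prob_measures_01_def)
  interpret real_distribution \<mu> by (rule r)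
  show "prob_space \<mu>" by (rule prob_space_axioms)
  show "sets \<mu> = sets borel" "space \<mu> = UNIV" by simp_all
qed

context
  fixes \<mu> assumes mu: "\<mu> \<in> prob_measures_01"
begin

interpretation prob_space \<mu> by (rule prob_measures_01D[OF mu])

lemma alpha_nonneg [simp]: "0 \<le> alpha \<mu> s" and alpha_le_1: "alpha \<mu> s \<le> 1"
  by (simp_all add: alpha_def)

lemma alpha_mono: "s \<le> t \<Longrightarrow> alpha \<mu> s \<le> alpha \<mu> t"
  unfolding alpha_def using prob_measures_01D(3)[OF mu] by (intro finite_measure_mono) auto

lemma alpha_measurable [measurable]: "alpha \<mu> \<in> borel_measurable borel"
  by (intro borel_measurable_mono monoI alpha_mono)

lemma bdd_meas_alpha: "bdd_meas (alpha \<mu>)"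
  by (rule bdd_meas_borel[of _ 1]) (use alpha_le_1 alpha_nonneg in auto)

lemma alpha_outside: "measure \<mu> (- {0..1}) = 0"
  using prob_compl[of "{0..1}"] prob_measures_01D[OF mu] by (simp add: Compl_eq_Diff_UNIV)

lemma alpha_eq:
  assumes "0 \<le> s" "s \<le> t" "measure \<mu> {s<..t} = 0"
  shows "alpha \<mu> t = alpha \<mu> s"
proof -
  have "{0..t} = {0..s} \<union> {s<..t}" using assms by auto
  then have "alpha \<mu> t = measure \<mu> ({0..s} \<union> {s<..t})" by (simp add: alpha_def)
  also have "\<dots> = alpha \<mu> s + measure \<mu> {s<..t}"
    unfolding alpha_def using prob_measures_01D(3)[OF mu] by (intro finite_measure_Union) auto
  finally show ?thesis using assms by simp
qed

context
  assumes fin: "finitely_atomic \<mu>"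
begin

lemma finite_atoms: "finite {a. measure \<mu> {a} > 0}"
proof -
  obtain A where A: "finite A" "measure \<mu> A = 1" using fin unfolding finitely_atomic_def by auto
  have "{a. measure \<mu> {a} > 0} \<subseteq> A"
  proof (rule ccontr)
    assume "\<not> ?thesis"
    then obtain a where a: "measure \<mu> {a} > 0" "a \<notin> A" by auto
    have "measure \<mu> (A \<union> {a}) = measure \<mu> A + measure \<mu> {a}"
      using a A prob_measures_01D(3)[OF mu] by (intro finite_measure_Union) (simp_all add: borel_closed finite_imp_closed)
    then show False using a A prob_le_1[of "A \<union> {a}"] by simp
  qed
  then show ?thesis using A finite_subset by blast
qed

lemma atomless_null:
  assumes "\<And>a. a \<in> S \<Longrightarrow> measure \<mu> {a} = 0" "S \<in> sets borel"
  shows "measure \<mu> S = 0"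
proof -
  obtain A where A: "finite A" "measure \<mu> A = 1" using fin unfolding finitely_atomic_def by auto
  have sA: "A \<in> sets \<mu>" "S \<in> sets \<mu>"
    using A assms prob_measures_01D(3)[OF mu] by (simp_all add: borel_closed finite_imp_closed)
  have 1: "measure \<mu> (A \<inter> S) = (\<Sum>a\<in>A \<inter> S. measure \<mu> {a})"
    using A sA prob_measures_01D(3)[OF mu] by (intro finite_measure_eq_sum_singleton) auto
  have "measure \<mu> S = measure \<mu> (A \<inter> S) + measure \<mu> (S - A)"
  proof -
    have "S = (A \<inter> S) \<union> (S - A)" by auto
    then have "measure \<mu> S = measure \<mu> ((A \<inter> S) \<union> (S - A))" by simp
    also have "\<dots> = measure \<mu> (A \<inter> S) + measure \<mu> (S - A)"
      using sA by (intro finite_measure_Union) auto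
    finally show ?thesis .
  qed
  moreover have "measure \<mu> (S - A) \<le> measure \<mu> (space \<mu> - A)"
    using sA(1) prob_measures_01D(4)[OF mu] by (intro finite_measure_mono sets.compl_sets) auto
  ultimately show ?thesis
    using 1 assms prob_compl[OF sA(1)] A measure_nonneg[of \<mu> "S - A"] by auto
qed

lemma alpha_const:
  assumes "0 \<le> s" "s \<le> t" "\<And>a. s < a \<Longrightarrow> a \<le> t \<Longrightarrow> measure \<mu> {a} = 0"
  shows "alpha \<mu> t = alpha \<mu> s"
  by (rule alpha_eq[OF assms(1,2) atomless_null]) (use assms(3) in auto)

end

end

text \<open>Backward induction over the next point of A, or 1 if there is none; the starting time s
  is arbitrary. It runs on the number of points of A in (s,1), and P 1 is the terminal
  condition.\<close>

lemma gap_induct [consumes 3, case_names final step]: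
  fixes A :: "real set"
  assumes "finite A" "0 \<le> s" "s \<le> 1" "P 1"
    and step: "\<And>s t. 0 \<le> s \<Longrightarrow> s < t \<Longrightarrow> t \<le> 1 \<Longrightarrow> (\<And>a. s < a \<Longrightarrow> a < t \<Longrightarrow> a \<notin> A) \<Longrightarrow> t = 1 \<or> t \<in> A \<Longrightarrow> P t \<Longrightarrow> P s"
  shows "P s"
  using assms(2,3)
proof (induction "card (A \<inter> {s<..<1})" arbitrary: s rule: less_induct)
  case less
  show ?case
  proof (cases "s = 1")
    case False
    let ?B = "A \<inter> {s<..<1}"
    show ?thesis
    proof (cases "?B = {}")
      case True
      with less False show ?thesis by (intro step[of s 1]) (auto simp: assms(4))
    next
      case ne: False
      have fB: "finite ?B" using assms(1) by auto
      define t where "t = Min ?B"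
      have t: "t \<in> ?B" unfolding t_def using fB ne by (rule Min_in)
      have "A \<inter> {t<..<1} \<subset> ?B" using t by auto
      then have "P t" using t less.prems fB by (intro less.hyps psubset_card_mono) auto
      then show ?thesis
      proof (rule step[rotated -1])
        show "a \<notin> A" if "s < a" "a < t" for a
          using that t Min_le[OF fB, of a] unfolding t_def by fastforce
      qed (use t less.prems in auto)
    qed
  qed (use assms in simp)
qed

lemma smooth3_mono: "smooth3 L f \<Longrightarrow> L \<le> L' \<Longrightarrow> smooth3 L' f"
  unfolding smooth3_def by (meson order_trans)

lemma smooth3_lip: "smooth3 L f \<Longrightarrow> \<bar>f x - f y\<bar> \<le> \<bar>x - y\<bar>"
  by (metis smooth3_imp_smooth2 smooth2_lip(1))

lemma smooth3_smooth2_deriv: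
  assumes "smooth3 L f"
  shows "smooth2 L f (deriv f) (deriv (deriv f))"
proof -
  obtain f1 f2 where f: "smooth2 L f f1 f2" using smooth3_imp_smooth2[OF assms] .
  have "deriv f = f1" using smooth2D(1)[OF f] by (intro ext DERIV_imp_deriv)
  moreover have "deriv f1 = f2" using smooth2D(2)[OF f] by (intro ext DERIV_imp_deriv)
  ultimately show ?thesis using f by simp
qed

lemma smooth3_ln_cosh: "smooth3 2 (\<lambda>x. ln (cosh x))"
proof -
  have t: "(tanh x)\<^sup>2 \<le> 1" for x :: real
    using tanh_real_lt_1[of x] tanh_real_gt_neg1[of x] by (simp add: abs_square_le_1 abs_le_iff)
  have "((\<lambda>x. ln (cosh x)) has_real_derivative tanh x) (at x)" for x :: real
    by (auto intro!: derivative_eq_intros simp: tanh_def cosh_real_pos divide_inverse mult.commute)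
  moreover have "(tanh has_real_derivative 1 - (tanh x)\<^sup>2) (at x)" for x :: real
    by (auto intro!: derivative_eq_intros simp: cosh_real_nonzero)
  moreover have "((\<lambda>x. 1 - (tanh x)\<^sup>2) has_real_derivative - (2 * tanh x * (1 - (tanh x)\<^sup>2))) (at x)" for x :: real
    by (auto intro!: derivative_eq_intros simp: cosh_real_nonzero power2_eq_square)
  moreover have "\<bar>- (2 * tanh x * (1 - (tanh x)\<^sup>2))\<bar> \<le> 2" for x :: real
  proof -
    have "\<bar>tanh x * (1 - (tanh x)\<^sup>2)\<bar> \<le> 1 * 1"
      unfolding abs_mult using t[of x] tanh_real_lt_1[of x] tanh_real_gt_neg1[of x] by (intro mult_mono) auto
    then show ?thesis by (simp add: abs_mult)
  qed
  ultimately show ?thesis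
    unfolding smooth3_def using t
    by (intro exI[of _ tanh] exI[of _ "\<lambda>x. 1 - (tanh x)\<^sup>2"] exI[of _ "\<lambda>x. - (2 * tanh x * (1 - (tanh x)\<^sup>2))"]) auto
qed

subsection \<open>The Parisi PDE for atomic measures\<close>

text \<open>What the analysis uses of the mixture. \<zeta> may vanish at 0, when the quadratic term
  is absent, so strict positivity is asked for on (0,1]. With K \<ge> 1, both 1 and sqrt K can be
  absorbed into K.\<close>

locale parisi_pde =
  fixes \<xi> :: "real \<Rightarrow> real" and K :: real
  assumes xi_deriv: "0 \<le> s \<Longrightarrow> s \<le> 1 \<Longrightarrow> (deriv \<xi> has_real_derivative deriv (deriv \<xi>) s) (at s)"
    and zeta_cont: "continuous_on {0..1} (deriv (deriv \<xi>))"
    and zeta_nonneg: "0 \<le> s \<Longrightarrow> s \<le> 1 \<Longrightarrow> 0 \<le> deriv (deriv \<xi>) s"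
    and zeta_pos: "0 < s \<Longrightarrow> s \<le> 1 \<Longrightarrow> 0 < deriv (deriv \<xi>) s"
    and zeta_le: "0 \<le> s \<Longrightarrow> s \<le> 1 \<Longrightarrow> deriv (deriv \<xi>) s \<le> K"
    and K_ge_1: "1 \<le> K"
begin

abbreviation "\<rho> \<equiv> deriv \<xi>"
abbreviation "\<zeta> \<equiv> deriv (deriv \<xi>)"

lemma rho_diff:
  assumes "0 \<le> s" "s \<le> t" "t \<le> 1"
  shows "0 \<le> \<rho> t - \<rho> s" "\<rho> t - \<rho> s \<le> K * (t - s)"
proof -
  have "\<exists>z. s \<le> z \<and> z \<le> t \<and> \<rho> t - \<rho> s = (t - s) * \<zeta> z"
  proof (cases "s = t")
    case False
    have "\<exists>z>s. z < t \<and> \<rho> t - \<rho> s = (t - s) * \<zeta> z"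
      by (rule MVT2) (use False assms xi_deriv in auto)
    then show ?thesis using less_imp_le by blast
  qed auto
  then obtain z where z: "s \<le> z" "z \<le> t" "\<rho> t - \<rho> s = (t - s) * \<zeta> z" by auto
  then show "0 \<le> \<rho> t - \<rho> s" "\<rho> t - \<rho> s \<le> K * (t - s)"
    using zeta_nonneg[of z] zeta_le[of z] assms mult_left_mono[of "\<zeta> z" K "t - s"] by (auto simp: mult.commute)
qed

lemma rho_diff_le_K:
  assumes "0 \<le> s" "s \<le> t" "t \<le> 1"
  shows "\<rho> t - \<rho> s \<le> K"
proof -
  have "K * (t - s) \<le> K * 1" using assms K_ge_1 by (intro mult_left_mono) auto
  then show ?thesis using rho_diff(2)[OF assms] by simp
qed

lemma bdd_meas_zeta [simp, intro]: "bdd_meas \<zeta>"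
  by (rule bdd_meas_continuous[OF zeta_cont])

lemma LBINT_zeta:
  assumes "0 \<le> s" "s \<le> t" "t \<le> 1"
  shows "(LBINT r:{s..t}. \<zeta> r) = \<rho> t - \<rho> s"
proof -
  have "integral\<^sup>L lborel (\<lambda>x. indicator {s..t} x *\<^sub>R \<zeta> x) = \<rho> t - \<rho> s"
  proof (rule integral_FTC_Icc)
    show "(\<rho> has_vector_derivative \<zeta> x) (at x within {s..t})" if "s \<le> x" "x \<le> t" for x
      using xi_deriv[of x] that assms
      by (auto simp: has_real_derivative_iff_has_vector_derivative[symmetric] intro: has_field_derivative_at_within)
    show "continuous_on {s..t} \<zeta>"
      by (rule continuous_on_subset[OF zeta_cont]) (use assms in auto)
  qed (use assms in auto)
  then show ?thesis by (simp add: set_lebesgue_integral_def)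
qed

lemma Phi_atomic_1: "Phi_atomic \<xi> \<nu> 1 = (\<lambda>x. ln (cosh x))"
proof -
  have "{1, 1} \<union> {a. 1 < a \<and> a < 1 \<and> measure \<nu> {a} > 0} = {1::real}" by auto
  then have "sorted_list_of_set ({1, 1} \<union> {a. 1 < a \<and> a < 1 \<and> measure \<nu> {a} > 0}) = [1]"
    by (simp only:) simp
  then show ?thesis by (simp only: Phi_atomic_def hopf_cole_iter.simps)
qed

definition "admissible \<nu> \<longleftrightarrow> \<nu> \<in> prob_measures_01 \<and> finitely_atomic \<nu>"

context
  fixes \<nu> assumes nu: "admissible \<nu>"
begin

lemma nu': "\<nu> \<in> prob_measures_01" "finitely_atomic \<nu>"
  using nu by (auto simp: admissible_def)

abbreviation "atoms \<equiv> {a. measure \<nu> {a} > 0}"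

lemma breakpoints_Cons:
  assumes "finite C" "\<And>c. c \<in> C \<Longrightarrow> s < c"
  shows "sorted_list_of_set (insert s C) = s # sorted_list_of_set C"
proof -
  have "Min (insert s C) = s" using assms by (intro Min_eqI) (auto intro: less_imp_le)
  moreover have "insert s C - {s} = C" using assms by auto
  ultimately show ?thesis
    using sorted_list_of_set_nonempty[of "insert s C"] assms(1) by simp
qed

text \<open>As no atom lies strictly between s and t, the breakpoint list of s is s followed by that
  of t. For this, t has to be a breakpoint seen from s, that is, an atom or 1.\<close>

lemma Phi_atomic_step:
  assumes "0 \<le> s" "s < t" "t \<le> 1" "\<And>a. s < a \<Longrightarrow> a < t \<Longrightarrow> a \<notin> atoms" "t = 1 \<or> t \<in> atoms"
  shows "Phi_atomic \<xi> \<nu> s = hopf_cole (alpha \<nu> s) (\<rho> t - \<rho> s) (Phi_atomic \<xi> \<nu> t)"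
proof -
  let ?B = "\<lambda>s. {s, 1} \<union> {a. s < a \<and> a < 1 \<and> measure \<nu> {a} > 0}"
  let ?C = "{1} \<union> {a. t < a \<and> a < 1 \<and> measure \<nu> {a} > 0} - {t}"
  have fin: "finite (?B s)" for s
    using finite_atoms[OF nu'] by (auto intro: finite_subset[of _ atoms])
  then have finC: "finite ?C" using fin[of t] by (auto intro: finite_subset[of _ "?B t"])
  have gap: "t \<le> x" if "s < x" "measure \<nu> {x} > 0" for x
    using assms(4)[of x] that by force
  have Bs: "?B s = insert s (?B t)"
  proof (intro equalityI subsetI)
    fix x assume "x \<in> ?B s"
    then show "x \<in> insert s (?B t)" using gap[of x] by (cases "x = t") auto
  qed (use assms in auto)
  have Bt: "?B t = insert t ?C" by auto
  have "sorted_list_of_set (?B t) = t # sorted_list_of_set ?C"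
    unfolding Bt by (rule breakpoints_Cons[OF finC]) (use assms in auto)
  moreover have "sorted_list_of_set (?B s) = s # sorted_list_of_set (?B t)"
    unfolding Bs by (rule breakpoints_Cons[OF fin]) (use assms in auto)
  ultimately show ?thesis by (simp add: Phi_atomic_def)
qed

text \<open>The subtracted 1 makes the invariant multiplicative: a step gives the bound plus 1 a
  factor 1 + c v \<le> exp (c v), and the exponents telescope whatever the number of atoms.\<close>

lemma Phi_atomic_smooth3:
  assumes "0 \<le> s" "s \<le> 1"
  shows "smooth3 (3 * exp (8 * tilt_const K * (\<rho> 1 - \<rho> s)) - 1) (Phi_atomic \<xi> \<nu> s)"
  using finite_atoms[OF nu'] assms
proof (induction rule: gap_induct)
  case final
  then show ?case using smooth3_ln_cosh by (simp add: Phi_atomic_1)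
next
  case (step s t)
  let ?c = "8 * tilt_const K" and ?v = "\<rho> t - \<rho> s" and ?e = "3 * exp (8 * tilt_const K * (\<rho> 1 - \<rho> t))"
  have v: "0 \<le> ?v" "?v \<le> K"
    using rho_diff(1)[of s t] rho_diff_le_K[of s t] step.hyps by auto
  have "smooth3 ((?e - 1) + ?c * ((?e - 1) + 1) * ?v) (hopf_cole (alpha \<nu> s) ?v (Phi_atomic \<xi> \<nu> t))"
    by (rule hopf_cole_smooth3[OF step.IH]) (use v alpha_nonneg[OF nu'(1)] alpha_le_1[OF nu'(1)] in auto)
  moreover have "(?e - 1) + ?c * ((?e - 1) + 1) * ?v \<le> 3 * exp (?c * (\<rho> 1 - \<rho> s)) - 1"
  proof -
    have "1 + ?c * ?v \<le> exp (?c * ?v)" by (rule exp_ge_add_one_self)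
    then have "?e * (1 + ?c * ?v) \<le> ?e * exp (?c * ?v)" by (intro mult_left_mono) auto
    also have "\<dots> = 3 * exp (?c * (\<rho> 1 - \<rho> s))" by (simp flip: exp_add) (simp add: algebra_simps)
    finally show ?thesis by (simp add: algebra_simps)
  qed
  ultimately show ?case
    using Phi_atomic_step[of s t] step.hyps by (simp add: smooth3_mono)
qed

end

text \<open>A Hopf-Cole step multiplies \<open>L + 1\<close> by at most \<open>1 + 8 c v\<close>, the \<open>v\<close> add up to at most \<open>K\<close>, and
  \<open>ln cosh\<close> starts with \<open>L = 2\<close>.\<close>

definition "L = 3 * exp (8 * tilt_const K * K)"

lemma L_pos: "0 < L"
  by (simp add: L_def)

lemma tilt_const_nonneg: "0 \<le> tilt_const V"
  unfolding tilt_const_def by (intro divide_nonneg_nonneg integral_nonneg_AE) auto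

lemma Phi_atomic_smooth:
  assumes "admissible \<nu>" "0 \<le> s" "s \<le> 1"
  shows "smooth3 L (Phi_atomic \<xi> \<nu> s)"
proof (rule smooth3_mono[OF Phi_atomic_smooth3[OF assms]])
  have "\<rho> 1 - \<rho> s \<le> K" using rho_diff_le_K[of s 1] assms by auto
  then show "3 * exp (8 * tilt_const K * (\<rho> 1 - \<rho> s)) - 1 \<le> L"
  proof -
    assume "\<rho> 1 - \<rho> s \<le> K"
    then have "8 * tilt_const K * (\<rho> 1 - \<rho> s) \<le> 8 * tilt_const K * K"
      using tilt_const_nonneg[of K] by (intro mult_left_mono) auto
    then have "exp (8 * tilt_const K * (\<rho> 1 - \<rho> s)) \<le> exp (8 * tilt_const K * K)" by simp
    then show ?thesis unfolding L_def by linarith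
  qed
qed

lemma Phi_atomic_smooth2:
  assumes "admissible \<nu>" "0 \<le> s" "s \<le> 1"
  shows "smooth2 L (Phi_atomic \<xi> \<nu> s) (deriv (Phi_atomic \<xi> \<nu> s)) (deriv (deriv (Phi_atomic \<xi> \<nu> s)))"
  by (rule smooth3_smooth2_deriv[OF Phi_atomic_smooth[OF assms]])

lemma Phi_atomic_lip:
  assumes "admissible \<nu>" "0 \<le> s" "s \<le> 1"
  shows "\<bar>Phi_atomic \<xi> \<nu> s x - Phi_atomic \<xi> \<nu> s y\<bar> \<le> \<bar>x - y\<bar>"
  by (rule smooth3_lip[OF Phi_atomic_smooth[OF assms]])

lemma alpha_const_gap:
  assumes "admissible \<nu>" "0 \<le> s" "s \<le> r" "r < t" "\<And>a. s < a \<Longrightarrow> a < t \<Longrightarrow> \<not> measure \<nu> {a} > 0"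
  shows "alpha \<nu> r = alpha \<nu> s"
proof (rule alpha_const)
  show "measure \<nu> {a} = 0" if "s < a" "a \<le> r" for a
    using assms(5)[of a] that assms(4) measure_nonneg[of \<nu> "{a}"] by linarith
qed (use assms nu' in auto)

text \<open>Here t may lie between breakpoints. The step from s to the next breakpoint b is split at
  t by the semigroup property, and its second part is the solution at t.\<close>

lemma Phi_atomic_flow:
  assumes nu: "admissible \<nu>" and st: "0 \<le> s" "s < t" "t \<le> 1"
    and gap: "\<And>a. s < a \<Longrightarrow> a < t \<Longrightarrow> \<not> measure \<nu> {a} > 0"
  shows "Phi_atomic \<xi> \<nu> s = hopf_cole (alpha \<nu> s) (\<rho> t - \<rho> s) (Phi_atomic \<xi> \<nu> t)"
proof (cases "t = 1 \<or> measure \<nu> {t} > 0")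
  case True
  then show ?thesis using assms by (intro Phi_atomic_step[OF nu]) auto
next
  case False
  let ?A = "insert 1 ({a. measure \<nu> {a} > 0} \<inter> {t<..1})"
  define b where "b = Min ?A"
  have fin: "finite ?A" using finite_atoms[OF nu'[OF nu]] by auto
  have b: "b \<in> ?A" unfolding b_def by (rule Min_in[OF fin]) auto
  have b': "b \<le> a" if "a \<in> ?A" for a unfolding b_def using fin that by (rule Min_le)
  have tb: "t < b" "b \<le> 1" using b False st by auto
  have no: "\<not> measure \<nu> {a} > 0" if "s < a" "a < b" for a
  proof (cases "a \<le> t")
    case True
    then show ?thesis using gap[of a] that False by (cases "a = t") auto
  next
    case F: False
    then show ?thesis using b'[of a] that tb by fastforce
  qed
  have at: "alpha \<nu> t = alpha \<nu> s"
    using alpha_const_gap[OF nu st(1) less_imp_le[OF st(2)] tb(1) no] .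
  have "Phi_atomic \<xi> \<nu> s = hopf_cole (alpha \<nu> s) (\<rho> b - \<rho> s) (Phi_atomic \<xi> \<nu> b)"
    by (rule Phi_atomic_step[OF nu]) (use st tb no b in auto)
  also have "\<dots> = hopf_cole (alpha \<nu> s) ((\<rho> t - \<rho> s) + (\<rho> b - \<rho> t)) (Phi_atomic \<xi> \<nu> b)"
    by simp
  also have "\<dots> = hopf_cole (alpha \<nu> s) (\<rho> t - \<rho> s) (hopf_cole (alpha \<nu> s) (\<rho> b - \<rho> t) (Phi_atomic \<xi> \<nu> b))"
    using st tb rho_diff(1)[of s t] rho_diff(1)[of t b] alpha_nonneg[OF nu'(1)[OF nu]] alpha_le_1[OF nu'(1)[OF nu]]
    by (intro hopf_cole_semigroup[symmetric] Phi_atomic_lip[OF nu]) auto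
  also have "hopf_cole (alpha \<nu> s) (\<rho> b - \<rho> t) (Phi_atomic \<xi> \<nu> b) = Phi_atomic \<xi> \<nu> t"
    unfolding at[symmetric] by (rule Phi_atomic_step[OF nu, symmetric]) (use st tb no b in auto)
  finally show ?thesis .
qed

lemma Phi_atomic_one_step:
  "\<exists>C\<ge>0. \<forall>\<nu> s t x. admissible \<nu> \<and> 0 \<le> s \<and> s < t \<and> t \<le> 1 \<and> (\<forall>a. s < a \<longrightarrow> a < t \<longrightarrow> \<not> measure \<nu> {a} > 0) \<longrightarrow>
    \<bar>Phi_atomic \<xi> \<nu> s x - Phi_atomic \<xi> \<nu> t x - (\<rho> t - \<rho> s) / 2 *
       (deriv (deriv (Phi_atomic \<xi> \<nu> t)) x + alpha \<nu> s * (deriv (Phi_atomic \<xi> \<nu> t) x)\<^sup>2)\<bar> \<le> C * ((t - s) * sqrt (t - s))"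
proof -
  obtain C where C: "0 \<le> C" "\<And>f f1 f2 m v x. smooth2 L f f1 f2 \<Longrightarrow> 0 \<le> m \<Longrightarrow> m \<le> 1 \<Longrightarrow> 0 \<le> v \<Longrightarrow> v \<le> K \<Longrightarrow>
    \<bar>hopf_cole m v f x - f x - v / 2 * (f2 x + m * (f1 x)\<^sup>2)\<bar> \<le> C * (v * sqrt v)"
    using hopf_cole_one_step[of L K] by blast
  show ?thesis
  proof (intro exI[of _ "C * (K * sqrt K)"] conjI allI impI)
    show "0 \<le> C * (K * sqrt K)" using C K_ge_1 by simp
    fix \<nu> and s t x :: real
    assume A: "admissible \<nu> \<and> 0 \<le> s \<and> s < t \<and> t \<le> 1 \<and> (\<forall>a. s < a \<longrightarrow> a < t \<longrightarrow> \<not> measure \<nu> {a} > 0)"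
    let ?v = "\<rho> t - \<rho> s"
    have v: "0 \<le> ?v" "?v \<le> K * (t - s)" using rho_diff[of s t] A by auto
    moreover have "K * (t - s) \<le> K * 1" using A K_ge_1 by (intro mult_left_mono) auto
    ultimately have "\<bar>hopf_cole (alpha \<nu> s) ?v (Phi_atomic \<xi> \<nu> t) x - Phi_atomic \<xi> \<nu> t x - ?v / 2 *
       (deriv (deriv (Phi_atomic \<xi> \<nu> t)) x + alpha \<nu> s * (deriv (Phi_atomic \<xi> \<nu> t) x)\<^sup>2)\<bar> \<le> C * (?v * sqrt ?v)"
      using A nu' by (intro C(2) Phi_atomic_smooth2) (auto simp: alpha_le_1 alpha_nonneg)
    also have "\<dots> \<le> C * ((K * (t - s)) * sqrt (K * (t - s)))"
      using v C A K_ge_1 by (intro mult_left_mono mult_mono) auto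
    also have "\<dots> = C * (K * sqrt K) * ((t - s) * sqrt (t - s))"
      using A by (simp add: real_sqrt_mult)
    finally show "\<bar>Phi_atomic \<xi> \<nu> s x - Phi_atomic \<xi> \<nu> t x - (\<rho> t - \<rho> s) / 2 *
       (deriv (deriv (Phi_atomic \<xi> \<nu> t)) x + alpha \<nu> s * (deriv (Phi_atomic \<xi> \<nu> t) x)\<^sup>2)\<bar> \<le> C * (K * sqrt K) * ((t - s) * sqrt (t - s))"
      using Phi_atomic_flow[of \<nu> s t] A by simp
  qed
qed

lemma sqrt_mult_self_le:
  assumes "0 \<le> d" "d \<le> 1"
  shows "d * sqrt d \<le> d"
proof -
  have "d * sqrt d \<le> d * 1" using assms by (intro mult_left_mono) auto
  then show ?thesis by simp
qed

text \<open>Both terms of the PDE are bounded, since the first two space derivatives are at most 1.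
  A gap therefore costs a multiple of its length, and lengths add up.\<close>

lemma Phi_atomic_time:
  "\<exists>C\<ge>0. \<forall>\<nu> s t x. admissible \<nu> \<and> 0 \<le> s \<and> s \<le> t \<and> t \<le> 1 \<longrightarrow>
    \<bar>Phi_atomic \<xi> \<nu> s x - Phi_atomic \<xi> \<nu> t x\<bar> \<le> C * (t - s)"
proof -
  obtain C where C: "0 \<le> C" "\<And>\<nu> s t x. admissible \<nu> \<Longrightarrow> 0 \<le> s \<Longrightarrow> s < t \<Longrightarrow> t \<le> 1 \<Longrightarrow> (\<And>a. s < a \<Longrightarrow> a < t \<Longrightarrow> \<not> measure \<nu> {a} > 0) \<Longrightarrow>
    \<bar>Phi_atomic \<xi> \<nu> s x - Phi_atomic \<xi> \<nu> t x - (\<rho> t - \<rho> s) / 2 *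
       (deriv (deriv (Phi_atomic \<xi> \<nu> t)) x + alpha \<nu> s * (deriv (Phi_atomic \<xi> \<nu> t) x)\<^sup>2)\<bar> \<le> C * ((t - s) * sqrt (t - s))"
    using Phi_atomic_one_step by metis
  have one: "\<bar>Phi_atomic \<xi> \<nu> s x - Phi_atomic \<xi> \<nu> t x\<bar> \<le> (K + C) * (t - s)"
    if nu: "admissible \<nu>" and st: "0 \<le> s" "s < t" "t \<le> 1" and gap: "\<And>a. s < a \<Longrightarrow> a < t \<Longrightarrow> \<not> measure \<nu> {a} > 0" for \<nu> s t x
  proof -
    let ?g = "deriv (deriv (Phi_atomic \<xi> \<nu> t)) x + alpha \<nu> s * (deriv (Phi_atomic \<xi> \<nu> t) x)\<^sup>2"
    note S = Phi_atomic_smooth2[OF nu, of t]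
    have "alpha \<nu> s * (deriv (Phi_atomic \<xi> \<nu> t) x)\<^sup>2 \<le> 1 * 1"
      using smooth2_bounds(1)[OF S, of x] st nu'[OF nu] by (intro mult_mono) (auto simp: abs_square_le_1 alpha_le_1 alpha_nonneg)
    then have "\<bar>?g\<bar> \<le> 2"
      using smooth2_bounds(2)[OF S, of x] st alpha_nonneg[OF nu'(1)[OF nu], of s] zero_le_power2[of "deriv (Phi_atomic \<xi> \<nu> t) x"]
        mult_nonneg_nonneg[of "alpha \<nu> s" "(deriv (Phi_atomic \<xi> \<nu> t) x)\<^sup>2"] unfolding abs_le_iff by linarith
    then have "\<bar>(\<rho> t - \<rho> s) / 2 * ?g\<bar> \<le> (K * (t - s)) / 2 * 2"
      unfolding abs_mult using rho_diff[of s t] st by (intro mult_mono) auto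
    moreover have "C * ((t - s) * sqrt (t - s)) \<le> C * (t - s)"
      using C st by (intro mult_left_mono sqrt_mult_self_le) auto
    moreover note C(2)[OF nu st gap, of x]
    ultimately show ?thesis by (simp add: distrib_right)
  qed
  show ?thesis
  proof (intro exI[of _ "K + C"] conjI allI impI)
    show "0 \<le> K + C" using K_ge_1 C by simp
    fix \<nu> and s t x :: real
    assume A: "admissible \<nu> \<and> 0 \<le> s \<and> s \<le> t \<and> t \<le> 1"
    \<comment> \<open>Adding t to the breakpoints prevents a gap from straddling t.\<close>
    then have "finite (insert t {a. measure \<nu> {a} > 0})" "0 \<le> s" "s \<le> 1"
      using finite_atoms[OF nu'] by auto
    then have "s \<le> t \<longrightarrow> \<bar>Phi_atomic \<xi> \<nu> s x - Phi_atomic \<xi> \<nu> t x\<bar> \<le> (K + C) * (t - s)"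
    proof (induction rule: gap_induct)
      case final
      then show ?case using A by auto
    next
      case (step s r)
      show ?case
      proof
        assume st: "s \<le> t"
        show "\<bar>Phi_atomic \<xi> \<nu> s x - Phi_atomic \<xi> \<nu> t x\<bar> \<le> (K + C) * (t - s)"
        proof (cases "s = t")
          case False
          with st step.hyps(4)[of t] have "r \<le> t" by force
          then have "\<bar>Phi_atomic \<xi> \<nu> r x - Phi_atomic \<xi> \<nu> t x\<bar> \<le> (K + C) * (t - r)" using step.IH by simp
          moreover have "\<bar>Phi_atomic \<xi> \<nu> s x - Phi_atomic \<xi> \<nu> r x\<bar> \<le> (K + C) * (r - s)"
            using one[of \<nu> s r x] A step.hyps by auto
          moreover have "(K + C) * (t - s) = (K + C) * (t - r) + (K + C) * (r - s)" by (simp add: algebra_simps)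
          ultimately show ?thesis by linarith
        qed simp
      qed
    qed
    then show "\<bar>Phi_atomic \<xi> \<nu> s x - Phi_atomic \<xi> \<nu> t x\<bar> \<le> (K + C) * (t - s)" using A by simp
  qed
qed

end

text \<open>The choice \<open>h = \<delta>\<^sup>1\<^sup>/\<^sup>3\<close> in the interpolation is the source of the cube roots below.\<close>

lemma smooth2_interpolate_root:
  assumes S: "smooth2 L f f1 f2" and S': "smooth2 L g g1 g2" and d: "\<And>x. \<bar>f x - g x\<bar> \<le> \<delta>"
  shows "\<bar>f1 x - g1 x\<bar> \<le> (1 + 2 * L) * (root 3 \<delta>)\<^sup>2" "\<bar>f2 x - g2 x\<bar> \<le> (4 + 4 * L) * root 3 \<delta>"
proof -
  have d0: "0 \<le> \<delta>" using order_trans[OF abs_ge_zero d[of 0]] .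
  have "\<bar>f1 x - g1 x\<bar> \<le> (1 + 2 * L) * (root 3 \<delta>)\<^sup>2 \<and> \<bar>f2 x - g2 x\<bar> \<le> (4 + 4 * L) * root 3 \<delta>"
  proof (cases "\<delta> = 0")
    case True
    then have "f = g" using d by (intro ext) simp
    then have "f1 = g1" using smooth2D(1)[OF S] smooth2D(1)[OF S'] by (intro ext) (auto intro: DERIV_unique)
    then have "f2 = g2" using smooth2D(2)[OF S] smooth2D(2)[OF S'] by (intro ext) (auto intro: DERIV_unique)
    then show ?thesis using True \<open>f1 = g1\<close> by simp
  next
    case False
    define h where "h = root 3 \<delta>"
    have h: "0 < h" "\<delta> = h ^ 3" using d0 False by (auto simp: h_def)
    have "\<delta> / h = h\<^sup>2" "4 * \<delta> / h\<^sup>2 = 4 * h"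
      using h(1) unfolding h(2) by (simp_all add: power3_eq_cube power2_eq_square)
    then show ?thesis
      using smooth2_interpolate[OF S S' d h(1), of x] unfolding h_def[symmetric] by (simp add: algebra_simps)
  qed
  then show "\<bar>f1 x - g1 x\<bar> \<le> (1 + 2 * L) * (root 3 \<delta>)\<^sup>2" "\<bar>f2 x - g2 x\<bar> \<le> (4 + 4 * L) * root 3 \<delta>"
    by auto
qed

section \<open>Time regularity of the derivatives, the integrated PDE, and stability in the
  measure\<close>

lemma sqrt_le_root3:
  assumes "0 \<le> d" "d \<le> 1"
  shows "sqrt d \<le> root 3 d"
  using assms real_root_increasing[of 2 3 d] by (simp add: sqrt_def)

lemma root3_sq_le: "0 \<le> d \<Longrightarrow> d \<le> 1 \<Longrightarrow> (root 3 d)\<^sup>2 \<le> root 3 d"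
  using mult_left_mono[of "root 3 d" 1 "root 3 d"] by (simp add: power2_eq_square)

lemma LBINT_point [simp]: "(LBINT t:{a..a::real}. (f t :: real)) = 0"
  unfolding set_lebesgue_integral_def
proof (rule integral_eq_zero_AE)
  have "AE t in lborel. t \<noteq> a" by (rule AE_lborel_singleton)
  then show "AE t in lborel. indicator {a..a} t *\<^sub>R f t = 0"
    by eventually_elim (auto simp: indicator_def)
qed

context parisi_pde
begin

text \<open>Interpolation with \<delta> = C (t - s), applied to the solutions at the two times s and
  t.\<close>

lemma Phi_atomic_deriv_time:
  "\<exists>C\<ge>0. \<forall>\<nu> s t x. admissible \<nu> \<and> 0 \<le> s \<and> s \<le> t \<and> t \<le> 1 \<longrightarrow>
    \<bar>deriv (Phi_atomic \<xi> \<nu> s) x - deriv (Phi_atomic \<xi> \<nu> t) x\<bar> \<le> C * (root 3 (t - s))\<^sup>2 \<and>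
    \<bar>deriv (deriv (Phi_atomic \<xi> \<nu> s)) x - deriv (deriv (Phi_atomic \<xi> \<nu> t)) x\<bar> \<le> C * root 3 (t - s)"
proof -
  obtain C where C: "0 \<le> C" "\<And>\<nu> s t x. admissible \<nu> \<Longrightarrow> 0 \<le> s \<Longrightarrow> s \<le> t \<Longrightarrow> t \<le> 1 \<Longrightarrow>
    \<bar>Phi_atomic \<xi> \<nu> s x - Phi_atomic \<xi> \<nu> t x\<bar> \<le> C * (t - s)"
    using Phi_atomic_time by metis
  let ?A = "(1 + 2 * L) * (root 3 C)\<^sup>2" and ?B = "(4 + 4 * L) * root 3 C"
  have AB: "0 \<le> ?A" "0 \<le> ?B" using L_pos C by auto
  show ?thesis
  proof (intro exI[of _ "?A + ?B"] conjI allI impI)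
    show "0 \<le> ?A + ?B" using AB by simp
    fix \<nu> and s t x :: real
    assume A: "admissible \<nu> \<and> 0 \<le> s \<and> s \<le> t \<and> t \<le> 1"
    have S: "smooth2 L (Phi_atomic \<xi> \<nu> s) (deriv (Phi_atomic \<xi> \<nu> s)) (deriv (deriv (Phi_atomic \<xi> \<nu> s)))"
      "smooth2 L (Phi_atomic \<xi> \<nu> t) (deriv (Phi_atomic \<xi> \<nu> t)) (deriv (deriv (Phi_atomic \<xi> \<nu> t)))"
      using A by (auto intro: Phi_atomic_smooth2)
    have d: "\<bar>Phi_atomic \<xi> \<nu> s x - Phi_atomic \<xi> \<nu> t x\<bar> \<le> C * (t - s)" for x
      using C(2) A by simp
    have "\<bar>deriv (Phi_atomic \<xi> \<nu> s) x - deriv (Phi_atomic \<xi> \<nu> t) x\<bar> \<le> ?A * (root 3 (t - s))\<^sup>2"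
      using smooth2_interpolate_root(1)[OF S d, of x] by (simp add: real_root_mult power_mult_distrib mult.assoc)
    then show "\<bar>deriv (Phi_atomic \<xi> \<nu> s) x - deriv (Phi_atomic \<xi> \<nu> t) x\<bar> \<le> (?A + ?B) * (root 3 (t - s))\<^sup>2"
      by (rule order_trans) (use AB in \<open>auto intro!: mult_right_mono\<close>)
    have "\<bar>deriv (deriv (Phi_atomic \<xi> \<nu> s)) x - deriv (deriv (Phi_atomic \<xi> \<nu> t)) x\<bar> \<le> ?B * root 3 (t - s)"
      using smooth2_interpolate_root(2)[OF S d, of x] by (simp add: real_root_mult mult.assoc)
    then show "\<bar>deriv (deriv (Phi_atomic \<xi> \<nu> s)) x - deriv (deriv (Phi_atomic \<xi> \<nu> t)) x\<bar> \<le> (?A + ?B) * root 3 (t - s)"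
      by (rule order_trans) (use AB A in \<open>auto intro!: mult_right_mono\<close>)
  qed
qed

lemma bdd_meas_alpha_zeta: "\<mu> \<in> prob_measures_01 \<Longrightarrow> bdd_meas (\<lambda>r. alpha \<mu> r * \<zeta> r)"
  by (intro bdd_meas_mult bdd_meas_alpha bdd_meas_zeta)

lemma LBINT_alpha_zeta:
  assumes "\<mu> \<in> prob_measures_01" "0 \<le> s" "s \<le> t" "t \<le> 1"
  shows "0 \<le> (LBINT r:{s..t}. alpha \<mu> r * \<zeta> r)" "(LBINT r:{s..t}. alpha \<mu> r * \<zeta> r) \<le> \<rho> t - \<rho> s"
    "(LBINT r:{s..t}. alpha \<mu> r * \<zeta> r) \<le> K * (t - s)"
proof -
  show "0 \<le> (LBINT r:{s..t}. alpha \<mu> r * \<zeta> r)"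
    using assms by (intro LBINT_nonneg mult_nonneg_nonneg alpha_nonneg zeta_nonneg) auto
  show le: "(LBINT r:{s..t}. alpha \<mu> r * \<zeta> r) \<le> \<rho> t - \<rho> s"
    unfolding LBINT_zeta[OF assms(2-4), symmetric]
    using assms alpha_le_1[OF assms(1)] zeta_nonneg
    by (intro LBINT_mono bdd_meas_alpha_zeta bdd_meas_zeta mult_left_le_one_le alpha_nonneg) auto
  show "(LBINT r:{s..t}. alpha \<mu> r * \<zeta> r) \<le> K * (t - s)"
    using le rho_diff(2)[OF assms(2-4)] by simp
qed

lemma LBINT_gap:
  assumes "admissible \<nu>" "0 \<le> s" "s < t" "t \<le> 1" "\<And>a. s < a \<Longrightarrow> a < t \<Longrightarrow> \<not> measure \<nu> {a} > 0"
  shows "(LBINT r:{s..t}. alpha \<nu> r * \<zeta> r) = alpha \<nu> s * (\<rho> t - \<rho> s)"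
proof -
  have "(LBINT r:{s..t}. alpha \<nu> r * \<zeta> r) = (LBINT r:{s..t}. alpha \<nu> s * \<zeta> r)"
  proof (rule LBINT_cong_Ico)
    show "alpha \<nu> r * \<zeta> r = alpha \<nu> s * \<zeta> r" if "s \<le> r" "r < t" for r
      by (subst alpha_const_gap[OF assms(1,2) that assms(5)]) auto
    show "set_borel_measurable lborel {s..t} (\<lambda>r. alpha \<nu> r * \<zeta> r)"
      "set_borel_measurable lborel {s..t} (\<lambda>r. alpha \<nu> s * \<zeta> r)"
      using assms nu'[OF assms(1)] by (auto intro!: bdd_meas_sub bdd_meas_alpha_zeta)
  qed
  then show ?thesis using LBINT_zeta[of s t] assms by simp
qed

text \<open>The PDE in integrated form, with the derivatives frozen at the right end t. On each gap
  the expansion has them at the right end r of that gap; moving them to t costs their modulus of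
  continuity in time, times the length of the gap. As every error is proportional to a length, the
  number of gaps does not matter.\<close>

lemma Phi_atomic_consistency:
  "\<exists>C\<ge>0. \<forall>\<nu> s t x. admissible \<nu> \<and> 0 \<le> s \<and> s \<le> t \<and> t \<le> 1 \<longrightarrow>
    \<bar>Phi_atomic \<xi> \<nu> s x - Phi_atomic \<xi> \<nu> t x - ((\<rho> t - \<rho> s) * deriv (deriv (Phi_atomic \<xi> \<nu> t)) x
      + (LBINT r:{s..t}. alpha \<nu> r * \<zeta> r) * (deriv (Phi_atomic \<xi> \<nu> t) x)\<^sup>2) / 2\<bar> \<le> C * ((t - s) * root 3 (t - s))"
proof -
  obtain C where C: "0 \<le> C" "\<And>\<nu> s t x. admissible \<nu> \<Longrightarrow> 0 \<le> s \<Longrightarrow> s < t \<Longrightarrow> t \<le> 1 \<Longrightarrow> (\<And>a. s < a \<Longrightarrow> a < t \<Longrightarrow> \<not> measure \<nu> {a} > 0) \<Longrightarrow>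
    \<bar>Phi_atomic \<xi> \<nu> s x - Phi_atomic \<xi> \<nu> t x - (\<rho> t - \<rho> s) / 2 *
       (deriv (deriv (Phi_atomic \<xi> \<nu> t)) x + alpha \<nu> s * (deriv (Phi_atomic \<xi> \<nu> t) x)\<^sup>2)\<bar> \<le> C * ((t - s) * sqrt (t - s))"
    using Phi_atomic_one_step by metis
  obtain D where D: "0 \<le> D" "\<And>\<nu> s t x. admissible \<nu> \<Longrightarrow> 0 \<le> s \<Longrightarrow> s \<le> t \<Longrightarrow> t \<le> 1 \<Longrightarrow>
      \<bar>deriv (Phi_atomic \<xi> \<nu> s) x - deriv (Phi_atomic \<xi> \<nu> t) x\<bar> \<le> D * (root 3 (t - s))\<^sup>2"
     "\<And>\<nu> s t x. admissible \<nu> \<Longrightarrow> 0 \<le> s \<Longrightarrow> s \<le> t \<Longrightarrow> t \<le> 1 \<Longrightarrow>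
      \<bar>deriv (deriv (Phi_atomic \<xi> \<nu> s)) x - deriv (deriv (Phi_atomic \<xi> \<nu> t)) x\<bar> \<le> D * root 3 (t - s)"
    using Phi_atomic_deriv_time by metis
  define E where "E = C + K * (3 * D)"
  have E: "0 \<le> E" using C D K_ge_1 by (simp add: E_def)
  show ?thesis
  proof (intro exI[of _ E] conjI allI impI)
    show "0 \<le> E" by (rule E)
    fix \<nu> and s0 t x :: real
    assume A: "admissible \<nu> \<and> 0 \<le> s0 \<and> s0 \<le> t \<and> t \<le> 1"
    then have nu: "admissible \<nu>" and t: "0 \<le> t" "t \<le> 1" by auto
    define u where "u r = deriv (Phi_atomic \<xi> \<nu> r) x" for r
    define p where "p r = deriv (deriv (Phi_atomic \<xi> \<nu> r)) x" for r
    \<comment> \<open>One modulus for all gaps: \<open>e\<close> belongs to the whole interval from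
      s0 to t.\<close>
    define e where "e = root 3 (t - s0)"
    define G where "G s = ((\<rho> t - \<rho> s) * p t + (LBINT r:{s..t}. alpha \<nu> r * \<zeta> r) * (u t)\<^sup>2) / 2" for s
    define R where "R s = Phi_atomic \<xi> \<nu> s x - Phi_atomic \<xi> \<nu> t x - G s" for s
    have e0: "0 \<le> e" using A by (simp add: e_def)
    have e_mono: "root 3 (t - s) \<le> e" if "s0 \<le> s" for s using that by (simp add: e_def)
    have "finite (insert t {a. measure \<nu> {a} > 0})" "0 \<le> s0" "s0 \<le> 1"
      using A finite_atoms[OF nu'] by auto
    then have "s0 \<le> s0 \<longrightarrow> s0 \<le> t \<longrightarrow> \<bar>R s0\<bar> \<le> E * ((t - s0) * e)"
    proof (induction s0 arbitrary: rule: gap_induct[where P="\<lambda>s. s0 \<le> s \<longrightarrow> s \<le> t \<longrightarrow> \<bar>R s\<bar> \<le> E * ((t - s) * e)"])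
      case final
      show ?case
      proof (intro impI)
        assume "1 \<le> t"
        with t have "t = 1" by simp
        moreover have "R t = 0" by (simp only: R_def G_def LBINT_point) simp
        ultimately show "\<bar>R 1\<bar> \<le> E * ((t - 1) * e)" by simp
      qed
    next
      case (step s r)
      show ?case
      proof (intro impI)
        assume st: "s0 \<le> s" "s \<le> t"
        show "\<bar>R s\<bar> \<le> E * ((t - s) * e)"
        proof (cases "s = t")
          case True
          have "R t = 0" by (simp only: R_def G_def LBINT_point) simp
          then show ?thesis using True by simp
        next
          case False
          have rt: "r \<le> t" using step.hyps(4)[of t] False st by (cases "r \<le> t") auto
          have gap: "\<not> measure \<nu> {a} > 0" if "s < a" "a < r" for a
            using step.hyps(4)[of a] that by simp
          define m where "m = alpha \<nu> s"
          define v where "v = \<rho> r - \<rho> s"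
          have m: "0 \<le> m" "m \<le> 1" unfolding m_def using nu'[OF nu] by (auto simp: alpha_nonneg alpha_le_1)
          have v: "0 \<le> v" "v \<le> K * (r - s)" unfolding v_def using rho_diff[of s r] step.hyps by auto
          have Gd: "G s - G r = v * (p t + m * (u t)\<^sup>2) / 2"
          proof -
            have "(LBINT r:{s..t}. alpha \<nu> r * \<zeta> r) = m * v + (LBINT r:{r..t}. alpha \<nu> r * \<zeta> r)"
              using LBINT_split[OF bdd_meas_alpha_zeta[OF nu'(1)[OF nu]], of s r t] LBINT_gap[OF nu step.hyps(1-3) gap] rt t step.hyps
              by (simp add: v_def m_def)
            then show ?thesis unfolding G_def by (simp only:) (simp add: v_def algebra_simps diff_divide_distrib add_divide_distrib)
          qed
          have 1: "\<bar>Phi_atomic \<xi> \<nu> s x - Phi_atomic \<xi> \<nu> r x - v / 2 * (p r + m * (u r)\<^sup>2)\<bar> \<le> C * ((r - s) * sqrt (r - s))"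
            unfolding v_def p_def u_def m_def using C(2)[OF nu step.hyps(1-3) gap] by simp
          have 2: "\<bar>p r - p t\<bar> \<le> D * e"
            unfolding p_def using D(3)[OF nu _ rt t(2), of x] mult_left_mono[OF e_mono[of r] D(1)] step.hyps st by fastforce
          have 3: "\<bar>u r - u t\<bar> \<le> D * e"
          proof -
            have "\<bar>u r - u t\<bar> \<le> D * (root 3 (t - r))\<^sup>2" unfolding u_def using D(2)[OF nu _ rt t(2)] step.hyps by simp
            also have "\<dots> \<le> D * root 3 (t - r)" using D(1) rt t step.hyps by (intro mult_left_mono root3_sq_le) auto
            also have "\<dots> \<le> D * e" using D(1) e_mono[of r] step.hyps st by (intro mult_left_mono) auto
            finally show ?thesis .
          qed
          have ub: "\<bar>u r\<bar> \<le> 1" "\<bar>u t\<bar> \<le> 1"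
            unfolding u_def using smooth2_bounds(1)[OF Phi_atomic_smooth2[OF nu]] t step.hyps by auto
          have "\<bar>(u r)\<^sup>2 - (u t)\<^sup>2\<bar> = \<bar>u r + u t\<bar> * \<bar>u r - u t\<bar>"
            by (simp add: power2_eq_square algebra_simps flip: abs_mult)
          also have "\<dots> \<le> 2 * (D * e)" using ub 3 by (intro mult_mono) auto
          finally have 4: "\<bar>m * ((u r)\<^sup>2 - (u t)\<^sup>2)\<bar> \<le> 1 * (2 * (D * e))"
            unfolding abs_mult using m by (intro mult_mono) auto
          have "\<bar>(p r - p t) + m * ((u r)\<^sup>2 - (u t)\<^sup>2)\<bar> \<le> 3 * D * e"
            using 2 4 by linarith
          then have "\<bar>v * ((p r - p t) + m * ((u r)\<^sup>2 - (u t)\<^sup>2))\<bar> \<le> (K * (r - s)) * (3 * D * e)"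
            unfolding abs_mult using v by (intro mult_mono) auto
          moreover have "v / 2 * (p r + m * (u r)\<^sup>2) - v * (p t + m * (u t)\<^sup>2) / 2 = v * ((p r - p t) + m * ((u r)\<^sup>2 - (u t)\<^sup>2)) / 2"
            by (simp add: field_simps)
          moreover have "C * ((r - s) * sqrt (r - s)) \<le> C * ((r - s) * e)"
          proof -
            have "sqrt (r - s) \<le> root 3 (r - s)" using step.hyps by (intro sqrt_le_root3) auto
            also have "\<dots> \<le> e" using rt st by (simp add: e_def)
            finally show ?thesis using C(1) step.hyps by (intro mult_left_mono) auto
          qed
          moreover have "0 \<le> (K * (r - s)) * (3 * D * e)" using K_ge_1 D e0 step.hyps by simp
          ultimately have "\<bar>R s - R r\<bar> \<le> C * ((r - s) * e) + (K * (r - s)) * (3 * D * e)"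
            using 1 Gd unfolding R_def by linarith
          also have "\<dots> = E * ((r - s) * e)" by (simp add: E_def algebra_simps)
          finally have "\<bar>R s - R r\<bar> \<le> E * ((r - s) * e)" .
          moreover have "\<bar>R r\<bar> \<le> E * ((t - r) * e)" using step.IH rt st step.hyps by simp
          moreover have "E * ((t - s) * e) = E * ((t - r) * e) + E * ((r - s) * e)" by (simp add: algebra_simps)
          ultimately show ?thesis by linarith
        qed
      qed
    qed
    then show "\<bar>Phi_atomic \<xi> \<nu> s0 x - Phi_atomic \<xi> \<nu> t x - ((\<rho> t - \<rho> s0) * deriv (deriv (Phi_atomic \<xi> \<nu> t)) x
      + (LBINT r:{s0..t}. alpha \<nu> r * \<zeta> r) * (deriv (Phi_atomic \<xi> \<nu> t) x)\<^sup>2) / 2\<bar> \<le> E * ((t - s0) * root 3 (t - s0))"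
      using A by (simp add: R_def G_def p_def u_def e_def)
  qed
qed

text \<open>Two different constants m and m' on a common gap. A single expansion would leave an
  error of order (t - s)^(3/2), so the gap is cut into arbitrarily small steps. In each step the
  contraction property carries the sup distance along, while the expansions for m and m' differ by
  at most K |m - m'| times the step, up to an error that vanishes in the sum.\<close>

lemma Phi_atomic_stability_gap:
  assumes nu: "admissible \<nu>" "admissible \<nu>'" and st: "0 \<le> s" "s < t" "t \<le> 1"
    and gap: "\<And>a. s < a \<Longrightarrow> a < t \<Longrightarrow> \<not> measure \<nu> {a} > 0" "\<And>a. s < a \<Longrightarrow> a < t \<Longrightarrow> \<not> measure \<nu>' {a} > 0"
    and d: "\<And>x. \<bar>Phi_atomic \<xi> \<nu> t x - Phi_atomic \<xi> \<nu>' t x\<bar> \<le> \<delta>"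
  shows "\<bar>Phi_atomic \<xi> \<nu> s x - Phi_atomic \<xi> \<nu>' s x\<bar> \<le> \<delta> + K * \<bar>alpha \<nu> s - alpha \<nu>' s\<bar> * (t - s)"
proof -
  obtain C where C: "0 \<le> C" "\<And>f f1 f2 m v x. smooth2 L f f1 f2 \<Longrightarrow> 0 \<le> m \<Longrightarrow> m \<le> 1 \<Longrightarrow> 0 \<le> v \<Longrightarrow> v \<le> K \<Longrightarrow>
    \<bar>hopf_cole m v f x - f x - v / 2 * (f2 x + m * (f1 x)\<^sup>2)\<bar> \<le> C * (v * sqrt v)"
    using hopf_cole_one_step[of L K] by blast
  obtain T where T: "0 \<le> T" "\<And>\<nu> s t x. admissible \<nu> \<Longrightarrow> 0 \<le> s \<Longrightarrow> s \<le> t \<Longrightarrow> t \<le> 1 \<Longrightarrow>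
    \<bar>Phi_atomic \<xi> \<nu> s x - Phi_atomic \<xi> \<nu> t x\<bar> \<le> T * (t - s)"
    using Phi_atomic_time by metis
  define m m' where "m = alpha \<nu> s" and "m' = alpha \<nu>' s"
  have m: "0 \<le> m" "m \<le> 1" "0 \<le> m'" "m' \<le> 1"
    unfolding m_def m'_def using nu'[OF nu(1)] nu'[OF nu(2)] by (auto simp: alpha_nonneg alpha_le_1)
  define \<Delta> where "\<Delta> r x = \<bar>Phi_atomic \<xi> \<nu> r x - Phi_atomic \<xi> \<nu>' r x\<bar>" for r x
  define D where "D r = (SUP x. \<Delta> r x)" for r
  \<comment> \<open>The supremum is finite because both solutions stay within T of the common
    terminal value.\<close>
  have bdd: "bdd_above (range (\<Delta> r))" if "0 \<le> r" "r \<le> 1" for r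
  proof (rule bdd_aboveI2)
    fix x
    have "\<bar>Phi_atomic \<xi> \<nu> r x - ln (cosh x)\<bar> \<le> T * 1" "\<bar>Phi_atomic \<xi> \<nu>' r x - ln (cosh x)\<bar> \<le> T * 1"
      using T(2)[OF nu(1), of r 1 x] T(2)[OF nu(2), of r 1 x] that T(1) mult_left_mono[of "1 - r" 1 T]
      by (auto simp: Phi_atomic_1)
    then show "\<Delta> r x \<le> 2 * T" unfolding \<Delta>_def by linarith
  qed
  have DD: "\<Delta> r x \<le> D r" if "0 \<le> r" "r \<le> 1" for r x
    unfolding D_def using bdd[OF that] by (intro cSUP_upper) auto
  \<comment> \<open>The expansion errors for m and for m', per unit of length.\<close>
  define w where "w d = 2 * (C * (K * sqrt K)) * sqrt d" for d
  have step: "D r \<le> D q + K * \<bar>m - m'\<bar> * (q - r) + (q - r) * w (q - r)" if rq: "s \<le> r" "r < q" "q \<le> t" for r q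
    unfolding D_def[of r]
  proof (rule cSUP_least)
    fix x
    let ?v = "\<rho> q - \<rho> r" and ?f = "Phi_atomic \<xi> \<nu> q" and ?g = "Phi_atomic \<xi> \<nu>' q"
    have q: "0 \<le> q" "q \<le> 1" "0 \<le> r" "r \<le> 1" using rq st by auto
    have v: "0 \<le> ?v" "?v \<le> K * (q - r)" "?v \<le> K"
      using rho_diff[of r q] rho_diff_le_K[of r q] rq q by auto
    have al: "alpha \<nu> r = m" "alpha \<nu>' r = m'"
      unfolding m_def m'_def using rq st gap by (auto intro!: alpha_const_gap[OF nu(1)] alpha_const_gap[OF nu(2)])
    have f: "Phi_atomic \<xi> \<nu> r = hopf_cole m ?v ?f" "Phi_atomic \<xi> \<nu>' r = hopf_cole m' ?v ?g"
      unfolding al[symmetric] using rq q gap by (auto intro!: Phi_atomic_flow[OF nu(1)] Phi_atomic_flow[OF nu(2)])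
    have 1: "\<bar>hopf_cole m ?v ?f x - hopf_cole m ?v ?g x\<bar> \<le> D q"
      using DD[OF q(1,2)] v m q by (intro hopf_cole_contraction Phi_atomic_lip[OF nu(1)] Phi_atomic_lip[OF nu(2)]) (auto simp: \<Delta>_def)
    let ?g1 = "deriv ?g x" and ?g2 = "deriv (deriv ?g) x"
    note S = Phi_atomic_smooth2[OF nu(2) q(1,2)]
    have 2: "\<bar>hopf_cole m ?v ?g x - ?g x - ?v / 2 * (?g2 + m * ?g1\<^sup>2)\<bar> \<le> C * (?v * sqrt ?v)"
      "\<bar>hopf_cole m' ?v ?g x - ?g x - ?v / 2 * (?g2 + m' * ?g1\<^sup>2)\<bar> \<le> C * (?v * sqrt ?v)"
      using C(2)[OF S] m v by auto
    have 3: "C * (?v * sqrt ?v) \<le> C * ((K * (q - r)) * sqrt (K * (q - r)))"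
      using v C rq K_ge_1 by (intro mult_left_mono mult_mono) auto
    have 4: "2 * (C * ((K * (q - r)) * sqrt (K * (q - r)))) = (q - r) * w (q - r)"
      using rq by (simp add: w_def real_sqrt_mult)
    have "\<bar>?v / 2 * ((m - m') * ?g1\<^sup>2)\<bar> \<le> (K * (q - r)) * (\<bar>m - m'\<bar> * 1)"
      unfolding abs_mult using v smooth2_bounds(1)[OF S, of x] rq
      by (intro mult_mono) (auto simp: abs_square_le_1)
    moreover have "?v / 2 * (?g2 + m * ?g1\<^sup>2) - ?v / 2 * (?g2 + m' * ?g1\<^sup>2) = ?v / 2 * ((m - m') * ?g1\<^sup>2)"
      by (simp add: algebra_simps)
    moreover have "(K * (q - r)) * (\<bar>m - m'\<bar> * 1) = K * \<bar>m - m'\<bar> * (q - r)" by simp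
    ultimately have "\<bar>hopf_cole m ?v ?g x - hopf_cole m' ?v ?g x\<bar> \<le> K * \<bar>m - m'\<bar> * (q - r) + (q - r) * w (q - r)"
      using 2 3 4 by linarith
    then show "\<Delta> r x \<le> D q + K * \<bar>m - m'\<bar> * (q - r) + (q - r) * w (q - r)"
      using 1 unfolding \<Delta>_def f by linarith
  qed simp
  \<comment> \<open>Adding the linear term turns the claim into monotonicity up to small
    errors.\<close>
  have "D s + K * \<bar>m - m'\<bar> * s \<le> D t + K * \<bar>m - m'\<bar> * t"
  proof (rule increasing_up_to_small_error[where w=w and D="\<lambda>r. D r + K * \<bar>m - m'\<bar> * r"])
    show "D r + K * \<bar>m - m'\<bar> * r \<le> D q + K * \<bar>m - m'\<bar> * q + (q - r) * w (q - r)" if "s \<le> r" "r < q" "q \<le> t" for r q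
      using step[OF that] by (simp add: right_diff_distrib)
    show "(w \<longlongrightarrow> 0) (at_right 0)"
      unfolding w_def by (auto intro!: tendsto_eq_intros)
  qed (use st in auto)
  moreover have "D t \<le> \<delta>"
    unfolding D_def \<Delta>_def using d by (intro cSUP_least) auto
  moreover have "\<Delta> s x \<le> D s" using DD[of s x] st by auto
  ultimately show ?thesis unfolding \<Delta>_def m_def[symmetric] m'_def[symmetric] by (simp add: right_diff_distrib)
qed

text \<open>The induction runs over the atoms of both measures together, so that both distribution
  functions are constant on every gap; the costs of the gaps add up to the integral.\<close>

lemma Phi_atomic_stability:
  assumes nu: "admissible \<nu>" "admissible \<nu>'" and s: "0 \<le> s" "s \<le> 1"
  shows "\<bar>Phi_atomic \<xi> \<nu> s x - Phi_atomic \<xi> \<nu>' s x\<bar> \<le> K * (LBINT r:{s..1}. \<bar>alpha \<nu> r - alpha \<nu>' r\<bar>)"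
proof -
  have bm: "bdd_meas (\<lambda>r. \<bar>alpha \<nu> r - alpha \<nu>' r\<bar>)"
    using nu'[OF nu(1)] nu'[OF nu(2)] by (intro bdd_meas_abs bdd_meas_diff bdd_meas_alpha)
  have "finite ({a. measure \<nu> {a} > 0} \<union> {a. measure \<nu>' {a} > 0})"
    using finite_atoms nu'[OF nu(1)] nu'[OF nu(2)] by auto
  then have "\<forall>x. \<bar>Phi_atomic \<xi> \<nu> s x - Phi_atomic \<xi> \<nu>' s x\<bar> \<le> K * (LBINT r:{s..1}. \<bar>alpha \<nu> r - alpha \<nu>' r\<bar>)"
    using s
  proof (induction rule: gap_induct)
    case final
    show ?case by (simp only: Phi_atomic_1 LBINT_point) simp
  next
    case (step s t)
    have gap: "\<not> measure \<nu> {a} > 0" "\<not> measure \<nu>' {a} > 0" if "s < a" "a < t" for a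
      using step.hyps(4)[of a] that by simp_all
    have "(LBINT r:{s..t}. \<bar>alpha \<nu> r - alpha \<nu>' r\<bar>) = (LBINT r:{s..t}. \<bar>alpha \<nu> s - alpha \<nu>' s\<bar>)"
    proof (rule LBINT_cong_Ico)
      show "\<bar>alpha \<nu> r - alpha \<nu>' r\<bar> = \<bar>alpha \<nu> s - alpha \<nu>' s\<bar>" if "s \<le> r" "r < t" for r
        by (subst alpha_const_gap[OF nu(1) step.hyps(1) that gap(1)], simp, simp,
            subst alpha_const_gap[OF nu(2) step.hyps(1) that gap(2)]) auto
      show "set_borel_measurable lborel {s..t} (\<lambda>r. \<bar>alpha \<nu> r - alpha \<nu>' r\<bar>)"
        "set_borel_measurable lborel {s..t} (\<lambda>r. \<bar>alpha \<nu> s - alpha \<nu>' s\<bar>)"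
        using step.hyps by (auto intro!: bdd_meas_sub[OF bm] bdd_meas_sub[OF bdd_meas_const])
    qed
    then have "(LBINT r:{s..t}. \<bar>alpha \<nu> r - alpha \<nu>' r\<bar>) = (t - s) * \<bar>alpha \<nu> s - alpha \<nu>' s\<bar>"
      using step.hyps by (simp add: LBINT_const)
    with LBINT_split[OF bm, of s t 1] step.hyps
    have "(LBINT r:{s..1}. \<bar>alpha \<nu> r - alpha \<nu>' r\<bar>) = (t - s) * \<bar>alpha \<nu> s - alpha \<nu>' s\<bar> + (LBINT r:{t..1}. \<bar>alpha \<nu> r - alpha \<nu>' r\<bar>)"
      by linarith
    then have "K * (LBINT r:{s..1}. \<bar>alpha \<nu> r - alpha \<nu>' r\<bar>) = K * (LBINT r:{t..1}. \<bar>alpha \<nu> r - alpha \<nu>' r\<bar>) + K * \<bar>alpha \<nu> s - alpha \<nu>' s\<bar> * (t - s)"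
      by (simp only:) (simp add: algebra_simps)
    then show ?case
      using Phi_atomic_stability_gap[OF nu step.hyps(1-3) gap] step.IH by simp
  qed
  then show ?thesis by simp
qed

end

subsection \<open>The Parisi PDE for general measures\<close>

definition alpha_dist :: "real measure \<Rightarrow> real measure \<Rightarrow> real" where
  "alpha_dist \<mu> \<nu> = (LBINT t:{0..1}. \<bar>alpha \<mu> t - alpha \<nu> t\<bar>)"

lemma alpha_dist_commute: "alpha_dist \<mu> \<nu> = alpha_dist \<nu> \<mu>"
  by (simp add: alpha_dist_def abs_minus_commute)

lemma bdd_meas_alpha_diff:
  "\<mu> \<in> prob_measures_01 \<Longrightarrow> \<nu> \<in> prob_measures_01 \<Longrightarrow> bdd_meas (\<lambda>t. \<bar>alpha \<mu> t - alpha \<nu> t\<bar>)"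
  by (intro bdd_meas_abs bdd_meas_diff bdd_meas_alpha)

lemma alpha_dist_triangle:
  assumes "\<mu> \<in> prob_measures_01" "\<nu> \<in> prob_measures_01" "\<kappa> \<in> prob_measures_01"
  shows "alpha_dist \<mu> \<kappa> \<le> alpha_dist \<mu> \<nu> + alpha_dist \<nu> \<kappa>"
proof -
  have "alpha_dist \<mu> \<kappa> \<le> (LBINT t:{0..1}. \<bar>alpha \<mu> t - alpha \<nu> t\<bar> + \<bar>alpha \<nu> t - alpha \<kappa> t\<bar>)"
    unfolding alpha_dist_def using assms by (intro LBINT_mono bdd_meas_add bdd_meas_alpha_diff) auto
  also have "\<dots> = alpha_dist \<mu> \<nu> + alpha_dist \<nu> \<kappa>"
    unfolding alpha_dist_def using assms by (intro set_integral_add bdd_meas_integrable bdd_meas_alpha_diff) auto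
  finally show ?thesis .
qed

lemma alpha_dist_nonneg: "0 \<le> alpha_dist \<mu> \<nu>"
  unfolding alpha_dist_def by (intro LBINT_nonneg) auto

text \<open>The atomic approximation moves each point of \<open>(k/n, (k+1)/n]\<close> to the right end point.\<close>

lemma alpha_left_shift_integral:
  assumes "\<mu> \<in> prob_measures_01"
  shows "(\<lambda>n. LBINT t:{0..1}. alpha \<mu> t - alpha \<mu> (t - 1 / real (Suc n))) \<longlonglongrightarrow> 0"
proof -
  note [measurable] = alpha_measurable[OF assms]
  have "(\<lambda>n. \<integral>t. indicator {0..1} t *\<^sub>R (alpha \<mu> t - alpha \<mu> (t - 1 / real (Suc n))) \<partial>lborel) \<longlonglongrightarrow> (\<integral>t. (0 :: real) \<partial>(lborel :: real measure))"
  proof (rule integral_dominated_convergence[where w="\<lambda>t. indicator {0..1::real} t * 2"])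
    show "integrable lborel (\<lambda>t. indicator {0..1::real} t * 2 :: real)"
      by (intro integrable_mult_left integrable_real_indicator) auto
    have "countable {t. \<not> isCont (alpha \<mu>) t}"
      by (intro mono_ctble_discont monoI alpha_mono[OF assms])
    then have "AE t in lborel. t \<notin> {t. \<not> isCont (alpha \<mu>) t}"
      by (intro AE_not_in countable_imp_null_set_lborel)
    then show "AE t in lborel. (\<lambda>n. indicator {0..1} t *\<^sub>R (alpha \<mu> t - alpha \<mu> (t - 1 / real (Suc n)))) \<longlonglongrightarrow> 0"
    proof eventually_elim
      fix t assume "t \<notin> {t. \<not> isCont (alpha \<mu>) t}"
      then have c: "isCont (alpha \<mu>) t" by simp
      have "(\<lambda>n. t - 1 / real (Suc n)) \<longlonglongrightarrow> t - 0"
        using LIMSEQ_Suc[OF lim_const_over_n[of 1]] by (intro tendsto_intros) auto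
      then have "(\<lambda>n. alpha \<mu> (t - 1 / real (Suc n))) \<longlonglongrightarrow> alpha \<mu> t"
        using isCont_tendsto_compose[OF c] by simp
      then have "(\<lambda>n. indicator {0..1} t *\<^sub>R (alpha \<mu> t - alpha \<mu> (t - 1 / real (Suc n)))) \<longlonglongrightarrow> indicator {0..1} t *\<^sub>R (alpha \<mu> t - alpha \<mu> t)"
        by (intro tendsto_intros)
      then show "(\<lambda>n. indicator {0..1} t *\<^sub>R (alpha \<mu> t - alpha \<mu> (t - 1 / real (Suc n)))) \<longlonglongrightarrow> 0"
        by simp
    qed
    fix n
    have "\<bar>alpha \<mu> t - alpha \<mu> (t - 1 / real (Suc n))\<bar> \<le> 2" for t
      using alpha_nonneg[OF assms] alpha_le_1[OF assms] by (smt (verit, best))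
    then show "AE t in lborel. norm (indicator {0..1} t *\<^sub>R (alpha \<mu> t - alpha \<mu> (t - 1 / real (Suc n)))) \<le> indicator {0..1::real} t * 2"
      by (intro AE_I2) (auto simp: indicator_def)
  qed auto
  then show ?thesis by (simp add: set_lebesgue_integral_def)
qed

text \<open>Rounding up puts the new distribution function, on [0,1], between \<alpha> and its
  translate by 1/(n+1); the integral of the difference of these two tends to 0.\<close>

lemma atomic_approximation:
  assumes mu: "\<mu> \<in> prob_measures_01"
  obtains \<nu> where "\<And>n. \<nu> n \<in> prob_measures_01" "\<And>n. finitely_atomic (\<nu> n)" "(\<lambda>n. alpha_dist (\<nu> n) \<mu>) \<longlonglongrightarrow> 0"
proof -
  interpret real_distribution \<mu> by (rule prob_measures_01D[OF mu])
  \<comment> \<open>Points outside [0,1] carry no mass; sending them to 0 keeps the range inside the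
    finite grid.\<close>
  define f where "f n x = (if x \<in> {0..1} then of_int \<lceil>real (Suc n) * x\<rceil> / real (Suc n) else 0)" for n and x :: real
  have [measurable]: "f n \<in> borel_measurable borel" for n unfolding f_def by measurable
  have fm: "f n -` B \<in> sets borel" if "B \<in> sets borel" for n B
    using measurable_sets[of "f n" borel borel B] that by simp
  define \<nu> where "\<nu> n = distr \<mu> borel (f n)" for n
  have f01: "f n x \<in> (\<lambda>k. real k / real (Suc n)) ` {..Suc n}" for n x
  proof (cases "x \<in> {0..1}")
    case True
    have c: "0 \<le> \<lceil>real (Suc n) * x\<rceil>" "\<lceil>real (Suc n) * x\<rceil> \<le> int (Suc n)"
      using True by (auto simp: ceiling_le_iff mult_left_le)
         (smt (verit) ceiling_less_zero of_nat_0_le_iff mult_nonneg_nonneg le_minus_one_simps(1) zero_le_ceiling of_nat_Suc)+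
    then have "f n x = real (nat \<lceil>real (Suc n) * x\<rceil>) / real (Suc n)" "nat \<lceil>real (Suc n) * x\<rceil> \<le> Suc n"
      using True by (auto simp: f_def)
    then show ?thesis by (metis atMost_iff imageI)
  next
    case False
    then have "f n x = real 0 / real (Suc n)" by (auto simp: f_def)
    then show ?thesis by (metis atMost_iff imageI le0)
  qed
  have m: "measure (\<nu> n) B = measure \<mu> (f n -` B)" if "B \<in> sets borel" for n B
    unfolding \<nu>_def using that by (subst measure_distr) auto
  have 1: "\<nu> n \<in> prob_measures_01" for n
  proof -
    have "f n -` {0..1} = UNIV" using f01[of n] by fastforce
    then have "measure (\<nu> n) {0..1} = 1" using m[of "{0..1}" n] prob_space by simp
    moreover have "real_distribution (\<nu> n)"
      unfolding \<nu>_def by (intro real_distribution_distr) auto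
    ultimately show ?thesis by (simp add: prob_measures_01_def)
  qed
  have 2: "finitely_atomic (\<nu> n)" for n
  proof -
    let ?A = "(\<lambda>k. real k / real (Suc n)) ` {..Suc n}"
    have "f n -` ?A = UNIV" using f01[of n] by blast
    then have "measure (\<nu> n) ?A = 1" using m[of ?A n] prob_space by (simp add: borel_closed finite_imp_closed)
    then show ?thesis unfolding finitely_atomic_def by (intro exI[of _ ?A]) auto
  qed
  have null: "measure \<mu> (- {0..1}) = 0" by (rule alpha_outside[OF mu])
  have up: "alpha (\<nu> n) t \<le> alpha \<mu> t" for n t
  proof -
    have "f n -` {0..t} \<subseteq> {0..t} \<union> - {0..1}"
    proof
      fix x assume x: "x \<in> f n -` {0..t}"
      show "x \<in> {0..t} \<union> - {0..1}"
      proof (cases "x \<in> {0..1}")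
        case True
        have "x \<le> of_int \<lceil>real (Suc n) * x\<rceil> / real (Suc n)"
          by (simp add: pos_le_divide_eq mult.commute del: of_nat_Suc)
        then show ?thesis using x True by (auto simp: f_def)
      qed auto
    qed
    then have "alpha (\<nu> n) t \<le> measure \<mu> ({0..t} \<union> - {0..1})"
      unfolding alpha_def by (subst m) (auto intro!: finite_measure_mono)
    also have "\<dots> \<le> measure \<mu> {0..t} + measure \<mu> (- {0..1})"
      by (intro measure_Un_le) auto
    finally show ?thesis using null by (simp add: alpha_def)
  qed
  have lo: "alpha \<mu> (t - 1 / real (Suc n)) \<le> alpha (\<nu> n) t" if "t \<le> 1" for n t
  proof -
    have "{0..t - 1 / real (Suc n)} \<subseteq> f n -` {0..t}"
    proof
      fix x assume x: "x \<in> {0..t - 1 / real (Suc n)}"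
      have "of_int \<lceil>real (Suc n) * x\<rceil> \<le> real (Suc n) * x + 1" by linarith
      then have "of_int \<lceil>real (Suc n) * x\<rceil> / real (Suc n) \<le> (real (Suc n) * x + 1) / real (Suc n)"
        by (intro divide_right_mono) auto
      also have "\<dots> = x + 1 / real (Suc n)" by (simp add: add_divide_distrib del: of_nat_Suc)
      also have "\<dots> \<le> t" using x by auto
      finally have "of_int \<lceil>real (Suc n) * x\<rceil> / real (Suc n) \<le> t" .
      moreover have "0 \<le> f n x" using f01[of n x] by auto
      moreover have "0 < 1 / real (Suc n)" by simp
      then have "x \<in> {0..1}" using x that unfolding atLeastAtMost_iff by linarith
      ultimately show "x \<in> f n -` {0..t}" by (auto simp: f_def)
    qed
    then show ?thesis
      unfolding alpha_def by (subst m) (auto intro!: finite_measure_mono fm)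
  qed
  have shift: "bdd_meas (\<lambda>t. alpha \<mu> (t - 1 / real (Suc n)))" for n
    by (rule bdd_meas_borel[of _ 1]) (use alpha_measurable[OF mu] alpha_nonneg[OF mu] alpha_le_1[OF mu] in auto)
  have "(\<lambda>n. alpha_dist (\<nu> n) \<mu>) \<longlonglongrightarrow> 0"
  proof (rule tendsto_sandwich[OF _ _ tendsto_const alpha_left_shift_integral[OF mu]])
    show "\<forall>\<^sub>F n in sequentially. alpha_dist (\<nu> n) \<mu> \<le> (LBINT t:{0..1}. alpha \<mu> t - alpha \<mu> (t - 1 / real (Suc n)))"
    proof (intro always_eventually allI)
      fix n
      show "alpha_dist (\<nu> n) \<mu> \<le> (LBINT t:{0..1}. alpha \<mu> t - alpha \<mu> (t - 1 / real (Suc n)))"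
        unfolding alpha_dist_def
      proof (rule LBINT_mono[OF bdd_meas_alpha_diff[OF 1 mu] bdd_meas_diff[OF bdd_meas_alpha[OF mu] shift]])
        fix t :: real assume "0 \<le> t" "t \<le> 1"
        then show "\<bar>alpha (\<nu> n) t - alpha \<mu> t\<bar> \<le> alpha \<mu> t - alpha \<mu> (t - 1 / real (Suc n))"
          using up[of n t] lo[of t n] by linarith
      qed auto
    qed
  qed (auto intro: always_eventually alpha_dist_nonneg)
  then show thesis using 1 2 that by blast
qed

text \<open>A quadratic remainder bound is an inequality between values, so it passes to pointwise
  limits. This is how limits of derivatives are recognised as derivatives of the limit.\<close>

lemma has_derivative_from_quadratic:
  fixes f :: "real \<Rightarrow> real"
  assumes "\<And>h. \<bar>f (x + h) - f x - a * h\<bar> \<le> C * h\<^sup>2"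
  shows "(f has_real_derivative a) (at x)"
  unfolding DERIV_def
proof (rule Lim_null[THEN iffD2], rule Lim_null_comparison)
  show "\<forall>\<^sub>F h in at 0. norm ((f (x + h) - f x) / h - a) \<le> C * \<bar>h\<bar>"
    unfolding eventually_at
  proof (intro exI[of _ 1] conjI ballI impI)
    fix h :: real assume h: "h \<noteq> 0 \<and> dist h 0 < 1"
    then have "(f (x + h) - f x) / h - a = (f (x + h) - f x - a * h) / h" by (simp add: field_simps)
    also have "\<bar>\<dots>\<bar> \<le> C * h\<^sup>2 / \<bar>h\<bar>"
      using assms[of h] by (simp add: abs_divide divide_right_mono)
    also have "\<dots> = C * \<bar>h\<bar>" using h by (simp add: power2_eq_square field_simps abs_mult_self_eq flip: abs_mult)
    finally show "norm ((f (x + h) - f x) / h - a) \<le> C * \<bar>h\<bar>" by simp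
  qed simp
  show "((\<lambda>h. C * \<bar>h\<bar>) \<longlongrightarrow> 0) (at 0)"
    by (auto intro!: tendsto_eq_intros)
qed

text \<open>Interpolation turns uniform closeness of the functions into the Cauchy property of both
  derivatives. The Taylor inequalities then hold for the limits and identify them.\<close>

lemma smooth2_limit:
  assumes S: "\<And>n. smooth2 L (f n) (f1 n) (f2 n)" and d: "\<And>n x. \<bar>f n x - g x\<bar> \<le> \<delta> n" "\<delta> \<longlonglongrightarrow> 0"
  shows "smooth2 L g (deriv g) (deriv (deriv g)) \<and> (\<forall>x. (\<lambda>n. f1 n x) \<longlonglongrightarrow> deriv g x \<and> (\<lambda>n. f2 n x) \<longlonglongrightarrow> deriv (deriv g) x)"
proof -
  have L: "0 \<le> L" by (rule smooth2_L_nonneg[OF S])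
  have lim0: "(\<lambda>n. f n x) \<longlonglongrightarrow> g x" for x
    by (rule Lim_null[THEN iffD2], rule Lim_null_comparison[OF _ d(2)]) (use d(1) in auto)
  have dd: "\<bar>f n x - f k x\<bar> \<le> \<delta> n + \<delta> k" for n k x
    using d(1)[of n x] d(1)[of k x] by linarith
  have small: "\<exists>N. \<forall>n\<ge>N. \<forall>k\<ge>N. root 3 (\<delta> n + \<delta> k) < e" if "0 < e" for e
  proof -
    have "0 < e ^ 3 / 2" using that by simp
    from LIMSEQ_D[OF d(2) this] obtain N where N: "\<And>n. n \<ge> N \<Longrightarrow> \<bar>\<delta> n\<bar> < e ^ 3 / 2"
      unfolding diff_0_right real_norm_def by blast
    have "root 3 (\<delta> n + \<delta> k) < root 3 (e ^ 3)" if "n \<ge> N" "k \<ge> N" for n k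
      using N[OF that(1)] N[OF that(2)] by (intro real_root_less_mono) auto
    then show ?thesis using that by (auto simp: real_root_power_cancel)
  qed
  have "\<exists>a. (\<lambda>n. f2 n x) \<longlonglongrightarrow> a" for x
  proof -
    have "Cauchy (\<lambda>n. f2 n x)"
    proof (rule metric_CauchyI)
      fix e :: real assume e: "0 < e"
      then obtain N where N: "\<And>n k. n \<ge> N \<Longrightarrow> k \<ge> N \<Longrightarrow> root 3 (\<delta> n + \<delta> k) < e / (4 + 4 * L)"
        using small[of "e / (4 + 4 * L)"] L by auto
      have "dist (f2 n x) (f2 k x) < e" if "n \<ge> N" "k \<ge> N" for n k
        using smooth2_interpolate_root(2)[OF S[of n] S[of k] dd, of x] N[OF that] L by (simp add: dist_real_def field_simps)
      then show "\<exists>M. \<forall>m\<ge>M. \<forall>n\<ge>M. dist (f2 m x) (f2 n x) < e" by blast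
    qed
    then show ?thesis by (simp add: Cauchy_convergent_iff convergent_def)
  qed
  then obtain b where b: "\<And>x. (\<lambda>n. f2 n x) \<longlonglongrightarrow> b x" by metis
  have "\<exists>a. (\<lambda>n. f1 n x) \<longlonglongrightarrow> a" for x
  proof -
    have "Cauchy (\<lambda>n. f1 n x)"
    proof (rule metric_CauchyI)
      fix e :: real assume e: "0 < e"
      then obtain N where N: "\<And>n k. n \<ge> N \<Longrightarrow> k \<ge> N \<Longrightarrow> root 3 (\<delta> n + \<delta> k) < min 1 (e / (1 + 2 * L))"
        using small[of "min 1 (e / (1 + 2 * L))"] L by auto
      have "dist (f1 n x) (f1 k x) < e" if "n \<ge> N" "k \<ge> N" for n k
      proof -
        let ?r = "root 3 (\<delta> n + \<delta> k)"
        have "0 \<le> \<delta> n + \<delta> k" using order_trans[OF abs_ge_zero dd] .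
        then have r: "0 \<le> ?r" "?r < 1" "?r < e / (1 + 2 * L)" using N[OF that] by auto
        have "\<bar>f1 n x - f1 k x\<bar> \<le> (1 + 2 * L) * ?r\<^sup>2" by (rule smooth2_interpolate_root(1)[OF S S dd])
        also have "\<dots> \<le> (1 + 2 * L) * ?r"
          using r L by (intro mult_left_mono) (auto simp: power2_eq_square mult_left_le)
        also have "\<dots> < e" using r L by (simp add: field_simps)
        finally show ?thesis by (simp add: dist_real_def)
      qed
      then show "\<exists>M. \<forall>m\<ge>M. \<forall>n\<ge>M. dist (f1 m x) (f1 n x) < e" by blast
    qed
    then show ?thesis by (simp add: Cauchy_convergent_iff convergent_def)
  qed
  then obtain a where a: "\<And>x. (\<lambda>n. f1 n x) \<longlonglongrightarrow> a x" by metis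
  have 1: "(g has_real_derivative a x) (at x)" for x
  proof (rule has_derivative_from_quadratic)
    fix h
    have "(\<lambda>n. \<bar>f n (x + h) - f n x - f1 n x * h\<bar>) \<longlonglongrightarrow> \<bar>g (x + h) - g x - a x * h\<bar>"
      by (intro tendsto_intros lim0 a)
    then show "\<bar>g (x + h) - g x - a x * h\<bar> \<le> 1 * h\<^sup>2"
      by (rule LIMSEQ_le_const2) (use smooth2_taylor0[OF S] in auto)
  qed
  have 2: "(a has_real_derivative b x) (at x)" for x
  proof (rule has_derivative_from_quadratic)
    fix h
    have "(\<lambda>n. \<bar>f1 n (x + h) - f1 n x - f2 n x * h\<bar>) \<longlonglongrightarrow> \<bar>a (x + h) - a x - b x * h\<bar>"
      by (intro tendsto_intros b a)
    then show "\<bar>a (x + h) - a x - b x * h\<bar> \<le> L * h\<^sup>2"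
      by (rule LIMSEQ_le_const2) (use smooth2_taylor1[OF S] in auto)
  qed
  have 3: "0 \<le> b x" for x
    by (rule LIMSEQ_le_const[OF b]) (use smooth2D(3)[OF S] in auto)
  have 4: "b x \<le> 1 - (a x)\<^sup>2" for x
    by (rule LIMSEQ_le[OF b tendsto_diff[OF tendsto_const tendsto_power[OF a]]]) (use smooth2D(4)[OF S] in auto)
  have 5: "\<bar>b x - b y\<bar> \<le> L * \<bar>x - y\<bar>" for x y
    by (rule LIMSEQ_le_const2[OF tendsto_rabs[OF tendsto_diff[OF b b]]]) (use smooth2D(5)[OF S] in auto)
  have "deriv g = a" "deriv a = b"
    using DERIV_imp_deriv[OF 1] DERIV_imp_deriv[OF 2] by (auto intro!: ext)
  then show ?thesis
    using 1 2 3 4 5 a b by (simp add: smooth2_def)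
qed

context parisi_pde
begin

lemma stability_01:
  assumes "admissible \<nu>" "admissible \<nu>'" "0 \<le> s" "s \<le> 1"
  shows "\<bar>Phi_atomic \<xi> \<nu> s x - Phi_atomic \<xi> \<nu>' s x\<bar> \<le> K * alpha_dist \<nu> \<nu>'"
proof -
  have bm: "bdd_meas (\<lambda>t. \<bar>alpha \<nu> t - alpha \<nu>' t\<bar>)"
    using assms nu' by (intro bdd_meas_alpha_diff) auto
  have "(LBINT r:{s..1}. \<bar>alpha \<nu> r - alpha \<nu>' r\<bar>) \<le> alpha_dist \<nu> \<nu>'"
    unfolding alpha_dist_def using LBINT_split[OF bm, of 0 s 1] LBINT_nonneg[of 0 s "\<lambda>t. \<bar>alpha \<nu> t - alpha \<nu>' t\<bar>"] assms by simp
  then have "K * (LBINT r:{s..1}. \<bar>alpha \<nu> r - alpha \<nu>' r\<bar>) \<le> K * alpha_dist \<nu> \<nu>'"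
    using K_ge_1 by (intro mult_left_mono) auto
  then show ?thesis using Phi_atomic_stability[OF assms, of x] by simp
qed

text \<open>Shows on the way that the definite description in \<open>Phi\<close> is meaningful.
  Stability makes all approximating sequences converge to one limit l; the existence of at least one
  such sequence is what makes the described number unique.\<close>

lemma Phi_approx:
  assumes mu: "\<mu> \<in> prob_measures_01" and nu: "admissible \<nu>" and s: "0 \<le> s" "s \<le> 1"
  shows "\<bar>Phi_atomic \<xi> \<nu> s x - Phi \<xi> \<mu> s x\<bar> \<le> K * alpha_dist \<nu> \<mu>"
proof -
  obtain \<kappa> where \<kappa>: "\<And>n. \<kappa> n \<in> prob_measures_01" "\<And>n. finitely_atomic (\<kappa> n)" "(\<lambda>n. alpha_dist (\<kappa> n) \<mu>) \<longlonglongrightarrow> 0"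
    using atomic_approximation[OF mu] by blast
  have adm: "admissible (\<kappa> n)" for n using \<kappa> by (simp add: admissible_def)
  have st: "\<bar>Phi_atomic \<xi> \<nu> s x - Phi_atomic \<xi> \<nu>' s x\<bar> \<le> K * (alpha_dist \<nu> \<mu> + alpha_dist \<nu>' \<mu>)"
    if "admissible \<nu>" "admissible \<nu>'" for \<nu> \<nu>'
  proof -
    have "alpha_dist \<nu> \<nu>' \<le> alpha_dist \<nu> \<mu> + alpha_dist \<nu>' \<mu>"
      using alpha_dist_triangle[of \<nu> \<mu> \<nu>'] that nu' mu by (simp add: alpha_dist_commute)
    then have "K * alpha_dist \<nu> \<nu>' \<le> K * (alpha_dist \<nu> \<mu> + alpha_dist \<nu>' \<mu>)"
      using K_ge_1 by (intro mult_left_mono) auto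
    then show ?thesis using stability_01[OF that s, of x] by simp
  qed
  have "Cauchy (\<lambda>n. Phi_atomic \<xi> (\<kappa> n) s x)"
  proof (rule metric_CauchyI)
    fix e :: real assume e: "0 < e"
    have "0 < e / (2 * K)" using e K_ge_1 by simp
    then obtain N where N: "\<And>n. n \<ge> N \<Longrightarrow> alpha_dist (\<kappa> n) \<mu> < e / (2 * K)"
      using LIMSEQ_D[OF \<kappa>(3)] by force
    have "dist (Phi_atomic \<xi> (\<kappa> m) s x) (Phi_atomic \<xi> (\<kappa> n) s x) < e" if "m \<ge> N" "n \<ge> N" for m n
    proof -
      have "K * (alpha_dist (\<kappa> m) \<mu> + alpha_dist (\<kappa> n) \<mu>) < K * (e / (2 * K) + e / (2 * K))"
        using N[OF that(1)] N[OF that(2)] K_ge_1 by (intro mult_strict_left_mono add_strict_mono) auto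
      also have "\<dots> = e" using K_ge_1 by simp
      finally show ?thesis using st[OF adm adm, of m n] by (simp add: dist_real_def)
    qed
    then show "\<exists>M. \<forall>m\<ge>M. \<forall>n\<ge>M. dist (Phi_atomic \<xi> (\<kappa> m) s x) (Phi_atomic \<xi> (\<kappa> n) s x) < e" by blast
  qed
  then obtain l where l: "(\<lambda>n. Phi_atomic \<xi> (\<kappa> n) s x) \<longlonglongrightarrow> l"
    by (auto simp: Cauchy_convergent_iff convergent_def)
  have bound: "\<bar>Phi_atomic \<xi> \<nu> s x - l\<bar> \<le> K * alpha_dist \<nu> \<mu>" if nu: "admissible \<nu>" for \<nu>
  proof -
    have "(\<lambda>n. \<bar>Phi_atomic \<xi> \<nu> s x - Phi_atomic \<xi> (\<kappa> n) s x\<bar>) \<longlonglongrightarrow> \<bar>Phi_atomic \<xi> \<nu> s x - l\<bar>"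
      by (intro tendsto_intros l)
    moreover have "(\<lambda>n. K * (alpha_dist \<nu> \<mu> + alpha_dist (\<kappa> n) \<mu>)) \<longlonglongrightarrow> K * (alpha_dist \<nu> \<mu> + 0)"
      by (intro tendsto_intros \<kappa>)
    ultimately have "\<bar>Phi_atomic \<xi> \<nu> s x - l\<bar> \<le> K * (alpha_dist \<nu> \<mu> + 0)"
      by (rule LIMSEQ_le) (use st[OF nu adm] in auto)
    then show ?thesis by simp
  qed
  have "Phi \<xi> \<mu> s x = l"
    unfolding Phi_def
  proof (rule the_equality)
    show "\<forall>\<nu>. (\<forall>n. \<nu> n \<in> prob_measures_01 \<and> finitely_atomic (\<nu> n)) \<and> (\<lambda>n. LBINT t:{0..1}. \<bar>alpha (\<nu> n) t - alpha \<mu> t\<bar>) \<longlonglongrightarrow> 0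
        \<longrightarrow> (\<lambda>n. Phi_atomic \<xi> (\<nu> n) s x) \<longlonglongrightarrow> l"
    proof (intro allI impI, elim conjE)
      fix \<nu>' assume a: "\<forall>n. \<nu>' n \<in> prob_measures_01 \<and> finitely_atomic (\<nu>' n)" "(\<lambda>n. LBINT t:{0..1}. \<bar>alpha (\<nu>' n) t - alpha \<mu> t\<bar>) \<longlonglongrightarrow> 0"
      then have "admissible (\<nu>' n)" for n by (simp add: admissible_def)
      then have "\<forall>\<^sub>F n in sequentially. norm (Phi_atomic \<xi> (\<nu>' n) s x - l) \<le> K * alpha_dist (\<nu>' n) \<mu>"
        using bound by (auto intro: always_eventually)
      moreover have "(\<lambda>n. K * alpha_dist (\<nu>' n) \<mu>) \<longlonglongrightarrow> K * 0"
        using a(2) unfolding alpha_dist_def by (intro tendsto_intros)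
      then have "(\<lambda>n. K * alpha_dist (\<nu>' n) \<mu>) \<longlonglongrightarrow> 0" by simp
      ultimately have "(\<lambda>n. Phi_atomic \<xi> (\<nu>' n) s x - l) \<longlonglongrightarrow> 0"
        by (rule Lim_null_comparison)
      then show "(\<lambda>n. Phi_atomic \<xi> (\<nu>' n) s x) \<longlonglongrightarrow> l"
        by (simp only: Lim_null[symmetric])
    qed
    fix l' assume "\<forall>\<nu>. (\<forall>n. \<nu> n \<in> prob_measures_01 \<and> finitely_atomic (\<nu> n)) \<and> (\<lambda>n. LBINT t:{0..1}. \<bar>alpha (\<nu> n) t - alpha \<mu> t\<bar>) \<longlonglongrightarrow> 0
        \<longrightarrow> (\<lambda>n. Phi_atomic \<xi> (\<nu> n) s x) \<longlonglongrightarrow> l'"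
    then have "(\<lambda>n. Phi_atomic \<xi> (\<kappa> n) s x) \<longlonglongrightarrow> l'"
      using \<kappa> unfolding alpha_dist_def by blast
    then show "l' = l" using l LIMSEQ_unique by blast
  qed
  then show ?thesis using bound[OF nu] by simp
qed

text \<open>One approximating sequence serves all times, all points and both derivatives, so that
  inequalities involving several of them pass to the limit jointly.\<close>

lemma Phi_approx_sequence:
  assumes mu: "\<mu> \<in> prob_measures_01"
  obtains \<nu> where "\<And>n. admissible (\<nu> n)" "(\<lambda>n. alpha_dist (\<nu> n) \<mu>) \<longlonglongrightarrow> 0"
    "\<And>s. 0 \<le> s \<Longrightarrow> s \<le> 1 \<Longrightarrow> smooth2 L (Phi \<xi> \<mu> s) (dx_Phi \<xi> \<mu> s) (dxx_Phi \<xi> \<mu> s)"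
    "\<And>s x. 0 \<le> s \<Longrightarrow> s \<le> 1 \<Longrightarrow> (\<lambda>n. Phi_atomic \<xi> (\<nu> n) s x) \<longlonglongrightarrow> Phi \<xi> \<mu> s x"
    "\<And>s x. 0 \<le> s \<Longrightarrow> s \<le> 1 \<Longrightarrow> (\<lambda>n. deriv (Phi_atomic \<xi> (\<nu> n) s) x) \<longlonglongrightarrow> dx_Phi \<xi> \<mu> s x"
    "\<And>s x. 0 \<le> s \<Longrightarrow> s \<le> 1 \<Longrightarrow> (\<lambda>n. deriv (deriv (Phi_atomic \<xi> (\<nu> n) s)) x) \<longlonglongrightarrow> dxx_Phi \<xi> \<mu> s x"
proof -
  obtain \<nu> where \<nu>: "\<And>n. \<nu> n \<in> prob_measures_01" "\<And>n. finitely_atomic (\<nu> n)" "(\<lambda>n. alpha_dist (\<nu> n) \<mu>) \<longlonglongrightarrow> 0"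
    using atomic_approximation[OF mu] by blast
  have adm: "admissible (\<nu> n)" for n using \<nu> by (simp add: admissible_def)
  have lim: "(\<lambda>n. K * alpha_dist (\<nu> n) \<mu>) \<longlonglongrightarrow> 0"
    using tendsto_mult_left[OF \<nu>(3), of K] by simp
  note * = smooth2_limit[OF Phi_atomic_smooth2[OF adm] Phi_approx[OF mu adm] lim, folded dx_Phi_def, folded dxx_Phi_def]
  have "(\<lambda>n. Phi_atomic \<xi> (\<nu> n) s x) \<longlonglongrightarrow> Phi \<xi> \<mu> s x" if "0 \<le> s" "s \<le> 1" for s x
    by (rule Lim_null[THEN iffD2], rule Lim_null_comparison[OF _ lim]) (use Phi_approx[OF mu adm that] in auto)
  with adm \<nu>(3) * show thesis by (intro that[of \<nu>]) auto
qed

lemma Phi_smooth2: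
  assumes "\<mu> \<in> prob_measures_01" "0 \<le> s" "s \<le> 1"
  shows "smooth2 L (Phi \<xi> \<mu> s) (dx_Phi \<xi> \<mu> s) (dxx_Phi \<xi> \<mu> s)"
  using Phi_approx_sequence[OF assms(1)] assms(2,3) by metis

lemma Phi_1:
  assumes "\<mu> \<in> prob_measures_01"
  shows "Phi \<xi> \<mu> 1 = (\<lambda>x. ln (cosh x))"
proof
  fix x
  obtain \<nu> where "(\<lambda>n. Phi_atomic \<xi> (\<nu> n) 1 x) \<longlonglongrightarrow> Phi \<xi> \<mu> 1 x"
    using Phi_approx_sequence[OF assms] by (metis order_refl zero_le_one)
  then show "Phi \<xi> \<mu> 1 x = ln (cosh x)"
    unfolding Phi_atomic_1 using LIMSEQ_unique tendsto_const by blast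
qed

lemma Phi_stability:
  assumes "\<mu> \<in> prob_measures_01" "\<nu> \<in> prob_measures_01" "0 \<le> s" "s \<le> 1"
  shows "\<bar>Phi \<xi> \<mu> s x - Phi \<xi> \<nu> s x\<bar> \<le> K * alpha_dist \<mu> \<nu>"
proof -
  obtain \<kappa> where \<kappa>: "\<And>n. admissible (\<kappa> n)" "(\<lambda>n. alpha_dist (\<kappa> n) \<mu>) \<longlonglongrightarrow> 0" "(\<lambda>n. Phi_atomic \<xi> (\<kappa> n) s x) \<longlonglongrightarrow> Phi \<xi> \<mu> s x"
    using Phi_approx_sequence[OF assms(1)] assms(3,4) by metis
  have "(\<lambda>n. \<bar>Phi_atomic \<xi> (\<kappa> n) s x - Phi \<xi> \<nu> s x\<bar>) \<longlonglongrightarrow> \<bar>Phi \<xi> \<mu> s x - Phi \<xi> \<nu> s x\<bar>"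
    by (intro tendsto_intros \<kappa>)
  moreover have "(\<lambda>n. K * (alpha_dist (\<kappa> n) \<mu> + alpha_dist \<mu> \<nu>)) \<longlonglongrightarrow> K * (0 + alpha_dist \<mu> \<nu>)"
    by (intro tendsto_intros \<kappa>)
  moreover have "\<bar>Phi_atomic \<xi> (\<kappa> n) s x - Phi \<xi> \<nu> s x\<bar> \<le> K * (alpha_dist (\<kappa> n) \<mu> + alpha_dist \<mu> \<nu>)" for n
  proof -
    have "K * alpha_dist (\<kappa> n) \<nu> \<le> K * (alpha_dist (\<kappa> n) \<mu> + alpha_dist \<mu> \<nu>)"
      using K_ge_1 nu'[OF \<kappa>(1)] assms by (intro mult_left_mono alpha_dist_triangle) auto
    then show ?thesis using Phi_approx[OF assms(2) \<kappa>(1) assms(3,4), of n x] by simp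
  qed
  ultimately have "\<bar>Phi \<xi> \<mu> s x - Phi \<xi> \<nu> s x\<bar> \<le> K * (0 + alpha_dist \<mu> \<nu>)"
    by (intro LIMSEQ_le) auto
  then show ?thesis by simp
qed

lemma dx_Phi_stability:
  assumes "\<mu> \<in> prob_measures_01" "\<nu> \<in> prob_measures_01" "0 \<le> s" "s \<le> 1"
  shows "\<bar>dx_Phi \<xi> \<mu> s x - dx_Phi \<xi> \<nu> s x\<bar> \<le> (1 + 2 * L) * (root 3 (K * alpha_dist \<mu> \<nu>))\<^sup>2"
  by (rule smooth2_interpolate_root(1)[OF Phi_smooth2 Phi_smooth2 Phi_stability]) (use assms in auto)

text \<open>All four bounds hold for atomic measures with constants independent of the measure, so
  they survive the limit.\<close>

lemma Phi_time_bounds: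
  "\<exists>C\<ge>0. \<forall>\<mu> s t x. \<mu> \<in> prob_measures_01 \<and> 0 \<le> s \<and> s \<le> t \<and> t \<le> 1 \<longrightarrow>
    \<bar>Phi \<xi> \<mu> s x - Phi \<xi> \<mu> t x\<bar> \<le> C * (t - s) \<and>
    \<bar>dx_Phi \<xi> \<mu> s x - dx_Phi \<xi> \<mu> t x\<bar> \<le> C * (root 3 (t - s))\<^sup>2 \<and>
    \<bar>dxx_Phi \<xi> \<mu> s x - dxx_Phi \<xi> \<mu> t x\<bar> \<le> C * root 3 (t - s) \<and>
    \<bar>Phi \<xi> \<mu> s x - Phi \<xi> \<mu> t x - ((\<rho> t - \<rho> s) * dxx_Phi \<xi> \<mu> t x
      + (LBINT r:{s..t}. alpha \<mu> r * \<zeta> r) * (dx_Phi \<xi> \<mu> t x)\<^sup>2) / 2\<bar> \<le> C * ((t - s) * root 3 (t - s))"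
proof -
  obtain A where A: "0 \<le> A" "\<And>\<nu> s t x. admissible \<nu> \<Longrightarrow> 0 \<le> s \<Longrightarrow> s \<le> t \<Longrightarrow> t \<le> 1 \<Longrightarrow>
    \<bar>Phi_atomic \<xi> \<nu> s x - Phi_atomic \<xi> \<nu> t x\<bar> \<le> A * (t - s)"
    using Phi_atomic_time by metis
  obtain B where B: "0 \<le> B" "\<And>\<nu> s t x. admissible \<nu> \<Longrightarrow> 0 \<le> s \<Longrightarrow> s \<le> t \<Longrightarrow> t \<le> 1 \<Longrightarrow>
      \<bar>deriv (Phi_atomic \<xi> \<nu> s) x - deriv (Phi_atomic \<xi> \<nu> t) x\<bar> \<le> B * (root 3 (t - s))\<^sup>2"
     "\<And>\<nu> s t x. admissible \<nu> \<Longrightarrow> 0 \<le> s \<Longrightarrow> s \<le> t \<Longrightarrow> t \<le> 1 \<Longrightarrow>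
      \<bar>deriv (deriv (Phi_atomic \<xi> \<nu> s)) x - deriv (deriv (Phi_atomic \<xi> \<nu> t)) x\<bar> \<le> B * root 3 (t - s)"
    using Phi_atomic_deriv_time by blast
  obtain C where C: "0 \<le> C" "\<And>\<nu> s t x. admissible \<nu> \<Longrightarrow> 0 \<le> s \<Longrightarrow> s \<le> t \<Longrightarrow> t \<le> 1 \<Longrightarrow>
    \<bar>Phi_atomic \<xi> \<nu> s x - Phi_atomic \<xi> \<nu> t x - ((\<rho> t - \<rho> s) * deriv (deriv (Phi_atomic \<xi> \<nu> t)) x
      + (LBINT r:{s..t}. alpha \<nu> r * \<zeta> r) * (deriv (Phi_atomic \<xi> \<nu> t) x)\<^sup>2) / 2\<bar> \<le> C * ((t - s) * root 3 (t - s))"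
    using Phi_atomic_consistency by blast
  show ?thesis
  proof (intro exI[of _ "A + B + C"] conjI allI impI)
    show "0 \<le> A + B + C" using A B C by simp
  next
    fix \<mu> and s t x :: real
    assume a: "\<mu> \<in> prob_measures_01 \<and> 0 \<le> s \<and> s \<le> t \<and> t \<le> 1"
    then have mu: "\<mu> \<in> prob_measures_01" and st: "0 \<le> s" "s \<le> t" "t \<le> 1" and s: "0 \<le> s" "s \<le> 1" and t: "0 \<le> t" "t \<le> 1" by auto
    obtain \<nu> where \<nu>: "\<And>n. admissible (\<nu> n)" "(\<lambda>n. alpha_dist (\<nu> n) \<mu>) \<longlonglongrightarrow> 0"
      "\<And>s x. 0 \<le> s \<Longrightarrow> s \<le> 1 \<Longrightarrow> (\<lambda>n. Phi_atomic \<xi> (\<nu> n) s x) \<longlonglongrightarrow> Phi \<xi> \<mu> s x"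
      "\<And>s x. 0 \<le> s \<Longrightarrow> s \<le> 1 \<Longrightarrow> (\<lambda>n. deriv (Phi_atomic \<xi> (\<nu> n) s) x) \<longlonglongrightarrow> dx_Phi \<xi> \<mu> s x"
      "\<And>s x. 0 \<le> s \<Longrightarrow> s \<le> 1 \<Longrightarrow> (\<lambda>n. deriv (deriv (Phi_atomic \<xi> (\<nu> n) s)) x) \<longlonglongrightarrow> dxx_Phi \<xi> \<mu> s x"
      using Phi_approx_sequence[OF mu] by metis
    \<comment> \<open>The weights converge because \<zeta> is at most K, so that their difference is
      controlled by the L1 distance of the distribution functions.\<close>
    have I: "(\<lambda>n. LBINT r:{s..t}. alpha (\<nu> n) r * \<zeta> r) \<longlonglongrightarrow> (LBINT r:{s..t}. alpha \<mu> r * \<zeta> r)"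
    proof (rule Lim_null[THEN iffD2], rule Lim_null_comparison)
      show "(\<lambda>n. K * alpha_dist (\<nu> n) \<mu>) \<longlonglongrightarrow> 0" using tendsto_mult_left[OF \<nu>(2), of K] by simp
      show "\<forall>\<^sub>F n in sequentially. norm ((LBINT r:{s..t}. alpha (\<nu> n) r * \<zeta> r) - (LBINT r:{s..t}. alpha \<mu> r * \<zeta> r)) \<le> K * alpha_dist (\<nu> n) \<mu>"
      proof (intro always_eventually allI)
        fix n
        note pn = nu'(1)[OF \<nu>(1)[of n]]
        have bd: "bdd_meas (\<lambda>r. \<bar>alpha (\<nu> n) r - alpha \<mu> r\<bar>)" using pn mu by (rule bdd_meas_alpha_diff)
        have "(LBINT r:{s..t}. alpha (\<nu> n) r * \<zeta> r) - (LBINT r:{s..t}. alpha \<mu> r * \<zeta> r) = (LBINT r:{s..t}. alpha (\<nu> n) r * \<zeta> r - alpha \<mu> r * \<zeta> r)"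
          using st pn mu by (intro set_integral_diff(2)[symmetric] bdd_meas_integrable bdd_meas_alpha_zeta) auto
        also have "\<bar>\<dots>\<bar> \<le> (LBINT r:{s..t}. K * \<bar>alpha (\<nu> n) r - alpha \<mu> r\<bar>)"
        proof (rule LBINT_abs_le)
          fix r assume r: "s \<le> r" "r \<le> t"
          have "\<bar>alpha (\<nu> n) r * \<zeta> r - alpha \<mu> r * \<zeta> r\<bar> = \<bar>\<zeta> r\<bar> * \<bar>alpha (\<nu> n) r - alpha \<mu> r\<bar>"
            by (simp add: algebra_simps flip: abs_mult)
          also have "\<dots> \<le> K * \<bar>alpha (\<nu> n) r - alpha \<mu> r\<bar>"
            using zeta_nonneg[of r] zeta_le[of r] r st by (intro mult_right_mono) auto
          finally show "\<bar>alpha (\<nu> n) r * \<zeta> r - alpha \<mu> r * \<zeta> r\<bar> \<le> K * \<bar>alpha (\<nu> n) r - alpha \<mu> r\<bar>" .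
        qed (use st pn mu bd in \<open>auto intro!: bdd_meas_diff bdd_meas_alpha_zeta bdd_meas_mult\<close>)
        also have "\<dots> = K * (LBINT r:{s..t}. \<bar>alpha (\<nu> n) r - alpha \<mu> r\<bar>)" by simp
        also have "\<dots> \<le> K * alpha_dist (\<nu> n) \<mu>"
        proof -
          have "alpha_dist (\<nu> n) \<mu> = (LBINT r:{0..s}. \<bar>alpha (\<nu> n) r - alpha \<mu> r\<bar>) + (LBINT r:{s..t}. \<bar>alpha (\<nu> n) r - alpha \<mu> r\<bar>) + (LBINT r:{t..1}. \<bar>alpha (\<nu> n) r - alpha \<mu> r\<bar>)"
            unfolding alpha_dist_def using LBINT_split[OF bd, of 0 s 1] LBINT_split[OF bd, of s t 1] st by simp
          moreover have "0 \<le> (LBINT r:{0..s}. \<bar>alpha (\<nu> n) r - alpha \<mu> r\<bar>)" "0 \<le> (LBINT r:{t..1}. \<bar>alpha (\<nu> n) r - alpha \<mu> r\<bar>)"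
            by (intro LBINT_nonneg; simp)+
          ultimately show ?thesis using K_ge_1 by (intro mult_left_mono) auto
        qed
        finally show "norm ((LBINT r:{s..t}. alpha (\<nu> n) r * \<zeta> r) - (LBINT r:{s..t}. alpha \<mu> r * \<zeta> r)) \<le> K * alpha_dist (\<nu> n) \<mu>" by simp
      qed
    qed
    have up: "x \<le> (A + B + C) * y" if "x \<le> D * y" "D \<in> {A, B, C}" "0 \<le> y" for x y D
      by (rule order_trans[OF that(1) mult_right_mono]) (use that A B C in auto)
    show "\<bar>Phi \<xi> \<mu> s x - Phi \<xi> \<mu> t x\<bar> \<le> (A + B + C) * (t - s)"
      by (rule up[of _ A], rule LIMSEQ_le_const2[OF tendsto_rabs[OF tendsto_diff[OF \<nu>(3)[OF s] \<nu>(3)[OF t]]]])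
        (use A(2)[OF \<nu>(1) st] st in auto)
    show "\<bar>dx_Phi \<xi> \<mu> s x - dx_Phi \<xi> \<mu> t x\<bar> \<le> (A + B + C) * (root 3 (t - s))\<^sup>2"
      by (rule up[of _ B], rule LIMSEQ_le_const2[OF tendsto_rabs[OF tendsto_diff[OF \<nu>(4)[OF s] \<nu>(4)[OF t]]]])
        (use B(2)[OF \<nu>(1) st] st in auto)
    show "\<bar>dxx_Phi \<xi> \<mu> s x - dxx_Phi \<xi> \<mu> t x\<bar> \<le> (A + B + C) * root 3 (t - s)"
      by (rule up[of _ B], rule LIMSEQ_le_const2[OF tendsto_rabs[OF tendsto_diff[OF \<nu>(5)[OF s] \<nu>(5)[OF t]]]])
        (use B(3)[OF \<nu>(1) st] st in auto)
    have "(\<lambda>n. \<bar>Phi_atomic \<xi> (\<nu> n) s x - Phi_atomic \<xi> (\<nu> n) t x - ((\<rho> t - \<rho> s) * deriv (deriv (Phi_atomic \<xi> (\<nu> n) t)) x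
      + (LBINT r:{s..t}. alpha (\<nu> n) r * \<zeta> r) * (deriv (Phi_atomic \<xi> (\<nu> n) t) x)\<^sup>2) / 2\<bar>) \<longlonglongrightarrow>
      \<bar>Phi \<xi> \<mu> s x - Phi \<xi> \<mu> t x - ((\<rho> t - \<rho> s) * dxx_Phi \<xi> \<mu> t x
      + (LBINT r:{s..t}. alpha \<mu> r * \<zeta> r) * (dx_Phi \<xi> \<mu> t x)\<^sup>2) / 2\<bar>"
      by (intro tendsto_intros \<nu>(3-5) I s t) auto
    then have "\<bar>Phi \<xi> \<mu> s x - Phi \<xi> \<mu> t x - ((\<rho> t - \<rho> s) * dxx_Phi \<xi> \<mu> t x
      + (LBINT r:{s..t}. alpha \<mu> r * \<zeta> r) * (dx_Phi \<xi> \<mu> t x)\<^sup>2) / 2\<bar> \<le> C * ((t - s) * root 3 (t - s))"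
      by (rule LIMSEQ_le_const2) (use C(2)[OF \<nu>(1) st] in auto)
    then show "\<bar>Phi \<xi> \<mu> s x - Phi \<xi> \<mu> t x - ((\<rho> t - \<rho> s) * dxx_Phi \<xi> \<mu> t x
      + (LBINT r:{s..t}. alpha \<mu> r * \<zeta> r) * (dx_Phi \<xi> \<mu> t x)\<^sup>2) / 2\<bar> \<le> (A + B + C) * ((t - s) * root 3 (t - s))"
      by (rule up) (use st in auto)
  qed
qed

end

subsection \<open>Brownian motion\<close>

lemma (in prob_space) integrable_power_le:
  fixes X :: "'a \<Rightarrow> real"
  assumes [measurable]: "X \<in> borel_measurable M" and "integrable M (\<lambda>w. (X w) ^ 4)" "i \<le> 4"
  shows "integrable M (\<lambda>w. (X w) ^ i)"
proof (rule Bochner_Integration.integrable_bound[of M "\<lambda>w. 1 + (X w) ^ 4"])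
  show "integrable M (\<lambda>w. 1 + (X w) ^ 4)" using assms by simp
  have "\<bar>x\<bar> ^ i \<le> 1 + x ^ 4" for x :: real
  proof (cases "\<bar>x\<bar> \<le> 1")
    case True
    then have "\<bar>x\<bar> ^ i \<le> 1" by (simp add: power_le_one)
    moreover have "0 \<le> x ^ 4" by simp
    ultimately show ?thesis by linarith
  next
    case False
    then have "\<bar>x\<bar> ^ i \<le> \<bar>x\<bar> ^ 4" using assms(3) by (intro power_increasing) auto
    then show ?thesis by simp
  qed
  then show "AE w in M. norm ((X w) ^ i) \<le> norm (1 + (X w) ^ 4)"
    by (intro AE_I2) (auto simp: power_abs intro: order_trans[OF _ abs_ge_self])
qed simp

text \<open>Convergence in L2 gives no fourth moment by itself; this comes from Fatou's lemma along
  an almost surely convergent subsequence. First and second moments against a bounded Y converge by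
  Young's inequality.\<close>

lemma (in prob_space) L2_limit_moments:
  fixes Q :: "nat \<Rightarrow> 'a \<Rightarrow> real" and \<Delta> :: "'a \<Rightarrow> real"
  assumes [measurable]: "\<And>n. Q n \<in> borel_measurable M" "\<Delta> \<in> borel_measurable M"
    and Q4: "\<And>n. integrable M (\<lambda>w. (Q n w) ^ 4)" "\<And>n. (\<integral>w. (Q n w) ^ 4 \<partial>M) \<le> C"
    and lim: "(\<lambda>n. \<integral>\<^sup>+w. ennreal ((Q n w - \<Delta> w)\<^sup>2) \<partial>M) \<longlonglongrightarrow> 0"
  shows "integrable M (\<lambda>w. (\<Delta> w) ^ 4)" "(\<integral>w. (\<Delta> w) ^ 4 \<partial>M) \<le> C"
    "\<And>Y b. Y \<in> borel_measurable M \<Longrightarrow> (\<And>w. \<bar>Y w\<bar> \<le> b) \<Longrightarrow> (\<lambda>n. \<integral>w. Y w * Q n w \<partial>M) \<longlonglongrightarrow> (\<integral>w. Y w * \<Delta> w \<partial>M)"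
    "\<And>Y b. Y \<in> borel_measurable M \<Longrightarrow> (\<And>w. \<bar>Y w\<bar> \<le> b) \<Longrightarrow> (\<lambda>n. \<integral>w. Y w * (Q n w)\<^sup>2 \<partial>M) \<longlonglongrightarrow> (\<integral>w. Y w * (\<Delta> w)\<^sup>2 \<partial>M)"
proof -
  have "\<forall>\<^sub>F n in sequentially. (\<integral>\<^sup>+w. ennreal ((Q n w - \<Delta> w)\<^sup>2) \<partial>M) < 1"
    using order_tendstoD(2)[OF lim] by simp
  then obtain N where N: "\<And>n. n \<ge> N \<Longrightarrow> (\<integral>\<^sup>+w. ennreal ((Q n w - \<Delta> w)\<^sup>2) \<partial>M) < 1"
    by (auto simp: eventually_sequentially)
  \<comment> \<open>Finiteness of the L2 distance is known only eventually, hence the shift by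
    N.\<close>
  define R where "R n = Q (n + N)" for n
  have [measurable]: "R n \<in> borel_measurable M" for n unfolding R_def by simp
  have R4: "integrable M (\<lambda>w. (R n w) ^ 4)" "(\<integral>w. (R n w) ^ 4 \<partial>M) \<le> C" for n
    unfolding R_def by (rule Q4)+
  have D2i: "integrable M (\<lambda>w. (R n w - \<Delta> w)\<^sup>2)" for n
    using N[of "n + N"] by (intro integrableI_bounded) (auto simp: R_def intro: order.strict_trans)
  define D where "D n = (\<integral>w. (R n w - \<Delta> w)\<^sup>2 \<partial>M)" for n
  have limR: "(\<lambda>n. \<integral>\<^sup>+w. ennreal ((R n w - \<Delta> w)\<^sup>2) \<partial>M) \<longlonglongrightarrow> 0"
    unfolding R_def by (rule LIMSEQ_ignore_initial_segment[OF lim])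
  have "(\<integral>\<^sup>+w. ennreal ((R n w - \<Delta> w)\<^sup>2) \<partial>M) = ennreal (D n)" for n
    unfolding D_def by (rule nn_integral_eq_integral[OF D2i]) simp
  then have "(\<lambda>n. ennreal (D n)) \<longlonglongrightarrow> ennreal 0" using limR by simp
  then have D0: "D \<longlonglongrightarrow> 0"
    by (subst (asm) tendsto_ennreal_iff) (auto simp: D_def)
  have R2i: "integrable M (\<lambda>w. (R n w)\<^sup>2)" for n
    by (rule integrable_power_le[OF _ R4(1)]) auto
  have \<Delta>2i: "integrable M (\<lambda>w. (\<Delta> w)\<^sup>2)"
  proof (rule Bochner_Integration.integrable_bound[of M "\<lambda>w. 2 * (R 0 w)\<^sup>2 + 2 * (R 0 w - \<Delta> w)\<^sup>2"])
    have "x\<^sup>2 \<le> 2 * y\<^sup>2 + 2 * (y - x)\<^sup>2" for x y :: real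
      using zero_le_power2[of "2 * y - x"] by (simp add: power2_eq_square algebra_simps)
    then show "AE w in M. norm ((\<Delta> w)\<^sup>2) \<le> norm (2 * (R 0 w)\<^sup>2 + 2 * (R 0 w - \<Delta> w)\<^sup>2)"
      by (intro AE_I2) (auto intro: order_trans[OF _ abs_ge_self])
  qed (use R2i D2i in auto)
  have "\<exists>r. strict_mono r \<and> (AE x in M. (\<lambda>n. (R (r n) x - \<Delta> x)\<^sup>2) \<longlonglongrightarrow> 0)"
    by (rule tendsto_L1_AE_subseq[OF D2i]) (use D0 in \<open>simp add: D_def[abs_def]\<close>)
  then obtain r where r: "strict_mono r" "AE x in M. (\<lambda>n. (R (r n) x - \<Delta> x)\<^sup>2) \<longlonglongrightarrow> 0" by blast
  have "(\<integral>\<^sup>+w. ennreal ((\<Delta> w) ^ 4) \<partial>M) = (\<integral>\<^sup>+w. liminf (\<lambda>n. ennreal ((R (r n) w) ^ 4)) \<partial>M)"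
  proof (rule nn_integral_cong_AE)
    show "AE w in M. ennreal ((\<Delta> w) ^ 4) = liminf (\<lambda>n. ennreal ((R (r n) w) ^ 4))"
      using r(2)
    proof eventually_elim
      fix w assume "(\<lambda>n. (R (r n) w - \<Delta> w)\<^sup>2) \<longlonglongrightarrow> 0"
      then have "(\<lambda>n. sqrt ((R (r n) w - \<Delta> w)\<^sup>2)) \<longlonglongrightarrow> sqrt 0" by (rule tendsto_real_sqrt)
      then have "(\<lambda>n. R (r n) w - \<Delta> w) \<longlonglongrightarrow> 0" by (simp add: tendsto_rabs_zero_iff)
      then have "(\<lambda>n. R (r n) w) \<longlonglongrightarrow> \<Delta> w" by (simp only: Lim_null[symmetric])
      then have "(\<lambda>n. ennreal ((R (r n) w) ^ 4)) \<longlonglongrightarrow> ennreal ((\<Delta> w) ^ 4)"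
        by (intro tendsto_ennrealI tendsto_power)
      then show "ennreal ((\<Delta> w) ^ 4) = liminf (\<lambda>n. ennreal ((R (r n) w) ^ 4))"
        by (rule lim_imp_Liminf[OF trivial_limit_sequentially, symmetric])
    qed
  qed
  also have "\<dots> \<le> liminf (\<lambda>n. \<integral>\<^sup>+w. ennreal ((R (r n) w) ^ 4) \<partial>M)"
    by (intro nn_integral_liminf) auto
  also have "\<dots> \<le> liminf (\<lambda>n. ennreal C)"
  proof (intro Liminf_mono always_eventually allI)
    fix n
    have "(\<integral>\<^sup>+w. ennreal ((R (r n) w) ^ 4) \<partial>M) = ennreal (\<integral>w. (R (r n) w) ^ 4 \<partial>M)"
      by (rule nn_integral_eq_integral[OF R4(1)]) simp
    then show "(\<integral>\<^sup>+w. ennreal ((R (r n) w) ^ 4) \<partial>M) \<le> ennreal C"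
      using R4(2) by (simp add: ennreal_leI)
  qed
  finally have F: "(\<integral>\<^sup>+w. ennreal ((\<Delta> w) ^ 4) \<partial>M) \<le> ennreal C" by (simp add: Liminf_const)
  have C0: "0 \<le> C" using order_trans[OF integral_nonneg_AE R4(2)[of 0]] by simp
  show i4: "integrable M (\<lambda>w. (\<Delta> w) ^ 4)"
    by (intro integrableI_bounded) (use F in \<open>auto simp: power_abs[symmetric] intro: le_less_trans\<close>)
  show "(\<integral>w. (\<Delta> w) ^ 4 \<partial>M) \<le> C"
    using F C0 by (subst (asm) nn_integral_eq_integral[OF i4]) auto
  have \<Delta>1i: "integrable M \<Delta>" using integrable_power_le[OF _ i4, of 1] by simp
  have R1i: "integrable M (R n)" for n using integrable_power_le[OF _ R4(1), of n 1] by simp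
  fix Y b assume Y: "Y \<in> borel_measurable M" "\<And>w. \<bar>Y w\<bar> \<le> (b :: real)"
  have b: "0 \<le> b" using order_trans[OF abs_ge_zero Y(2)] .
  note [measurable] = Y(1)
  have Yi: "integrable M (\<lambda>w. Y w * Z w)" if "integrable M Z" for Z
    by (rule Bochner_Integration.integrable_bound[of M "\<lambda>w. b * Z w"])
      (use that Y b in \<open>auto simp: abs_mult intro!: mult_right_mono AE_I2 dest: borel_measurable_integrable\<close>)
  have key: "(\<lambda>n. \<integral>w. Y w * U n w \<partial>M) \<longlonglongrightarrow> (\<integral>w. Y w * W w \<partial>M)"
    if U: "\<And>n. integrable M (U n)" "integrable M W"
      and bound: "\<And>\<eta> n w. 0 < \<eta> \<Longrightarrow> \<bar>U n w - W w\<bar> \<le> \<eta> * (1 + (\<Delta> w)\<^sup>2) + (1 + 1 / \<eta>) * (R n w - \<Delta> w)\<^sup>2" for U W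
  proof (rule LIMSEQ_I)
    fix e :: real assume e: "0 < e"
    define A where "A = (\<integral>w. 1 + (\<Delta> w)\<^sup>2 \<partial>M)"
    have A: "0 \<le> A" unfolding A_def by (intro integral_nonneg_AE) auto
    \<comment> \<open>This makes the part proportional to \<eta> at most e/2, where the + 1 avoids a
      zero denominator; n is chosen afterwards to make the part with 1 + 1/\<eta> small.\<close>
    define \<eta> where "\<eta> = e / (2 * (b * A + 1))"
    have \<eta>: "0 < \<eta>" using e A b by (simp add: \<eta>_def add_nonneg_pos)
    have "(\<lambda>n. b * ((1 + 1 / \<eta>) * D n)) \<longlonglongrightarrow> b * ((1 + 1 / \<eta>) * 0)" by (intro tendsto_intros D0)
    then have "\<forall>\<^sub>F n in sequentially. b * ((1 + 1 / \<eta>) * D n) < e / 2"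
      using e by (intro order_tendstoD(2)) auto
    then obtain n0 where n0: "\<And>n. n \<ge> n0 \<Longrightarrow> b * ((1 + 1 / \<eta>) * D n) < e / 2"
      by (auto simp: eventually_sequentially)
    have "norm ((\<integral>w. Y w * U n w \<partial>M) - (\<integral>w. Y w * W w \<partial>M)) < e" if "n \<ge> n0" for n
    proof -
      have "(\<integral>w. Y w * U n w \<partial>M) - (\<integral>w. Y w * W w \<partial>M) = (\<integral>w. Y w * (U n w - W w) \<partial>M)"
        using Yi[OF U(1)] Yi[OF U(2)] by (simp add: right_diff_distrib)
      also have "\<bar>\<dots>\<bar> \<le> (\<integral>w. b * (\<eta> * (1 + (\<Delta> w)\<^sup>2) + (1 + 1 / \<eta>) * (R n w - \<Delta> w)\<^sup>2) \<partial>M)"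
      proof (rule order_trans[OF integral_abs_bound integral_mono])
        show "integrable M (\<lambda>w. \<bar>Y w * (U n w - W w)\<bar>)"
          using U by (intro integrable_abs Yi Bochner_Integration.integrable_diff)
        show "\<bar>Y w * (U n w - W w)\<bar> \<le> b * (\<eta> * (1 + (\<Delta> w)\<^sup>2) + (1 + 1 / \<eta>) * (R n w - \<Delta> w)\<^sup>2)" for w
          unfolding abs_mult using Y(2) bound[OF \<eta>] b by (intro mult_mono) auto
      qed (use \<Delta>2i D2i in auto)
      also have "\<dots> = b * (\<eta> * A) + b * ((1 + 1 / \<eta>) * D n)"
        using \<Delta>2i D2i by (simp add: A_def D_def distrib_left)
      also have "\<dots> < e / 2 + e / 2"
      proof (rule add_le_less_mono)
        have "b * (\<eta> * A) = (b * A) / (b * A + 1) * (e / 2)" using A b by (simp add: \<eta>_def field_simps)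
        also have "\<dots> \<le> 1 * (e / 2)" using A b e by (intro mult_right_mono) (auto simp: divide_le_eq add_nonneg_pos)
        finally show "b * (\<eta> * A) \<le> e / 2" by simp
      qed (rule n0[OF that])
      finally show ?thesis by simp
    qed
    then show "\<exists>no. \<forall>n\<ge>no. norm ((\<integral>w. Y w * U n w \<partial>M) - (\<integral>w. Y w * W w \<partial>M)) < e" by blast
  qed
  have young: "2 * \<bar>x * y\<bar> \<le> \<eta> * x\<^sup>2 + y\<^sup>2 / \<eta>" if "0 < \<eta>" for x y \<eta> :: real
  proof -
    have "0 \<le> (\<eta> * \<bar>x\<bar> - \<bar>y\<bar>)\<^sup>2" by simp
    then have "\<eta> * (2 * \<bar>x * y\<bar>) \<le> \<eta> * (\<eta> * x\<^sup>2 + y\<^sup>2 / \<eta>)"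
      using that by (simp add: power2_eq_square algebra_simps abs_mult)
    then show ?thesis using that by simp
  qed
  have aux1: "a \<le> \<eta> + e + d + q" if "0 \<le> e" "0 \<le> d" "2 * a \<le> \<eta> + q" "0 \<le> a" for a e d q \<eta> :: real
    using that by linarith
  have aux2: "a \<le> \<eta> + e + d + q" if "a \<le> c + d" "c \<le> e + q" "0 \<le> \<eta>" for a c e d q \<eta> :: real
    using that by linarith
  have expand: "\<eta> * (1 + x) + (1 + 1 / \<eta>) * y = \<eta> + \<eta> * x + y + y / \<eta>" for \<eta> x y :: real
    by (simp add: distrib_left distrib_right)
  have 1: "(\<lambda>n. \<integral>w. Y w * R n w \<partial>M) \<longlonglongrightarrow> (\<integral>w. Y w * \<Delta> w \<partial>M)"
  proof (rule key[OF R1i \<Delta>1i])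
    fix \<eta> :: real and n w assume \<eta>: "0 < \<eta>"
    have "0 \<le> \<eta> * (\<Delta> w)\<^sup>2" "0 \<le> (R n w - \<Delta> w)\<^sup>2" using \<eta> by auto
    then show "\<bar>R n w - \<Delta> w\<bar> \<le> \<eta> * (1 + (\<Delta> w)\<^sup>2) + (1 + 1 / \<eta>) * (R n w - \<Delta> w)\<^sup>2"
      using young[OF \<eta>, of 1 "R n w - \<Delta> w"] abs_ge_zero[of "R n w - \<Delta> w"] unfolding expand mult_1_right mult_1 power_one by (rule aux1)
  qed
  have 2: "(\<lambda>n. \<integral>w. Y w * (R n w)\<^sup>2 \<partial>M) \<longlonglongrightarrow> (\<integral>w. Y w * (\<Delta> w)\<^sup>2 \<partial>M)"
  proof (rule key[OF R2i \<Delta>2i])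
    fix \<eta> :: real and n w assume \<eta>: "0 < \<eta>"
    let ?d = "R n w - \<Delta> w"
    have "(R n w)\<^sup>2 - (\<Delta> w)\<^sup>2 = 2 * (\<Delta> w * ?d) + ?d\<^sup>2" by (simp add: power2_eq_square algebra_simps)
    moreover have "0 \<le> ?d\<^sup>2" by simp
    ultimately have "\<bar>(R n w)\<^sup>2 - (\<Delta> w)\<^sup>2\<bar> \<le> 2 * \<bar>\<Delta> w * ?d\<bar> + ?d\<^sup>2" by linarith
    moreover have "2 * \<bar>\<Delta> w * ?d\<bar> \<le> \<eta> * (\<Delta> w)\<^sup>2 + ?d\<^sup>2 / \<eta>" by (rule young[OF \<eta>])
    ultimately show "\<bar>(R n w)\<^sup>2 - (\<Delta> w)\<^sup>2\<bar> \<le> \<eta> * (1 + (\<Delta> w)\<^sup>2) + (1 + 1 / \<eta>) * ?d\<^sup>2"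
      using less_imp_le[OF \<eta>] unfolding expand by (rule aux2)
  qed
  show "(\<lambda>n. \<integral>w. Y w * Q n w \<partial>M) \<longlonglongrightarrow> (\<integral>w. Y w * \<Delta> w \<partial>M)"
    by (rule LIMSEQ_offset[of _ N]) (use 1 in \<open>simp add: R_def\<close>)
  show "(\<lambda>n. \<integral>w. Y w * (Q n w)\<^sup>2 \<partial>M) \<longlonglongrightarrow> (\<integral>w. Y w * (\<Delta> w)\<^sup>2 \<partial>M)"
    by (rule LIMSEQ_offset[of _ N]) (use 2 in \<open>simp add: R_def\<close>)
qed

locale wiener = prob_space M for M :: "'a measure" +
  fixes F :: "real \<Rightarrow> 'a measure" and B :: "real \<Rightarrow> 'a \<Rightarrow> real"
  assumes filt: "usual_filtration M F" and bm: "brownian_motion M F B"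
begin

lemma sub: "0 \<le> t \<Longrightarrow> subalgebra M (F t)"
  using filt by (auto simp: usual_filtration_def)

lemma F_measurable_M: "0 \<le> t \<Longrightarrow> X \<in> borel_measurable (F t) \<Longrightarrow> X \<in> borel_measurable M"
  by (rule measurable_from_subalg[OF sub])

lemma F_space: "0 \<le> t \<Longrightarrow> space (F t) = space M"
  using sub by (simp add: subalgebra_def)

lemma F_mono: "0 \<le> s \<Longrightarrow> s \<le> t \<Longrightarrow> sets (F s) \<subseteq> sets (F t)"
  using filt unfolding usual_filtration_def by blast

lemma F_measurable_mono:
  assumes "0 \<le> s" "s \<le> t" "X \<in> borel_measurable (F s)"
  shows "X \<in> borel_measurable (F t)"
proof -
  have "subalgebra (F t) (F s)"
    using F_mono[OF assms(1,2)] F_space[of s] F_space[of t] assms(1,2) unfolding subalgebra_def by simp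
  then show ?thesis by (rule measurable_from_subalg[OF _ assms(3)])
qed

lemma B_adapted: "0 \<le> t \<Longrightarrow> B t \<in> borel_measurable (F t)"
  using bm unfolding brownian_motion_def by blast

lemma B_measurable: "0 \<le> t \<Longrightarrow> B t \<in> borel_measurable M"
  by (rule F_measurable_M[OF _ B_adapted])

lemma increment_moments:
  assumes "0 \<le> s" "s \<le> t"
  shows "integrable M (\<lambda>w. (B t w - B s w) ^ i)"
    "(\<integral>w. (B t w - B s w) \<partial>M) = 0" "(\<integral>w. (B t w - B s w)\<^sup>2 \<partial>M) = t - s"
    "(\<integral>w. (B t w - B s w) ^ 3 \<partial>M) = 0" "(\<integral>w. (B t w - B s w) ^ 4 \<partial>M) = 3 * (t - s)\<^sup>2"
proof -
  have "integrable M (\<lambda>w. (B t w - B s w) ^ i) \<and> (\<integral>w. (B t w - B s w) \<partial>M) = 0 \<and> (\<integral>w. (B t w - B s w)\<^sup>2 \<partial>M) = t - s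
    \<and> (\<integral>w. (B t w - B s w) ^ 3 \<partial>M) = 0 \<and> (\<integral>w. (B t w - B s w) ^ 4 \<partial>M) = 3 * (t - s)\<^sup>2"
  proof (cases "s = t")
    case False
    with assms have st: "s < t" by simp
    define \<sigma> where "\<sigma> = sqrt (t - s)"
    have \<sigma>: "0 < \<sigma>" "\<sigma>\<^sup>2 = t - s" using st by (auto simp: \<sigma>_def)
    have d: "distributed M lborel (\<lambda>w. B t w - B s w) (normal_density 0 \<sigma>)"
      using bm assms(1) st unfolding brownian_motion_def \<sigma>_def by blast
    have i: "integrable M (\<lambda>w. (B t w - B s w) ^ i)"
      using distributed_integrable[OF d, of "\<lambda>x. x ^ i"] integrable_normal_moment[OF \<sigma>(1), of 0 i] by simp
    have m: "(\<integral>w. (B t w - B s w) ^ k \<partial>M) = (\<integral>x. normal_density 0 \<sigma> x * x ^ k \<partial>lborel)" for k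
      using distributed_integral[OF d, of "\<lambda>x. x ^ k"] by simp
    note ev = normal_moment_even[OF \<sigma>(1), of 0, simplified, THEN has_bochner_integral_integral_eq]
    note od = normal_moment_odd[OF \<sigma>(1), of 0, THEN has_bochner_integral_integral_eq]
    have "(\<integral>w. (B t w - B s w)\<^sup>2 \<partial>M) = t - s" using m[of 2] ev[of 1] \<sigma> by simp
    moreover have "(\<integral>w. (B t w - B s w) ^ 4 \<partial>M) = 3 * (t - s)\<^sup>2"
      using m[of 4] ev[of 2] \<sigma> by (simp add: fact_numeral power_divide field_simps)
    moreover have "(\<integral>w. (B t w - B s w) \<partial>M) = 0" "(\<integral>w. (B t w - B s w) ^ 3 \<partial>M) = 0"
      using m[of 1] od[of 0] m[of 3] od[of 1] by (simp_all add: numeral_3_eq_3)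
    ultimately show ?thesis using i by blast
  qed (auto simp: power_0_left)
  then show "integrable M (\<lambda>w. (B t w - B s w) ^ i)"
    "(\<integral>w. (B t w - B s w) \<partial>M) = 0" "(\<integral>w. (B t w - B s w)\<^sup>2 \<partial>M) = t - s"
    "(\<integral>w. (B t w - B s w) ^ 3 \<partial>M) = 0" "(\<integral>w. (B t w - B s w) ^ 4 \<partial>M) = 3 * (t - s)\<^sup>2"
    by auto
qed

text \<open>Independence is given for the events of \<open>F s\<close> and the events of the
  increment. Both families are stable under intersection, so it extends to the generated
  \<sigma>-algebras, hence to W and every power of the increment.\<close>

lemma increment_independent:
  assumes "0 \<le> s" "s \<le> t" "W \<in> borel_measurable (F s)" "integrable M W"
  shows "integrable M (\<lambda>w. W w * (B t w - B s w) ^ i)"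
    "(\<integral>w. W w * (B t w - B s w) ^ i \<partial>M) = (\<integral>w. W w \<partial>M) * (\<integral>w. (B t w - B s w) ^ i \<partial>M)"
proof -
  have "integrable M (\<lambda>w. W w * (B t w - B s w) ^ i) \<and>
    (\<integral>w. W w * (B t w - B s w) ^ i \<partial>M) = (\<integral>w. W w \<partial>M) * (\<integral>w. (B t w - B s w) ^ i \<partial>M)"
  proof (cases "s = t")
    case True
    then show ?thesis using assms(4) by (cases "i = 0") (auto simp: prob_space)
  next
    case False
    with assms have st: "s < t" by simp
    let ?\<Delta> = "\<lambda>w. B t w - B s w"
    have [measurable]: "?\<Delta> \<in> borel_measurable M" "W \<in> borel_measurable M"
      using B_measurable[of s] B_measurable[of t] assms F_measurable_M by auto
    have "indep_set (sets (F s)) {?\<Delta> -` A \<inter> space M | A. A \<in> sets borel}"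
      using bm assms(1) st unfolding brownian_motion_def by blast
    then have "indep_set (sigma_sets (space M) (sets (F s))) (sigma_sets (space M) {?\<Delta> -` A \<inter> space M | A. A \<in> sets borel})"
    proof (rule indep_set_sigma_sets)
      show "Int_stable (sets (F s))" by (auto simp: Int_stable_def)
      show "Int_stable {?\<Delta> -` A \<inter> space M | A. A \<in> sets borel}"
        unfolding Int_stable_def
      proof safe
        fix A C :: "real set" assume "A \<in> sets borel" "C \<in> sets borel"
        then show "\<exists>E. ?\<Delta> -` A \<inter> space M \<inter> (?\<Delta> -` C \<inter> space M) = ?\<Delta> -` E \<inter> space M \<and> E \<in> sets borel"
          by (intro exI[of _ "A \<inter> C"]) auto
      qed
    qed
    moreover have "sigma_sets (space M) {W -` A \<inter> space M | A. A \<in> sets borel} \<subseteq> sigma_sets (space M) (sets (F s))"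
    proof (rule sigma_sets_mono')
      have "space (F s) = space M" using sub[OF assms(1)] by (simp add: subalgebra_def)
      then show "{W -` A \<inter> space M | A. A \<in> sets borel} \<subseteq> sets (F s)"
        using assms(3) by (auto dest: measurable_sets)
    qed
    ultimately have "indep_set (sigma_sets (space M) {W -` A \<inter> space M | A. A \<in> sets borel}) (sigma_sets (space M) {?\<Delta> -` A \<inter> space M | A. A \<in> sets borel})"
      unfolding indep_sets2_eq by blast
    then have "indep_var borel W borel ?\<Delta>"
      unfolding indep_var_eq by simp
    then have "indep_var borel ((\<lambda>x. x) \<circ> W) borel ((\<lambda>x. x ^ i) \<circ> ?\<Delta>)"
      by (rule indep_var_compose) auto
    then have ind: "indep_var borel W borel (\<lambda>w. ?\<Delta> w ^ i)" by (simp add: comp_def)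
    show ?thesis
      using indep_var_integrable[OF ind assms(4) increment_moments(1)[OF assms(1,2)]]
        indep_var_lebesgue_integral[OF ind assms(4) increment_moments(1)[OF assms(1,2)]] by simp
  qed
  then show "integrable M (\<lambda>w. W w * (B t w - B s w) ^ i)"
    "(\<integral>w. W w * (B t w - B s w) ^ i \<partial>M) = (\<integral>w. W w \<partial>M) * (\<integral>w. (B t w - B s w) ^ i \<partial>M)"
    by auto
qed

subsection \<open>The stochastic integral\<close>

definition grid_int :: "(nat \<Rightarrow> real) \<Rightarrow> (nat \<Rightarrow> real) \<Rightarrow> nat \<Rightarrow> 'a \<Rightarrow> real" where
  "grid_int c p k w = (\<Sum>j<k. c j * (B (p (Suc j)) w - B (p j) w))"

text \<open>The variance of \<open>grid_int\<close>, as the increments over the cells are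
  independent.\<close>

definition grid_var :: "(nat \<Rightarrow> real) \<Rightarrow> (nat \<Rightarrow> real) \<Rightarrow> nat \<Rightarrow> real" where
  "grid_var c p k = (\<Sum>j<k. (c j)\<^sup>2 * (p (Suc j) - p j))"

lemma bounded_times_integrable:
  fixes Y Z :: "'a \<Rightarrow> real"
  assumes "Y \<in> borel_measurable M" "\<And>w. \<bar>Y w\<bar> \<le> b" "integrable M Z"
  shows "integrable M (\<lambda>w. Y w * Z w)"
proof (rule Bochner_Integration.integrable_bound[of M "\<lambda>w. b * Z w"])
  have b: "0 \<le> b" using order_trans[OF abs_ge_zero assms(2)] .
  show "AE w in M. norm (Y w * Z w) \<le> norm (b * Z w)"
    using assms(2) b by (intro AE_I2) (simp add: abs_mult mult_right_mono)
  show "(\<lambda>w. Y w * Z w) \<in> borel_measurable M"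
    using assms(1) borel_measurable_integrable[OF assms(3)] by (intro borel_measurable_times)
qed (use assms(3) in simp)

text \<open>Induction on the number of cells. By independence the odd powers of the last increment
  drop out, and 3 V^2 + 6 a^2 V d + 3 a^4 d^2 = 3 (V + a^2 d)^2 reproduces the Gaussian fourth
  moment. The test variable Y is known at the first grid point, which makes the first two moments
  conditional ones.\<close>

lemma grid_moments:
  assumes p: "0 \<le> p 0" "\<And>j. p j \<le> p (Suc j)"
  shows "grid_int c p k \<in> borel_measurable (F (p k)) \<and> integrable M (\<lambda>w. (grid_int c p k w) ^ 4) \<and>
    (\<integral>w. (grid_int c p k w) ^ 4 \<partial>M) \<le> 3 * (grid_var c p k)\<^sup>2 \<and>
    (\<forall>Y b. Y \<in> borel_measurable (F (p 0)) \<longrightarrow> (\<forall>w. \<bar>Y w\<bar> \<le> b) \<longrightarrow>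
      (\<integral>w. Y w * grid_int c p k w \<partial>M) = 0 \<and> (\<integral>w. Y w * (grid_int c p k w)\<^sup>2 \<partial>M) = (\<integral>w. Y w \<partial>M) * grid_var c p k)"
proof (induction k)
  case 0
  then show ?case by (simp add: grid_int_def grid_var_def)
next
  case (Suc k)
  let ?Q = "grid_int c p k" and ?V = "grid_var c p k"
  define d where "d = p (Suc k) - p k"
  define a where "a = c k"
  let ?\<Delta> = "\<lambda>w. B (p (Suc k)) w - B (p k) w"
  have pm: "p 0 \<le> p k" by (rule lift_Suc_mono_le[of p]) (use p in auto)
  have pk: "0 \<le> p k" "p k \<le> p (Suc k)" "0 \<le> p (Suc k)" using pm p(1) p(2)[of k] by auto
  have QF: "?Q \<in> borel_measurable (F (p k))" and Q4: "integrable M (\<lambda>w. (?Q w) ^ 4)" and Q4b: "(\<integral>w. (?Q w) ^ 4 \<partial>M) \<le> 3 * ?V\<^sup>2"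
    and QY: "\<And>Y b. Y \<in> borel_measurable (F (p 0)) \<Longrightarrow> (\<And>w. \<bar>Y w\<bar> \<le> b) \<Longrightarrow>
      (\<integral>w. Y w * ?Q w \<partial>M) = 0 \<and> (\<integral>w. Y w * (?Q w)\<^sup>2 \<partial>M) = (\<integral>w. Y w \<partial>M) * ?V"
    using Suc by blast+
  have QM [measurable]: "?Q \<in> borel_measurable M" by (rule F_measurable_M[OF pk(1) QF])
  have Qi: "integrable M (\<lambda>w. (?Q w) ^ i)" if "i \<le> 4" for i by (rule integrable_power_le[OF QM Q4 that])
  have QFi: "(\<lambda>w. (?Q w) ^ i) \<in> borel_measurable (F (p k))" for i
    by (rule borel_measurable_power[OF QF])
  note inc = increment_independent[OF pk(1,2)] and mom = increment_moments[OF pk(1,2), folded d_def]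
  have eq: "grid_int c p (Suc k) = (\<lambda>w. ?Q w + a * ?\<Delta> w)" by (auto simp: grid_int_def a_def)
  have Veq: "grid_var c p (Suc k) = ?V + a\<^sup>2 * d" by (simp add: grid_var_def a_def d_def)
  have meas: "grid_int c p (Suc k) \<in> borel_measurable (F (p (Suc k)))"
    unfolding eq using F_measurable_mono[OF pk(1,2) QF] F_measurable_mono[OF pk(1,2) B_adapted[OF pk(1)]] B_adapted[OF pk(3)]
    by (intro borel_measurable_add borel_measurable_times borel_measurable_const borel_measurable_diff)
  have one: "(\<lambda>w. 1 :: real) \<in> borel_measurable (F (p 0))" by simp
  have EQ2: "(\<integral>w. (?Q w)\<^sup>2 \<partial>M) = ?V" using QY[OF one, of 1] prob_space by simp
  have quart: "(\<lambda>w. (?Q w + a * ?\<Delta> w) ^ 4) = (\<lambda>w. (?Q w) ^ 4 + 4 * a * ((?Q w) ^ 3 * ?\<Delta> w ^ 1) + 6 * a\<^sup>2 * ((?Q w) ^ 2 * ?\<Delta> w ^ 2)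
      + 4 * a ^ 3 * ((?Q w) ^ 1 * ?\<Delta> w ^ 3) + a ^ 4 * ?\<Delta> w ^ 4)"
    by (rule ext) (simp add: power4_eq_xxxx power3_eq_cube power2_eq_square algebra_simps)
  have I: "integrable M (\<lambda>w. (?Q w) ^ 3 * ?\<Delta> w ^ 1)" "integrable M (\<lambda>w. (?Q w) ^ 2 * ?\<Delta> w ^ 2)" "integrable M (\<lambda>w. (?Q w) ^ 1 * ?\<Delta> w ^ 3)"
    by (rule inc(1)[OF QFi Qi]; simp)+
  have E: "(\<integral>w. (?Q w) ^ 3 * ?\<Delta> w ^ 1 \<partial>M) = 0" "(\<integral>w. (?Q w) ^ 2 * ?\<Delta> w ^ 2 \<partial>M) = ?V * d" "(\<integral>w. (?Q w) ^ 1 * ?\<Delta> w ^ 3 \<partial>M) = 0"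
    using inc(2)[OF QFi Qi, of 3 1] inc(2)[OF QFi Qi, of 2 2] inc(2)[OF QFi Qi, of 1 3] mom EQ2 by simp_all
  have i4: "integrable M (\<lambda>w. (?Q w + a * ?\<Delta> w) ^ 4)"
    unfolding quart using I Q4 mom(1)[of 4] by (intro Bochner_Integration.integrable_add integrable_mult_right) auto
  have "(\<integral>w. (?Q w + a * ?\<Delta> w) ^ 4 \<partial>M) = (\<integral>w. (?Q w) ^ 4 \<partial>M) + 6 * a\<^sup>2 * (?V * d) + a ^ 4 * (3 * d\<^sup>2)"
  proof -
    have "(\<integral>w. (?Q w + a * ?\<Delta> w) ^ 4 \<partial>M) = (\<integral>w. (?Q w) ^ 4 \<partial>M) + 4 * a * (\<integral>w. (?Q w) ^ 3 * ?\<Delta> w ^ 1 \<partial>M) + 6 * a\<^sup>2 * (\<integral>w. (?Q w) ^ 2 * ?\<Delta> w ^ 2 \<partial>M)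
        + 4 * a ^ 3 * (\<integral>w. (?Q w) ^ 1 * ?\<Delta> w ^ 3 \<partial>M) + a ^ 4 * (\<integral>w. ?\<Delta> w ^ 4 \<partial>M)"
      unfolding quart using I Q4 mom(1)[of 4] by (simp del: power_one_right)
    then show ?thesis unfolding E mom(5) by simp
  qed
  also have "\<dots> \<le> 3 * ?V\<^sup>2 + 6 * a\<^sup>2 * (?V * d) + a ^ 4 * (3 * d\<^sup>2)" using Q4b by simp
  also have "\<dots> = 3 * (grid_var c p (Suc k))\<^sup>2"
    unfolding Veq by (simp add: power4_eq_xxxx power2_eq_square algebra_simps)
  finally have b4: "(\<integral>w. (?Q w + a * ?\<Delta> w) ^ 4 \<partial>M) \<le> 3 * (grid_var c p (Suc k))\<^sup>2" .
  have "(\<integral>w. Y w * grid_int c p (Suc k) w \<partial>M) = 0 \<and> (\<integral>w. Y w * (grid_int c p (Suc k) w)\<^sup>2 \<partial>M) = (\<integral>w. Y w \<partial>M) * grid_var c p (Suc k)"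
    if Y: "Y \<in> borel_measurable (F (p 0))" "\<And>w. \<bar>Y w\<bar> \<le> (b :: real)" for Y b
  proof -
    have YF: "Y \<in> borel_measurable (F (p k))" by (rule F_measurable_mono[OF p(1) pm Y(1)])
    have YM: "Y \<in> borel_measurable M" by (rule F_measurable_M[OF p(1) Y(1)])
    have YQi: "integrable M (\<lambda>w. Y w * (?Q w) ^ i)" if "i \<le> 4" for i
      by (rule bounded_times_integrable[OF YM Y(2) Qi[OF that]])
    have YQF: "(\<lambda>w. Y w * (?Q w) ^ i) \<in> borel_measurable (F (p k))" for i
      by (rule borel_measurable_times[OF YF QFi])
    have i: "integrable M (\<lambda>w. (Y w * (?Q w) ^ i) * ?\<Delta> w ^ l)" if "i \<le> 4" for i l by (rule inc(1)[OF YQF YQi[OF that]])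
    have e: "(\<integral>w. (Y w * (?Q w) ^ i) * ?\<Delta> w ^ l \<partial>M) = (\<integral>w. Y w * (?Q w) ^ i \<partial>M) * (\<integral>w. ?\<Delta> w ^ l \<partial>M)" if "i \<le> 4" for i l
      by (rule inc(2)[OF YQF YQi[OF that]])
    have "(\<integral>w. Y w * grid_int c p (Suc k) w \<partial>M) = (\<integral>w. Y w * (?Q w) ^ 1 + a * ((Y w * (?Q w) ^ 0) * ?\<Delta> w ^ 1) \<partial>M)"
      unfolding eq by (simp add: algebra_simps)
    also have "\<dots> = (\<integral>w. Y w * (?Q w) ^ 1 \<partial>M) + a * (\<integral>w. (Y w * (?Q w) ^ 0) * ?\<Delta> w ^ 1 \<partial>M)"
      using YQi[of 1] i[of 0 1] by (simp only: Bochner_Integration.integral_add integrable_mult_right integral_mult_right_zero one_le_numeral zero_le)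
    also have "\<dots> = 0" using e[of 0 1] QY[OF Y] mom(2) by simp
    finally have 1: "(\<integral>w. Y w * grid_int c p (Suc k) w \<partial>M) = 0" .
    have "(\<integral>w. Y w * (grid_int c p (Suc k) w)\<^sup>2 \<partial>M) = (\<integral>w. (Y w * (?Q w) ^ 2 + 2 * a * ((Y w * (?Q w) ^ 1) * ?\<Delta> w ^ 1)) + a\<^sup>2 * ((Y w * (?Q w) ^ 0) * ?\<Delta> w ^ 2) \<partial>M)"
      unfolding eq by (simp add: power2_eq_square algebra_simps)
    also have "\<dots> = (\<integral>w. Y w * (?Q w) ^ 2 \<partial>M) + 2 * a * (\<integral>w. (Y w * (?Q w) ^ 1) * ?\<Delta> w ^ 1 \<partial>M) + a\<^sup>2 * (\<integral>w. (Y w * (?Q w) ^ 0) * ?\<Delta> w ^ 2 \<partial>M)"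
    proof -
      have "integrable M (\<lambda>w. Y w * (?Q w) ^ 2)" "integrable M (\<lambda>w. 2 * a * ((Y w * (?Q w) ^ 1) * ?\<Delta> w ^ 1))" "integrable M (\<lambda>w. a\<^sup>2 * ((Y w * (?Q w) ^ 0) * ?\<Delta> w ^ 2))"
        by (intro YQi integrable_mult_right i; simp)+
      then show ?thesis by (simp only: Bochner_Integration.integral_add Bochner_Integration.integrable_add integral_mult_right_zero)
    qed
    also have "\<dots> = (\<integral>w. Y w \<partial>M) * grid_var c p (Suc k)"
      using e[of 1 1] e[of 0 2] QY[OF Y] mom(2,3) unfolding Veq by (simp add: distrib_left)
    finally show ?thesis using 1 by simp
  qed
  then show ?case using meas i4 b4 unfolding eq by blast
qed

text \<open>Polarization writes the product of two increments with four squared increments, so the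
  two intervals may overlap in any way; the result is the length of the overlap.\<close>

lemma increment_covariance:
  assumes "0 \<le> a" "a \<le> b" "0 \<le> c" "c \<le> d"
  shows "integrable M (\<lambda>w. (B b w - B a w) * (B d w - B c w))"
    "(\<integral>w. (B b w - B a w) * (B d w - B c w) \<partial>M) = (\<integral>\<tau>. indicator {a<..b} \<tau> * indicator {c<..d} \<tau> \<partial>lborel)"
proof -
  have sq: "integrable M (\<lambda>w. (B t w - B s w)\<^sup>2) \<and> (\<integral>w. (B t w - B s w)\<^sup>2 \<partial>M) = \<bar>t - s\<bar>" if "0 \<le> s" "0 \<le> t" for s t
  proof (cases "s \<le> t")
    case True
    then show ?thesis using increment_moments(1)[of s t 2] increment_moments(3)[of s t] that by simp
  next
    case False
    then have "integrable M (\<lambda>w. (B s w - B t w)\<^sup>2) \<and> (\<integral>w. (B s w - B t w)\<^sup>2 \<partial>M) = s - t"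
      using increment_moments(1)[of t s 2] increment_moments(3)[of t s] that by simp
    then show ?thesis using False by (simp add: power2_commute)
  qed
  have nn: "0 \<le> b" "0 \<le> d" using assms by auto
  have pol: "(\<lambda>w. (B b w - B a w) * (B d w - B c w)) = (\<lambda>w. ((B d w - B a w)\<^sup>2 + (B b w - B c w)\<^sup>2 - (B d w - B b w)\<^sup>2 - (B c w - B a w)\<^sup>2) / 2)"
    by (rule ext) (simp add: power2_eq_square algebra_simps)
  show "integrable M (\<lambda>w. (B b w - B a w) * (B d w - B c w))"
    unfolding pol using sq assms nn by (intro integrable_divide_zero Bochner_Integration.integrable_diff Bochner_Integration.integrable_add) auto
  have "(\<integral>w. (B b w - B a w) * (B d w - B c w) \<partial>M) = (\<bar>d - a\<bar> + \<bar>b - c\<bar> - \<bar>d - b\<bar> - \<bar>c - a\<bar>) / 2"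
    unfolding pol using sq assms nn by simp
  also have "\<dots> = max 0 (min b d - max a c)" using assms by (auto simp: max_def min_def abs_if)
  also have "\<dots> = (\<integral>\<tau>. indicator {max a c<..min b d} \<tau> \<partial>lborel)"
    by (cases "max a c \<le> min b d") (auto simp: measure_def max_def)
  also have "\<dots> = (\<integral>\<tau>. indicator {a<..b} \<tau> * indicator {c<..d} \<tau> \<partial>lborel)"
    by (intro Bochner_Integration.integral_cong) (auto simp: indicator_def)
  finally show "(\<integral>w. (B b w - B a w) * (B d w - B c w) \<partial>M) = (\<integral>\<tau>. indicator {a<..b} \<tau> * indicator {c<..d} \<tau> \<partial>lborel)" .
qed

section \<open>Isometry for step functions\<close>

lemma step_Cons [simp]: "step_fun ((c, a, b) # S) \<tau> = c * indicator {a<..b} \<tau> + step_fun S \<tau>"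
  "step_integral B ((c, a, b) # S) w = c * (B b w - B a w) + step_integral B S w"
  "step_fun [] \<tau> = 0" "step_integral B [] w = 0"
  by (simp_all add: step_fun_def step_integral_def)

definition "valid_steps S \<longleftrightarrow> (\<forall>(c, a, b)\<in>set S. 0 \<le> a \<and> a \<le> (b :: real))"

text \<open>The intervals in a list may overlap or repeat. Linearity and the covariance of
  increments give the isometry without rearranging them into a partition.\<close>

lemma step_isometry1:
  assumes "valid_steps S" "0 \<le> a" "a \<le> b"
  shows "integrable M (\<lambda>w. step_integral B S w * (B b w - B a w)) \<and>
    integrable lborel (\<lambda>\<tau>. step_fun S \<tau> * indicator {a<..b} \<tau>) \<and>
    (\<integral>w. step_integral B S w * (B b w - B a w) \<partial>M) = (\<integral>\<tau>. step_fun S \<tau> * indicator {a<..b} \<tau> \<partial>lborel)"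
  using assms(1)
proof (induction S)
  case (Cons x S)
  obtain c a' b' where x: "x = (c, a', b')" by (cases x)
  have v: "0 \<le> a'" "a' \<le> b'" "valid_steps S" using Cons.prems by (auto simp: valid_steps_def x)
  note IH = Cons.IH[OF v(3)]
  note cov = increment_covariance[OF v(1,2) assms(2,3)]
  have i: "integrable lborel (\<lambda>\<tau>. indicator {a'<..b'} \<tau> * indicator {a<..b} \<tau> :: real)"
  proof -
    have "(\<lambda>\<tau>. indicator {a'<..b'} \<tau> * indicator {a<..b} \<tau> :: real) = indicator ({a'<..b'} \<inter> {a<..b})"
      by (auto simp: indicator_def)
    moreover have "emeasure lborel ({a'<..b'} \<inter> {a<..b}) \<le> emeasure lborel {a<..b}" by (intro emeasure_mono) auto
    ultimately show ?thesis using assms by (auto intro!: integrable_real_indicator elim: le_less_trans)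
  qed
  have e1: "(\<lambda>w. step_integral B (x # S) w * (B b w - B a w)) = (\<lambda>w. c * ((B b' w - B a' w) * (B b w - B a w)) + step_integral B S w * (B b w - B a w))"
    by (rule ext) (simp only: x step_Cons distrib_right mult.assoc)
  have e2: "(\<lambda>\<tau>. step_fun (x # S) \<tau> * indicator {a<..b} \<tau>) = (\<lambda>\<tau>. c * (indicator {a'<..b'} \<tau> * indicator {a<..b} \<tau>) + step_fun S \<tau> * indicator {a<..b} \<tau>)"
    by (rule ext) (simp only: x step_Cons distrib_right mult.assoc)
  show ?case unfolding e1 e2 using IH cov i by simp
qed simp

lemma step_isometry2:
  assumes "valid_steps S" "valid_steps S'"
  shows "integrable M (\<lambda>w. step_integral B S w * step_integral B S' w) \<and>
    integrable lborel (\<lambda>\<tau>. step_fun S \<tau> * step_fun S' \<tau>) \<and>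
    (\<integral>w. step_integral B S w * step_integral B S' w \<partial>M) = (\<integral>\<tau>. step_fun S \<tau> * step_fun S' \<tau> \<partial>lborel)"
  using assms(2)
proof (induction S')
  case (Cons x S')
  obtain c a b where x: "x = (c, a, b)" by (cases x)
  have v: "0 \<le> a" "a \<le> b" "valid_steps S'" using Cons.prems by (auto simp: valid_steps_def x)
  note IH = Cons.IH[OF v(3)]
  note iso = step_isometry1[OF assms(1) v(1,2)]
  have e1: "(\<lambda>w. step_integral B S w * step_integral B (x # S') w) = (\<lambda>w. c * (step_integral B S w * (B b w - B a w)) + step_integral B S w * step_integral B S' w)"
    by (rule ext) (simp only: x step_Cons distrib_left mult.left_commute)
  have e2: "(\<lambda>\<tau>. step_fun S \<tau> * step_fun (x # S') \<tau>) = (\<lambda>\<tau>. c * (step_fun S \<tau> * indicator {a<..b} \<tau>) + step_fun S \<tau> * step_fun S' \<tau>)"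
    by (rule ext) (simp only: x step_Cons distrib_left mult.left_commute)
  show ?case unfolding e1 e2 using IH iso by simp
qed simp

lemma step_isometry:
  assumes "valid_steps S"
  shows "(\<integral>\<^sup>+w. ennreal ((step_integral B S w)\<^sup>2) \<partial>M) = (\<integral>\<^sup>+\<tau>. ennreal ((step_fun S \<tau>)\<^sup>2) \<partial>lborel)"
  using step_isometry2[OF assms assms] unfolding power2_eq_square
  by (subst (1 2) nn_integral_eq_integral) auto

definition "neg_steps = map (\<lambda>(c :: real, a :: real, b :: real). (- c, a, b))"

lemma step_append: "step_fun (S @ S') \<tau> = step_fun S \<tau> + step_fun S' \<tau>"
  "step_integral B (S @ S') w = step_integral B S w + step_integral B S' w"
  by (simp_all add: step_fun_def step_integral_def)

lemma step_neg: "step_fun (neg_steps S) \<tau> = - step_fun S \<tau>" "step_integral B (neg_steps S) w = - step_integral B S w"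
  by (induction S) (auto simp: neg_steps_def)

lemma valid_steps_append: "valid_steps (S @ S') \<longleftrightarrow> valid_steps S \<and> valid_steps S'"
  by (simp add: valid_steps_def ball_Un)

lemma valid_steps_neg: "valid_steps (neg_steps S) \<longleftrightarrow> valid_steps S"
  by (induction S) (auto simp: neg_steps_def valid_steps_def)

definition "grid_steps c p k = map (\<lambda>j. (c j :: real, p j :: real, p (Suc j))) [0..<k]"

lemma grid_steps_fun: "step_fun (grid_steps c p k) \<tau> = (\<Sum>j<k. c j * indicator {p j<..p (Suc j)} \<tau>)"
  by (simp add: step_fun_def grid_steps_def comp_def interv_sum_list_conv_sum_set_nat lessThan_atLeast0)

lemma grid_steps_integral: "step_integral B (grid_steps c p k) = grid_int c p k"
  by (rule ext) (simp add: step_integral_def grid_int_def grid_steps_def comp_def interv_sum_list_conv_sum_set_nat lessThan_atLeast0)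

lemma step_fun_measurable [measurable]: "step_fun S \<in> borel_measurable borel"
  by (induction S) (auto simp: fun_eq_iff[symmetric] step_fun_def split: prod.splits)

lemma step_integral_measurable:
  "valid_steps S \<Longrightarrow> step_integral B S \<in> borel_measurable M"
proof (induction S)
  case (Cons x S)
  obtain c a b where x: "x = (c, a, b)" by (cases x)
  have v: "0 \<le> a" "a \<le> b" "valid_steps S" using Cons.prems by (auto simp: valid_steps_def x)
  have "step_integral B (x # S) = (\<lambda>w. c * (B b w - B a w) + step_integral B S w)" by (rule ext) (simp add: x)
  then show ?case using Cons.IH[OF v(3)] B_measurable[of a] B_measurable[of b] v by simp
qed (simp add: step_integral_def[abs_def])

end

section \<open>Increments of the stochastic integral of the square root of \<zeta>\<close>

locale wiener_pde = wiener M F B + parisi_pde \<xi> K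
  for M :: "'a measure" and F and B :: "real \<Rightarrow> 'a \<Rightarrow> real" and \<xi> K
begin

abbreviation "is_J s J \<equiv> is_stochastic_integral M B (\<lambda>\<tau>. sqrt (\<zeta> \<tau>)) s J"

lemma sqrt_zeta_cont: "continuous_on {0..1} (\<lambda>\<tau>. sqrt (\<zeta> \<tau>))"
  by (intro continuous_on_real_sqrt zeta_cont)

text \<open>The approximating step functions vanish outside (0,s], so convergence on [0,s] is
  convergence on the whole line to the truncated integrand. This makes integrals up to different
  times comparable.\<close>

lemma J_approx:
  assumes "is_J s J" "0 \<le> s" "s \<le> 1"
  obtains S where "\<And>n. valid_steps (S n)" "J \<in> borel_measurable M"
    "(\<lambda>n. \<integral>\<^sup>+\<tau>. ennreal ((step_fun (S n) \<tau> - sqrt (\<zeta> \<tau>) * indicator {0<..s} \<tau>)\<^sup>2) \<partial>lborel) \<longlonglongrightarrow> 0"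
    "(\<lambda>n. \<integral>\<^sup>+w. ennreal ((step_integral B (S n) w - J w)\<^sup>2) \<partial>M) \<longlonglongrightarrow> 0"
proof -
  obtain S where S: "\<And>n. \<forall>(c, a, b)\<in>set (S n). 0 \<le> a \<and> a \<le> b \<and> b \<le> s"
    "(\<lambda>n. \<integral>\<^sup>+\<tau>\<in>{0..s}. ennreal ((step_fun (S n) \<tau> - sqrt (\<zeta> \<tau>))\<^sup>2) \<partial>lborel) \<longlonglongrightarrow> 0"
    "(\<lambda>n. \<integral>\<^sup>+w. ennreal ((step_integral B (S n) w - J w)\<^sup>2) \<partial>M) \<longlonglongrightarrow> 0"
    and J: "J \<in> borel_measurable M"
    using assms(1) unfolding is_stochastic_integral_def by blast
  have v: "valid_steps (S n)" for n using S(1)[of n] by (auto simp: valid_steps_def)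
  have out: "step_fun T \<tau> = 0" if "\<forall>(c, a, b)\<in>set T. 0 \<le> a \<and> a \<le> b \<and> b \<le> s" "\<tau> \<notin> {0<..s}" for T \<tau>
    using that
  proof (induction T)
    case (Cons x T)
    obtain c a b where x: "x = (c, a, b)" by (cases x)
    show ?case using Cons by (simp add: x) (auto simp: indicator_def)
  qed simp
  have "(\<integral>\<^sup>+\<tau>\<in>{0..s}. ennreal ((step_fun (S n) \<tau> - sqrt (\<zeta> \<tau>))\<^sup>2) \<partial>lborel)
      = (\<integral>\<^sup>+\<tau>. ennreal ((step_fun (S n) \<tau> - sqrt (\<zeta> \<tau>) * indicator {0<..s} \<tau>)\<^sup>2) \<partial>lborel)" for n
  proof (rule nn_integral_cong_AE)
    have "AE \<tau> in lborel. \<tau> \<noteq> (0 :: real)" by (rule AE_lborel_singleton)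
    then show "AE \<tau> in lborel. ennreal ((step_fun (S n) \<tau> - sqrt (\<zeta> \<tau>))\<^sup>2) * indicator {0..s} \<tau>
        = ennreal ((step_fun (S n) \<tau> - sqrt (\<zeta> \<tau>) * indicator {0<..s} \<tau>)\<^sup>2)"
    proof eventually_elim
      fix \<tau> :: real assume \<tau>: "\<tau> \<noteq> 0"
      show "ennreal ((step_fun (S n) \<tau> - sqrt (\<zeta> \<tau>))\<^sup>2) * indicator {0..s} \<tau>
        = ennreal ((step_fun (S n) \<tau> - sqrt (\<zeta> \<tau>) * indicator {0<..s} \<tau>)\<^sup>2)"
      proof (cases "\<tau> \<in> {0<..s}")
        case True
        then show ?thesis by (simp add: indicator_def)
      next
        case False
        then have "\<tau> \<notin> {0..s}" using \<tau> by auto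
        then show ?thesis using out[OF S(1) False] False by simp
      qed
    qed
  qed
  then show thesis using that[OF v J _ S(3)] S(2) by simp
qed

text \<open>Choosing the coefficients by the mean value theorem makes the variance of every grid integral exact.\<close>

definition "mesh_pt s t n j = s + real j * ((t - s) / real (Suc n))"
definition "mesh_coef s t n j = sqrt ((\<rho> (mesh_pt s t n (Suc j)) - \<rho> (mesh_pt s t n j)) / ((t - s) / real (Suc n)))"

lemma mesh_pt_simps:
  "mesh_pt s t n 0 = s" "mesh_pt s t n (Suc n) = t" "mesh_pt s t n (Suc j) - mesh_pt s t n j = (t - s) / real (Suc n)"
proof -
  show "mesh_pt s t n 0 = s" by (simp add: mesh_pt_def)
  show "mesh_pt s t n (Suc n) = t" unfolding mesh_pt_def by (simp del: of_nat_Suc)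
  have "real (Suc j) * d = real j * d + d" for d by (simp add: distrib_right)
  from this[of "(t - s) / real (Suc n)"] show "mesh_pt s t n (Suc j) - mesh_pt s t n j = (t - s) / real (Suc n)"
    unfolding mesh_pt_def by linarith
qed

lemma mesh_pt_mono:
  assumes "s \<le> t"
  shows "mesh_pt s t n j \<le> mesh_pt s t n (Suc j)"
proof -
  have "0 \<le> (t - s) / real (Suc n)" using assms by simp
  then show ?thesis using mesh_pt_simps(3)[of s t n j] by linarith
qed

lemma mesh_pt_range:
  assumes "0 \<le> s" "s \<le> t" "t \<le> 1" "j \<le> Suc n"
  shows "s \<le> mesh_pt s t n j" "mesh_pt s t n j \<le> t" "0 \<le> mesh_pt s t n j" "mesh_pt s t n j \<le> 1"
proof -
  show 1: "s \<le> mesh_pt s t n j"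
    using lift_Suc_mono_le[of "mesh_pt s t n" 0 j] mesh_pt_mono[OF assms(2)] by (simp add: mesh_pt_simps)
  show 2: "mesh_pt s t n j \<le> t"
    using lift_Suc_mono_le[of "mesh_pt s t n" j "Suc n"] mesh_pt_mono[OF assms(2)] assms(4) by (simp add: mesh_pt_simps)
  show "0 \<le> mesh_pt s t n j" "mesh_pt s t n j \<le> 1" using 1 2 assms by auto
qed

lemma mesh_var:
  assumes "0 \<le> s" "s < t" "t \<le> 1"
  shows "grid_var (mesh_coef s t n) (mesh_pt s t n) (Suc n) = \<rho> t - \<rho> s"
proof -
  have "grid_var (mesh_coef s t n) (mesh_pt s t n) (Suc n) = (\<Sum>j<Suc n. \<rho> (mesh_pt s t n (Suc j)) - \<rho> (mesh_pt s t n j))"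
    unfolding grid_var_def
  proof (rule sum.cong[OF refl])
    fix j assume j: "j \<in> {..<Suc n}"
    have "0 \<le> \<rho> (mesh_pt s t n (Suc j)) - \<rho> (mesh_pt s t n j)"
      using j assms mesh_pt_range[of s t j n] mesh_pt_range[of s t "Suc j" n] mesh_pt_mono[of s t n j]
      by (intro rho_diff(1)) auto
    then show "(mesh_coef s t n j)\<^sup>2 * (mesh_pt s t n (Suc j) - mesh_pt s t n j) = \<rho> (mesh_pt s t n (Suc j)) - \<rho> (mesh_pt s t n j)"
      unfolding mesh_coef_def mesh_pt_simps(3) using assms by simp
  qed
  also have "\<dots> = \<rho> t - \<rho> s"
    using sum_lessThan_telescope[of "\<lambda>j. \<rho> (mesh_pt s t n j)" "Suc n"] by (simp only: mesh_pt_simps)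
  finally show ?thesis .
qed

lemma mesh_coef_close:
  assumes st: "0 \<le> s" "s < t" "t \<le> 1" and e: "0 < e"
  shows "\<exists>N. \<forall>n\<ge>N. \<forall>j<Suc n. \<forall>\<tau>. mesh_pt s t n j < \<tau> \<longrightarrow> \<tau> \<le> mesh_pt s t n (Suc j) \<longrightarrow> \<bar>mesh_coef s t n j - sqrt (\<zeta> \<tau>)\<bar> \<le> e"
proof -
  have "uniformly_continuous_on {0..1} (\<lambda>\<tau>. sqrt (\<zeta> \<tau>))"
    by (rule compact_uniformly_continuous[OF sqrt_zeta_cont]) simp
  then obtain d where d: "0 < d" "\<And>x y. x \<in> {0..1} \<Longrightarrow> y \<in> {0..1} \<Longrightarrow> \<bar>y - x\<bar> < d \<Longrightarrow> \<bar>sqrt (\<zeta> y) - sqrt (\<zeta> x)\<bar> < e"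
    using e unfolding uniformly_continuous_on_def dist_real_def by blast
  have "(\<lambda>n. (t - s) / real (Suc n)) \<longlonglongrightarrow> 0" by (rule LIMSEQ_Suc[OF lim_const_over_n])
  then have "\<forall>\<^sub>F n in sequentially. (t - s) / real (Suc n) < d" using d(1) by (rule order_tendstoD(2))
  then obtain N where N: "\<And>n. n \<ge> N \<Longrightarrow> (t - s) / real (Suc n) < d" unfolding eventually_sequentially by blast
  have "\<bar>mesh_coef s t n j - sqrt (\<zeta> \<tau>)\<bar> \<le> e" if n: "n \<ge> N" and j: "j < Suc n" and \<tau>: "mesh_pt s t n j < \<tau>" "\<tau> \<le> mesh_pt s t n (Suc j)" for n j \<tau>
  proof -
    let ?p = "mesh_pt s t n j" and ?q = "mesh_pt s t n (Suc j)"
    have pq: "0 \<le> ?p" "?q \<le> 1" using j st mesh_pt_range[of s t j n] mesh_pt_range[of s t "Suc j" n] by auto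
    \<comment> \<open>By the mean value theorem the coefficient is the integrand at a point of the
      same cell; uniform continuity does the rest.\<close>
    have "\<exists>z>?p. z < ?q \<and> \<rho> ?q - \<rho> ?p = (?q - ?p) * \<zeta> z"
      by (rule MVT2) (use \<tau> pq xi_deriv in auto)
    then obtain z where z: "?p < z" "z < ?q" "\<rho> ?q - \<rho> ?p = (?q - ?p) * \<zeta> z" by blast
    have "mesh_coef s t n j = sqrt (\<zeta> z)"
      unfolding mesh_coef_def z(3) mesh_pt_simps(3) using st by simp
    moreover have "?q - ?p < d" using N[OF n] unfolding mesh_pt_simps(3) .
    then have "\<bar>z - \<tau>\<bar> < d" using z \<tau> by linarith
    then have "\<bar>sqrt (\<zeta> z) - sqrt (\<zeta> \<tau>)\<bar> < e"
      using z \<tau> pq by (intro d(2)) auto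
    ultimately show ?thesis by simp
  qed
  then show ?thesis by blast
qed

lemma mesh_fun_close:
  assumes st: "0 \<le> s" "s < t" "t \<le> 1"
  shows "(\<lambda>n. \<integral>\<^sup>+\<tau>. ennreal ((step_fun (grid_steps (mesh_coef s t n) (mesh_pt s t n) (Suc n)) \<tau> - sqrt (\<zeta> \<tau>) * indicator {s<..t} \<tau>)\<^sup>2) \<partial>lborel) \<longlonglongrightarrow> 0"
proof (rule order_tendstoI)
  fix e :: ennreal assume "0 < e"
  then obtain e' :: real where e': "0 < e'" "ennreal e' < e"
    by (metis ennreal_0 ennreal_less_zero_iff ennreal_neq_top not_less_zero dense ennreal_cases top_greatest less_top order_less_trans)
  define \<eta> where "\<eta> = sqrt e'"
  have \<eta>: "0 < \<eta>" "\<eta>\<^sup>2 = e'" using e' by (auto simp: \<eta>_def)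
  obtain N where N: "\<And>n j \<tau>. n \<ge> N \<Longrightarrow> j < Suc n \<Longrightarrow> mesh_pt s t n j < \<tau> \<Longrightarrow> \<tau> \<le> mesh_pt s t n (Suc j) \<Longrightarrow> \<bar>mesh_coef s t n j - sqrt (\<zeta> \<tau>)\<bar> \<le> \<eta>"
    using mesh_coef_close[OF st \<eta>(1)] by blast
  have "(\<integral>\<^sup>+\<tau>. ennreal ((step_fun (grid_steps (mesh_coef s t n) (mesh_pt s t n) (Suc n)) \<tau> - sqrt (\<zeta> \<tau>) * indicator {s<..t} \<tau>)\<^sup>2) \<partial>lborel) < e" if n: "n \<ge> N" for n
  proof -
    let ?I = "\<lambda>j \<tau>. indicator {mesh_pt s t n j<..mesh_pt s t n (Suc j)} \<tau> :: real"
    have tel: "(\<Sum>j<Suc n. ?I j \<tau>) = indicator {s<..t} \<tau>" for \<tau>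
    proof -
      have "(\<Sum>j<k. ?I j \<tau>) = indicator {s<..mesh_pt s t n k} \<tau>" for k
      proof (induction k)
        case (Suc k)
        have "s \<le> mesh_pt s t n k"
          using lift_Suc_mono_le[of "mesh_pt s t n" 0 k] mesh_pt_mono[of s t n] st by (simp add: mesh_pt_simps)
        moreover have "mesh_pt s t n k \<le> mesh_pt s t n (Suc k)" using mesh_pt_mono st by simp
        ultimately show ?case using Suc by (auto simp: indicator_def)
      qed (simp add: mesh_pt_simps)
      from this[of "Suc n"] show ?thesis by (simp only: mesh_pt_simps)
    qed
    have "\<bar>step_fun (grid_steps (mesh_coef s t n) (mesh_pt s t n) (Suc n)) \<tau> - sqrt (\<zeta> \<tau>) * indicator {s<..t} \<tau>\<bar> \<le> \<eta> * indicator {s<..t} \<tau>" for \<tau>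
    proof -
      have eq: "step_fun (grid_steps (mesh_coef s t n) (mesh_pt s t n) (Suc n)) \<tau> - sqrt (\<zeta> \<tau>) * indicator {s<..t} \<tau>
          = (\<Sum>j<Suc n. (mesh_coef s t n j - sqrt (\<zeta> \<tau>)) * ?I j \<tau>)"
        unfolding grid_steps_fun tel[symmetric] by (simp only: sum_distrib_left sum_subtractf[symmetric] left_diff_distrib)
      have "\<bar>\<Sum>j<Suc n. (mesh_coef s t n j - sqrt (\<zeta> \<tau>)) * ?I j \<tau>\<bar> \<le> (\<Sum>j<Suc n. \<bar>(mesh_coef s t n j - sqrt (\<zeta> \<tau>)) * ?I j \<tau>\<bar>)" by (rule sum_abs)
      also have "\<dots> \<le> (\<Sum>j<Suc n. \<eta> * ?I j \<tau>)"
      proof (rule sum_mono)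
        fix j assume "j \<in> {..<Suc n}"
        then show "\<bar>(mesh_coef s t n j - sqrt (\<zeta> \<tau>)) * ?I j \<tau>\<bar> \<le> \<eta> * ?I j \<tau>"
          using N[OF n, of j \<tau>] by (cases "\<tau> \<in> {mesh_pt s t n j<..mesh_pt s t n (Suc j)}") simp_all
      qed
      also have "\<dots> = \<eta> * indicator {s<..t} \<tau>" by (simp only: sum_distrib_left[symmetric] tel)
      finally show ?thesis unfolding eq .
    qed
    then have "(\<integral>\<^sup>+\<tau>. ennreal ((step_fun (grid_steps (mesh_coef s t n) (mesh_pt s t n) (Suc n)) \<tau> - sqrt (\<zeta> \<tau>) * indicator {s<..t} \<tau>)\<^sup>2) \<partial>lborel)
        \<le> (\<integral>\<^sup>+\<tau>. ennreal (\<eta>\<^sup>2) * indicator {s<..t} \<tau> \<partial>lborel)"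
    proof (intro nn_integral_mono)
      fix \<tau>
      assume b: "\<And>\<tau>. \<bar>step_fun (grid_steps (mesh_coef s t n) (mesh_pt s t n) (Suc n)) \<tau> - sqrt (\<zeta> \<tau>) * indicator {s<..t} \<tau>\<bar> \<le> \<eta> * indicator {s<..t} \<tau>"
      have "(step_fun (grid_steps (mesh_coef s t n) (mesh_pt s t n) (Suc n)) \<tau> - sqrt (\<zeta> \<tau>) * indicator {s<..t} \<tau>)\<^sup>2 \<le> (\<eta> * indicator {s<..t} \<tau>)\<^sup>2"
        using power_mono[OF b abs_ge_zero, of \<tau> 2] by simp
      also have "\<dots> = \<eta>\<^sup>2 * indicator {s<..t} \<tau>" by (simp add: indicator_def)
      finally show "ennreal ((step_fun (grid_steps (mesh_coef s t n) (mesh_pt s t n) (Suc n)) \<tau> - sqrt (\<zeta> \<tau>) * indicator {s<..t} \<tau>)\<^sup>2) \<le> ennreal (\<eta>\<^sup>2) * indicator {s<..t} \<tau>"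
        by (cases "\<tau> \<in> {s<..t}") (auto intro: ennreal_leI)
    qed
    also have "\<dots> = ennreal (\<eta>\<^sup>2) * ennreal (t - s)"
      using st by (subst nn_integral_cmult_indicator) auto
    also have "\<dots> = ennreal (\<eta>\<^sup>2 * (t - s))" using st by (simp add: ennreal_mult)
    also have "\<dots> \<le> ennreal e'" unfolding \<eta>(2) using st e' by (intro ennreal_leI mult_left_le) auto
    also have "\<dots> < e" by (rule e'(2))
    finally show ?thesis .
  qed
  then show "\<forall>\<^sub>F n in sequentially. (\<integral>\<^sup>+\<tau>. ennreal ((step_fun (grid_steps (mesh_coef s t n) (mesh_pt s t n) (Suc n)) \<tau> - sqrt (\<zeta> \<tau>) * indicator {s<..t} \<tau>)\<^sup>2) \<partial>lborel) < e"
    unfolding eventually_sequentially by blast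
qed simp

lemma three_squares: "(x + y + z)\<^sup>2 \<le> 3 * (x\<^sup>2 + y\<^sup>2 + z\<^sup>2)" for x y z :: real
  using sum_squares_bound[of x y] sum_squares_bound[of x z] sum_squares_bound[of y z]
  by (simp add: power2_eq_square algebra_simps)

lemma nn_three_squares:
  fixes f g k :: "'b \<Rightarrow> real"
  assumes [measurable]: "f \<in> borel_measurable N" "g \<in> borel_measurable N" "k \<in> borel_measurable N"
  shows "(\<integral>\<^sup>+x. ennreal ((f x + g x + k x)\<^sup>2) \<partial>N) \<le> 3 * ((\<integral>\<^sup>+x. ennreal ((f x)\<^sup>2) \<partial>N) + (\<integral>\<^sup>+x. ennreal ((g x)\<^sup>2) \<partial>N) + (\<integral>\<^sup>+x. ennreal ((k x)\<^sup>2) \<partial>N))"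
proof -
  have "(\<integral>\<^sup>+x. ennreal ((f x + g x + k x)\<^sup>2) \<partial>N) \<le> (\<integral>\<^sup>+x. 3 * (ennreal ((f x)\<^sup>2) + ennreal ((g x)\<^sup>2) + ennreal ((k x)\<^sup>2)) \<partial>N)"
  proof (rule nn_integral_mono)
    fix x
    have "ennreal ((f x + g x + k x)\<^sup>2) \<le> ennreal (3 * ((f x)\<^sup>2 + (g x)\<^sup>2 + (k x)\<^sup>2))"
      by (rule ennreal_leI[OF three_squares])
    also have "\<dots> = 3 * (ennreal ((f x)\<^sup>2) + ennreal ((g x)\<^sup>2) + ennreal ((k x)\<^sup>2))"
      by (simp add: ennreal_mult)
    finally show "ennreal ((f x + g x + k x)\<^sup>2) \<le> 3 * (ennreal ((f x)\<^sup>2) + ennreal ((g x)\<^sup>2) + ennreal ((k x)\<^sup>2))" .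
  qed
  also have "\<dots> = 3 * ((\<integral>\<^sup>+x. ennreal ((f x)\<^sup>2) \<partial>N) + (\<integral>\<^sup>+x. ennreal ((g x)\<^sup>2) \<partial>N) + (\<integral>\<^sup>+x. ennreal ((k x)\<^sup>2) \<partial>N))"
    by (simp add: nn_integral_cmult nn_integral_add)
  finally show ?thesis .
qed

text \<open>The integrals up to s and up to t come with unrelated approximating sequences S and T.
  The mesh steps on [s,t], minus T k, plus S k, again form a step function, and the isometry bounds
  its integral. Letting k tend to infinity with n fixed removes S and T, so the increment is
  approximated by grid integrals that start at time s.\<close>

lemma J_increment_approx:
  assumes J: "is_J s Js" "is_J t Jt" and st: "0 \<le> s" "s < t" "t \<le> 1"
  shows "(\<lambda>n. \<integral>\<^sup>+w. ennreal ((grid_int (mesh_coef s t n) (mesh_pt s t n) (Suc n) w - (Jt w - Js w))\<^sup>2) \<partial>M) \<longlonglongrightarrow> 0"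
proof -
  have s1: "s \<le> 1" and t0: "0 \<le> t" using st by auto
  obtain S where S: "\<And>n. valid_steps (S n)" "Js \<in> borel_measurable M"
    "(\<lambda>n. \<integral>\<^sup>+\<tau>. ennreal ((step_fun (S n) \<tau> - sqrt (\<zeta> \<tau>) * indicator {0<..s} \<tau>)\<^sup>2) \<partial>lborel) \<longlonglongrightarrow> 0"
    "(\<lambda>n. \<integral>\<^sup>+w. ennreal ((step_integral B (S n) w - Js w)\<^sup>2) \<partial>M) \<longlonglongrightarrow> 0"
    by (rule J_approx[OF J(1) st(1) s1]) (rule that)
  obtain T where T: "\<And>n. valid_steps (T n)" "Jt \<in> borel_measurable M"
    "(\<lambda>n. \<integral>\<^sup>+\<tau>. ennreal ((step_fun (T n) \<tau> - sqrt (\<zeta> \<tau>) * indicator {0<..t} \<tau>)\<^sup>2) \<partial>lborel) \<longlonglongrightarrow> 0"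
    "(\<lambda>n. \<integral>\<^sup>+w. ennreal ((step_integral B (T n) w - Jt w)\<^sup>2) \<partial>M) \<longlonglongrightarrow> 0"
    by (rule J_approx[OF J(2) t0 st(3)]) (rule that)
  note [measurable] = S(2) T(2) step_integral_measurable[OF S(1)] step_integral_measurable[OF T(1)]
  define G where "G n = grid_steps (mesh_coef s t n) (mesh_pt s t n) (Suc n)" for n
  have vG: "valid_steps (G n)" for n
    unfolding valid_steps_def G_def grid_steps_def
    using mesh_pt_range(3)[OF st(1) less_imp_le[OF st(2)] st(3)] mesh_pt_mono[OF less_imp_le[OF st(2)]] by auto
  have Gi: "step_integral B (G n) = grid_int (mesh_coef s t n) (mesh_pt s t n) (Suc n)" for n
    unfolding G_def by (rule grid_steps_integral)
  note [measurable] = step_integral_measurable[OF vG]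
  have fm [measurable]: "(\<lambda>\<tau>. sqrt (\<zeta> \<tau>) * indicator {a<..b} \<tau>) \<in> borel_measurable lborel" if "0 \<le> a" "b \<le> 1" for a b
  proof -
    have "(\<lambda>\<tau>. (indicator {0..1} \<tau> *\<^sub>R sqrt (\<zeta> \<tau>)) * indicator {a<..b} \<tau>) \<in> borel_measurable lborel"
      using borel_measurable_continuous_on_indicator[OF _ sqrt_zeta_cont] by (intro borel_measurable_times) auto
    also have "(\<lambda>\<tau>. (indicator {0..1} \<tau> *\<^sub>R sqrt (\<zeta> \<tau>)) * indicator {a<..b} \<tau>) = (\<lambda>\<tau>. sqrt (\<zeta> \<tau>) * indicator {a<..b} \<tau>)"
      using that by (auto simp: indicator_def)
    finally show ?thesis .
  qed
  have m: "(\<lambda>\<tau>. sqrt (\<zeta> \<tau>) * indicator {0<..s} \<tau>) \<in> borel_measurable lborel" "(\<lambda>\<tau>. sqrt (\<zeta> \<tau>) * indicator {0<..t} \<tau>) \<in> borel_measurable lborel"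
    "(\<lambda>\<tau>. sqrt (\<zeta> \<tau>) * indicator {s<..t} \<tau>) \<in> borel_measurable lborel"
    using st by (intro fm; simp)+
  note [measurable] = m
  define g where "g n = (\<integral>\<^sup>+\<tau>. ennreal ((step_fun (G n) \<tau> - sqrt (\<zeta> \<tau>) * indicator {s<..t} \<tau>)\<^sup>2) \<partial>lborel)" for n
  have bound: "(\<integral>\<^sup>+w. ennreal ((step_integral B (G n) w - (Jt w - Js w))\<^sup>2) \<partial>M) \<le> 3 * (3 * g n)" for n
  proof -
    have 1: "(\<integral>\<^sup>+w. ennreal ((step_integral B (G n) w - (Jt w - Js w))\<^sup>2) \<partial>M)
      \<le> 3 * ((3 * (g n + (\<integral>\<^sup>+\<tau>. ennreal ((step_fun (T k) \<tau> - sqrt (\<zeta> \<tau>) * indicator {0<..t} \<tau>)\<^sup>2) \<partial>lborel)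
              + (\<integral>\<^sup>+\<tau>. ennreal ((step_fun (S k) \<tau> - sqrt (\<zeta> \<tau>) * indicator {0<..s} \<tau>)\<^sup>2) \<partial>lborel)))
         + (\<integral>\<^sup>+w. ennreal ((step_integral B (T k) w - Jt w)\<^sup>2) \<partial>M)
         + (\<integral>\<^sup>+w. ennreal ((step_integral B (S k) w - Js w)\<^sup>2) \<partial>M))" for k
    proof -
      define U where "U = G n @ neg_steps (T k) @ S k"
      have vU: "valid_steps U" unfolding U_def valid_steps_append valid_steps_neg using vG S(1) T(1) by simp
      have [measurable]: "step_integral B U \<in> borel_measurable M" by (rule step_integral_measurable[OF vU])
      have "(\<integral>\<^sup>+w. ennreal ((step_integral B (G n) w - (Jt w - Js w))\<^sup>2) \<partial>M)
          = (\<integral>\<^sup>+w. ennreal ((step_integral B U w + (step_integral B (T k) w - Jt w) + (Js w - step_integral B (S k) w))\<^sup>2) \<partial>M)"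
        unfolding U_def step_append step_neg by (simp add: algebra_simps)
      also have "\<dots> \<le> 3 * ((\<integral>\<^sup>+w. ennreal ((step_integral B U w)\<^sup>2) \<partial>M) + (\<integral>\<^sup>+w. ennreal ((step_integral B (T k) w - Jt w)\<^sup>2) \<partial>M)
          + (\<integral>\<^sup>+w. ennreal ((Js w - step_integral B (S k) w)\<^sup>2) \<partial>M))"
        by (intro nn_three_squares) measurable
      finally have A: "(\<integral>\<^sup>+w. ennreal ((step_integral B (G n) w - (Jt w - Js w))\<^sup>2) \<partial>M)
          \<le> 3 * ((\<integral>\<^sup>+w. ennreal ((step_integral B U w)\<^sup>2) \<partial>M) + (\<integral>\<^sup>+w. ennreal ((step_integral B (T k) w - Jt w)\<^sup>2) \<partial>M)
          + (\<integral>\<^sup>+w. ennreal ((step_integral B (S k) w - Js w)\<^sup>2) \<partial>M))"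
        by (simp only: power2_commute[of "Js _"])
      have "(\<integral>\<^sup>+w. ennreal ((step_integral B U w)\<^sup>2) \<partial>M) = (\<integral>\<^sup>+\<tau>. ennreal ((step_fun U \<tau>)\<^sup>2) \<partial>lborel)" by (rule step_isometry[OF vU])
      also have "\<dots> = (\<integral>\<^sup>+\<tau>. ennreal (((step_fun (G n) \<tau> - sqrt (\<zeta> \<tau>) * indicator {s<..t} \<tau>) + (sqrt (\<zeta> \<tau>) * indicator {0<..t} \<tau> - step_fun (T k) \<tau>)
          + (step_fun (S k) \<tau> - sqrt (\<zeta> \<tau>) * indicator {0<..s} \<tau>))\<^sup>2) \<partial>lborel)"
      proof (intro nn_integral_cong arg_cong[where f=ennreal] arg_cong[where f="\<lambda>x. x\<^sup>2"])
        fix \<tau>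
        have "indicator {0<..t} \<tau> = (indicator {0<..s} \<tau> + indicator {s<..t} \<tau> :: real)" using st by (auto simp: indicator_def)
        then have "sqrt (\<zeta> \<tau>) * indicator {0<..t} \<tau> = sqrt (\<zeta> \<tau>) * indicator {0<..s} \<tau> + sqrt (\<zeta> \<tau>) * indicator {s<..t} \<tau>"
          by (simp only: distrib_left)
        then show "step_fun U \<tau> = (step_fun (G n) \<tau> - sqrt (\<zeta> \<tau>) * indicator {s<..t} \<tau>) + (sqrt (\<zeta> \<tau>) * indicator {0<..t} \<tau> - step_fun (T k) \<tau>)
          + (step_fun (S k) \<tau> - sqrt (\<zeta> \<tau>) * indicator {0<..s} \<tau>)"
          unfolding U_def step_append step_neg by linarith
      qed
      also have "\<dots> \<le> 3 * (g n + (\<integral>\<^sup>+\<tau>. ennreal ((sqrt (\<zeta> \<tau>) * indicator {0<..t} \<tau> - step_fun (T k) \<tau>)\<^sup>2) \<partial>lborel)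
          + (\<integral>\<^sup>+\<tau>. ennreal ((step_fun (S k) \<tau> - sqrt (\<zeta> \<tau>) * indicator {0<..s} \<tau>)\<^sup>2) \<partial>lborel))"
        unfolding g_def by (intro nn_three_squares borel_measurable_diff m) auto
      also have "(\<integral>\<^sup>+\<tau>. ennreal ((sqrt (\<zeta> \<tau>) * indicator {0<..t} \<tau> - step_fun (T k) \<tau>)\<^sup>2) \<partial>lborel)
          = (\<integral>\<^sup>+\<tau>. ennreal ((step_fun (T k) \<tau> - sqrt (\<zeta> \<tau>) * indicator {0<..t} \<tau>)\<^sup>2) \<partial>lborel)"
        by (simp only: power2_commute)
      finally have "(\<integral>\<^sup>+w. ennreal ((step_integral B U w)\<^sup>2) \<partial>M) \<le> 3 * (g n + (\<integral>\<^sup>+\<tau>. ennreal ((step_fun (T k) \<tau> - sqrt (\<zeta> \<tau>) * indicator {0<..t} \<tau>)\<^sup>2) \<partial>lborel)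
              + (\<integral>\<^sup>+\<tau>. ennreal ((step_fun (S k) \<tau> - sqrt (\<zeta> \<tau>) * indicator {0<..s} \<tau>)\<^sup>2) \<partial>lborel))" .
      then show ?thesis
        by (intro order_trans[OF A] mult_left_mono add_right_mono) auto
    qed
    have "(\<lambda>k. 3 * ((3 * (g n + (\<integral>\<^sup>+\<tau>. ennreal ((step_fun (T k) \<tau> - sqrt (\<zeta> \<tau>) * indicator {0<..t} \<tau>)\<^sup>2) \<partial>lborel)
              + (\<integral>\<^sup>+\<tau>. ennreal ((step_fun (S k) \<tau> - sqrt (\<zeta> \<tau>) * indicator {0<..s} \<tau>)\<^sup>2) \<partial>lborel)))
         + (\<integral>\<^sup>+w. ennreal ((step_integral B (T k) w - Jt w)\<^sup>2) \<partial>M)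
         + (\<integral>\<^sup>+w. ennreal ((step_integral B (S k) w - Js w)\<^sup>2) \<partial>M))) \<longlonglongrightarrow> 3 * ((3 * (g n + 0 + 0)) + 0 + 0)"
      by (intro ennreal_tendsto_cmult tendsto_add S(3,4) T(3,4) tendsto_const) auto
    then have "(\<integral>\<^sup>+w. ennreal ((step_integral B (G n) w - (Jt w - Js w))\<^sup>2) \<partial>M) \<le> 3 * ((3 * (g n + 0 + 0)) + 0 + 0)"
      by (rule LIMSEQ_le_const) (use 1 in blast)
    then show ?thesis by simp
  qed
  have "(\<lambda>n. 3 * (3 * g n)) \<longlonglongrightarrow> 3 * (3 * 0)"
    unfolding g_def G_def by (intro ennreal_tendsto_cmult mesh_fun_close st) auto
  then have g0: "(\<lambda>n. 3 * (3 * g n)) \<longlonglongrightarrow> 0" by simp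
  show ?thesis
    unfolding Gi[symmetric] by (rule tendsto_sandwich[OF _ _ tendsto_const g0]) (use bound in \<open>auto intro: always_eventually\<close>)
qed

text \<open>The mesh has the exact variance, so the grid integrals have the right conditional
  moments for every n; the limits are limits of constant sequences.\<close>

lemma J_increment:
  assumes J: "is_J s Js" "is_J t Jt" and st: "0 \<le> s" "s < t" "t \<le> 1"
  shows "integrable M (\<lambda>w. (Jt w - Js w) ^ 4)" "(\<integral>w. (Jt w - Js w) ^ 4 \<partial>M) \<le> 3 * (\<rho> t - \<rho> s)\<^sup>2"
    "\<And>Y b. Y \<in> borel_measurable (F s) \<Longrightarrow> (\<And>w. \<bar>Y w\<bar> \<le> b) \<Longrightarrow> (\<integral>w. Y w * (Jt w - Js w) \<partial>M) = 0"
    "\<And>Y b. Y \<in> borel_measurable (F s) \<Longrightarrow> (\<And>w. \<bar>Y w\<bar> \<le> b) \<Longrightarrow> (\<integral>w. Y w * (Jt w - Js w)\<^sup>2 \<partial>M) = (\<integral>w. Y w \<partial>M) * (\<rho> t - \<rho> s)"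
proof -
  define Q where "Q n = grid_int (mesh_coef s t n) (mesh_pt s t n) (Suc n)" for n
  have p: "0 \<le> mesh_pt s t n 0" "\<And>j. mesh_pt s t n j \<le> mesh_pt s t n (Suc j)" for n
    using st mesh_pt_mono[of s t n] by (auto simp: mesh_pt_simps)
  note G = grid_moments[where p="mesh_pt s t n" and c="mesh_coef s t n" and k="Suc n" for n, OF p, folded Q_def, unfolded mesh_pt_simps mesh_var[OF st]]
  have meas: "(\<lambda>w. Jt w - Js w) \<in> borel_measurable M"
    using J unfolding is_stochastic_integral_def by (intro borel_measurable_diff) blast+
  have Qm: "Q n \<in> borel_measurable M" for n by (rule F_measurable_M[of t]) (use G[of n] st in auto)
  have Q4: "integrable M (\<lambda>w. (Q n w) ^ 4)" "(\<integral>w. (Q n w) ^ 4 \<partial>M) \<le> 3 * (\<rho> t - \<rho> s)\<^sup>2" for n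
    using G[of n] by auto
  have lim: "(\<lambda>n. \<integral>\<^sup>+w. ennreal ((Q n w - (Jt w - Js w))\<^sup>2) \<partial>M) \<longlonglongrightarrow> 0"
    unfolding Q_def by (rule J_increment_approx[OF J st])
  note L2 = L2_limit_moments[OF Qm meas Q4 lim]
  show "integrable M (\<lambda>w. (Jt w - Js w) ^ 4)" "(\<integral>w. (Jt w - Js w) ^ 4 \<partial>M) \<le> 3 * (\<rho> t - \<rho> s)\<^sup>2"
    by (rule L2(1), rule L2(2))
  fix Y and b :: real assume Y: "Y \<in> borel_measurable (F s)" "\<And>w. \<bar>Y w\<bar> \<le> b"
  have YM: "Y \<in> borel_measurable M" by (rule F_measurable_M[OF st(1) Y(1)])
  have GY: "(\<integral>w. Y w * Q n w \<partial>M) = 0" "(\<integral>w. Y w * (Q n w)\<^sup>2 \<partial>M) = (\<integral>w. Y w \<partial>M) * (\<rho> t - \<rho> s)" for n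
    using G[of n] Y by blast+
  show "(\<integral>w. Y w * (Jt w - Js w) \<partial>M) = 0"
    using L2(3)[OF YM Y(2)] unfolding GY by (rule LIMSEQ_unique[OF _ tendsto_const])
  show "(\<integral>w. Y w * (Jt w - Js w)\<^sup>2 \<partial>M) = (\<integral>w. Y w \<partial>M) * (\<rho> t - \<rho> s)"
    using L2(4)[OF YM Y(2)] unfolding GY by (rule LIMSEQ_unique[OF _ tendsto_const])
qed

end

subsection \<open>The stochastic differential equation\<close>

locale parisi_sde = wiener_pde M F B \<xi> K
  for M :: "'a measure" and F and B :: "real \<Rightarrow> 'a \<Rightarrow> real" and \<xi> K +
  fixes \<mu> :: "real measure" and h :: real and X :: "real \<Rightarrow> 'a \<Rightarrow> real"
  assumes mu: "\<mu> \<in> prob_measures_01" and sde: "solves_parisi_sde M F B \<xi> h \<mu> X"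
begin

abbreviation "u \<equiv> dx_Phi \<xi> \<mu>"

lemma X_adapted: "0 \<le> s \<Longrightarrow> s \<le> 1 \<Longrightarrow> X s \<in> borel_measurable (F s)"
  using sde unfolding solves_parisi_sde_def by simp

lemma X_measurable: "0 \<le> s \<Longrightarrow> s \<le> 1 \<Longrightarrow> X s \<in> borel_measurable M"
  by (rule F_measurable_M[OF _ X_adapted])

lemma X_continuous: "AE w in M. continuous_on {0..1} (\<lambda>s. X s w)"
  using sde unfolding solves_parisi_sde_def by simp

lemma dx_Phi_bound: "\<nu> \<in> prob_measures_01 \<Longrightarrow> 0 \<le> s \<Longrightarrow> s \<le> 1 \<Longrightarrow> \<bar>dx_Phi \<xi> \<nu> s x\<bar> \<le> 1"
  using smooth2_bounds(1)[OF Phi_smooth2] .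

lemma dx_Phi_lip: "\<nu> \<in> prob_measures_01 \<Longrightarrow> 0 \<le> s \<Longrightarrow> s \<le> 1 \<Longrightarrow> \<bar>dx_Phi \<xi> \<nu> s x - dx_Phi \<xi> \<nu> s y\<bar> \<le> \<bar>x - y\<bar>"
  using smooth2_lip(2)[OF Phi_smooth2] .

lemma dx_Phi_measurable: "\<nu> \<in> prob_measures_01 \<Longrightarrow> 0 \<le> s \<Longrightarrow> s \<le> 1 \<Longrightarrow> dx_Phi \<xi> \<nu> s \<in> borel_measurable borel"
  using deriv_imp_measurable[OF smooth2D(2)[OF Phi_smooth2]] .

lemma Phi_measurable: "\<nu> \<in> prob_measures_01 \<Longrightarrow> 0 \<le> s \<Longrightarrow> s \<le> 1 \<Longrightarrow> Phi \<xi> \<nu> s \<in> borel_measurable borel"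
  using deriv_imp_measurable[OF smooth2D(1)[OF Phi_smooth2]] .

lemma dxx_Phi_measurable: "\<nu> \<in> prob_measures_01 \<Longrightarrow> 0 \<le> s \<Longrightarrow> s \<le> 1 \<Longrightarrow> dxx_Phi \<xi> \<nu> s \<in> borel_measurable borel"
  using derivative_borel_measurable[OF smooth2D(2)[OF Phi_smooth2]] .

lemma dx_Phi_joint:
  "\<exists>C\<ge>0. \<forall>\<nu> s t x y. \<nu> \<in> prob_measures_01 \<and> s \<in> {0..1} \<and> t \<in> {0..1} \<longrightarrow>
    \<bar>dx_Phi \<xi> \<nu> s x - dx_Phi \<xi> \<nu> t y\<bar> \<le> C * (root 3 \<bar>s - t\<bar>)\<^sup>2 + \<bar>x - y\<bar>"
proof -
  obtain C where C: "0 \<le> C" "\<And>\<nu> s t x. \<nu> \<in> prob_measures_01 \<Longrightarrow> 0 \<le> s \<Longrightarrow> s \<le> t \<Longrightarrow> t \<le> 1 \<Longrightarrow>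
      \<bar>dx_Phi \<xi> \<nu> s x - dx_Phi \<xi> \<nu> t x\<bar> \<le> C * (root 3 (t - s))\<^sup>2"
    using Phi_time_bounds by blast
  have "\<bar>dx_Phi \<xi> \<nu> s x - dx_Phi \<xi> \<nu> t y\<bar> \<le> C * (root 3 \<bar>s - t\<bar>)\<^sup>2 + \<bar>x - y\<bar>"
    if "\<nu> \<in> prob_measures_01" "s \<in> {0..1}" "t \<in> {0..1}" for \<nu> s t x y
  proof -
    have "\<bar>dx_Phi \<xi> \<nu> s x - dx_Phi \<xi> \<nu> t x\<bar> \<le> C * (root 3 \<bar>s - t\<bar>)\<^sup>2"
    proof (cases "s \<le> t")
      case True
      then show ?thesis using C(2)[OF that(1), of s t x] that by simp
    next
      case False
      then show ?thesis using C(2)[OF that(1), of t s x] that by (simp add: abs_minus_commute)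
    qed
    moreover have "\<bar>dx_Phi \<xi> \<nu> t x - dx_Phi \<xi> \<nu> t y\<bar> \<le> \<bar>x - y\<bar>" using dx_Phi_lip that by simp
    ultimately show ?thesis by linarith
  qed
  then show ?thesis using C(1) by blast
qed

lemma dx_Phi_path_continuous:
  assumes nu: "\<nu> \<in> prob_measures_01" and c: "continuous_on {0..1} Y"
  shows "continuous_on {0..1} (\<lambda>\<tau>. dx_Phi \<xi> \<nu> \<tau> (Y \<tau>))"
  unfolding continuous_on_def
proof
  fix \<tau> :: real assume \<tau>: "\<tau> \<in> {0..1}"
  obtain C where C: "\<And>s t x y. s \<in> {0..1} \<Longrightarrow> t \<in> {0..1} \<Longrightarrow>
    \<bar>dx_Phi \<xi> \<nu> s x - dx_Phi \<xi> \<nu> t y\<bar> \<le> C * (root 3 \<bar>s - t\<bar>)\<^sup>2 + \<bar>x - y\<bar>"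
    using dx_Phi_joint nu by blast
  have Y: "(Y \<longlongrightarrow> Y \<tau>) (at \<tau> within {0..1})" using c \<tau> unfolding continuous_on_def by blast
  have "((\<lambda>v. C * (root 3 \<bar>v - \<tau>\<bar>)\<^sup>2 + \<bar>Y v - Y \<tau>\<bar>) \<longlongrightarrow> C * (root 3 \<bar>\<tau> - \<tau>\<bar>)\<^sup>2 + \<bar>Y \<tau> - Y \<tau>\<bar>) (at \<tau> within {0..1})"
    by (intro tendsto_intros Y)
  then have "((\<lambda>v. C * (root 3 \<bar>v - \<tau>\<bar>)\<^sup>2 + \<bar>Y v - Y \<tau>\<bar>) \<longlongrightarrow> 0) (at \<tau> within {0..1})" by simp
  moreover have "\<forall>\<^sub>F v in at \<tau> within {0..1}. norm (dx_Phi \<xi> \<nu> v (Y v) - dx_Phi \<xi> \<nu> \<tau> (Y \<tau>)) \<le> C * (root 3 \<bar>v - \<tau>\<bar>)\<^sup>2 + \<bar>Y v - Y \<tau>\<bar>"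
    unfolding eventually_at using C \<tau> by (intro exI[of _ 1]) auto
  ultimately have "((\<lambda>v. dx_Phi \<xi> \<nu> v (Y v) - dx_Phi \<xi> \<nu> \<tau> (Y \<tau>)) \<longlongrightarrow> 0) (at \<tau> within {0..1})"
    by (rule Lim_null_comparison[rotated])
  then show "((\<lambda>v. dx_Phi \<xi> \<nu> v (Y v)) \<longlongrightarrow> dx_Phi \<xi> \<nu> \<tau> (Y \<tau>)) (at \<tau> within {0..1})"
    by (simp only: Lim_null[symmetric])
qed

text \<open>Tonelli's theorem needs a process that is jointly measurable in time and path. Step
  interpolations on the grid are jointly measurable, and on continuous paths they converge to
  X.\<close>

lemma joint_version:
  obtains Z where "Z \<in> borel_measurable (lborel \<Otimes>\<^sub>M M)" "AE w in M. \<forall>\<tau>\<in>{0..1}. Z (\<tau>, w) = X \<tau> w"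
proof -
  \<comment> \<open>The index k = n + 1 is included so that the time 1 is covered.\<close>
  define Zn where "Zn n p = (\<Sum>k\<le>Suc n. indicator {\<tau>. \<lfloor>real (Suc n) * \<tau>\<rfloor> = int k} (fst p) * X (real k / real (Suc n)) (snd p))" for n and p :: "real \<times> 'a"
  define Z where "Z p = lim (\<lambda>n. Zn n p)" for p
  have Xm: "X (real k / real (Suc n)) \<in> borel_measurable M" if "k \<le> Suc n" for k n
    using that by (intro X_measurable) (auto simp: divide_le_eq)
  have "Zn n \<in> borel_measurable (lborel \<Otimes>\<^sub>M M)" for n
    unfolding Zn_def
  proof (intro borel_measurable_sum borel_measurable_times)
    fix k assume "k \<in> {..Suc n}"
    then have [measurable]: "X (real k / real (Suc n)) \<in> borel_measurable M" using Xm by simp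
    show "(\<lambda>p. X (real k / real (Suc n)) (snd p)) \<in> borel_measurable (lborel \<Otimes>\<^sub>M M)" by measurable
    have [measurable]: "{\<tau>. \<lfloor>real (Suc n) * \<tau>\<rfloor> = int k} \<in> sets lborel" by measurable
    show "(\<lambda>p. indicator {\<tau>. \<lfloor>real (Suc n) * \<tau>\<rfloor> = int k} (fst p)) \<in> borel_measurable (lborel \<Otimes>\<^sub>M M)" by measurable
  qed
  then have 1: "Z \<in> borel_measurable (lborel \<Otimes>\<^sub>M M)"
    unfolding Z_def by (rule borel_measurable_lim_metric)
  have 2: "AE w in M. \<forall>\<tau>\<in>{0..1}. Z (\<tau>, w) = X \<tau> w"
    using X_continuous
  proof eventually_elim
    fix w assume c: "continuous_on {0..1} (\<lambda>s. X s w)"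
    show "\<forall>\<tau>\<in>{0..1}. Z (\<tau>, w) = X \<tau> w"
    proof
      fix \<tau> :: real assume \<tau>: "\<tau> \<in> {0..1}"
      define q where "q n = real_of_int \<lfloor>real (Suc n) * \<tau>\<rfloor> / real (Suc n)" for n
      have fl: "0 \<le> \<lfloor>real (Suc n) * \<tau>\<rfloor>" "\<lfloor>real (Suc n) * \<tau>\<rfloor> \<le> int (Suc n)" for n
      proof -
        show "0 \<le> \<lfloor>real (Suc n) * \<tau>\<rfloor>" using \<tau> by simp
        have "real (Suc n) * \<tau> \<le> real (Suc n) * 1" using \<tau> by (intro mult_left_mono) auto
        then have "\<lfloor>real (Suc n) * \<tau>\<rfloor> \<le> \<lfloor>real (Suc n)\<rfloor>" by (intro floor_mono) simp
        then show "\<lfloor>real (Suc n) * \<tau>\<rfloor> \<le> int (Suc n)" by (simp only: floor_of_nat)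
      qed
      have Zq: "Zn n (\<tau>, w) = X (q n) w" for n
      proof -
        let ?k = "nat \<lfloor>real (Suc n) * \<tau>\<rfloor>"
        have k: "?k \<le> Suc n" "\<lfloor>real (Suc n) * \<tau>\<rfloor> = int ?k" using fl[of n] by auto
        have "Zn n (\<tau>, w) = (\<Sum>k\<in>{?k}. indicator {\<tau>. \<lfloor>real (Suc n) * \<tau>\<rfloor> = int k} \<tau> * X (real k / real (Suc n)) w)"
          unfolding Zn_def fst_conv snd_conv
          by (rule sum.mono_neutral_right) (use k in \<open>auto simp: indicator_def simp del: of_nat_Suc\<close>)
        also have "\<dots> = X (real ?k / real (Suc n)) w" using k(2) by (simp del: of_nat_Suc int_nat_eq)
        also have "real ?k = real_of_int \<lfloor>real (Suc n) * \<tau>\<rfloor>" using fl(1)[of n] by (rule of_nat_nat)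
        also have "X (real_of_int \<lfloor>real (Suc n) * \<tau>\<rfloor> / real (Suc n)) w = X (q n) w" by (simp only: q_def)
        finally show ?thesis .
      qed
      have q01: "q n \<in> {0..1}" for n
        using fl[of n] unfolding q_def by (auto simp: divide_le_eq simp del: of_nat_Suc)
      have "q \<longlonglongrightarrow> \<tau>"
      proof (rule Lim_null[THEN iffD2], rule Lim_null_comparison)
        show "(\<lambda>n. inverse (real (Suc n))) \<longlonglongrightarrow> 0" by (rule LIMSEQ_inverse_real_of_nat)
        have "norm (q n - \<tau>) \<le> inverse (real (Suc n))" for n
        proof -
          have "q n - \<tau> = (real_of_int \<lfloor>real (Suc n) * \<tau>\<rfloor> - real (Suc n) * \<tau>) / real (Suc n)"
            by (simp add: q_def diff_divide_distrib del: of_nat_Suc)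
          moreover have "\<bar>real_of_int \<lfloor>real (Suc n) * \<tau>\<rfloor> - real (Suc n) * \<tau>\<bar> \<le> 1" by linarith
          ultimately show ?thesis by (simp add: abs_divide divide_right_mono inverse_eq_divide del: of_nat_Suc)
        qed
        then show "\<forall>\<^sub>F n in sequentially. norm (q n - \<tau>) \<le> inverse (real (Suc n))" by (rule always_eventually[OF allI])
      qed
      then have "(\<lambda>n. X (q n) w) \<longlonglongrightarrow> X \<tau> w"
        using continuous_on_tendsto_compose[OF c, of q \<tau> sequentially] \<tau> q01 by simp
      then show "Z (\<tau>, w) = X \<tau> w" unfolding Z_def Zq by (rule limI)
    qed
  qed
  show thesis by (rule that[OF 1 2])
qed

text \<open>With a an upper bound for the standard deviation, |x| \<le> (a + x^2 / a) / 2;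
  multiplied by x^2, this bounds |x|^3 by the second and fourth moments.\<close>

lemma moment_bounds:
  fixes \<Delta> :: "'a \<Rightarrow> real"
  assumes "\<Delta> \<in> borel_measurable M" "integrable M (\<lambda>w. (\<Delta> w) ^ 4)" "(\<integral>w. (\<Delta> w) ^ 4 \<partial>M) \<le> 3 * v\<^sup>2" "(\<integral>w. (\<Delta> w)\<^sup>2 \<partial>M) = v"
    "v \<le> a\<^sup>2" "0 < a"
  shows "integrable M (\<lambda>w. \<bar>\<Delta> w\<bar>)" "(\<integral>w. \<bar>\<Delta> w\<bar> \<partial>M) \<le> a" "integrable M (\<lambda>w. \<bar>\<Delta> w\<bar> ^ 3)" "(\<integral>w. \<bar>\<Delta> w\<bar> ^ 3 \<partial>M) \<le> 2 * a ^ 3"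
proof -
  have i1: "integrable M \<Delta>" and i2: "integrable M (\<lambda>w. (\<Delta> w)\<^sup>2)" and i3: "integrable M (\<lambda>w. (\<Delta> w) ^ 3)"
    using integrable_power_le[OF assms(1,2), of 1] integrable_power_le[OF assms(1,2), of 2] integrable_power_le[OF assms(1,2), of 3] by simp_all
  show j1: "integrable M (\<lambda>w. \<bar>\<Delta> w\<bar>)" and j3: "integrable M (\<lambda>w. \<bar>\<Delta> w\<bar> ^ 3)"
    using integrable_abs[OF i1] integrable_abs[OF i3] by (simp_all add: power_abs)
  have v0: "0 \<le> v" unfolding assms(4)[symmetric] by simp
  have b1: "\<bar>x\<bar> \<le> (a + x\<^sup>2 / a) / 2" for x
  proof -
    have "0 \<le> (a - \<bar>x\<bar>)\<^sup>2" by simp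
    then have "a * (2 * \<bar>x\<bar>) \<le> a * (a + x\<^sup>2 / a)" using assms(6) by (simp add: power2_eq_square algebra_simps)
    then show ?thesis using assms(6) by simp
  qed
  have "(\<integral>w. \<bar>\<Delta> w\<bar> \<partial>M) \<le> (\<integral>w. (a + (\<Delta> w)\<^sup>2 / a) / 2 \<partial>M)"
    using b1 i2 j1 by (intro integral_mono) auto
  also have "\<dots> = (a + v / a) / 2" using i2 assms(4) prob_space by simp
  also have "\<dots> \<le> a" using assms(5,6) by (simp add: divide_le_eq power2_eq_square)
  finally show "(\<integral>w. \<bar>\<Delta> w\<bar> \<partial>M) \<le> a" .
  have b3: "\<bar>x\<bar> ^ 3 \<le> (a * x\<^sup>2 + x ^ 4 / a) / 2" for x
  proof -
    have "\<bar>x\<bar> ^ 3 = x\<^sup>2 * \<bar>x\<bar>" by (simp add: power3_eq_cube power2_eq_square)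
    also have "\<dots> \<le> x\<^sup>2 * ((a + x\<^sup>2 / a) / 2)" by (intro mult_left_mono b1) auto
    also have "\<dots> = (a * x\<^sup>2 + x ^ 4 / a) / 2" by (simp add: power2_eq_square power4_eq_xxxx algebra_simps)
    finally show ?thesis .
  qed
  have "(\<integral>w. \<bar>\<Delta> w\<bar> ^ 3 \<partial>M) \<le> (\<integral>w. (a * (\<Delta> w)\<^sup>2 + (\<Delta> w) ^ 4 / a) / 2 \<partial>M)"
    using b3 i2 j3 assms(2) by (intro integral_mono) auto
  also have "\<dots> = (a * v + (\<integral>w. (\<Delta> w) ^ 4 \<partial>M) / a) / 2" using i2 assms(2,4) by simp
  also have "\<dots> \<le> (a * a\<^sup>2 + (3 * (a\<^sup>2)\<^sup>2) / a) / 2"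
  proof -
    have "v\<^sup>2 \<le> (a\<^sup>2)\<^sup>2" using assms(5) v0 by (intro power_mono) auto
    then have "(\<integral>w. (\<Delta> w) ^ 4 \<partial>M) \<le> 3 * (a\<^sup>2)\<^sup>2" using assms(3) by linarith
    then have "(\<integral>w. (\<Delta> w) ^ 4 \<partial>M) / a \<le> (3 * (a\<^sup>2)\<^sup>2) / a" using assms(6) by (intro divide_right_mono) auto
    moreover have "a * v \<le> a * a\<^sup>2" using assms(5,6) by (intro mult_left_mono) auto
    ultimately have "a * v + (\<integral>w. (\<Delta> w) ^ 4 \<partial>M) / a \<le> a * a\<^sup>2 + (3 * (a\<^sup>2)\<^sup>2) / a" by (rule add_mono[rotated])
    then show ?thesis by (rule divide_right_mono) simp
  qed
  also have "\<dots> = 2 * a ^ 3" using assms(6) by (simp add: power2_eq_square power3_eq_cube)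
  finally show "(\<integral>w. \<bar>\<Delta> w\<bar> ^ 3 \<partial>M) \<le> 2 * a ^ 3" .
qed

definition "Aint \<nu> s t = (LBINT r:{s..t}. alpha \<nu> r * \<zeta> r)"

text \<open>\<open>\<Delta>\<close> stands for the increment of the stochastic integral over \<open>[s,t]\<close>.\<close>

definition noise :: "real \<Rightarrow> real \<Rightarrow> ('a \<Rightarrow> real) \<Rightarrow> bool" where
  "noise s t \<Delta> \<longleftrightarrow> \<Delta> \<in> borel_measurable M \<and> integrable M (\<lambda>w. (\<Delta> w) ^ 4) \<and> (\<integral>w. (\<Delta> w) ^ 4 \<partial>M) \<le> 3 * (\<rho> t - \<rho> s)\<^sup>2 \<and>
    (\<forall>Y b. Y \<in> borel_measurable (F s) \<and> (\<forall>w. \<bar>Y w\<bar> \<le> b) \<longrightarrow>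
      (\<integral>w. Y w * \<Delta> w \<partial>M) = 0 \<and> (\<integral>w. Y w * (\<Delta> w)\<^sup>2 \<partial>M) = (\<integral>w. Y w \<partial>M) * (\<rho> t - \<rho> s))"

lemma noiseD:
  assumes "noise s t \<Delta>"
  shows "\<Delta> \<in> borel_measurable M" "integrable M (\<lambda>w. (\<Delta> w) ^ 4)" "(\<integral>w. (\<Delta> w) ^ 4 \<partial>M) \<le> 3 * (\<rho> t - \<rho> s)\<^sup>2"
    "\<And>Y b. Y \<in> borel_measurable (F s) \<Longrightarrow> (\<And>w. \<bar>Y w\<bar> \<le> b) \<Longrightarrow> (\<integral>w. Y w * \<Delta> w \<partial>M) = 0"
    "\<And>Y b. Y \<in> borel_measurable (F s) \<Longrightarrow> (\<And>w. \<bar>Y w\<bar> \<le> b) \<Longrightarrow> (\<integral>w. Y w * (\<Delta> w)\<^sup>2 \<partial>M) = (\<integral>w. Y w \<partial>M) * (\<rho> t - \<rho> s)"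
  using assms unfolding noise_def by blast+

lemma noise_moments:
  assumes "noise s t \<Delta>" "0 \<le> s" "s < t" "t \<le> 1"
  shows "integrable M (\<lambda>w. \<bar>\<Delta> w\<bar>)" "(\<integral>w. \<bar>\<Delta> w\<bar> \<partial>M) \<le> sqrt (K * (t - s))"
    "integrable M (\<lambda>w. \<bar>\<Delta> w\<bar> ^ 3)" "(\<integral>w. \<bar>\<Delta> w\<bar> ^ 3 \<partial>M) \<le> 2 * sqrt (K * (t - s)) ^ 3"
proof -
  have "(\<integral>w. (\<Delta> w)\<^sup>2 \<partial>M) = \<rho> t - \<rho> s"
    using noiseD(5)[OF assms(1), of "\<lambda>_. 1" 1] prob_space by simp
  moreover have "\<rho> t - \<rho> s \<le> (sqrt (K * (t - s)))\<^sup>2" using rho_diff(2)[of s t] assms K_ge_1 by simp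
  moreover have "0 < sqrt (K * (t - s))" using assms K_ge_1 by simp
  ultimately show "integrable M (\<lambda>w. \<bar>\<Delta> w\<bar>)" "(\<integral>w. \<bar>\<Delta> w\<bar> \<partial>M) \<le> sqrt (K * (t - s))"
    "integrable M (\<lambda>w. \<bar>\<Delta> w\<bar> ^ 3)" "(\<integral>w. \<bar>\<Delta> w\<bar> ^ 3 \<partial>M) \<le> 2 * sqrt (K * (t - s)) ^ 3"
    using moment_bounds[OF noiseD(1-3)[OF assms(1)]] by blast+
qed

lemma X_structure:
  obtains J where "\<And>s. 0 \<le> s \<Longrightarrow> s \<le> 1 \<Longrightarrow> is_J s (J s)"
    "AE w in M. \<forall>s\<in>{0..1}. X s w = h + (LBINT \<tau>:{0..s}. alpha \<mu> \<tau> * \<zeta> \<tau> * u \<tau> (X \<tau> w)) + J s w"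
    "\<And>s t. 0 \<le> s \<Longrightarrow> s < t \<Longrightarrow> t \<le> 1 \<Longrightarrow> noise s t (\<lambda>w. J t w - J s w)"
    "AE w in M. \<forall>s t. 0 \<le> s \<and> s \<le> t \<and> t \<le> 1 \<longrightarrow> X t w - X s w - (J t w - J s w) = (LBINT \<tau>:{s..t}. alpha \<mu> \<tau> * \<zeta> \<tau> * u \<tau> (X \<tau> w))"
proof -
  obtain J where J: "\<forall>s\<in>{0..1}. is_J s (J s)"
    and eq: "AE w in M. \<forall>s\<in>{0..1}. X s w = h + (LBINT \<tau>:{0..s}. alpha \<mu> \<tau> * \<zeta> \<tau> * u \<tau> (X \<tau> w)) + J s w"
    using sde unfolding solves_parisi_sde_def by blast
  have 1: "is_J s (J s)" if "0 \<le> s" "s \<le> 1" for s using J that by simp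
  have 3: "noise s t (\<lambda>w. J t w - J s w)" if st: "0 \<le> s" "s < t" "t \<le> 1" for s t
  proof -
    have Js: "is_J s (J s)" and Jt: "is_J t (J t)" using 1 st by auto
    note I = J_increment[OF Js Jt st]
    have "(\<lambda>w. J t w - J s w) \<in> borel_measurable M"
      using Js Jt unfolding is_stochastic_integral_def by (intro borel_measurable_diff) blast+
    then show ?thesis unfolding noise_def using I by blast
  qed
  have 4: "AE w in M. \<forall>s t. 0 \<le> s \<and> s \<le> t \<and> t \<le> 1 \<longrightarrow> X t w - X s w - (J t w - J s w) = (LBINT \<tau>:{s..t}. alpha \<mu> \<tau> * \<zeta> \<tau> * u \<tau> (X \<tau> w))"
    using eq X_continuous
  proof eventually_elim
    fix w assume a: "\<forall>s\<in>{0..1}. X s w = h + (LBINT \<tau>:{0..s}. alpha \<mu> \<tau> * \<zeta> \<tau> * u \<tau> (X \<tau> w)) + J s w"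
      and c: "continuous_on {0..1} (\<lambda>s. X s w)"
    have bm: "bdd_meas (\<lambda>\<tau>. alpha \<mu> \<tau> * \<zeta> \<tau> * u \<tau> (X \<tau> w))"
      by (intro bdd_meas_mult bdd_meas_alpha_zeta mu bdd_meas_continuous dx_Phi_path_continuous c)
    show "\<forall>s t. 0 \<le> s \<and> s \<le> t \<and> t \<le> 1 \<longrightarrow> X t w - X s w - (J t w - J s w) = (LBINT \<tau>:{s..t}. alpha \<mu> \<tau> * \<zeta> \<tau> * u \<tau> (X \<tau> w))"
    proof (intro allI impI, elim conjE)
      fix s t :: real assume st: "0 \<le> s" "s \<le> t" "t \<le> 1"
      have "X s w = h + (LBINT \<tau>:{0..s}. alpha \<mu> \<tau> * \<zeta> \<tau> * u \<tau> (X \<tau> w)) + J s w" "X t w = h + (LBINT \<tau>:{0..t}. alpha \<mu> \<tau> * \<zeta> \<tau> * u \<tau> (X \<tau> w)) + J t w"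
        using a st by auto
      then show "X t w - X s w - (J t w - J s w) = (LBINT \<tau>:{s..t}. alpha \<mu> \<tau> * \<zeta> \<tau> * u \<tau> (X \<tau> w))"
        using LBINT_split[OF bm, of 0 s t] st by simp
    qed
  qed
  show thesis by (rule that[OF 1 eq 3 4])
qed

lemma drift_bound:
  assumes c: "continuous_on {0..1} (\<lambda>s. X s w)" and st: "0 \<le> s" "s \<le> t" "t \<le> 1"
  shows "\<bar>LBINT \<tau>:{s..t}. alpha \<mu> \<tau> * \<zeta> \<tau> * u \<tau> (X \<tau> w)\<bar> \<le> K * (t - s)"
proof -
  have bm: "bdd_meas (\<lambda>\<tau>. alpha \<mu> \<tau> * \<zeta> \<tau> * u \<tau> (X \<tau> w))"
    by (intro bdd_meas_mult bdd_meas_alpha_zeta mu bdd_meas_continuous dx_Phi_path_continuous c)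
  show ?thesis
  proof (rule LBINT_bound[OF bm st])
    fix \<tau> assume \<tau>: "s \<le> \<tau>" "\<tau> \<le> t"
    have "\<bar>alpha \<mu> \<tau> * \<zeta> \<tau> * u \<tau> (X \<tau> w)\<bar> = alpha \<mu> \<tau> * \<zeta> \<tau> * \<bar>u \<tau> (X \<tau> w)\<bar>"
      using \<tau> st by (simp add: abs_mult alpha_nonneg[OF mu] zeta_nonneg)
    also have "\<dots> \<le> (1 * K) * 1"
      using \<tau> st by (intro mult_mono mult_nonneg_nonneg alpha_nonneg[OF mu] alpha_le_1[OF mu] zeta_le zeta_nonneg dx_Phi_bound[OF mu])
        (use K_ge_1 in auto)
    finally show "\<bar>alpha \<mu> \<tau> * \<zeta> \<tau> * u \<tau> (X \<tau> w)\<bar> \<le> K" by simp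
  qed
qed

text \<open>The drift contributes order t - s and the noise order sqrt (t - s) in mean; K \<ge> 1
  merges the constants.\<close>

lemma X_increment_L1:
  assumes "0 \<le> s" "s \<le> t" "t \<le> 1"
  shows "integrable M (\<lambda>w. \<bar>X t w - X s w\<bar>)" "(\<integral>w. \<bar>X t w - X s w\<bar> \<partial>M) \<le> 2 * K * sqrt (t - s)"
proof -
  have "integrable M (\<lambda>w. \<bar>X t w - X s w\<bar>) \<and> (\<integral>w. \<bar>X t w - X s w\<bar> \<partial>M) \<le> 2 * K * sqrt (t - s)"
  proof (cases "s = t")
    case False
    with assms have st: "0 \<le> s" "s < t" "t \<le> 1" by auto
    obtain J where J: "\<And>s t. 0 \<le> s \<Longrightarrow> s < t \<Longrightarrow> t \<le> 1 \<Longrightarrow> noise s t (\<lambda>w. J t w - J s w)"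
      "AE w in M. \<forall>s t. 0 \<le> s \<and> s \<le> t \<and> t \<le> 1 \<longrightarrow> X t w - X s w - (J t w - J s w) = (LBINT \<tau>:{s..t}. alpha \<mu> \<tau> * \<zeta> \<tau> * u \<tau> (X \<tau> w))"
      by (rule X_structure) (rule that)
    note N = noise_moments[OF J(1)[OF st] st]
    have ae: "AE w in M. \<bar>X t w - X s w\<bar> \<le> K * (t - s) + \<bar>J t w - J s w\<bar>"
      using J(2) X_continuous
    proof eventually_elim
      fix w assume "\<forall>s t. 0 \<le> s \<and> s \<le> t \<and> t \<le> 1 \<longrightarrow> X t w - X s w - (J t w - J s w) = (LBINT \<tau>:{s..t}. alpha \<mu> \<tau> * \<zeta> \<tau> * u \<tau> (X \<tau> w))"
        "continuous_on {0..1} (\<lambda>s. X s w)"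
      then show "\<bar>X t w - X s w\<bar> \<le> K * (t - s) + \<bar>J t w - J s w\<bar>"
        using drift_bound[of w s t] assms by fastforce
    qed
    have [measurable]: "X s \<in> borel_measurable M" "X t \<in> borel_measurable M" using X_measurable assms by auto
    have i: "integrable M (\<lambda>w. K * (t - s) + \<bar>J t w - J s w\<bar>)" using N(1) by simp
    have j: "integrable M (\<lambda>w. \<bar>X t w - X s w\<bar>)"
      by (rule Bochner_Integration.integrable_bound[OF i]) (use ae in \<open>auto elim!: eventually_mono intro: order_trans[OF _ abs_ge_self]\<close>)
    have "(\<integral>w. \<bar>X t w - X s w\<bar> \<partial>M) \<le> (\<integral>w. K * (t - s) + \<bar>J t w - J s w\<bar> \<partial>M)"
      by (rule integral_mono_AE[OF j i ae])
    also have "\<dots> \<le> K * (t - s) + sqrt (K * (t - s))" using N(1,2) prob_space by simp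
    also have "\<dots> \<le> K * sqrt (t - s) + K * sqrt (t - s)"
    proof (rule add_mono)
      have "t - s = sqrt (t - s) * sqrt (t - s)" using st by simp
      also have "\<dots> \<le> sqrt (t - s) * 1" using st by (intro mult_left_mono) auto
      finally show "K * (t - s) \<le> K * sqrt (t - s)" using K_ge_1 by (intro mult_left_mono) auto
      have "sqrt K \<le> K" using K_ge_1 by (simp add: sqrt_le_D real_sqrt_le_iff' real_le_lsqrt power2_eq_square)
      then show "sqrt (K * (t - s)) \<le> K * sqrt (t - s)" using st by (simp add: real_sqrt_mult mult_right_mono)
    qed
    finally show ?thesis using j by simp
  qed simp
  then show "integrable M (\<lambda>w. \<bar>X t w - X s w\<bar>)" "(\<integral>w. \<bar>X t w - X s w\<bar> \<partial>M) \<le> 2 * K * sqrt (t - s)" by auto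
qed

text \<open>The pathwise integral is replaced by H, whose measurability comes from the jointly
  measurable version of X. Tonelli's theorem and the L1 bound for increments give its mean.\<close>

lemma path_error:
  assumes st: "0 \<le> s" "s < t" "t \<le> 1"
  obtains H where "integrable M H" "\<And>w. 0 \<le> H w" "(\<integral>w. H w \<partial>M) \<le> 2 * K * ((t - s) * sqrt (t - s))"
    "AE w in M. (LBINT \<tau>:{s..t}. \<bar>X \<tau> w - X s w\<bar>) = H w"
proof -
  obtain Z where Z [measurable]: "Z \<in> borel_measurable (lborel \<Otimes>\<^sub>M M)" and ZX: "AE w in M. \<forall>\<tau>\<in>{0..1}. Z (\<tau>, w) = X \<tau> w"
    using joint_version .
  have [measurable]: "X s \<in> borel_measurable M" using X_measurable st by auto
  define G where "G \<tau> w = indicator {s..t} \<tau> * \<bar>Z (\<tau>, w) - X s w\<bar>" for \<tau> w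
  define H where "H w = (\<integral>\<tau>. G \<tau> w \<partial>lborel)" for w
  interpret P: pair_sigma_finite lborel M ..
  have Gm [measurable]: "(\<lambda>p. G (fst p) (snd p)) \<in> borel_measurable (lborel \<Otimes>\<^sub>M M)"
    unfolding G_def by measurable
  have Gm2: "(\<lambda>(w, \<tau>). G \<tau> w) \<in> borel_measurable (M \<Otimes>\<^sub>M lborel)"
    unfolding G_def by measurable
  have Hm: "H \<in> borel_measurable M" unfolding H_def
    using lborel.borel_measurable_lebesgue_integral[OF Gm2] by simp
  have H0: "0 \<le> H w" for w unfolding H_def G_def by (rule integral_nonneg_AE) auto
  have G0: "0 \<le> G \<tau> w" for \<tau> w unfolding G_def by simp
  have "(\<integral>\<^sup>+w. ennreal (H w) \<partial>M) \<le> (\<integral>\<^sup>+w. (\<integral>\<^sup>+\<tau>. ennreal (G \<tau> w) \<partial>lborel) \<partial>M)"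
  proof (rule nn_integral_mono)
    fix w assume \<tau>: "w \<in> space M"
    show "ennreal (H w) \<le> (\<integral>\<^sup>+\<tau>. ennreal (G \<tau> w) \<partial>lborel)"
    proof (cases "integrable lborel (\<lambda>\<tau>. G \<tau> w)")
      case True
      then show ?thesis unfolding H_def using G0 by (subst nn_integral_eq_integral) auto
    next
      case False
      then show ?thesis unfolding H_def by (simp add: not_integrable_integral_eq)
    qed
  qed
  also have "\<dots> = (\<integral>\<^sup>+\<tau>. (\<integral>\<^sup>+w. ennreal (G \<tau> w) \<partial>M) \<partial>lborel)"
    by (rule P.Fubini'[of "\<lambda>\<tau> w. ennreal (G \<tau> w)"]) (simp add: case_prod_unfold)
  also have "\<dots> \<le> (\<integral>\<^sup>+\<tau>. ennreal (2 * K * sqrt (t - s)) * indicator {s..t} \<tau> \<partial>lborel)"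
  proof (rule nn_integral_mono)
    fix \<tau>
    show "(\<integral>\<^sup>+w. ennreal (G \<tau> w) \<partial>M) \<le> ennreal (2 * K * sqrt (t - s)) * indicator {s..t} \<tau>"
    proof (cases "\<tau> \<in> {s..t}")
      case True
      then have \<tau>: "s \<le> \<tau>" "\<tau> \<le> 1" "\<tau> \<in> {0..1}" "\<tau> \<le> t" using st by auto
      have "(\<integral>\<^sup>+w. ennreal (G \<tau> w) \<partial>M) = (\<integral>\<^sup>+w. ennreal \<bar>X \<tau> w - X s w\<bar> \<partial>M)"
      proof (rule nn_integral_cong_AE)
        show "AE w in M. ennreal (G \<tau> w) = ennreal \<bar>X \<tau> w - X s w\<bar>"
          using ZX by eventually_elim (use True \<tau> in \<open>simp add: G_def\<close>)
      qed
      also have "\<dots> = ennreal (\<integral>w. \<bar>X \<tau> w - X s w\<bar> \<partial>M)"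
        using X_increment_L1(1)[OF st(1) \<tau>(1,2)] by (intro nn_integral_eq_integral) auto
      also have "\<dots> \<le> ennreal (2 * K * sqrt (t - s))"
      proof (rule ennreal_leI)
        have "sqrt (\<tau> - s) \<le> sqrt (t - s)" using \<tau> by simp
        then have "2 * K * sqrt (\<tau> - s) \<le> 2 * K * sqrt (t - s)" using K_ge_1 by (intro mult_left_mono) auto
        then show "(\<integral>w. \<bar>X \<tau> w - X s w\<bar> \<partial>M) \<le> 2 * K * sqrt (t - s)"
          using X_increment_L1(2)[OF st(1) \<tau>(1,2)] by linarith
      qed
      finally show ?thesis using True by simp
    qed (simp add: G_def)
  qed
  also have "\<dots> = ennreal (2 * K * sqrt (t - s)) * ennreal (t - s)"
    using st by (subst nn_integral_cmult_indicator) auto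
  also have "\<dots> = ennreal (2 * K * ((t - s) * sqrt (t - s)))"
    using st K_ge_1 by (simp add: mult_ac flip: ennreal_mult)
  finally have HH: "(\<integral>\<^sup>+w. ennreal (H w) \<partial>M) \<le> ennreal (2 * K * ((t - s) * sqrt (t - s)))" .
  have Hi: "integrable M H"
    by (rule integrableI_bounded[OF Hm]) (use HH H0 in \<open>auto intro: le_less_trans\<close>)
  have "ennreal (\<integral>w. H w \<partial>M) \<le> ennreal (2 * K * ((t - s) * sqrt (t - s)))"
    using HH nn_integral_eq_integral[OF Hi] H0 by simp
  moreover have "0 \<le> 2 * K * ((t - s) * sqrt (t - s))" using st K_ge_1 by simp
  ultimately have Hb: "(\<integral>w. H w \<partial>M) \<le> 2 * K * ((t - s) * sqrt (t - s))"
    by (simp add: ennreal_le_iff)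
  have ae: "AE w in M. (LBINT \<tau>:{s..t}. \<bar>X \<tau> w - X s w\<bar>) = H w"
    using ZX
  proof eventually_elim
    fix w assume a: "\<forall>\<tau>\<in>{0..1}. Z (\<tau>, w) = X \<tau> w"
    show "(LBINT \<tau>:{s..t}. \<bar>X \<tau> w - X s w\<bar>) = H w"
      unfolding H_def set_lebesgue_integral_def
      by (intro Bochner_Integration.integral_cong) (use a st in \<open>auto simp: G_def indicator_def\<close>)
  qed
  show thesis by (rule that[OF Hi H0 Hb ae])
qed

end

subsection \<open>Ito's formula for expectations\<close>

lemma cube_sum: "\<bar>a + b\<bar> ^ 3 \<le> 4 * (\<bar>a\<bar> ^ 3 + \<bar>b\<bar> ^ 3)" for a b :: real
proof -
  have "\<bar>a + b\<bar> ^ 3 \<le> (\<bar>a\<bar> + \<bar>b\<bar>) ^ 3" by (intro power_mono abs_triangle_ineq) auto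
  also have "\<dots> \<le> 4 * (\<bar>a\<bar> ^ 3 + \<bar>b\<bar> ^ 3)"
  proof -
    have "4 * (x ^ 3 + y ^ 3) - (x + y) ^ 3 = 3 * (x + y) * (x - y)\<^sup>2" for x y :: real
      by (simp add: power3_eq_cube power2_eq_square algebra_simps)
    moreover have "0 \<le> 3 * (\<bar>a\<bar> + \<bar>b\<bar>) * (\<bar>a\<bar> - \<bar>b\<bar>)\<^sup>2" by simp
    ultimately show ?thesis by (metis diff_ge_0_iff_ge)
  qed
  finally show ?thesis .
qed

lemma four_term_bound:
  fixes a1 a2 z1 z2 r1 r2 r3 :: real
  assumes "\<bar>a1\<bar> \<le> r1" "\<bar>a2\<bar> \<le> r2" "\<bar>z1\<bar> \<le> r3" "\<bar>z2\<bar> \<le> 2 * r3"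
  shows "\<bar>a1 - a2 + z1 - z2 / 2\<bar> \<le> r1 + (r2 + 2 * r3)"
  using assms by linarith

lemma hoelder_continuous:
  fixes k :: "real \<Rightarrow> real"
  assumes "\<And>s t. 0 \<le> s \<Longrightarrow> s < t \<Longrightarrow> t \<le> 1 \<Longrightarrow> \<bar>k t - k s\<bar> \<le> C * root 3 (t - s)"
  shows "continuous_on {0..1} k"
  unfolding continuous_on_def
proof
  fix \<tau> :: real assume \<tau>: "\<tau> \<in> {0..1}"
  have b: "\<bar>k v - k \<tau>\<bar> \<le> C * root 3 \<bar>v - \<tau>\<bar>" if "v \<in> {0..1}" for v
  proof (cases v \<tau> rule: linorder_cases)
    case less
    then show ?thesis using assms[of v \<tau>] that \<tau> by (simp add: abs_minus_commute)
  next
    case greater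
    then show ?thesis using assms[of \<tau> v] that \<tau> by simp
  qed simp
  have "((\<lambda>v. C * root 3 \<bar>v - \<tau>\<bar>) \<longlongrightarrow> C * root 3 \<bar>\<tau> - \<tau>\<bar>) (at \<tau> within {0..1})"
    by (intro tendsto_intros)
  then have "((\<lambda>v. C * root 3 \<bar>v - \<tau>\<bar>) \<longlongrightarrow> 0) (at \<tau> within {0..1})" by simp
  moreover have "\<forall>\<^sub>F v in at \<tau> within {0..1}. norm (k v - k \<tau>) \<le> C * root 3 \<bar>v - \<tau>\<bar>"
    unfolding eventually_at using b by (intro exI[of _ 1]) auto
  ultimately have "((\<lambda>v. k v - k \<tau>) \<longlongrightarrow> 0) (at \<tau> within {0..1})"
    by (rule Lim_null_comparison[rotated])
  then show "(k \<longlongrightarrow> k \<tau>) (at \<tau> within {0..1})" by (simp only: Lim_null[symmetric])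
qed

lemma scale_bounds:
  assumes "0 \<le> d" "d \<le> (1 :: real)"
  shows "0 \<le> root 3 d" "root 3 d \<le> 1" "sqrt d \<le> root 3 d" "(root 3 d)\<^sup>2 \<le> root 3 d" "d \<le> root 3 d" "root 3 d ^ 4 = d * root 3 d"
proof -
  show e: "0 \<le> root 3 d" "root 3 d \<le> 1" using assms by auto
  show "sqrt d \<le> root 3 d" by (rule sqrt_le_root3[OF assms])
  show e2: "(root 3 d)\<^sup>2 \<le> root 3 d" by (rule root3_sq_le[OF assms])
  have d: "d = root 3 d ^ 3" using assms by simp
  show "d \<le> root 3 d" using power_decreasing[of 1 3 "root 3 d"] e d by simp
  show "root 3 d ^ 4 = d * root 3 d" using d by (metis power_Suc2 eval_nat_numeral(2) numeral_eq_Suc semiring_norm(26) semiring_norm(27) Suc_numeral power_Suc mult.commute semiring_norm(2) semiring_norm(8))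
qed

context parisi_sde
begin

text \<open>The drift over [s,t] is frozen at (s, X(s)). The error R collects the modulus of u in
  time and the oscillation of the path, and its mean is of order d^(4/3). The cruder bound K d is
  kept as well, because it is not random.\<close>

lemma increment:
  "\<exists>C\<ge>0. \<forall>s t. 0 \<le> s \<and> s < t \<and> t \<le> 1 \<longrightarrow> (\<exists>\<Delta> R. noise s t \<Delta> \<and> integrable M R \<and> (\<integral>w. R w \<partial>M) \<le> C * ((t - s) * root 3 (t - s)) \<and>
     (AE w in M. \<bar>X t w - X s w - \<Delta> w\<bar> \<le> K * (t - s)) \<and>
     (AE w in M. \<bar>X t w - X s w - \<Delta> w - u s (X s w) * Aint \<mu> s t\<bar> \<le> R w))"
proof -
  obtain C where C: "0 \<le> C" "\<And>s t x y. s \<in> {0..1} \<Longrightarrow> t \<in> {0..1} \<Longrightarrow>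
    \<bar>u s x - u t y\<bar> \<le> C * (root 3 \<bar>s - t\<bar>)\<^sup>2 + \<bar>x - y\<bar>"
    using dx_Phi_joint mu by blast
  obtain J where J: "\<And>s t. 0 \<le> s \<Longrightarrow> s < t \<Longrightarrow> t \<le> 1 \<Longrightarrow> noise s t (\<lambda>w. J t w - J s w)"
    "AE w in M. \<forall>s t. 0 \<le> s \<and> s \<le> t \<and> t \<le> 1 \<longrightarrow> X t w - X s w - (J t w - J s w) = (LBINT \<tau>:{s..t}. alpha \<mu> \<tau> * \<zeta> \<tau> * u \<tau> (X \<tau> w))"
    by (rule X_structure) (rule that)
  let ?C = "K * C + 2 * K * K"
  have "\<exists>\<Delta> R. noise s t \<Delta> \<and> integrable M R \<and> (\<integral>w. R w \<partial>M) \<le> ?C * ((t - s) * root 3 (t - s)) \<and>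
     (AE w in M. \<bar>X t w - X s w - \<Delta> w\<bar> \<le> K * (t - s)) \<and>
     (AE w in M. \<bar>X t w - X s w - \<Delta> w - u s (X s w) * Aint \<mu> s t\<bar> \<le> R w)"
    if st: "0 \<le> s" "s < t" "t \<le> 1" for s t
  proof -
    let ?d = "t - s" and ?e = "root 3 (t - s)"
    note sc = scale_bounds[of ?d]
    have d: "0 \<le> ?d" "?d \<le> 1" using st by auto
    obtain H where H: "integrable M H" "\<And>w. 0 \<le> H w" "(\<integral>w. H w \<partial>M) \<le> 2 * K * (?d * sqrt ?d)"
      "AE w in M. (LBINT \<tau>:{s..t}. \<bar>X \<tau> w - X s w\<bar>) = H w"
      by (rule path_error[OF st]) (rule that)
    define R where "R w = K * (C * ?e\<^sup>2 * ?d + H w)" for w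
    have 1: "integrable M R" unfolding R_def using H(1) by simp
    have "(\<integral>w. R w \<partial>M) = K * (C * ?e\<^sup>2 * ?d + (\<integral>w. H w \<partial>M))" unfolding R_def using H(1) prob_space by simp
    also have "\<dots> \<le> K * (C * ?e * ?d + 2 * K * (?d * ?e))"
    proof (intro mult_left_mono add_mono)
      show "C * ?e\<^sup>2 * ?d \<le> C * ?e * ?d" using sc(4)[OF d] C d by (intro mult_right_mono mult_left_mono) auto
      have "2 * K * (?d * sqrt ?d) \<le> 2 * K * (?d * ?e)" using sc(3)[OF d] K_ge_1 d by (intro mult_left_mono) auto
      then show "(\<integral>w. H w \<partial>M) \<le> 2 * K * (?d * ?e)" using H(3) by linarith
    qed (use K_ge_1 in auto)
    also have "\<dots> = ?C * (?d * ?e)" by (simp add: algebra_simps)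
    finally have 2: "(\<integral>w. R w \<partial>M) \<le> ?C * (?d * ?e)" .
    have 3: "AE w in M. \<bar>X t w - X s w - (J t w - J s w)\<bar> \<le> K * ?d"
      using J(2) X_continuous
    proof eventually_elim
      fix w assume a: "\<forall>s t. 0 \<le> s \<and> s \<le> t \<and> t \<le> 1 \<longrightarrow> X t w - X s w - (J t w - J s w) = (LBINT \<tau>:{s..t}. alpha \<mu> \<tau> * \<zeta> \<tau> * u \<tau> (X \<tau> w))"
        and c: "continuous_on {0..1} (\<lambda>s. X s w)"
      have "X t w - X s w - (J t w - J s w) = (LBINT \<tau>:{s..t}. alpha \<mu> \<tau> * \<zeta> \<tau> * u \<tau> (X \<tau> w))"
        using a st by simp
      then show "\<bar>X t w - X s w - (J t w - J s w)\<bar> \<le> K * ?d"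
        using drift_bound[OF c st(1) less_imp_le[OF st(2)] st(3)] by simp
    qed
    have 4: "AE w in M. \<bar>X t w - X s w - (J t w - J s w) - u s (X s w) * Aint \<mu> s t\<bar> \<le> R w"
      using J(2) X_continuous H(4)
    proof eventually_elim
      fix w assume a: "\<forall>s t. 0 \<le> s \<and> s \<le> t \<and> t \<le> 1 \<longrightarrow> X t w - X s w - (J t w - J s w) = (LBINT \<tau>:{s..t}. alpha \<mu> \<tau> * \<zeta> \<tau> * u \<tau> (X \<tau> w))"
        and c: "continuous_on {0..1} (\<lambda>s. X s w)" and Hw: "(LBINT \<tau>:{s..t}. \<bar>X \<tau> w - X s w\<bar>) = H w"
      have bX: "bdd_meas (\<lambda>\<tau>. \<bar>X \<tau> w - X s w\<bar>)"
        by (intro bdd_meas_abs bdd_meas_diff bdd_meas_continuous[OF c] bdd_meas_const)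
      have b1: "bdd_meas (\<lambda>\<tau>. alpha \<mu> \<tau> * \<zeta> \<tau> * u \<tau> (X \<tau> w))"
        by (intro bdd_meas_mult bdd_meas_alpha_zeta mu bdd_meas_continuous dx_Phi_path_continuous c)
      have b2: "bdd_meas (\<lambda>\<tau>. alpha \<mu> \<tau> * \<zeta> \<tau> * u s (X s w))"
        by (intro bdd_meas_mult bdd_meas_alpha_zeta mu bdd_meas_const)
      have b3: "bdd_meas (\<lambda>\<tau>. K * (C * ?e\<^sup>2 + \<bar>X \<tau> w - X s w\<bar>))"
        by (intro bdd_meas_mult bdd_meas_add bdd_meas_const bX)
      have s1: "0 \<le> s" "t \<le> 1" "s \<le> t" using st by auto
      have "u s (X s w) * Aint \<mu> s t = (LBINT \<tau>:{s..t}. alpha \<mu> \<tau> * \<zeta> \<tau> * u s (X s w))"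
        unfolding Aint_def by (simp add: mult.commute)
      moreover have "X t w - X s w - (J t w - J s w) = (LBINT \<tau>:{s..t}. alpha \<mu> \<tau> * \<zeta> \<tau> * u \<tau> (X \<tau> w))"
        using a st by simp
      ultimately have "X t w - X s w - (J t w - J s w) - u s (X s w) * Aint \<mu> s t
          = (LBINT \<tau>:{s..t}. alpha \<mu> \<tau> * \<zeta> \<tau> * u \<tau> (X \<tau> w) - alpha \<mu> \<tau> * \<zeta> \<tau> * u s (X s w))"
        using set_integral_diff(2)[OF bdd_meas_integrable[OF b1 s1(1,2)] bdd_meas_integrable[OF b2 s1(1,2)]] by simp
      then have "\<bar>X t w - X s w - (J t w - J s w) - u s (X s w) * Aint \<mu> s t\<bar> \<le> (LBINT \<tau>:{s..t}. K * (C * ?e\<^sup>2 + \<bar>X \<tau> w - X s w\<bar>))"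
      proof (simp only:, intro LBINT_abs_le[OF bdd_meas_diff[OF b1 b2] b3 s1(1,2)])
        fix \<tau> assume \<tau>: "s \<le> \<tau>" "\<tau> \<le> t"
        have "\<bar>u \<tau> (X \<tau> w) - u s (X s w)\<bar> \<le> C * (root 3 \<bar>\<tau> - s\<bar>)\<^sup>2 + \<bar>X \<tau> w - X s w\<bar>"
          by (rule C(2)) (use \<tau> st in auto)
        also have "\<dots> \<le> C * ?e\<^sup>2 + \<bar>X \<tau> w - X s w\<bar>"
          using C(1) \<tau> by (intro add_right_mono mult_left_mono power_mono) auto
        finally have ub: "\<bar>u \<tau> (X \<tau> w) - u s (X s w)\<bar> \<le> C * ?e\<^sup>2 + \<bar>X \<tau> w - X s w\<bar>" .
        have "\<bar>alpha \<mu> \<tau> * \<zeta> \<tau> * u \<tau> (X \<tau> w) - alpha \<mu> \<tau> * \<zeta> \<tau> * u s (X s w)\<bar> = (alpha \<mu> \<tau> * \<zeta> \<tau>) * \<bar>u \<tau> (X \<tau> w) - u s (X s w)\<bar>"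
          using alpha_nonneg[OF mu, of \<tau>] zeta_nonneg[of \<tau>] \<tau> st by (simp add: abs_mult flip: right_diff_distrib)
        also have "\<dots> \<le> (1 * K) * (C * ?e\<^sup>2 + \<bar>X \<tau> w - X s w\<bar>)"
          using \<tau> st K_ge_1 by (intro mult_mono ub mult_nonneg_nonneg alpha_nonneg[OF mu] alpha_le_1[OF mu] zeta_le zeta_nonneg) auto
        finally show "\<bar>alpha \<mu> \<tau> * \<zeta> \<tau> * u \<tau> (X \<tau> w) - alpha \<mu> \<tau> * \<zeta> \<tau> * u s (X s w)\<bar> \<le> K * (C * ?e\<^sup>2 + \<bar>X \<tau> w - X s w\<bar>)" by simp
      qed
      also have "\<dots> = K * ((LBINT \<tau>:{s..t}. C * ?e\<^sup>2) + (LBINT \<tau>:{s..t}. \<bar>X \<tau> w - X s w\<bar>))"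
        using set_integral_add(2)[OF bdd_meas_integrable[OF bdd_meas_const s1(1,2)] bdd_meas_integrable[OF bX s1(1,2)], of "C * ?e\<^sup>2"] by simp
      also have "\<dots> = R w" unfolding R_def Hw LBINT_const[OF s1(3)] by (simp only: mult.commute[of ?d])
      finally show "\<bar>X t w - X s w - (J t w - J s w) - u s (X s w) * Aint \<mu> s t\<bar> \<le> R w" .
    qed
    show ?thesis
      using J(1)[OF st] 1 2 3 4 by (intro exI[of _ "\<lambda>w. J t w - J s w"] exI[of _ R] conjI)
  qed
  moreover have "0 \<le> ?C" using K_ge_1 C(1) by simp
  ultimately show ?thesis by blast
qed

text \<open>\<open>J 0\<close> is an L2 limit of step integrals over intervals inside [0,0], all of
  which vanish.\<close>

lemma X_0: "AE w in M. X 0 w = h"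
proof -
  obtain J where J: "\<And>s. 0 \<le> s \<Longrightarrow> s \<le> 1 \<Longrightarrow> is_J s (J s)"
    and eq: "AE w in M. \<forall>s\<in>{0..1}. X s w = h + (LBINT \<tau>:{0..s}. alpha \<mu> \<tau> * \<zeta> \<tau> * u \<tau> (X \<tau> w)) + J s w"
    by (rule X_structure) (rule that)
  have J0: "is_J 0 (J 0)" using J by simp
  then obtain S where S: "\<And>n. \<forall>(c, a, b)\<in>set (S n). 0 \<le> a \<and> a \<le> b \<and> b \<le> (0 :: real)"
    "(\<lambda>n. \<integral>\<^sup>+w. ennreal ((step_integral B (S n) w - J 0 w)\<^sup>2) \<partial>M) \<longlonglongrightarrow> 0" and Jm: "J 0 \<in> borel_measurable M"
    unfolding is_stochastic_integral_def by blast
  have "step_integral B T w = 0" if "\<forall>(c, a, b)\<in>set T. 0 \<le> a \<and> a \<le> b \<and> b \<le> (0 :: real)" for T w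
    using that
  proof (induction T)
    case (Cons x T)
    obtain c a b where x: "x = (c, a, b)" by (cases x)
    with Cons.prems have "a = 0" "b = 0" by auto
    with Cons show ?case by (simp add: x)
  qed simp
  then have "step_integral B (S n) w = 0" for n w using S(1) by blast
  then have "(\<lambda>n. \<integral>\<^sup>+w. ennreal ((J 0 w)\<^sup>2) \<partial>M) \<longlonglongrightarrow> (0 :: ennreal)" using S(2) by simp
  then have "(\<integral>\<^sup>+w. ennreal ((J 0 w)\<^sup>2) \<partial>M) = 0" by (simp add: LIMSEQ_const_iff)
  then have "AE w in M. ennreal ((J 0 w)\<^sup>2) = 0"
    using Jm by (subst (asm) nn_integral_0_iff_AE) auto
  then show ?thesis
    using eq
  proof eventually_elim
    fix w assume a: "ennreal ((J 0 w)\<^sup>2) = 0" "\<forall>s\<in>{0..1}. X s w = h + (LBINT \<tau>:{0..s}. alpha \<mu> \<tau> * \<zeta> \<tau> * u \<tau> (X \<tau> w)) + J s w"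
    have "J 0 w = 0" using a(1) by (simp add: ennreal_eq_0_iff)
    moreover have "X 0 w = h + (LBINT \<tau>:{0..0}. alpha \<mu> \<tau> * \<zeta> \<tau> * u \<tau> (X \<tau> w)) + J 0 w" using a(2) by simp
    ultimately show "X 0 w = h" by (simp only: LBINT_point)
  qed
qed

lemma X_integrable:
  assumes "0 \<le> t" "t \<le> 1"
  shows "integrable M (X t)"
proof -
  have [measurable]: "X 0 \<in> borel_measurable M" "X t \<in> borel_measurable M" using X_measurable assms by auto
  have "integrable M (X 0) \<longleftrightarrow> integrable M (\<lambda>_. h)" by (rule integrable_cong_AE) (use X_0 in auto)
  then have "integrable M (X 0)" by simp
  moreover have "integrable M (\<lambda>w. X t w - X 0 w)"
    using X_increment_L1(1)[of 0 t] assms by (subst (asm) integrable_abs_iff) auto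
  ultimately have "integrable M (\<lambda>w. (X t w - X 0 w) + X 0 w)" by (intro Bochner_Integration.integrable_add)
  then show ?thesis by simp
qed

lemma Phi_X_integrable:
  assumes "\<nu> \<in> prob_measures_01" "0 \<le> t" "t \<le> 1"
  shows "integrable M (\<lambda>w. Phi \<xi> \<nu> t (X t w + \<delta>))"
proof (rule Bochner_Integration.integrable_bound)
  show "integrable M (\<lambda>w. \<bar>Phi \<xi> \<nu> t 0\<bar> + (\<bar>X t w\<bar> + \<bar>\<delta>\<bar>))" using X_integrable[OF assms(2,3)] by simp
  have "\<bar>Phi \<xi> \<nu> t (X t w + \<delta>)\<bar> \<le> \<bar>Phi \<xi> \<nu> t 0\<bar> + (\<bar>X t w\<bar> + \<bar>\<delta>\<bar>)" for w
    using smooth2_lip(1)[OF Phi_smooth2[OF assms], of "X t w + \<delta>" 0] by linarith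
  then show "AE w in M. norm (Phi \<xi> \<nu> t (X t w + \<delta>)) \<le> norm (\<bar>Phi \<xi> \<nu> t 0\<bar> + (\<bar>X t w\<bar> + \<bar>\<delta>\<bar>))"
    by (intro AE_I2) auto
  show "(\<lambda>w. Phi \<xi> \<nu> t (X t w + \<delta>)) \<in> borel_measurable M"
    by (rule measurable_compose[OF _ Phi_measurable[OF assms]]) (use X_measurable[OF assms(2,3)] in simp)
qed

lemma comp_X_measurable:
  assumes "g \<in> borel_measurable borel" "0 \<le> s" "s \<le> 1"
  shows "(\<lambda>w. g (X s w + \<delta>)) \<in> borel_measurable (F s)" "(\<lambda>w. g (X s w + \<delta>)) \<in> borel_measurable M"
proof -
  show "(\<lambda>w. g (X s w + \<delta>)) \<in> borel_measurable (F s)"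
    by (rule measurable_compose[OF _ assms(1)]) (use X_adapted[OF assms(2,3)] in simp)
  then show "(\<lambda>w. g (X s w + \<delta>)) \<in> borel_measurable M" by (rule F_measurable_M[OF assms(2)])
qed

lemma comp_X_measurable0:
  assumes "g \<in> borel_measurable borel" "0 \<le> s" "s \<le> 1"
  shows "(\<lambda>w. g (X s w)) \<in> borel_measurable (F s)" "(\<lambda>w. g (X s w)) \<in> borel_measurable M"
  using comp_X_measurable[OF assms, of 0] by simp_all

text \<open>The integrands of Ito's formula for \<open>\<Phi>\<^sub>\<nu>(s, X(s) + \<delta>)\<close>.  Differentiating the formula for \<open>\<nu> = \<mu>\<close> at
  \<open>\<delta> = 0\<close> yields the martingale property of \<open>u(s, X(s))\<close>.\<close>

definition "k1 \<nu> \<delta> Y s = (\<integral>w. Y w * (dx_Phi \<xi> \<nu> s (X s w + \<delta>) * u s (X s w)) \<partial>M)"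
definition "k2 \<nu> \<delta> Y s = (\<integral>w. Y w * (dx_Phi \<xi> \<nu> s (X s w + \<delta>))\<^sup>2 \<partial>M)"

lemma taylor_remainder:
  assumes S: "smooth2 L f f1 f2" and D: "\<bar>dX - \<Delta>\<bar> \<le> a" "\<bar>dX - \<Delta> - \<tau>\<bar> \<le> R"
  shows "\<bar>f (x + dX) - f x - f1 x * (\<Delta> + \<tau>) - f2 x * \<Delta>\<^sup>2 / 2\<bar> \<le> R + a * \<bar>\<Delta>\<bar> + a\<^sup>2 + 4 * L * (\<bar>\<Delta>\<bar> ^ 3 + a ^ 3)"
proof -
  have a: "0 \<le> a" using order_trans[OF abs_ge_zero D(1)] .
  note b = smooth2_bounds[OF S, of x]
  define T where "T = f (x + dX) - f x - f1 x * dX - f2 x * dX\<^sup>2 / 2"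
  have "\<bar>T\<bar> \<le> L * \<bar>dX\<bar> ^ 3" unfolding T_def by (rule smooth2_taylor2[OF S])
  also have "\<dots> \<le> L * (4 * (\<bar>\<Delta>\<bar> ^ 3 + a ^ 3))"
  proof (rule mult_left_mono)
    have "\<bar>\<Delta> + (dX - \<Delta>)\<bar> ^ 3 \<le> 4 * (\<bar>\<Delta>\<bar> ^ 3 + \<bar>dX - \<Delta>\<bar> ^ 3)" by (rule cube_sum)
    also have "\<dots> \<le> 4 * (\<bar>\<Delta>\<bar> ^ 3 + a ^ 3)" using D(1) by (intro mult_left_mono add_left_mono power_mono) auto
    finally show "\<bar>dX\<bar> ^ 3 \<le> 4 * (\<bar>\<Delta>\<bar> ^ 3 + a ^ 3)" by simp
  qed (rule less_imp_le[OF L_pos])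
  finally have T: "\<bar>T\<bar> \<le> 4 * L * (\<bar>\<Delta>\<bar> ^ 3 + a ^ 3)" by (simp add: algebra_simps)
  have P: "\<bar>f1 x * (dX - \<Delta> - \<tau>)\<bar> \<le> R"
    unfolding abs_mult using mult_mono[OF b(1) D(2)] by simp
  define q where "q = f2 x * ((dX - \<Delta>) * (2 * \<Delta> + (dX - \<Delta>)))"
  have "\<bar>(dX - \<Delta>) * (2 * \<Delta> + (dX - \<Delta>))\<bar> \<le> a * (2 * \<bar>\<Delta>\<bar> + a)"
    unfolding abs_mult using D(1) a by (intro mult_mono) auto
  then have "\<bar>q\<bar> \<le> 1 * (a * (2 * \<bar>\<Delta>\<bar> + a))"
    unfolding q_def abs_mult[of "f2 x"] using b(2) by (intro mult_mono) auto
  then have Q: "\<bar>q\<bar> \<le> 2 * (a * \<bar>\<Delta>\<bar>) + a\<^sup>2" by (simp add: power2_eq_square algebra_simps)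
  have a2: "0 \<le> a\<^sup>2" by simp
  have "f (x + dX) - f x - f1 x * (\<Delta> + \<tau>) - f2 x * \<Delta>\<^sup>2 / 2 = T + f1 x * (dX - \<Delta> - \<tau>) + q / 2"
    unfolding T_def q_def by (simp add: power2_eq_square algebra_simps add_divide_distrib diff_divide_distrib)
  then show ?thesis using T P Q a2 by linarith
qed

text \<open>\<Phi> is expanded in space at the later time t, and the integrated PDE then leads from
  t back to s. The linear noise term has mean zero, and so has the second derivative times
  \<Delta>^2 minus its variance; only two gradient terms survive. The drift of X contributes the
  weight of \<mu>, the PDE that of \<nu>.\<close>

lemma ito_step:
  "\<exists>C\<ge>0. \<forall>\<nu> \<delta> Y b s t. \<nu> \<in> prob_measures_01 \<and> 0 \<le> s \<and> s < t \<and> t \<le> 1 \<and> Y \<in> borel_measurable (F s) \<and> (\<forall>w. \<bar>Y w\<bar> \<le> b) \<longrightarrow>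
    \<bar>(\<integral>w. Y w * (Phi \<xi> \<nu> t (X t w + \<delta>) - Phi \<xi> \<nu> s (X s w + \<delta>)) \<partial>M) - (Aint \<mu> s t * k1 \<nu> \<delta> Y s - Aint \<nu> s t / 2 * k2 \<nu> \<delta> Y s)\<bar>
      \<le> b * C * ((t - s) * root 3 (t - s))"
proof -
  obtain C1 where C1: "0 \<le> C1" "\<And>s t. 0 \<le> s \<Longrightarrow> s < t \<Longrightarrow> t \<le> 1 \<Longrightarrow> (\<exists>\<Delta> R. noise s t \<Delta> \<and> integrable M R \<and> (\<integral>w. R w \<partial>M) \<le> C1 * ((t - s) * root 3 (t - s)) \<and>
     (AE w in M. \<bar>X t w - X s w - \<Delta> w\<bar> \<le> K * (t - s)) \<and>
     (AE w in M. \<bar>X t w - X s w - \<Delta> w - u s (X s w) * Aint \<mu> s t\<bar> \<le> R w))"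
    using increment by blast
  obtain C2 where C2: "0 \<le> C2" "\<And>\<mu> s t x. \<mu> \<in> prob_measures_01 \<Longrightarrow> 0 \<le> s \<Longrightarrow> s \<le> t \<Longrightarrow> t \<le> 1 \<Longrightarrow>
    \<bar>dx_Phi \<xi> \<mu> s x - dx_Phi \<xi> \<mu> t x\<bar> \<le> C2 * (root 3 (t - s))\<^sup>2"
    "\<And>\<mu> s t x. \<mu> \<in> prob_measures_01 \<Longrightarrow> 0 \<le> s \<Longrightarrow> s \<le> t \<Longrightarrow> t \<le> 1 \<Longrightarrow>
    \<bar>Phi \<xi> \<mu> s x - Phi \<xi> \<mu> t x - ((\<rho> t - \<rho> s) * dxx_Phi \<xi> \<mu> t x
      + Aint \<mu> s t * (dx_Phi \<xi> \<mu> t x)\<^sup>2) / 2\<bar> \<le> C2 * ((t - s) * root 3 (t - s))"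
    unfolding Aint_def using Phi_time_bounds by blast
  let ?C = "C1 + K * K + K * K + 4 * L * (2 * (K * K) + K ^ 3) + C2 + 2 * K * C2"
  have main: "\<bar>(\<integral>w. Y w * (Phi \<xi> \<nu> t (X t w + \<delta>) - Phi \<xi> \<nu> s (X s w + \<delta>)) \<partial>M) - (Aint \<mu> s t * k1 \<nu> \<delta> Y s - Aint \<nu> s t / 2 * k2 \<nu> \<delta> Y s)\<bar>
      \<le> b * ?C * ((t - s) * root 3 (t - s))"
    if nu: "\<nu> \<in> prob_measures_01" and st: "0 \<le> s" "s < t" "t \<le> 1" and Y: "Y \<in> borel_measurable (F s)" "\<And>w. \<bar>Y w\<bar> \<le> b"
    for \<nu> \<delta> Y b s t
  proof -
    let ?d = "t - s" and ?e = "root 3 (t - s)" and ?v = "\<rho> t - \<rho> s" and ?A = "Aint \<mu> s t" and ?An = "Aint \<nu> s t"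
    have s1: "0 \<le> s" "s \<le> 1" "0 \<le> t" "t \<le> 1" using st by auto
    have d: "0 \<le> ?d" "?d \<le> 1" using st by auto
    note sc = scale_bounds[OF d]
    have b0: "0 \<le> b" using order_trans[OF abs_ge_zero Y(2)] .
    obtain \<Delta> R where N: "noise s t \<Delta>" and R: "integrable M R" "(\<integral>w. R w \<partial>M) \<le> C1 * (?d * ?e)"
      and ae1: "AE w in M. \<bar>X t w - X s w - \<Delta> w\<bar> \<le> K * ?d"
      and ae2: "AE w in M. \<bar>X t w - X s w - \<Delta> w - u s (X s w) * ?A\<bar> \<le> R w"
      using C1(2)[OF st] by blast
    note NM = noise_moments[OF N st]
    define f1 where "f1 w = dx_Phi \<xi> \<nu> t (X s w + \<delta>)" for w
    define f2 where "f2 w = dxx_Phi \<xi> \<nu> t (X s w + \<delta>)" for w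
    define g1 where "g1 w = dx_Phi \<xi> \<nu> s (X s w + \<delta>)" for w
    define us where "us w = u s (X s w)" for w
    define W where "W w = Phi \<xi> \<nu> t (X t w + \<delta>) - Phi \<xi> \<nu> s (X s w + \<delta>)" for w
    define R1 where "R1 w = R w + K * ?d * \<bar>\<Delta> w\<bar> + (K * ?d)\<^sup>2 + 4 * L * (\<bar>\<Delta> w\<bar> ^ 3 + (K * ?d) ^ 3) + (C2 * (?d * ?e) + 2 * K * C2 * (?d * ?e))" for w
    note S = Phi_smooth2[OF nu s1(3,4)]
    have f1F: "f1 \<in> borel_measurable (F s)" and f2F: "f2 \<in> borel_measurable (F s)" and g1F: "g1 \<in> borel_measurable (F s)" and usF: "us \<in> borel_measurable (F s)"
      unfolding f1_def f2_def g1_def us_def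
      by (intro comp_X_measurable dx_Phi_measurable dxx_Phi_measurable nu s1 comp_X_measurable0 mu)+
    note fM = F_measurable_M[OF st(1)]
    have fb: "\<bar>f1 w\<bar> \<le> 1" "\<bar>f2 w\<bar> \<le> 1" "\<bar>g1 w\<bar> \<le> 1" "\<bar>us w\<bar> \<le> 1" for w
      unfolding f1_def f2_def g1_def us_def using smooth2_bounds[OF S] dx_Phi_bound[OF nu s1(1,2)] dx_Phi_bound[OF mu s1(1,2)] by auto
    have A: "0 \<le> ?A" "?A \<le> K * ?d" "0 \<le> ?An" "?An \<le> K * ?d"
      unfolding Aint_def using LBINT_alpha_zeta[OF mu st(1) less_imp_le[OF st(2)] st(3)] LBINT_alpha_zeta[OF nu st(1) less_imp_le[OF st(2)] st(3)] by auto
    have g1f1: "\<bar>f1 w - g1 w\<bar> \<le> C2 * ?e" for w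
    proof -
      have "\<bar>g1 w - f1 w\<bar> \<le> C2 * ?e\<^sup>2" unfolding f1_def g1_def using C2(2)[OF nu, of s t] st by simp
      also have "\<dots> \<le> C2 * ?e" using sc C2 by (intro mult_left_mono) auto
      finally show ?thesis by (simp add: abs_minus_commute)
    qed
    have E: "AE w in M. \<bar>W w - (f1 w * \<Delta> w + ?A * (g1 w * us w) + (f2 w * (\<Delta> w)\<^sup>2 - f2 w * ?v) / 2 - ?An / 2 * (g1 w)\<^sup>2)\<bar> \<le> R1 w"
      using ae1 ae2
    proof eventually_elim
      fix w assume a: "\<bar>X t w - X s w - \<Delta> w\<bar> \<le> K * ?d" "\<bar>X t w - X s w - \<Delta> w - u s (X s w) * ?A\<bar> \<le> R w"
      have x: "X s w + \<delta> + (X t w - X s w) = X t w + \<delta>" by simp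
      note T = taylor_remainder[OF S a, of "X s w + \<delta>", unfolded x, folded f1_def f2_def us_def]
      define p where "p = Phi \<xi> \<nu> t (X t w + \<delta>)"
      define q where "q = Phi \<xi> \<nu> t (X s w + \<delta>)"
      define r where "r = Phi \<xi> \<nu> s (X s w + \<delta>)"
      have T': "\<bar>p - q - f1 w * (\<Delta> w + us w * ?A) - f2 w * (\<Delta> w)\<^sup>2 / 2\<bar> \<le> R w + K * ?d * \<bar>\<Delta> w\<bar> + (K * ?d)\<^sup>2 + 4 * L * (\<bar>\<Delta> w\<bar> ^ 3 + (K * ?d) ^ 3)"
        using T unfolding p_def q_def .
      have Q: "\<bar>r - q - (?v * f2 w + ?An * (f1 w)\<^sup>2) / 2\<bar> \<le> C2 * (?d * ?e)"
        using C2(3)[OF nu, of s t "X s w + \<delta>"] st unfolding r_def q_def f1_def f2_def by simp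
      \<comment> \<open>The costs of evaluating the gradients at time s instead of t, in the drift
        term and in the PDE term.\<close>
      define z1 where "z1 = ?A * ((f1 w - g1 w) * us w)"
      define z2 where "z2 = ?An * ((f1 w)\<^sup>2 - (g1 w)\<^sup>2)"
      have "\<bar>(f1 w - g1 w) * us w\<bar> \<le> (C2 * ?e) * 1"
        unfolding abs_mult using g1f1 fb C2 sc by (intro mult_mono) auto
      then have "\<bar>z1\<bar> \<le> (K * ?d) * (C2 * ?e)"
        unfolding z1_def abs_mult[of ?A] using A by (intro mult_mono) auto
      moreover have "\<bar>(f1 w)\<^sup>2 - (g1 w)\<^sup>2\<bar> \<le> 2 * (C2 * ?e)"
      proof -
        have "(f1 w)\<^sup>2 - (g1 w)\<^sup>2 = (f1 w + g1 w) * (f1 w - g1 w)" by (simp add: power2_eq_square algebra_simps)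
        moreover have "\<bar>f1 w + g1 w\<bar> \<le> 2" using fb(1,3)[of w] by linarith
        ultimately show ?thesis unfolding abs_mult using g1f1 by (simp only: abs_mult) (intro mult_mono, auto)
      qed
      then have "\<bar>z2\<bar> \<le> (K * ?d) * (2 * (C2 * ?e))"
        unfolding z2_def abs_mult[of ?An] using A by (intro mult_mono) auto
      ultimately have Z: "\<bar>z1\<bar> \<le> K * C2 * (?d * ?e)" "\<bar>z2\<bar> \<le> 2 * (K * C2 * (?d * ?e))" by (simp_all add: mult_ac)
      have eq: "W w - (f1 w * \<Delta> w + ?A * (g1 w * us w) + (f2 w * (\<Delta> w)\<^sup>2 - f2 w * ?v) / 2 - ?An / 2 * (g1 w)\<^sup>2)
          = (p - q - f1 w * (\<Delta> w + us w * ?A) - f2 w * (\<Delta> w)\<^sup>2 / 2) - (r - q - (?v * f2 w + ?An * (f1 w)\<^sup>2) / 2) + z1 - z2 / 2"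
        unfolding W_def p_def[symmetric] r_def[symmetric] z1_def z2_def by (simp add: algebra_simps add_divide_distrib diff_divide_distrib)
      have eq2: "2 * K * C2 * (?d * ?e) = 2 * (K * C2 * (?d * ?e))" by simp
      show "\<bar>W w - (f1 w * \<Delta> w + ?A * (g1 w * us w) + (f2 w * (\<Delta> w)\<^sup>2 - f2 w * ?v) / 2 - ?An / 2 * (g1 w)\<^sup>2)\<bar> \<le> R1 w"
        unfolding R1_def eq eq2 by (rule four_term_bound[OF T' Q Z])
    qed
    have R1i: "integrable M R1" unfolding R1_def using R(1) NM(1,3) by simp
    have R1b: "(\<integral>w. R1 w \<partial>M) \<le> ?C * (?d * ?e)"
    proof -
      have "(\<integral>w. R1 w \<partial>M) = (\<integral>w. R w \<partial>M) + K * ?d * (\<integral>w. \<bar>\<Delta> w\<bar> \<partial>M) + (K * ?d)\<^sup>2 + 4 * L * ((\<integral>w. \<bar>\<Delta> w\<bar> ^ 3 \<partial>M) + (K * ?d) ^ 3) + (C2 * (?d * ?e) + 2 * K * C2 * (?d * ?e))"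
        unfolding R1_def using R(1) NM(1,3) prob_space by simp
      also have "\<dots> \<le> C1 * (?d * ?e) + K * K * (?d * ?e) + K * K * (?d * ?e) + 4 * L * (2 * (K * K) * (?d * ?e) + K ^ 3 * (?d * ?e)) + (C2 * (?d * ?e) + 2 * K * C2 * (?d * ?e))"
      proof (intro add_mono mult_left_mono R order_refl)
        have sK: "sqrt (K * ?d) \<le> K * ?e"
        proof -
          have "sqrt K * 1 \<le> sqrt K * sqrt K" using K_ge_1 by (intro mult_left_mono) auto
          then have "sqrt K \<le> K" using K_ge_1 by simp
          then show ?thesis unfolding real_sqrt_mult using sc d K_ge_1 by (intro mult_mono) auto
        qed
        have "K * ?d * (\<integral>w. \<bar>\<Delta> w\<bar> \<partial>M) \<le> K * ?d * (K * ?e)"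
          using NM(2) sK K_ge_1 d by (intro mult_left_mono) auto
        then show "K * ?d * (\<integral>w. \<bar>\<Delta> w\<bar> \<partial>M) \<le> K * K * (?d * ?e)" by (simp add: mult_ac)
        have "?d * ?d \<le> ?d * ?e" using sc d by (intro mult_left_mono) auto
        then have "K * K * (?d * ?d) \<le> K * K * (?d * ?e)" by (rule mult_left_mono) (use K_ge_1 in simp)
        then show "(K * ?d)\<^sup>2 \<le> K * K * (?d * ?e)" by (simp add: power2_eq_square mult_ac)
        have "sqrt (K * ?d) ^ 3 = K * ?d * sqrt (K * ?d)" using K_ge_1 d by (simp add: power3_eq_cube)
        also have "\<dots> \<le> K * ?d * (K * ?e)" using sK K_ge_1 d by (intro mult_left_mono) auto
        finally show "(\<integral>w. \<bar>\<Delta> w\<bar> ^ 3 \<partial>M) \<le> 2 * (K * K) * (?d * ?e)" using NM(4) by (simp add: mult_ac)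
        have "?d ^ 3 \<le> ?d * ?e"
        proof -
          have "?d ^ 3 = ?d * (?d * ?d)" by (simp add: power3_eq_cube)
          also have "\<dots> \<le> ?d * (?d * 1)" by (rule mult_left_mono, rule mult_left_mono) (use d in simp_all)
          also have "\<dots> \<le> ?d * ?e" using sc d by (intro mult_left_mono) auto
          finally show ?thesis .
        qed
        then show "(K * ?d) ^ 3 \<le> K ^ 3 * (?d * ?e)" unfolding power_mult_distrib by (rule mult_left_mono) (use K_ge_1 in simp)
      qed (use less_imp_le[OF L_pos] st C2(1) K_ge_1 in auto)
      also have "\<dots> = ?C * (?d * ?e)" by (simp add: algebra_simps)
      finally show ?thesis .
    qed
    have Wi: "integrable M W" unfolding W_def using Phi_X_integrable[OF nu s1(3,4)] Phi_X_integrable[OF nu s1(1,2)] by simp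
    note YM = fM[OF Y(1)]
    note bi = bounded_times_integrable[OF YM Y(2)]
    have bdd: "integrable M (\<lambda>w. Y w * g w)" if "g \<in> borel_measurable M" "\<And>w. \<bar>g w\<bar> \<le> c" for g and c :: real
      by (rule bi, rule integrable_const_bound[of _ c]) (use that in auto)
    note ff = fM[OF f1F] fM[OF f2F] fM[OF g1F] fM[OF usF]
    have \<Delta>i: "integrable M \<Delta>" "integrable M (\<lambda>w. (\<Delta> w)\<^sup>2)"
      using integrable_power_le[OF noiseD(1,2)[OF N], of 1] integrable_power_le[OF noiseD(1,2)[OF N], of 2] by simp_all
    have g2b: "\<bar>(g1 w)\<^sup>2\<bar> \<le> 1" and gub: "\<bar>g1 w * us w\<bar> \<le> 1" for w
      using mult_mono[OF fb(3)[of w] fb(3)[of w]] mult_mono[OF fb(3)[of w] fb(4)[of w]] by (simp_all add: power2_eq_square abs_mult)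
    have i1: "integrable M (\<lambda>w. Y w * (f1 w * \<Delta> w))" by (intro bi bounded_times_integrable[OF ff(1) fb(1)] \<Delta>i)
    have i2: "integrable M (\<lambda>w. Y w * (f2 w * (\<Delta> w)\<^sup>2))" by (intro bi bounded_times_integrable[OF ff(2) fb(2)] \<Delta>i)
    have i3: "integrable M (\<lambda>w. Y w * f2 w)" by (rule bdd[OF ff(2) fb(2)])
    have i4: "integrable M (\<lambda>w. Y w * (g1 w * us w))" by (rule bdd[OF borel_measurable_times[OF ff(3,4)] gub])
    have i5: "integrable M (\<lambda>w. Y w * (g1 w)\<^sup>2)" by (rule bdd[OF borel_measurable_power[OF ff(3)] g2b])
    have i6: "integrable M (\<lambda>w. Y w * W w)" by (rule bi[OF Wi])
    have Yf: "\<bar>Y w * f1 w\<bar> \<le> b * 1" "\<bar>Y w * f2 w\<bar> \<le> b * 1" for w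
      unfolding abs_mult using Y(2) fb b0 by (intro mult_mono; simp)+
    \<comment> \<open>The factors \<open>Y w * f1 w\<close> and \<open>Y w * f2 w\<close> are known
      at time s, so the noise acts on them with mean zero and with its exact variance, which the PDE
      term compensates.\<close>
    have z: "(\<integral>w. Y w * (f1 w * \<Delta> w) \<partial>M) = 0" "(\<integral>w. Y w * (f2 w * (\<Delta> w)\<^sup>2) \<partial>M) = (\<integral>w. Y w * f2 w \<partial>M) * ?v"
      using noiseD(4)[OF N borel_measurable_times[OF Y(1) f1F] Yf(1)] noiseD(5)[OF N borel_measurable_times[OF Y(1) f2F] Yf(2)]
      by (simp_all add: mult.assoc)
    define T where "T w = Y w * W w - (Y w * (f1 w * \<Delta> w) + ?A * (Y w * (g1 w * us w)) + (Y w * (f2 w * (\<Delta> w)\<^sup>2) - (Y w * f2 w) * ?v) / 2 - ?An / 2 * (Y w * (g1 w)\<^sup>2))" for w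
    have Ti: "integrable M T" unfolding T_def using i1 i2 i3 i4 i5 i6 by simp
    have ET: "(\<integral>w. T w \<partial>M) = (\<integral>w. Y w * W w \<partial>M) - (?A * k1 \<nu> \<delta> Y s - ?An / 2 * k2 \<nu> \<delta> Y s)"
      unfolding T_def k1_def k2_def g1_def[symmetric] us_def[symmetric] using i1 i2 i3 i4 i5 i6 z by simp
    have "AE w in M. \<bar>T w\<bar> \<le> b * R1 w"
      using E
    proof eventually_elim
      fix w assume a: "\<bar>W w - (f1 w * \<Delta> w + ?A * (g1 w * us w) + (f2 w * (\<Delta> w)\<^sup>2 - f2 w * ?v) / 2 - ?An / 2 * (g1 w)\<^sup>2)\<bar> \<le> R1 w"
      have "T w = Y w * (W w - (f1 w * \<Delta> w + ?A * (g1 w * us w) + (f2 w * (\<Delta> w)\<^sup>2 - f2 w * ?v) / 2 - ?An / 2 * (g1 w)\<^sup>2))"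
        unfolding T_def by (simp add: algebra_simps)
      then show "\<bar>T w\<bar> \<le> b * R1 w" using a Y(2)[of w] b0 by (simp only: abs_mult) (intro mult_mono, auto)
    qed
    then have "(\<integral>w. \<bar>T w\<bar> \<partial>M) \<le> (\<integral>w. b * R1 w \<partial>M)" using Ti R1i by (intro integral_mono_AE) auto
    then have "\<bar>\<integral>w. T w \<partial>M\<bar> \<le> (\<integral>w. b * R1 w \<partial>M)" by (rule order_trans[OF integral_abs_bound])
    then have "\<bar>\<integral>w. T w \<partial>M\<bar> \<le> b * (\<integral>w. R1 w \<partial>M)" by simp
    also have "\<dots> \<le> b * (?C * (?d * ?e))" using R1b b0 by (rule mult_left_mono)
    finally show ?thesis unfolding ET W_def by (simp add: mult.assoc)
  qed
  have C0: "0 \<le> ?C" using C1(1) C2(1) K_ge_1 less_imp_le[OF L_pos] by (intro add_nonneg_nonneg mult_nonneg_nonneg) auto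
  show ?thesis using C0 main by blast
qed

end

section \<open>Regularity of the integrands and Ito's formula over an interval\<close>

lemma product_diff_le:
  fixes a b c d :: real
  assumes "\<bar>b\<bar> \<le> 1" "\<bar>c\<bar> \<le> 1" "\<bar>a - c\<bar> \<le> e" "\<bar>b - d\<bar> \<le> e"
  shows "\<bar>a * b - c * d\<bar> \<le> 2 * e"
proof -
  have "a * b - c * d = (a - c) * b + c * (b - d)" by (simp add: algebra_simps)
  moreover have "\<bar>(a - c) * b\<bar> \<le> e * 1" unfolding abs_mult using assms by (intro mult_mono) auto
  moreover have "\<bar>c * (b - d)\<bar> \<le> 1 * e" unfolding abs_mult using assms by (intro mult_mono) auto
  ultimately show ?thesis by linarith
qed

text \<open>The negative term absorbs the mixed term of the square, so the main part survives with a
  factor as close to 1 as desired.\<close>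

lemma square_lower:
  fixes x y \<eta> :: real
  assumes "0 < \<eta>"
  shows "(1 - \<eta>) * x\<^sup>2 - y\<^sup>2 / \<eta> \<le> (x + y)\<^sup>2"
proof -
  have "(x + y)\<^sup>2 - (1 - \<eta>) * x\<^sup>2 + y\<^sup>2 / \<eta> = (\<eta> * x + y)\<^sup>2 / \<eta> + y\<^sup>2"
    using assms by (simp add: power2_eq_square field_simps)
  moreover have "0 \<le> (\<eta> * x + y)\<^sup>2 / \<eta> + y\<^sup>2" using assms by simp
  ultimately show ?thesis by linarith
qed

context parisi_sde
begin

lemma bounded_integrable:
  fixes g :: "'a \<Rightarrow> real"
  assumes "g \<in> borel_measurable M" "\<And>w. \<bar>g w\<bar> \<le> c"
  shows "integrable M g"
  by (rule integrable_const_bound[of _ c]) (use assms in auto)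

lemma bounded_integral:
  fixes g :: "'a \<Rightarrow> real"
  assumes "g \<in> borel_measurable M" "\<And>w. \<bar>g w\<bar> \<le> c"
  shows "\<bar>\<integral>w. g w \<partial>M\<bar> \<le> c"
proof -
  have "\<bar>\<integral>w. g w \<partial>M\<bar> \<le> (\<integral>w. \<bar>g w\<bar> \<partial>M)" by (rule integral_abs_bound)
  also have "\<dots> \<le> (\<integral>w. c \<partial>M)" using bounded_integrable[OF assms] assms(2) by (intro integral_mono) auto
  finally show ?thesis using prob_space by simp
qed

lemma dx_X_measurable:
  assumes "\<nu> \<in> prob_measures_01" "0 \<le> s" "s \<le> 1"
  shows "(\<lambda>w. dx_Phi \<xi> \<nu> s (X s w + \<delta>)) \<in> borel_measurable M"
  by (rule comp_X_measurable(2)[OF dx_Phi_measurable[OF assms] assms(2,3)])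

text \<open>The gradients are Hoelder in time with exponent 2/3 and Lipschitz in space, and an
  increment of X is of order sqrt (t - s) in mean; both are weakened to the common exponent
  1/3.\<close>

lemma product_hoelder:
  "\<exists>C\<ge>0. \<forall>\<nu>1 \<nu>2 \<delta>1 \<delta>2 Y b s t. \<nu>1 \<in> prob_measures_01 \<and> \<nu>2 \<in> prob_measures_01 \<and> 0 \<le> s \<and> s < t \<and> t \<le> 1 \<and>
    Y \<in> borel_measurable M \<and> (\<forall>w. \<bar>Y w\<bar> \<le> b) \<longrightarrow>
    \<bar>(\<integral>w. Y w * (dx_Phi \<xi> \<nu>1 t (X t w + \<delta>1) * dx_Phi \<xi> \<nu>2 t (X t w + \<delta>2)) \<partial>M)
      - (\<integral>w. Y w * (dx_Phi \<xi> \<nu>1 s (X s w + \<delta>1) * dx_Phi \<xi> \<nu>2 s (X s w + \<delta>2)) \<partial>M)\<bar> \<le> b * C * root 3 (t - s)"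
proof -
  obtain C where C: "0 \<le> C" "\<And>\<nu> s t x y. \<nu> \<in> prob_measures_01 \<Longrightarrow> s \<in> {0..1} \<Longrightarrow> t \<in> {0..1} \<Longrightarrow>
    \<bar>dx_Phi \<xi> \<nu> s x - dx_Phi \<xi> \<nu> t y\<bar> \<le> C * (root 3 \<bar>s - t\<bar>)\<^sup>2 + \<bar>x - y\<bar>"
    using dx_Phi_joint by blast
  let ?C = "2 * (C + 2 * K)"
  have "\<bar>(\<integral>w. Y w * (dx_Phi \<xi> \<nu>1 t (X t w + \<delta>1) * dx_Phi \<xi> \<nu>2 t (X t w + \<delta>2)) \<partial>M)
      - (\<integral>w. Y w * (dx_Phi \<xi> \<nu>1 s (X s w + \<delta>1) * dx_Phi \<xi> \<nu>2 s (X s w + \<delta>2)) \<partial>M)\<bar> \<le> b * ?C * root 3 (t - s)"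
    if nu: "\<nu>1 \<in> prob_measures_01" "\<nu>2 \<in> prob_measures_01" and st: "0 \<le> s" "s < t" "t \<le> 1"
      and Y: "Y \<in> borel_measurable M" "\<And>w. \<bar>Y w\<bar> \<le> b" for \<nu>1 \<nu>2 \<delta>1 \<delta>2 Y b s t
  proof -
    let ?e = "root 3 (t - s)"
    have d: "0 \<le> t - s" "t - s \<le> 1" using st by auto
    note sc = scale_bounds[OF d]
    have s1: "0 \<le> s" "s \<le> 1" "0 \<le> t" "t \<le> 1" using st by auto
    have b0: "0 \<le> b" using order_trans[OF abs_ge_zero Y(2)] .
    define P where "P r w = dx_Phi \<xi> \<nu>1 r (X r w + \<delta>1) * dx_Phi \<xi> \<nu>2 r (X r w + \<delta>2)" for r w
    have Pm: "P r \<in> borel_measurable M" if "0 \<le> r" "r \<le> 1" for r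
      unfolding P_def by (intro borel_measurable_times dx_X_measurable nu that)
    have Pb: "\<bar>P r w\<bar> \<le> 1" if "0 \<le> r" "r \<le> 1" for r w
      unfolding P_def abs_mult using mult_mono[OF dx_Phi_bound[OF nu(1) that] dx_Phi_bound[OF nu(2) that]] by simp
    have i: "integrable M (\<lambda>w. Y w * P r w)" if "0 \<le> r" "r \<le> 1" for r
      by (rule bounded_times_integrable[OF Y bounded_integrable[OF Pm[OF that] Pb[OF that]]])
    have pt: "\<bar>Y w * P t w - Y w * P s w\<bar> \<le> b * (2 * (C * ?e + \<bar>X t w - X s w\<bar>))" for w
    proof -
      have u1: "\<bar>dx_Phi \<xi> \<nu> t (X t w + \<delta>) - dx_Phi \<xi> \<nu> s (X s w + \<delta>)\<bar> \<le> C * ?e + \<bar>X t w - X s w\<bar>"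
        if "\<nu> \<in> prob_measures_01" for \<nu> \<delta>
      proof -
        have "\<bar>dx_Phi \<xi> \<nu> t (X t w + \<delta>) - dx_Phi \<xi> \<nu> s (X s w + \<delta>)\<bar> \<le> C * ?e\<^sup>2 + \<bar>X t w - X s w\<bar>"
          using C(2)[OF that, of t s "X t w + \<delta>" "X s w + \<delta>"] st by simp
        also have "\<dots> \<le> C * ?e + \<bar>X t w - X s w\<bar>" using C(1) sc(4) by (intro add_right_mono mult_left_mono) auto
        finally show ?thesis .
      qed
      have "\<bar>P t w - P s w\<bar> \<le> 2 * (C * ?e + \<bar>X t w - X s w\<bar>)"
        unfolding P_def by (rule product_diff_le[OF dx_Phi_bound[OF nu(2) s1(3,4)] dx_Phi_bound[OF nu(1) s1(1,2)] u1[OF nu(1)] u1[OF nu(2)]])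
      then show ?thesis unfolding right_diff_distrib[symmetric] abs_mult[of "Y w"] using Y(2) b0 by (intro mult_mono) auto
    qed
    have X1: "integrable M (\<lambda>w. \<bar>X t w - X s w\<bar>)" "(\<integral>w. \<bar>X t w - X s w\<bar> \<partial>M) \<le> 2 * K * sqrt (t - s)"
      using X_increment_L1[of s t] st by auto
    have "(\<integral>w. Y w * P t w \<partial>M) - (\<integral>w. Y w * P s w \<partial>M) = (\<integral>w. Y w * P t w - Y w * P s w \<partial>M)"
      using i s1 by simp
    then have "\<bar>(\<integral>w. Y w * P t w \<partial>M) - (\<integral>w. Y w * P s w \<partial>M)\<bar> \<le> (\<integral>w. \<bar>Y w * P t w - Y w * P s w\<bar> \<partial>M)"
      using integral_abs_bound by metis
    also have "\<dots> \<le> (\<integral>w. b * (2 * (C * ?e + \<bar>X t w - X s w\<bar>)) \<partial>M)"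
      by (rule integral_mono) (use i s1 X1(1) pt in auto)
    also have "\<dots> = b * (2 * (C * ?e + (\<integral>w. \<bar>X t w - X s w\<bar> \<partial>M)))" using X1(1) prob_space by simp
    also have "\<dots> \<le> b * (2 * (C * ?e + 2 * K * ?e))"
    proof -
      have "2 * K * sqrt (t - s) \<le> 2 * K * ?e" by (rule mult_left_mono[OF sc(3)]) (use K_ge_1 in simp)
      then have "2 * (C * ?e + (\<integral>w. \<bar>X t w - X s w\<bar> \<partial>M)) \<le> 2 * (C * ?e + 2 * K * ?e)" by (rule mult_left_mono[OF add_left_mono[OF order_trans[OF X1(2)]]]) simp
      then show ?thesis using b0 by (rule mult_left_mono)
    qed
    also have "\<dots> = b * ?C * ?e" by (simp add: algebra_simps)
    finally show ?thesis unfolding P_def .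
  qed
  moreover have "0 \<le> ?C" using C(1) K_ge_1 by simp
  ultimately show ?thesis by blast
qed

lemma k_hoelder:
  "\<exists>C\<ge>0. \<forall>\<nu> \<delta> Y b s t. \<nu> \<in> prob_measures_01 \<and> 0 \<le> s \<and> s < t \<and> t \<le> 1 \<and>
    Y \<in> borel_measurable M \<and> (\<forall>w. \<bar>Y w\<bar> \<le> b) \<longrightarrow>
    \<bar>k1 \<nu> \<delta> Y t - k1 \<nu> \<delta> Y s\<bar> \<le> b * C * root 3 (t - s) \<and> \<bar>k2 \<nu> \<delta> Y t - k2 \<nu> \<delta> Y s\<bar> \<le> b * C * root 3 (t - s)"
proof -
  obtain C where C: "0 \<le> C" "\<And>\<nu>1 \<nu>2 \<delta>1 \<delta>2 Y b s t. \<nu>1 \<in> prob_measures_01 \<and> \<nu>2 \<in> prob_measures_01 \<and> 0 \<le> s \<and> s < t \<and> t \<le> 1 \<and>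
    Y \<in> borel_measurable M \<and> (\<forall>w. \<bar>Y w\<bar> \<le> b) \<Longrightarrow>
    \<bar>(\<integral>w. Y w * (dx_Phi \<xi> \<nu>1 t (X t w + \<delta>1) * dx_Phi \<xi> \<nu>2 t (X t w + \<delta>2)) \<partial>M)
      - (\<integral>w. Y w * (dx_Phi \<xi> \<nu>1 s (X s w + \<delta>1) * dx_Phi \<xi> \<nu>2 s (X s w + \<delta>2)) \<partial>M)\<bar> \<le> b * C * root 3 (t - s)"
    using product_hoelder by (elim exE conjE) blast
  show ?thesis
  proof (intro exI[of _ C] conjI allI impI C(1); elim conjE)
    fix \<nu> :: "real measure" and \<delta> :: real and Y :: "'a \<Rightarrow> real" and b s t :: real
    assume a: "\<nu> \<in> prob_measures_01" "0 \<le> s" "s < t" "t \<le> 1" "Y \<in> borel_measurable M" "\<forall>w. \<bar>Y w\<bar> \<le> b"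
    show "\<bar>k1 \<nu> \<delta> Y t - k1 \<nu> \<delta> Y s\<bar> \<le> b * C * root 3 (t - s)"
      using C(2)[of \<nu> \<mu> s t Y b \<delta> 0] a mu unfolding k1_def by simp
    show "\<bar>k2 \<nu> \<delta> Y t - k2 \<nu> \<delta> Y s\<bar> \<le> b * C * root 3 (t - s)"
      using C(2)[of \<nu> \<nu> s t Y b \<delta> \<delta>] a unfolding k2_def power2_eq_square by simp
  qed
qed

lemma k_bdd_meas:
  assumes "\<nu> \<in> prob_measures_01" "Y \<in> borel_measurable M" "\<And>w. \<bar>Y w\<bar> \<le> b"
  shows "bdd_meas (k1 \<nu> \<delta> Y)" "bdd_meas (k2 \<nu> \<delta> Y)"
proof -
  obtain C where C: "\<And>\<nu> \<delta> Y b s t. \<nu> \<in> prob_measures_01 \<and> 0 \<le> s \<and> s < t \<and> t \<le> 1 \<and>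
    Y \<in> borel_measurable M \<and> (\<forall>w. \<bar>Y w\<bar> \<le> b) \<Longrightarrow>
    \<bar>k1 \<nu> \<delta> Y t - k1 \<nu> \<delta> Y s\<bar> \<le> b * C * root 3 (t - s) \<and> \<bar>k2 \<nu> \<delta> Y t - k2 \<nu> \<delta> Y s\<bar> \<le> b * C * root 3 (t - s)"
    using k_hoelder by (elim exE conjE) blast
  show "bdd_meas (k1 \<nu> \<delta> Y)" "bdd_meas (k2 \<nu> \<delta> Y)"
    using C[of \<nu> _ _ Y b] assms by (intro bdd_meas_continuous hoelder_continuous[of _ "b * C"]; simp)+
qed

text \<open>The difference H of the two sides, as a function of the upper time, changes by at most d
  * w(d) over a step of length d, with w tending to 0. Both H and -H are therefore increasing, so H
  is constant.\<close>

lemma ito: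
  assumes nu: "\<nu> \<in> prob_measures_01" and qt: "0 \<le> q" "q \<le> t" "t \<le> 1"
    and Y: "Y \<in> borel_measurable (F q)" "\<And>w. \<bar>Y w\<bar> \<le> b"
  shows "(\<integral>w. Y w * (Phi \<xi> \<nu> t (X t w + \<delta>) - Phi \<xi> \<nu> q (X q w + \<delta>)) \<partial>M)
    = (LBINT r:{q..t}. alpha \<mu> r * \<zeta> r * k1 \<nu> \<delta> Y r - alpha \<nu> r * \<zeta> r * (k2 \<nu> \<delta> Y r / 2))"
proof -
  obtain C1 where C1: "0 \<le> C1" "\<And>\<nu> \<delta> Y b s t. \<nu> \<in> prob_measures_01 \<and> 0 \<le> s \<and> s < t \<and> t \<le> 1 \<and> Y \<in> borel_measurable (F s) \<and> (\<forall>w. \<bar>Y w\<bar> \<le> b) \<Longrightarrow>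
    \<bar>(\<integral>w. Y w * (Phi \<xi> \<nu> t (X t w + \<delta>) - Phi \<xi> \<nu> s (X s w + \<delta>)) \<partial>M) - (Aint \<mu> s t * k1 \<nu> \<delta> Y s - Aint \<nu> s t / 2 * k2 \<nu> \<delta> Y s)\<bar>
      \<le> b * C1 * ((t - s) * root 3 (t - s))"
    using ito_step by (elim exE conjE) blast
  obtain C2 where C2: "0 \<le> C2" "\<And>\<nu> \<delta> Y b s t. \<nu> \<in> prob_measures_01 \<and> 0 \<le> s \<and> s < t \<and> t \<le> 1 \<and>
    Y \<in> borel_measurable M \<and> (\<forall>w. \<bar>Y w\<bar> \<le> b) \<Longrightarrow>
    \<bar>k1 \<nu> \<delta> Y t - k1 \<nu> \<delta> Y s\<bar> \<le> b * C2 * root 3 (t - s) \<and> \<bar>k2 \<nu> \<delta> Y t - k2 \<nu> \<delta> Y s\<bar> \<le> b * C2 * root 3 (t - s)"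
    using k_hoelder by (elim exE conjE) blast
  have YM: "Y \<in> borel_measurable M" by (rule F_measurable_M[OF qt(1) Y(1)])
  have b0: "0 \<le> b" using order_trans[OF abs_ge_zero Y(2)] .
  let ?g = "\<lambda>r. alpha \<mu> r * \<zeta> r * k1 \<nu> \<delta> Y r - alpha \<nu> r * \<zeta> r * (k2 \<nu> \<delta> Y r / 2)"
  note kb = k_bdd_meas[OF nu YM Y(2), of \<delta>]
  have kb2: "bdd_meas (\<lambda>r. k2 \<nu> \<delta> Y r / 2)" using bdd_meas_mult[OF kb(2) bdd_meas_const[of "1/2"]] by simp
  note ba = bdd_meas_alpha_zeta[OF mu] bdd_meas_alpha_zeta[OF nu]
  have gb: "bdd_meas ?g" by (intro bdd_meas_diff bdd_meas_mult[OF ba(1) kb(1)] bdd_meas_mult[OF ba(2) kb2])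
  define N where "N r = (\<integral>w. Y w * Phi \<xi> \<nu> r (X r w + \<delta>) \<partial>M)" for r
  have Ni: "integrable M (\<lambda>w. Y w * Phi \<xi> \<nu> r (X r w + \<delta>))" if "0 \<le> r" "r \<le> 1" for r
    by (rule bounded_times_integrable[OF YM Y(2) Phi_X_integrable[OF nu that]])
  have Nd: "(\<integral>w. Y w * (Phi \<xi> \<nu> t (X t w + \<delta>) - Phi \<xi> \<nu> s (X s w + \<delta>)) \<partial>M) = N t - N s"
    if "0 \<le> s" "s \<le> 1" "0 \<le> t" "t \<le> 1" for s t
    unfolding N_def right_diff_distrib using Ni that by simp
  define H where "H r = N r - (LBINT v:{q..r}. ?g v)" for r
  let ?w = "\<lambda>d. (b * C1 + 2 * K * (b * C2)) * root 3 d"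
  have step: "\<bar>H t' - H s\<bar> \<le> (t' - s) * ?w (t' - s)" if st: "q \<le> s" "s < t'" "t' \<le> t" for s t'
  proof -
    let ?d = "t' - s" and ?e = "root 3 (t' - s)"
    have s1: "0 \<le> s" "t' \<le> 1" "s \<le> t'" "0 \<le> t'" "s \<le> 1" using st qt by auto
    have YF: "Y \<in> borel_measurable (F s)" by (rule F_measurable_mono[OF qt(1) st(1) Y(1)])
    have e0: "0 \<le> ?e" using st by simp
    have HH: "H t' - H s = (N t' - N s) - (LBINT v:{s..t'}. ?g v)"
      unfolding H_def using LBINT_split[OF gb qt(1) st(1) s1(3,2)] by simp
    have 1: "\<bar>(N t' - N s) - (Aint \<mu> s t' * k1 \<nu> \<delta> Y s - Aint \<nu> s t' / 2 * k2 \<nu> \<delta> Y s)\<bar> \<le> b * C1 * (?d * ?e)"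
      using C1(2)[of \<nu> s t' Y b \<delta>] nu s1 st YF Y(2) by (simp add: Nd)
    let ?c = "\<lambda>r. alpha \<mu> r * \<zeta> r * k1 \<nu> \<delta> Y s - alpha \<nu> r * \<zeta> r * (k2 \<nu> \<delta> Y s / 2)"
    have cb: "bdd_meas ?c" by (intro bdd_meas_diff bdd_meas_mult[OF ba(1)] bdd_meas_mult[OF ba(2)] bdd_meas_const)
    have "(LBINT v:{s..t'}. ?c v) = (LBINT v:{s..t'}. alpha \<mu> v * \<zeta> v * k1 \<nu> \<delta> Y s) - (LBINT v:{s..t'}. alpha \<nu> v * \<zeta> v * (k2 \<nu> \<delta> Y s / 2))"
      by (rule set_integral_diff(2); rule bdd_meas_integrable[OF bdd_meas_mult[OF _ bdd_meas_const] s1(1,2)]; rule ba)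
    also have "\<dots> = Aint \<mu> s t' * k1 \<nu> \<delta> Y s - Aint \<nu> s t' / 2 * k2 \<nu> \<delta> Y s"
      unfolding Aint_def by simp
    finally have ceq: "(LBINT v:{s..t'}. ?c v) = Aint \<mu> s t' * k1 \<nu> \<delta> Y s - Aint \<nu> s t' / 2 * k2 \<nu> \<delta> Y s" .
    have "\<bar>LBINT v:{s..t'}. ?g v - ?c v\<bar> \<le> (2 * K * (b * C2) * ?e) * ?d"
    proof (rule LBINT_bound[OF bdd_meas_diff[OF gb cb] s1(1,3,2)])
      fix v assume v: "s \<le> v" "v \<le> t'"
      have hk: "\<bar>k1 \<nu> \<delta> Y v - k1 \<nu> \<delta> Y s\<bar> \<le> b * C2 * ?e \<and> \<bar>k2 \<nu> \<delta> Y v - k2 \<nu> \<delta> Y s\<bar> \<le> b * C2 * ?e"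
      proof (cases "s = v")
        case True then show ?thesis using b0 C2(1) e0 by simp
      next
        case False
        then have "\<bar>k1 \<nu> \<delta> Y v - k1 \<nu> \<delta> Y s\<bar> \<le> b * C2 * root 3 (v - s) \<and> \<bar>k2 \<nu> \<delta> Y v - k2 \<nu> \<delta> Y s\<bar> \<le> b * C2 * root 3 (v - s)"
          using C2(2)[of \<nu> s v Y b \<delta>] nu YM Y(2) v s1 by simp
        moreover have "b * C2 * root 3 (v - s) \<le> b * C2 * ?e" by (rule mult_left_mono) (use v b0 C2(1) in auto)
        ultimately show ?thesis by linarith
      qed
      have az: "\<bar>alpha \<nu>' v * \<zeta> v\<bar> \<le> K" if "\<nu>' \<in> prob_measures_01" for \<nu>'
      proof -
        have "\<bar>alpha \<nu>' v\<bar> * \<bar>\<zeta> v\<bar> \<le> 1 * K" using alpha_nonneg[OF that] alpha_le_1[OF that] zeta_nonneg[of v] zeta_le[of v] v s1 K_ge_1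
          by (intro mult_mono) auto
        then show ?thesis by (simp add: abs_mult)
      qed
      have eq: "?g v - ?c v = alpha \<mu> v * \<zeta> v * (k1 \<nu> \<delta> Y v - k1 \<nu> \<delta> Y s) - alpha \<nu> v * \<zeta> v * (k2 \<nu> \<delta> Y v - k2 \<nu> \<delta> Y s) / 2"
        by (simp add: algebra_simps diff_divide_distrib)
      have p1: "\<bar>alpha \<mu> v * \<zeta> v * (k1 \<nu> \<delta> Y v - k1 \<nu> \<delta> Y s)\<bar> \<le> K * (b * C2 * ?e)"
        unfolding abs_mult[of "alpha \<mu> v * \<zeta> v"] by (rule mult_mono[OF az[OF mu]]) (use hk K_ge_1 in auto)
      have p2: "\<bar>alpha \<nu> v * \<zeta> v * (k2 \<nu> \<delta> Y v - k2 \<nu> \<delta> Y s)\<bar> \<le> K * (b * C2 * ?e)"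
        unfolding abs_mult[of "alpha \<nu> v * \<zeta> v"] by (rule mult_mono[OF az[OF nu]]) (use hk K_ge_1 in auto)
      have "\<bar>x - y / 2\<bar> \<le> 2 * z" if "\<bar>x\<bar> \<le> z" "\<bar>y\<bar> \<le> z" for x y z :: real using that by linarith
      from this[OF p1 p2] show "\<bar>?g v - ?c v\<bar> \<le> 2 * K * (b * C2) * ?e" unfolding eq by (simp add: mult_ac)
    qed
    moreover have "(LBINT v:{s..t'}. ?g v - ?c v) = (LBINT v:{s..t'}. ?g v) - (LBINT v:{s..t'}. ?c v)"
      by (rule set_integral_diff(2); rule bdd_meas_integrable[OF _ s1(1,2)]; rule gb cb)
    ultimately have 2: "\<bar>(LBINT v:{s..t'}. ?g v) - (Aint \<mu> s t' * k1 \<nu> \<delta> Y s - Aint \<nu> s t' / 2 * k2 \<nu> \<delta> Y s)\<bar> \<le> (2 * K * (b * C2) * ?e) * ?d"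
      unfolding ceq by simp
    have "\<bar>x - y\<bar> \<le> A + B" if "\<bar>x - z\<bar> \<le> A" "\<bar>y - z\<bar> \<le> B" for x y z A B :: real using that by linarith
    from this[OF 1 2] have "\<bar>H t' - H s\<bar> \<le> b * C1 * (?d * ?e) + (2 * K * (b * C2) * ?e) * ?d" unfolding HH .
    also have "\<dots> = ?d * ?w ?d" by (simp add: algebra_simps)
    finally show ?thesis .
  qed
  have w0: "(?w \<longlongrightarrow> 0) (at_right 0)"
  proof -
    have "(?w \<longlongrightarrow> ?w 0) (at_right 0)" by (intro tendsto_intros)
    then show ?thesis by simp
  qed
  have "H q \<le> H t"
  proof (rule increasing_up_to_small_error[OF qt(2) _ w0])
    fix s t' assume "q \<le> s" "s < t'" "t' \<le> t"
    from step[OF this] show "H s \<le> H t' + (t' - s) * ?w (t' - s)" by linarith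
  qed
  moreover have "- H q \<le> - H t"
  proof (rule increasing_up_to_small_error[OF qt(2) _ w0, of "\<lambda>r. - H r"])
    fix s t' assume "q \<le> s" "s < t'" "t' \<le> t"
    from step[OF this] show "- H s \<le> - H t' + (t' - s) * ?w (t' - s)" by linarith
  qed
  ultimately have "H t = H q" by linarith
  moreover have "H q = N q" unfolding H_def LBINT_point by simp
  ultimately have "N t - N q = (LBINT v:{q..t}. ?g v)" unfolding H_def by linarith
  then show ?thesis using Nd[of q t] qt by simp
qed

subsection \<open>The martingale of derivatives\<close>

text \<open>Ito's formula for the shift \<delta> minus the one for 0. The left sides differ by
  \<delta> times the change of E Y u, up to order \<delta>^2. On the right, with v and p the
  gradients at X and at X + \<delta>, k1 - k2 / 2 is the mean of Y (p v - p^2 / 2), which is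
  stationary at p = v: it changes by the mean of Y (p - v)^2 / 2, again of order \<delta>^2.
  Dividing by \<delta> gives the claim without third derivatives.\<close>

lemma dx_martingale:
  assumes qt: "0 \<le> q" "q \<le> t" "t \<le> 1" and Y: "Y \<in> borel_measurable (F q)" "\<And>w. \<bar>Y w\<bar> \<le> b"
  shows "(\<integral>w. Y w * u t (X t w) \<partial>M) = (\<integral>w. Y w * u q (X q w) \<partial>M)"
proof -
  have YM: "Y \<in> borel_measurable M" by (rule F_measurable_M[OF qt(1) Y(1)])
  have b0: "0 \<le> b" using order_trans[OF abs_ge_zero Y(2)] .
  note bi = bounded_times_integrable[OF YM Y(2)]
  note bd = bi[OF bounded_integrable]
  define I where "I \<delta> r = alpha \<mu> r * \<zeta> r * k1 \<mu> \<delta> Y r - alpha \<mu> r * \<zeta> r * (k2 \<mu> \<delta> Y r / 2)" for \<delta> r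
  define E where "E r = (\<integral>w. Y w * u r (X r w) \<partial>M)" for r
  have um: "(\<lambda>w. u r (X r w + \<delta>)) \<in> borel_measurable M" if "0 \<le> r" "r \<le> 1" for r \<delta>
    by (rule dx_X_measurable[OF mu that])
  have um0: "(\<lambda>w. u r (X r w)) \<in> borel_measurable M" if "0 \<le> r" "r \<le> 1" for r
    using um[OF that, of 0] by simp
  note ub = dx_Phi_bound[OF mu]
  have Ib: "bdd_meas (I \<delta>)" for \<delta>
    unfolding I_def using k_bdd_meas[OF mu YM Y(2), of \<delta>] bdd_meas_mult[OF k_bdd_meas(2)[OF mu YM Y(2), of \<delta>] bdd_meas_const[of "1/2"]]
    by (intro bdd_meas_diff bdd_meas_mult[OF bdd_meas_alpha_zeta[OF mu]]) simp_all
  have Idiff: "\<bar>I \<delta> r - I 0 r\<bar> \<le> K * (b * \<delta>\<^sup>2)" if r: "0 \<le> r" "r \<le> 1" for \<delta> r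
  proof -
    define p where "p w = u r (X r w + \<delta>)" for w
    define v where "v w = u r (X r w)" for w
    have pm: "p \<in> borel_measurable M" and vm: "v \<in> borel_measurable M"
      unfolding p_def v_def by (rule um[OF r], rule um0[OF r])
    have pb: "\<bar>p w\<bar> \<le> 1" and vb: "\<bar>v w\<bar> \<le> 1" for w unfolding p_def v_def by (rule ub[OF r])+
    have i1: "integrable M (\<lambda>w. Y w * (p w * v w))"
      by (rule bd[of _ 1]) (use pm vm mult_mono[OF pb vb] in \<open>auto simp: abs_mult\<close>)
    have i2: "integrable M (\<lambda>w. Y w * (p w)\<^sup>2)"
      by (rule bd[of _ 1]) (use pm pb in \<open>auto simp: abs_square_le_1\<close>)
    have i3: "integrable M (\<lambda>w. Y w * (v w)\<^sup>2)"
      by (rule bd[of _ 1]) (use vm vb in \<open>auto simp: abs_square_le_1\<close>)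
    have k: "k1 \<mu> \<delta> Y r = (\<integral>w. Y w * (p w * v w) \<partial>M)" "k2 \<mu> \<delta> Y r = (\<integral>w. Y w * (p w)\<^sup>2 \<partial>M)"
      "k1 \<mu> 0 Y r = (\<integral>w. Y w * (v w)\<^sup>2 \<partial>M)" "k2 \<mu> 0 Y r = (\<integral>w. Y w * (v w)\<^sup>2 \<partial>M)"
      unfolding k1_def k2_def p_def v_def by (simp_all add: power2_eq_square)
    have "k1 \<mu> \<delta> Y r - k2 \<mu> \<delta> Y r / 2 - (k1 \<mu> 0 Y r - k2 \<mu> 0 Y r / 2)
        = (\<integral>w. Y w * (p w * v w) - Y w * (p w)\<^sup>2 / 2 - (Y w * (v w)\<^sup>2 - Y w * (v w)\<^sup>2 / 2) \<partial>M)"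
      unfolding k using i1 i2 i3 by simp
    also have "\<dots> = (\<integral>w. - (Y w * (p w - v w)\<^sup>2 / 2) \<partial>M)"
      by (rule Bochner_Integration.integral_cong) (auto simp: power2_eq_square algebra_simps add_divide_distrib diff_divide_distrib)
    also have "\<bar>\<dots>\<bar> \<le> b * \<delta>\<^sup>2"
    proof (rule bounded_integral)
      show "(\<lambda>w. - (Y w * (p w - v w)\<^sup>2 / 2)) \<in> borel_measurable M" using pm vm YM by simp
      fix w
      have "\<bar>p w - v w\<bar> \<le> \<bar>\<delta>\<bar>" unfolding p_def v_def using dx_Phi_lip[OF mu r, of "X r w + \<delta>" "X r w"] by simp
      then have "(p w - v w)\<^sup>2 \<le> \<delta>\<^sup>2" by (simp only: abs_le_square_iff)
      then have "\<bar>Y w\<bar> * \<bar>(p w - v w)\<^sup>2\<bar> \<le> b * \<delta>\<^sup>2" using Y(2) b0 by (intro mult_mono) auto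
      then have "\<bar>Y w * (p w - v w)\<^sup>2\<bar> \<le> b * \<delta>\<^sup>2" by (simp only: abs_mult)
      moreover have "\<bar>- (z / 2)\<bar> \<le> c" if "\<bar>z\<bar> \<le> c" for z c :: real using that by linarith
      ultimately show "\<bar>- (Y w * (p w - v w)\<^sup>2 / 2)\<bar> \<le> b * \<delta>\<^sup>2" by blast
    qed
    finally have kd: "\<bar>k1 \<mu> \<delta> Y r - k2 \<mu> \<delta> Y r / 2 - (k1 \<mu> 0 Y r - k2 \<mu> 0 Y r / 2)\<bar> \<le> b * \<delta>\<^sup>2" .
    have eq: "I \<delta> r - I 0 r = (alpha \<mu> r * \<zeta> r) * (k1 \<mu> \<delta> Y r - k2 \<mu> \<delta> Y r / 2 - (k1 \<mu> 0 Y r - k2 \<mu> 0 Y r / 2))"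
      unfolding I_def by (simp add: algebra_simps)
    have "\<bar>alpha \<mu> r\<bar> * \<bar>\<zeta> r\<bar> \<le> 1 * K" using alpha_nonneg[OF mu] alpha_le_1[OF mu] zeta_nonneg[of r] zeta_le[of r] r K_ge_1
      by (intro mult_mono) auto
    then show ?thesis unfolding eq abs_mult using kd K_ge_1 by (intro mult_mono) auto
  qed
  \<comment> \<open>K comes from the integrand over an interval of length at most 1, and 2 from the
    Taylor remainders at t and at q.\<close>
  have key: "\<delta> * \<bar>E t - E q\<bar> \<le> \<delta> * (\<delta> * ((K + 2) * b))" if d: "0 < \<delta>" for \<delta>
  proof -
    define D where "D r = (\<integral>w. Y w * Phi \<xi> \<mu> r (X r w + \<delta>) \<partial>M) - (\<integral>w. Y w * Phi \<xi> \<mu> r (X r w) \<partial>M)" for r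
    have Pi: "integrable M (\<lambda>w. Y w * Phi \<xi> \<mu> r (X r w + \<delta>))" "integrable M (\<lambda>w. Y w * Phi \<xi> \<mu> r (X r w))" if "0 \<le> r" "r \<le> 1" for r
      using bi[OF Phi_X_integrable[OF mu that, of \<delta>]] bi[OF Phi_X_integrable[OF mu that, of 0]] by simp_all
    have Dq: "\<bar>D r - \<delta> * E r\<bar> \<le> b * \<delta>\<^sup>2" if r: "0 \<le> r" "r \<le> 1" for r
    proof -
      have ui: "integrable M (\<lambda>w. Y w * u r (X r w))" by (rule bd[OF um0[OF r] ub[OF r]])
      have "D r - \<delta> * E r = (\<integral>w. Y w * Phi \<xi> \<mu> r (X r w + \<delta>) - Y w * Phi \<xi> \<mu> r (X r w) - \<delta> * (Y w * u r (X r w)) \<partial>M)"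
        unfolding D_def E_def using Pi[OF r] ui by simp
      also have "\<bar>\<dots>\<bar> \<le> b * \<delta>\<^sup>2"
      proof (rule bounded_integral)
        show "(\<lambda>w. Y w * Phi \<xi> \<mu> r (X r w + \<delta>) - Y w * Phi \<xi> \<mu> r (X r w) - \<delta> * (Y w * u r (X r w))) \<in> borel_measurable M"
          using Pi[OF r] ui by (intro borel_measurable_diff borel_measurable_times borel_measurable_const borel_measurable_integrable)
        fix w
        have "\<bar>Phi \<xi> \<mu> r (X r w + \<delta>) - Phi \<xi> \<mu> r (X r w) - u r (X r w) * \<delta>\<bar> \<le> \<delta>\<^sup>2"
          by (rule smooth2_taylor0[OF Phi_smooth2[OF mu r]])
        then have "\<bar>Y w\<bar> * \<bar>Phi \<xi> \<mu> r (X r w + \<delta>) - Phi \<xi> \<mu> r (X r w) - u r (X r w) * \<delta>\<bar> \<le> b * \<delta>\<^sup>2"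
          using Y(2) b0 by (intro mult_mono) auto
        then show "\<bar>Y w * Phi \<xi> \<mu> r (X r w + \<delta>) - Y w * Phi \<xi> \<mu> r (X r w) - \<delta> * (Y w * u r (X r w))\<bar> \<le> b * \<delta>\<^sup>2"
          unfolding abs_mult[symmetric] by (simp add: algebra_simps)
      qed
      finally show ?thesis .
    qed
    have s1: "0 \<le> q" "q \<le> 1" "0 \<le> t" "t \<le> 1" using qt by auto
    have eq1: "(\<integral>w. Y w * Phi \<xi> \<mu> t (X t w + \<delta>) \<partial>M) - (\<integral>w. Y w * Phi \<xi> \<mu> q (X q w + \<delta>) \<partial>M) = (LBINT r:{q..t}. I \<delta> r)"
      using ito[OF mu qt Y, of \<delta>] Pi[OF s1(1,2)] Pi[OF s1(3,4)] unfolding I_def right_diff_distrib by simp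
    have eq2: "(\<integral>w. Y w * Phi \<xi> \<mu> t (X t w) \<partial>M) - (\<integral>w. Y w * Phi \<xi> \<mu> q (X q w) \<partial>M) = (LBINT r:{q..t}. I 0 r)"
      using ito[OF mu qt Y, of 0] Pi[OF s1(1,2)] Pi[OF s1(3,4)] unfolding I_def right_diff_distrib by simp
    have eq3: "D t - D q = (LBINT r:{q..t}. I \<delta> r - I 0 r)"
      using set_integral_diff(2)[OF bdd_meas_integrable[OF Ib qt(1,3)] bdd_meas_integrable[OF Ib qt(1,3)], of \<delta> 0] eq1 eq2
      unfolding D_def by linarith
    have "\<bar>LBINT r:{q..t}. I \<delta> r - I 0 r\<bar> \<le> K * (b * \<delta>\<^sup>2) * (t - q)"
      by (rule LBINT_bound[OF bdd_meas_diff[OF Ib Ib] qt]) (use Idiff qt in auto)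
    also have "\<dots> \<le> K * (b * \<delta>\<^sup>2) * 1" by (rule mult_left_mono) (use qt b0 K_ge_1 in auto)
    finally have 3: "\<bar>D t - D q\<bar> \<le> K * (b * \<delta>\<^sup>2)" unfolding eq3 by simp
    have "\<bar>x - y\<bar> \<le> A + B + B" if "\<bar>dt - x\<bar> \<le> B" "\<bar>dq - y\<bar> \<le> B" "\<bar>dt - dq\<bar> \<le> A" for x y dt dq A B :: real
      using that by linarith
    from this[OF Dq[OF s1(3,4)] Dq[OF s1(1,2)] 3]
    have "\<bar>\<delta> * (E t - E q)\<bar> \<le> K * (b * \<delta>\<^sup>2) + b * \<delta>\<^sup>2 + b * \<delta>\<^sup>2" by (simp add: right_diff_distrib)
    also have "\<dots> = \<delta> * (\<delta> * ((K + 2) * b))" by (simp add: power2_eq_square algebra_simps)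
    finally show ?thesis using d by (simp add: abs_mult)
  qed
  have "\<bar>E t - E q\<bar> \<le> 0"
  proof (rule tendsto_lowerbound[of "\<lambda>\<delta>. \<delta> * ((K + 2) * b)" _ "at_right 0"])
    have "((\<lambda>\<delta>. \<delta> * ((K + 2) * b)) \<longlongrightarrow> 0 * ((K + 2) * b)) (at_right 0)" by (intro tendsto_intros)
    then show "((\<lambda>\<delta>. \<delta> * ((K + 2) * b)) \<longlongrightarrow> 0) (at_right 0)" by simp
    show "\<forall>\<^sub>F \<delta> in at_right 0. \<bar>E t - E q\<bar> \<le> \<delta> * ((K + 2) * b)"
      by (rule eventually_at_right_less[THEN eventually_mono]) (use key in \<open>auto simp: mult_le_cancel_left\<close>)
  qed simp
  then show ?thesis unfolding E_def by simp
qed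

section \<open>The second moment of the gradient along X\<close>

definition "psi s = (\<integral>w. (u s (X s w))\<^sup>2 \<partial>M)"

lemma psi_continuous: "continuous_on {0..1} psi"
proof -
  obtain C where C: "\<And>\<nu> \<delta> Y b s t. \<nu> \<in> prob_measures_01 \<and> 0 \<le> s \<and> s < t \<and> t \<le> 1 \<and>
    Y \<in> borel_measurable M \<and> (\<forall>w. \<bar>Y w\<bar> \<le> b) \<Longrightarrow>
    \<bar>k1 \<nu> \<delta> Y t - k1 \<nu> \<delta> Y s\<bar> \<le> b * C * root 3 (t - s) \<and> \<bar>k2 \<nu> \<delta> Y t - k2 \<nu> \<delta> Y s\<bar> \<le> b * C * root 3 (t - s)"
    using k_hoelder by (elim exE conjE) blast
  have "psi = k2 \<mu> 0 (\<lambda>_. 1)" unfolding psi_def k2_def by (simp add: fun_eq_iff)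
  then show ?thesis
    by (intro hoelder_continuous[of _ C]) (use C[of \<mu> _ _ "\<lambda>_. 1" 1 0] mu in simp)
qed

lemma dx_X0_measurable: "0 \<le> s \<Longrightarrow> s \<le> 1 \<Longrightarrow> (\<lambda>w. u s (X s w)) \<in> borel_measurable M"
  using dx_X_measurable[OF mu, of s 0] by simp

lemma dx_X0_product_integrable:
  assumes "0 \<le> s" "s \<le> 1" "0 \<le> t" "t \<le> 1"
  shows "integrable M (\<lambda>w. u s (X s w) * u t (X t w))"
  by (rule bounded_times_integrable[OF dx_X0_measurable[OF assms(1,2)] dx_Phi_bound[OF mu assms(1,2)]
        bounded_integrable[OF dx_X0_measurable[OF assms(3,4)] dx_Phi_bound[OF mu assms(3,4)]]])

lemma psi_nonneg: "0 \<le> psi s"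
  unfolding psi_def by simp

lemma psi_le_1: "0 \<le> s \<Longrightarrow> s \<le> 1 \<Longrightarrow> psi s \<le> 1"
proof -
  assume s: "0 \<le> s" "s \<le> 1"
  have "\<bar>\<integral>w. (u s (X s w))\<^sup>2 \<partial>M\<bar> \<le> 1"
    by (rule bounded_integral) (use dx_X0_measurable[OF s] dx_Phi_bound[OF mu s] in \<open>auto simp: abs_square_le_1\<close>)
  then show ?thesis unfolding psi_def by simp
qed

text \<open>Orthogonality of martingale increments: the mixed term is evaluated by taking
  \<open>u q (X q w)\<close> itself as the test variable.\<close>

lemma psi_increment:
  assumes "0 \<le> q" "q \<le> t" "t \<le> 1"
  shows "psi t - psi q = (\<integral>w. (u t (X t w) - u q (X q w))\<^sup>2 \<partial>M)"
proof -
  have s1: "0 \<le> q" "q \<le> 1" "0 \<le> t" "t \<le> 1" using assms by auto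
  have "(\<integral>w. u q (X q w) * u t (X t w) \<partial>M) = (\<integral>w. u q (X q w) * u q (X q w) \<partial>M)"
    by (rule dx_martingale[OF assms comp_X_measurable0(1)[OF dx_Phi_measurable[OF mu s1(1,2)] s1(1,2)] dx_Phi_bound[OF mu s1(1,2)]])
  moreover have "(\<integral>w. (u t (X t w) - u q (X q w))\<^sup>2 \<partial>M)
      = (\<integral>w. u t (X t w) * u t (X t w) - 2 * (u q (X q w) * u t (X t w)) + u q (X q w) * u q (X q w) \<partial>M)"
    by (rule Bochner_Integration.integral_cong) (auto simp: power2_eq_square algebra_simps)
  moreover have "\<dots> = (\<integral>w. u t (X t w) * u t (X t w) \<partial>M) - 2 * (\<integral>w. u q (X q w) * u t (X t w) \<partial>M) + (\<integral>w. u q (X q w) * u q (X q w) \<partial>M)"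
    using dx_X0_product_integrable s1 by simp
  ultimately show ?thesis unfolding psi_def power2_eq_square by simp
qed

text \<open>The increment of u along X is p \<Delta> + R, with p the second derivative at time q and
  E R^2 of order d^(4/3). As p is known at time q, the mean of p^2 \<Delta>^2 is exact, and
  \<open>square_lower\<close> separates R from it.\<close>

lemma psi_increment_lower:
  "\<exists>C\<ge>0. \<forall>q t \<eta>. 0 \<le> q \<and> q < t \<and> t \<le> 1 \<and> 0 < \<eta> \<longrightarrow>
    (1 - \<eta>) * ((\<rho> t - \<rho> q) * (\<integral>w. (dxx_Phi \<xi> \<mu> q (X q w))\<^sup>2 \<partial>M)) - C * ((t - q) * root 3 (t - q)) / \<eta> \<le> psi t - psi q"
proof -
  obtain C1 where C1: "0 \<le> C1" "\<And>s t. 0 \<le> s \<and> s < t \<and> t \<le> 1 \<Longrightarrow> (\<exists>\<Delta> R. noise s t \<Delta> \<and> integrable M R \<and> (\<integral>w. R w \<partial>M) \<le> C1 * ((t - s) * root 3 (t - s)) \<and>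
     (AE w in M. \<bar>X t w - X s w - \<Delta> w\<bar> \<le> K * (t - s)) \<and>
     (AE w in M. \<bar>X t w - X s w - \<Delta> w - u s (X s w) * Aint \<mu> s t\<bar> \<le> R w))"
    using increment by (elim exE conjE) blast
  obtain C2 where C2: "0 \<le> C2" "\<And>\<nu> s t x y. \<nu> \<in> prob_measures_01 \<Longrightarrow> s \<in> {0..1} \<Longrightarrow> t \<in> {0..1} \<Longrightarrow>
    \<bar>dx_Phi \<xi> \<nu> s x - dx_Phi \<xi> \<nu> t y\<bar> \<le> C2 * (root 3 \<bar>s - t\<bar>)\<^sup>2 + \<bar>x - y\<bar>"
    using dx_Phi_joint by blast
  define A where "A = C2 + K + 2 * L * K\<^sup>2"
  \<comment> \<open>Squaring A e^2 + 2 L \<Delta>^2, with e^4 = d e, gives 2 A^2 and 8 L^2; the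
    fourth moment of \<Delta> turns the 8 into 24.\<close>
  let ?C = "2 * A\<^sup>2 + 24 * L\<^sup>2 * K\<^sup>2"
  have L0: "0 \<le> L" using L_pos by simp
  have "(1 - \<eta>) * ((\<rho> t - \<rho> q) * (\<integral>w. (dxx_Phi \<xi> \<mu> q (X q w))\<^sup>2 \<partial>M)) - ?C * ((t - q) * root 3 (t - q)) / \<eta> \<le> psi t - psi q"
    if st: "0 \<le> q" "q < t" "t \<le> 1" and \<eta>: "0 < \<eta>" for q t \<eta>
  proof -
    let ?d = "t - q" and ?e = "root 3 (t - q)"
    have d: "0 \<le> ?d" "?d \<le> 1" using st by auto
    note sc = scale_bounds[OF d]
    have s1: "0 \<le> q" "q \<le> 1" "0 \<le> t" "t \<le> 1" using st by auto
    obtain \<Delta> where N: "noise q t \<Delta>" and ae: "AE w in M. \<bar>X t w - X q w - \<Delta> w\<bar> \<le> K * ?d"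
      using C1(2)[of q t] st by blast
    note ND = noiseD[OF N]
    define p where "p w = dxx_Phi \<xi> \<mu> q (X q w)" for w
    note S = Phi_smooth2[OF mu s1(1,2)]
    have pF: "p \<in> borel_measurable (F q)" unfolding p_def
      by (rule comp_X_measurable0(1)[OF dxx_Phi_measurable[OF mu s1(1,2)] s1(1,2)])
    have pM: "p \<in> borel_measurable M" by (rule F_measurable_M[OF st(1) pF])
    have pb: "\<bar>p w\<bar> \<le> 1" for w unfolding p_def by (rule smooth2_bounds(2)[OF S])
    define R where "R w = u t (X t w) - u q (X q w) - p w * \<Delta> w" for w
    have de: "?d \<le> ?e\<^sup>2" "?d\<^sup>2 \<le> ?e\<^sup>2" "?d\<^sup>2 \<le> ?d * ?e"
    proof -
      have d3: "?d = ?e ^ 3" using d by simp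
      have "?e ^ 3 \<le> ?e\<^sup>2" using sc(1,2) by (intro power_decreasing) auto
      then show 1: "?d \<le> ?e\<^sup>2" using d3 by simp
      have "?d * ?d \<le> ?d * 1" by (rule mult_left_mono) (use d in auto)
      then show "?d\<^sup>2 \<le> ?e\<^sup>2" using 1 by (simp add: power2_eq_square)
      show "?d\<^sup>2 \<le> ?d * ?e" unfolding power2_eq_square by (rule mult_left_mono) (use d sc in auto)
    qed
    have Rb: "AE w in M. (R w)\<^sup>2 \<le> 2 * A\<^sup>2 * (?d * ?e) + 8 * L\<^sup>2 * (\<Delta> w) ^ 4"
      using ae
    proof eventually_elim
      fix w assume a: "\<bar>X t w - X q w - \<Delta> w\<bar> \<le> K * ?d"
      let ?x = "X t w - X q w"
      have r1: "\<bar>u t (X t w) - u q (X t w)\<bar> \<le> C2 * ?e\<^sup>2"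
        using C2(2)[OF mu, of t q "X t w" "X t w"] st by simp
      have r2: "\<bar>u q (X t w) - u q (X q w) - p w * ?x\<bar> \<le> L * ?x\<^sup>2"
        using smooth2_taylor1[OF S, of "X q w" ?x] unfolding p_def by simp
      have x2: "?x\<^sup>2 \<le> 2 * (\<Delta> w)\<^sup>2 + 2 * (K * ?d)\<^sup>2"
      proof -
        have "(?x - \<Delta> w)\<^sup>2 \<le> (K * ?d)\<^sup>2" using a by (intro abs_le_square_iff[THEN iffD1]) (simp add: abs_of_nonneg)
        moreover have "x\<^sup>2 \<le> 2 * y\<^sup>2 + 2 * (x - y)\<^sup>2" for x y :: real
        proof -
          have "0 \<le> (x - 2 * y)\<^sup>2" by simp
          then show ?thesis by (simp add: power2_eq_square algebra_simps)
        qed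
        ultimately show ?thesis using order_trans by (smt (verit))
      qed
      have r3: "\<bar>p w * (?x - \<Delta> w)\<bar> \<le> K * ?e\<^sup>2"
      proof -
        have "\<bar>p w * (?x - \<Delta> w)\<bar> \<le> 1 * (K * ?d)" unfolding abs_mult using pb a by (intro mult_mono) auto
        also have "\<dots> \<le> K * ?e\<^sup>2" unfolding mult_1 by (rule mult_left_mono[OF de(1)]) (use K_ge_1 in simp)
        finally show ?thesis .
      qed
      have r4: "L * ?x\<^sup>2 \<le> 2 * L * (\<Delta> w)\<^sup>2 + 2 * L * K\<^sup>2 * ?e\<^sup>2"
      proof -
        have "L * ?x\<^sup>2 \<le> L * (2 * (\<Delta> w)\<^sup>2 + 2 * (K * ?d)\<^sup>2)" by (rule mult_left_mono[OF x2 L0])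
        also have "\<dots> = 2 * L * (\<Delta> w)\<^sup>2 + 2 * L * K\<^sup>2 * ?d\<^sup>2" unfolding power_mult_distrib by (simp add: distrib_left)
        also have "\<dots> \<le> 2 * L * (\<Delta> w)\<^sup>2 + 2 * L * K\<^sup>2 * ?e\<^sup>2"
          by (rule add_left_mono, rule mult_left_mono[OF de(2)]) (use L0 in simp)
        finally show ?thesis .
      qed
      have sum: "\<bar>r + s + v\<bar> \<le> a + c + (k + l)" if "\<bar>r\<bar> \<le> a" "\<bar>s\<bar> \<le> b" "\<bar>v\<bar> \<le> c" "b \<le> k + l" for r s v a b c k l :: real
        using that by linarith
      have Req: "R w = (u t (X t w) - u q (X t w)) + (u q (X t w) - u q (X q w) - p w * ?x) + p w * (?x - \<Delta> w)"
        unfolding R_def by (simp add: algebra_simps)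
      have "\<bar>R w\<bar> \<le> C2 * ?e\<^sup>2 + K * ?e\<^sup>2 + (2 * L * (\<Delta> w)\<^sup>2 + 2 * L * K\<^sup>2 * ?e\<^sup>2)"
        unfolding Req by (rule sum[OF r1 r2 r3 r4])
      also have "\<dots> = A * ?e\<^sup>2 + 2 * L * (\<Delta> w)\<^sup>2" unfolding A_def by (simp add: algebra_simps)
      finally have "(R w)\<^sup>2 \<le> (A * ?e\<^sup>2 + 2 * L * (\<Delta> w)\<^sup>2)\<^sup>2"
        by (intro abs_le_square_iff[THEN iffD1]) (simp only: abs_of_nonneg[OF order_trans[OF abs_ge_zero]])
      also have "\<dots> \<le> 2 * (A * ?e\<^sup>2)\<^sup>2 + 2 * (2 * L * (\<Delta> w)\<^sup>2)\<^sup>2"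
      proof -
        have "(x + y)\<^sup>2 \<le> 2 * x\<^sup>2 + 2 * y\<^sup>2" for x y :: real
        proof -
          have "0 \<le> (x - y)\<^sup>2" by simp
          then show ?thesis by (simp add: power2_eq_square algebra_simps)
        qed
        then show ?thesis .
      qed
      also have "\<dots> = 2 * A\<^sup>2 * (?e ^ 4) + 8 * L\<^sup>2 * (\<Delta> w) ^ 4"
        by (simp add: power_mult_distrib flip: power_mult)
      finally show "(R w)\<^sup>2 \<le> 2 * A\<^sup>2 * (?d * ?e) + 8 * L\<^sup>2 * (\<Delta> w) ^ 4" unfolding sc(6) .
    qed
    have Rm: "R \<in> borel_measurable M" unfolding R_def using dx_X0_measurable[OF s1(1,2)] dx_X0_measurable[OF s1(3,4)] pM ND(1) by simp
    have bi: "integrable M (\<lambda>w. 2 * A\<^sup>2 * (?d * ?e) + 8 * L\<^sup>2 * (\<Delta> w) ^ 4)" using ND(2) by simp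
    have R2i: "integrable M (\<lambda>w. (R w)\<^sup>2)"
      by (rule Bochner_Integration.integrable_bound[OF bi]) (use Rm Rb in \<open>auto elim!: eventually_mono intro: order_trans[OF _ abs_ge_self]\<close>)
    have "(\<integral>w. (R w)\<^sup>2 \<partial>M) \<le> (\<integral>w. 2 * A\<^sup>2 * (?d * ?e) + 8 * L\<^sup>2 * (\<Delta> w) ^ 4 \<partial>M)"
      by (rule integral_mono_AE[OF R2i bi Rb])
    also have "\<dots> = 2 * A\<^sup>2 * (?d * ?e) + 8 * L\<^sup>2 * (\<integral>w. (\<Delta> w) ^ 4 \<partial>M)" using ND(2) prob_space by simp
    also have "\<dots> \<le> 2 * A\<^sup>2 * (?d * ?e) + 8 * L\<^sup>2 * (3 * (K\<^sup>2 * (?d * ?e)))"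
    proof (rule add_left_mono, rule mult_left_mono)
      have "(\<rho> t - \<rho> q)\<^sup>2 \<le> (K * ?d)\<^sup>2" using rho_diff[of q t] st by (intro power_mono) auto
      also have "\<dots> \<le> K\<^sup>2 * (?d * ?e)" unfolding power_mult_distrib by (rule mult_left_mono[OF de(3)]) simp
      finally show "(\<integral>w. (\<Delta> w) ^ 4 \<partial>M) \<le> 3 * (K\<^sup>2 * (?d * ?e))" using ND(3) by linarith
    qed simp
    also have "\<dots> = ?C * (?d * ?e)" by (simp add: algebra_simps)
    finally have ER: "(\<integral>w. (R w)\<^sup>2 \<partial>M) \<le> ?C * (?d * ?e)" .
    have p2b: "\<bar>(p w)\<^sup>2\<bar> \<le> 1" for w using pb[of w] by (simp add: abs_square_le_1)
    have E2: "(\<integral>w. (p w)\<^sup>2 * (\<Delta> w)\<^sup>2 \<partial>M) = (\<integral>w. (p w)\<^sup>2 \<partial>M) * (\<rho> t - \<rho> q)"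
      by (rule ND(5)[OF borel_measurable_power[OF pF] p2b])
    have \<Delta>2: "integrable M (\<lambda>w. (\<Delta> w)\<^sup>2)" using integrable_power_le[OF ND(1,2), of 2] by simp
    have i2: "integrable M (\<lambda>w. (p w)\<^sup>2 * (\<Delta> w)\<^sup>2)"
      by (rule bounded_times_integrable[OF borel_measurable_power[OF pM] p2b \<Delta>2])
    have i3: "integrable M (\<lambda>w. (u t (X t w) - u q (X q w))\<^sup>2)"
    proof (rule bounded_integrable[of _ "2\<^sup>2"])
      show "(\<lambda>w. (u t (X t w) - u q (X q w))\<^sup>2) \<in> borel_measurable M"
        using dx_X0_measurable[OF s1(1,2)] dx_X0_measurable[OF s1(3,4)] by simp
      fix w
      have "\<bar>u t (X t w) - u q (X q w)\<bar> \<le> \<bar>2\<bar>"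
        using dx_Phi_bound[OF mu s1(1,2), of "X q w"] dx_Phi_bound[OF mu s1(3,4), of "X t w"] by linarith
      then show "\<bar>(u t (X t w) - u q (X q w))\<^sup>2\<bar> \<le> 2\<^sup>2" by (simp only: abs_le_square_iff abs_power2)
    qed
    have "(1 - \<eta>) * ((\<rho> t - \<rho> q) * (\<integral>w. (p w)\<^sup>2 \<partial>M)) - ?C * (?d * ?e) / \<eta>
        \<le> (1 - \<eta>) * (\<integral>w. (p w)\<^sup>2 * (\<Delta> w)\<^sup>2 \<partial>M) - (\<integral>w. (R w)\<^sup>2 \<partial>M) / \<eta>"
      unfolding E2 using divide_right_mono[OF ER, of \<eta>] \<eta> by (simp add: mult_ac)
    also have "\<dots> = (\<integral>w. (1 - \<eta>) * ((p w)\<^sup>2 * (\<Delta> w)\<^sup>2) - (R w)\<^sup>2 / \<eta> \<partial>M)" using i2 R2i by simp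
    also have "\<dots> \<le> (\<integral>w. (u t (X t w) - u q (X q w))\<^sup>2 \<partial>M)"
    proof (rule integral_mono)
      show "integrable M (\<lambda>w. (1 - \<eta>) * ((p w)\<^sup>2 * (\<Delta> w)\<^sup>2) - (R w)\<^sup>2 / \<eta>)" using i2 R2i by simp
      show "integrable M (\<lambda>w. (u t (X t w) - u q (X q w))\<^sup>2)" by (rule i3)
      fix w
      show "(1 - \<eta>) * ((p w)\<^sup>2 * (\<Delta> w)\<^sup>2) - (R w)\<^sup>2 / \<eta> \<le> (u t (X t w) - u q (X q w))\<^sup>2"
        using square_lower[OF \<eta>, of "p w * \<Delta> w" "R w"] by (simp add: R_def power_mult_distrib)
    qed
    also have "\<dots> = psi t - psi q" using psi_increment[of q t] st by simp
    finally show ?thesis unfolding p_def .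
  qed
  moreover have "0 \<le> ?C" by simp
  ultimately show ?thesis by blast
qed

end

subsection \<open>First variation of the Parisi functional\<close>

text \<open>Realised as the law of a two-stage draw: a coin with parameter \<epsilon> selects \<nu>
  or \<mu>. The measure of each Borel set is then affine in \<epsilon>.\<close>

lemma mixture_measure:
  assumes mu: "\<mu> \<in> prob_measures_01" and nu: "\<nu> \<in> prob_measures_01" and e: "0 \<le> \<epsilon>" "\<epsilon> \<le> 1"
  obtains \<kappa> where "\<kappa> \<in> prob_measures_01" "\<And>s. alpha \<kappa> s = alpha \<mu> s + \<epsilon> * (alpha \<nu> s - alpha \<mu> s)"
proof -
  let ?f = "\<lambda>b. if b then \<nu> else \<mu>"
  let ?B = "measure_pmf (bernoulli_pmf \<epsilon>)"
  define \<kappa> where "\<kappa> = ?B \<bind> ?f"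
  note M = prob_measures_01D[OF mu] and N = prob_measures_01D[OF nu]
  have sp: "\<mu> \<in> space (prob_algebra borel)" "\<nu> \<in> space (prob_algebra borel)"
    unfolding space_prob_algebra using M N by auto
  then have f: "?f \<in> ?B \<rightarrow>\<^sub>M prob_algebra borel" by (intro measurableI) (simp_all split: if_splits)
  have B: "?B \<in> space (prob_algebra (count_space UNIV))"
    by (simp add: space_prob_algebra measure_pmf.prob_space_axioms)
  have f': "?f \<in> count_space UNIV \<rightarrow>\<^sub>M prob_algebra borel" using sp by (intro measurableI) (simp_all split: if_splits)
  interpret K: prob_space \<kappa> unfolding \<kappa>_def by (rule prob_space_bind'[OF B f'])
  have sets: "sets \<kappa> = sets borel" unfolding \<kappa>_def by (rule sets_bind'[OF B f'])
  interpret P: prob_space \<mu> by (rule M)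
  interpret Q: prob_space \<nu> by (rule N)
  have m: "measure \<kappa> X = measure \<mu> X + \<epsilon> * (measure \<nu> X - measure \<mu> X)" if "X \<in> sets borel" for X
  proof -
    have "emeasure \<kappa> X = (\<integral>\<^sup>+b. emeasure (?f b) X \<partial>?B)"
      unfolding \<kappa>_def by (rule emeasure_bind[OF _ measurable_prob_algebraD[OF f] that]) simp
    also have "\<dots> = emeasure \<nu> X * ennreal \<epsilon> + emeasure \<mu> X * ennreal (1 - \<epsilon>)" using e by simp
    also have "\<dots> = ennreal (measure \<nu> X * \<epsilon> + measure \<mu> X * (1 - \<epsilon>))"
      using e by (simp add: P.emeasure_eq_measure Q.emeasure_eq_measure ennreal_mult[symmetric] ennreal_plus[symmetric] del: ennreal_plus)
    finally have "measure \<kappa> X = measure \<nu> X * \<epsilon> + measure \<mu> X * (1 - \<epsilon>)"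
      using e by (intro measure_eq_emeasure_eq_ennreal) auto
    then show ?thesis by (simp add: algebra_simps)
  qed
  have "real_distribution \<kappa>"
    by unfold_locales (simp_all add: sets sets_eq_imp_space_eq[OF sets])
  then have "\<kappa> \<in> prob_measures_01" unfolding prob_measures_01_def using m[of "{0..1}"] M(5) N(5) by simp
  then show thesis by (rule that) (simp add: alpha_def m)
qed

lemma return_prob_measures_01:
  assumes "0 \<le> q" "q \<le> 1"
  shows "return borel q \<in> prob_measures_01" "0 \<le> s \<Longrightarrow> alpha (return borel q) s = (if q \<le> s then 1 else 0)"
proof -
  interpret prob_space "return borel q" by (rule prob_space_return) simp
  have "real_distribution (return borel q)" by unfold_locales auto
  then show "return borel q \<in> prob_measures_01" using assms by (simp add: prob_measures_01_def measure_return)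
  show "0 \<le> s \<Longrightarrow> alpha (return borel q) s = (if q \<le> s then 1 else 0)"
    using assms by (simp add: alpha_def measure_return)
qed

lemma support_subset:
  assumes mu: "\<mu> \<in> prob_measures_01" and q: "q \<in> support \<mu>"
  shows "0 \<le> q" "q \<le> 1"
proof -
  have "measure \<mu> (- {0..1}) = 0" by (rule alpha_outside[OF mu])
  moreover have "open (- {0..1 :: real})" by (simp add: open_Compl)
  ultimately have "q \<notin> - {0..1}" using q unfolding support_def by fastforce
  then show "0 \<le> q" "q \<le> 1" by auto
qed

text \<open>If G q exceeded c, the one-sided Lipschitz bound would keep G above c on the part of a
  ball around q that lies in [0,1], and the ball has positive mass.\<close>

lemma support_eq_of_AE:
  fixes G :: "real \<Rightarrow> real"
  assumes mu: "\<mu> \<in> prob_measures_01" and q: "q \<in> support \<mu>"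
    and ae: "AE x in \<mu>. G x \<le> c" and lip: "\<And>x. 0 \<le> x \<Longrightarrow> x \<le> 1 \<Longrightarrow> G q \<le> G x + B * \<bar>x - q\<bar>" and B: "0 < B"
  shows "G q \<le> c"
proof (rule ccontr)
  assume "\<not> G q \<le> c"
  then have gt: "c < G q" by simp
  interpret prob_space \<mu> by (rule prob_measures_01D[OF mu])
  note P = prob_measures_01D[OF mu]
  let ?U = "ball q ((G q - c) / B)"
  have "AE x in \<mu>. x \<in> {0..1}"
    by (rule AE_prob_1) (use P(5) in simp)
  then have "AE x in \<mu>. x \<notin> ?U"
    using ae
  proof eventually_elim
    fix x assume x: "x \<in> {0..1}" "G x \<le> c"
    show "x \<notin> ?U"
    proof
      assume "x \<in> ?U"
      then have "\<bar>x - q\<bar> < (G q - c) / B" by (simp add: dist_real_def abs_minus_commute)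
      then have "B * \<bar>x - q\<bar> < G q - c" using B by (simp add: less_divide_eq mult.commute)
      then show False using lip[of x] x by auto
    qed
  qed
  then have "prob ?U = 0" using P(3,4) by (subst prob_eq_0) auto
  moreover have "0 < prob ?U" using q gt B unfolding support_def by simp
  ultimately show False by simp
qed

text \<open>\<alpha>(s) is the \<mu>-integral of the indicator of 0 \<le> q \<le> s, so exchanging
  the integrals turns it into tail integrals of g. G is the inner integral supplied by Fubini's
  theorem, already integrable, and equal to the tail integral on [0,1].\<close>

lemma alpha_Fubini:
  fixes g :: "real \<Rightarrow> real"
  assumes mu: "\<mu> \<in> prob_measures_01" and g: "bdd_meas g"
  obtains G where "integrable \<mu> G" "AE q in \<mu>. G q = (LBINT s:{q..1}. g s)" "(\<integral>q. G q \<partial>\<mu>) = (LBINT s:{0..1}. alpha \<mu> s * g s)"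
proof -
  interpret prob_space \<mu> by (rule prob_measures_01D[OF mu])
  interpret pair_sigma_finite lborel \<mu> ..
  note P = prob_measures_01D[OF mu]
  note [measurable_cong] = P(3)
  define g' where "g' s = indicator {0..1} s * g s" for s :: real
  have g'm [measurable]: "g' \<in> borel_measurable borel"
    using bdd_meas_sub[OF g order_refl order_refl] unfolding set_borel_measurable_def g'_def by simp
  define f where "f s q = (if 0 \<le> q \<and> q \<le> s then g' s else 0)" for s q :: real
  have fm: "case_prod f \<in> borel_measurable (lborel \<Otimes>\<^sub>M \<mu>)"
    unfolding f_def by measurable
  have f1: "f s q = g' s * indicator {0..s} q" for s q unfolding f_def indicator_def by auto
  have i1: "integrable \<mu> (f s)" for s unfolding f1 by (intro integrable_mult_right integrable_real_indicator) (auto simp: P(3) less_top[symmetric])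
  have v1: "(\<integral>q. f s q \<partial>\<mu>) = indicator {0..1} s *\<^sub>R (alpha \<mu> s * g s)" for s
    unfolding f1 g'_def by (simp add: alpha_def P(3,4) mult_ac)
  have v2: "(\<integral>q. norm (f s q) \<partial>\<mu>) = indicator {0..1} s *\<^sub>R (alpha \<mu> s * \<bar>g s\<bar>)" for s
    unfolding f1 g'_def by (simp add: alpha_def P(3,4) mult_ac abs_mult)
  have int: "integrable (lborel \<Otimes>\<^sub>M \<mu>) (case_prod f)"
  proof (rule Fubini_integrable[OF fm])
    show "integrable lborel (\<lambda>x. \<integral>y. norm (case_prod f (x, y)) \<partial>\<mu>)"
      using bdd_meas_integrable[OF bdd_meas_mult[OF bdd_meas_alpha[OF mu] bdd_meas_abs[OF g]], of 0 1]
      unfolding set_integrable_def by (simp add: v2[unfolded real_norm_def])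
    show "AE x in lborel. integrable \<mu> (\<lambda>y. case_prod f (x, y))" using i1 by simp
  qed
  have ae: "AE q in \<mu>. (\<integral>s. f s q \<partial>lborel) = (LBINT s:{q..1}. g s)"
  proof -
    have "AE x in \<mu>. x \<in> {0..1}" by (rule AE_prob_1) (use P(5) in simp)
    then show ?thesis
    proof eventually_elim
      fix q :: real assume q: "q \<in> {0..1}"
      show "(\<integral>s. f s q \<partial>lborel) = (LBINT s:{q..1}. g s)"
        unfolding set_lebesgue_integral_def
        by (rule Bochner_Integration.integral_cong) (use q in \<open>auto simp: f_def g'_def indicator_def\<close>)
    qed
  qed
  have "(\<integral>q. (\<integral>s. f s q \<partial>lborel) \<partial>\<mu>) = (\<integral>s. (\<integral>q. f s q \<partial>\<mu>) \<partial>lborel)" by (rule Fubini_integral[OF int])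
  also have "\<dots> = (LBINT s:{0..1}. alpha \<mu> s * g s)" unfolding v1 set_lebesgue_integral_def ..
  finally show thesis by (rule that[OF integrable_snd[OF int] ae])
qed

context parisi_sde
begin

text \<open>Ito's formula over [0,1] with Y = 1, along the process of \<mu> for every \<nu>. The
  terminal term does not depend on \<nu> and cancels when two measures are compared.\<close>

lemma Phi_0_formula:
  assumes nu: "\<nu> \<in> prob_measures_01"
  shows "(\<integral>w. ln (cosh (X 1 w)) \<partial>M) - Phi \<xi> \<nu> 0 h
    = (LBINT r:{0..1}. alpha \<mu> r * \<zeta> r * k1 \<nu> 0 (\<lambda>_. 1) r - alpha \<nu> r * \<zeta> r * (k2 \<nu> 0 (\<lambda>_. 1) r / 2))"
proof -
  have i: "integrable M (\<lambda>w. Phi \<xi> \<nu> 1 (X 1 w))" "integrable M (\<lambda>w. Phi \<xi> \<nu> 0 (X 0 w))"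
    using Phi_X_integrable[OF nu, of 1 0] Phi_X_integrable[OF nu, of 0 0] by simp_all
  have "(\<integral>w. Phi \<xi> \<nu> 0 (X 0 w) \<partial>M) = (\<integral>w. Phi \<xi> \<nu> 0 h \<partial>M)"
    by (rule integral_cong_AE) (use i X_0 in \<open>auto elim: eventually_mono\<close>)
  then have "(\<integral>w. Phi \<xi> \<nu> 0 (X 0 w) \<partial>M) = Phi \<xi> \<nu> 0 h" using prob_space by simp
  moreover have "(\<integral>w. 1 * (Phi \<xi> \<nu> 1 (X 1 w + 0) - Phi \<xi> \<nu> 0 (X 0 w + 0)) \<partial>M)
    = (LBINT r:{0..1}. alpha \<mu> r * \<zeta> r * k1 \<nu> 0 (\<lambda>_. 1) r - alpha \<nu> r * \<zeta> r * (k2 \<nu> 0 (\<lambda>_. 1) r / 2))"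
    by (rule ito[OF nu, of 0 1 "\<lambda>_. 1" 1 0]) auto
  moreover have "(\<integral>w. 1 * (Phi \<xi> \<nu> 1 (X 1 w + 0) - Phi \<xi> \<nu> 0 (X 0 w + 0)) \<partial>M) = (\<integral>w. Phi \<xi> \<nu> 1 (X 1 w) \<partial>M) - (\<integral>w. Phi \<xi> \<nu> 0 (X 0 w) \<partial>M)"
    using i by simp
  ultimately show ?thesis by (simp add: Phi_1[OF nu])
qed

text \<open>\<mu> is compared with the mixture \<kappa> of weight \<epsilon>. Their gradients differ
  by order \<epsilon>^(2/3), and the change of gradient under the weight of \<mu> enters only
  through its mean square, of order \<epsilon>^(4/3), which is negligible against \<epsilon>. What
  remains at order \<epsilon> is half the integral of the claim.\<close>

lemma first_variation:
  assumes min: "\<And>\<nu>. \<nu> \<in> prob_measures_01 \<Longrightarrow> parisi_functional \<xi> h \<mu> \<le> parisi_functional \<xi> h \<nu>"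
    and nu: "\<nu> \<in> prob_measures_01"
  shows "0 \<le> (LBINT r:{0..1}. \<zeta> r * (alpha \<nu> r - alpha \<mu> r) * (psi r - r))"
proof -
  let ?V = "\<lambda>r. \<zeta> r * (alpha \<nu> r - alpha \<mu> r) * (psi r - r)"
  \<comment> \<open>\<open>C1\<close> is the stability constant of the gradient. In
    \<open>C0\<close> the square stems from the mean square difference of the gradients, the other
    term from replacing \<open>a2\<close> by \<open>psi\<close>.\<close>
  define C1 where "C1 = (1 + 2 * L) * (root 3 K)\<^sup>2"
  define C0 where "C0 = K * C1\<^sup>2 + 2 * K * C1"
  have C1: "0 \<le> C1" unfolding C1_def using L_pos by simp
  have bid: "bdd_meas (\<lambda>r. r)" by (rule bdd_meas_continuous) (intro continuous_intros)
  have bV: "bdd_meas ?V"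
    by (intro bdd_meas_mult bdd_meas_diff bdd_meas_zeta bdd_meas_alpha nu mu bid bdd_meas_continuous[OF psi_continuous])
  have key: "0 \<le> (LBINT r:{0..1}. ?V r) + C0 * root 3 \<epsilon>" if e: "0 < \<epsilon>" "\<epsilon> \<le> 1" for \<epsilon>
  proof -
    let ?e = "root 3 \<epsilon>"
    have e01: "0 \<le> \<epsilon>" "\<epsilon> \<le> 1" using e by auto
    note sc = scale_bounds[OF e01]
    obtain \<kappa> where \<kappa>: "\<kappa> \<in> prob_measures_01" and a\<kappa>: "\<And>s. alpha \<kappa> s = alpha \<mu> s + \<epsilon> * (alpha \<nu> s - alpha \<mu> s)"
      by (rule mixture_measure[OF mu nu e01]) (rule that)
    define a1 where "a1 = k1 \<kappa> 0 (\<lambda>_. 1)"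
    define a2 where "a2 = k2 \<kappa> 0 (\<lambda>_. 1)"
    have kk: "k1 \<mu> 0 (\<lambda>_. 1) = psi" "k2 \<mu> 0 (\<lambda>_. 1) = psi"
      unfolding psi_def k1_def k2_def by (simp_all add: fun_eq_iff power2_eq_square)
    have Pk: "(\<integral>w. ln (cosh (X 1 w)) \<partial>M) - Phi \<xi> \<kappa> 0 h = (LBINT r:{0..1}. alpha \<mu> r * \<zeta> r * a1 r - alpha \<kappa> r * \<zeta> r * (a2 r / 2))"
      unfolding a1_def a2_def by (rule Phi_0_formula[OF \<kappa>])
    have Pm: "(\<integral>w. ln (cosh (X 1 w)) \<partial>M) - Phi \<xi> \<mu> 0 h = (LBINT r:{0..1}. alpha \<mu> r * \<zeta> r * psi r - alpha \<mu> r * \<zeta> r * (psi r / 2))"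
      using Phi_0_formula[OF mu] unfolding kk .
    have ba: "bdd_meas a1" "bdd_meas a2" unfolding a1_def a2_def by (rule k_bdd_meas[OF \<kappa>, of _ 1]; simp)+
    have bp: "bdd_meas psi" by (rule bdd_meas_continuous[OF psi_continuous])
    have half: "bdd_meas (\<lambda>r. f r / 2)" if "bdd_meas f" for f
      using bdd_meas_mult[OF that bdd_meas_const[of "1/2"]] by simp
    let ?f1 = "\<lambda>r. alpha \<mu> r * \<zeta> r * psi r - alpha \<mu> r * \<zeta> r * (psi r / 2)"
    let ?f2 = "\<lambda>r. alpha \<mu> r * \<zeta> r * a1 r - alpha \<kappa> r * \<zeta> r * (a2 r / 2)"
    let ?f3 = "\<lambda>r. alpha \<kappa> r * r * \<zeta> r"
    let ?f4 = "\<lambda>r. alpha \<mu> r * r * \<zeta> r"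
    note bz = bdd_meas_alpha_zeta[OF mu] bdd_meas_alpha_zeta[OF \<kappa>]
    have b1: "bdd_meas ?f1" and b2: "bdd_meas ?f2"
      by (intro bdd_meas_diff bdd_meas_mult[OF bz(1)] bdd_meas_mult[OF bz(2)] half bp ba)+
    have b3: "bdd_meas ?f3" and b4: "bdd_meas ?f4"
      by (intro bdd_meas_mult bdd_meas_alpha \<kappa> mu bid bdd_meas_zeta)+
    note bi = bdd_meas_integrable[OF _ order_refl order_refl]
    let ?G = "\<lambda>r. (?f1 r - ?f2 r) - (?f3 r - ?f4 r) / 2"
    have bG: "bdd_meas ?G" by (intro bdd_meas_diff half b1 b2 b3 b4)
    have "(LBINT r:{0..1}. ?G r) = (LBINT r:{0..1}. ?f1 r - ?f2 r) - (LBINT r:{0..1}. (?f3 r - ?f4 r) / 2)"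
      by (rule set_integral_diff(2)[OF bi[OF bdd_meas_diff[OF b1 b2]] bi[OF half[OF bdd_meas_diff[OF b3 b4]]]])
    also have "(LBINT r:{0..1}. ?f1 r - ?f2 r) = (LBINT r:{0..1}. ?f1 r) - (LBINT r:{0..1}. ?f2 r)"
      by (rule set_integral_diff(2)[OF bi[OF b1] bi[OF b2]])
    also have "(LBINT r:{0..1}. (?f3 r - ?f4 r) / 2) = (LBINT r:{0..1}. ?f3 r - ?f4 r) / 2" by simp
    also have "(LBINT r:{0..1}. ?f3 r - ?f4 r) = (LBINT r:{0..1}. ?f3 r) - (LBINT r:{0..1}. ?f4 r)"
      by (rule set_integral_diff(2)[OF bi[OF b3] bi[OF b4]])
    finally have "(LBINT r:{0..1}. ?G r) = parisi_functional \<xi> h \<kappa> - parisi_functional \<xi> h \<mu>"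
      unfolding parisi_functional_def using Pk Pm by argo
    then have G0: "0 \<le> (LBINT r:{0..1}. ?G r)" using min[OF \<kappa>] by simp
    have ad: "alpha_dist \<kappa> \<mu> \<le> \<epsilon>"
    proof -
      have "\<bar>LBINT t:{0..1}. \<bar>alpha \<kappa> t - alpha \<mu> t\<bar>\<bar> \<le> \<epsilon> * (1 - 0)"
      proof (rule LBINT_bound)
        show "bdd_meas (\<lambda>t. \<bar>alpha \<kappa> t - alpha \<mu> t\<bar>)" by (rule bdd_meas_alpha_diff[OF \<kappa> mu])
        fix t
        have "\<bar>alpha \<nu> t - alpha \<mu> t\<bar> \<le> 1"
          using alpha_nonneg[OF mu, of t] alpha_le_1[OF mu, of t] alpha_nonneg[OF nu, of t] alpha_le_1[OF nu, of t] by linarith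
        then have "\<epsilon> * \<bar>alpha \<nu> t - alpha \<mu> t\<bar> \<le> \<epsilon> * 1" using e01(1) by (rule mult_left_mono)
        then show "\<bar>\<bar>alpha \<kappa> t - alpha \<mu> t\<bar>\<bar> \<le> \<epsilon>" using e01(1) unfolding a\<kappa> by (simp add: abs_mult)
      qed auto
      then show ?thesis unfolding alpha_dist_def by simp
    qed
    have du: "\<bar>dx_Phi \<xi> \<kappa> r x - u r x\<bar> \<le> C1 * ?e\<^sup>2" if r: "0 \<le> r" "r \<le> 1" for r x
    proof -
      have "\<bar>dx_Phi \<xi> \<kappa> r x - u r x\<bar> \<le> (1 + 2 * L) * (root 3 (K * alpha_dist \<kappa> \<mu>))\<^sup>2"
        by (rule dx_Phi_stability[OF \<kappa> mu r])
      also have "\<dots> \<le> (1 + 2 * L) * (root 3 (K * \<epsilon>))\<^sup>2"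
      proof (rule mult_left_mono, rule power_mono)
        show "root 3 (K * alpha_dist \<kappa> \<mu>) \<le> root 3 (K * \<epsilon>)" using ad K_ge_1 by simp
        show "0 \<le> root 3 (K * alpha_dist \<kappa> \<mu>)" using K_ge_1 alpha_dist_nonneg[of \<kappa> \<mu>] by simp
      qed (use L_pos in simp)
      also have "\<dots> = C1 * ?e\<^sup>2" unfolding C1_def by (simp add: real_root_mult power_mult_distrib)
      finally show ?thesis .
    qed
    have pt: "?G r \<le> \<epsilon> / 2 * (?V r + C0 * ?e)" if r: "0 \<le> r" "r \<le> 1" for r
    proof -
      define p where "p w = dx_Phi \<xi> \<kappa> r (X r w)" for w
      define v where "v w = u r (X r w)" for w
      have pm: "p \<in> borel_measurable M" and vm: "v \<in> borel_measurable M"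
        unfolding p_def v_def using dx_X_measurable[OF \<kappa> r, of 0] dx_X_measurable[OF mu r, of 0] by simp_all
      have pb: "\<bar>p w\<bar> \<le> 1" and vb: "\<bar>v w\<bar> \<le> 1" and pv: "\<bar>p w - v w\<bar> \<le> C1 * ?e\<^sup>2" for w
        unfolding p_def v_def by (rule dx_Phi_bound[OF \<kappa> r] dx_Phi_bound[OF mu r] du[OF r])+
      have a: "a1 r = (\<integral>w. p w * v w \<partial>M)" "a2 r = (\<integral>w. p w * p w \<partial>M)" "psi r = (\<integral>w. v w * v w \<partial>M)"
        unfolding a1_def a2_def psi_def k1_def k2_def p_def v_def by (simp_all add: power2_eq_square)
      have pi: "integrable M (\<lambda>w. p w * v w)" "integrable M (\<lambda>w. p w * p w)" "integrable M (\<lambda>w. v w * v w)"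
        by (rule bounded_times_integrable[OF pm pb bounded_integrable[OF vm vb]])
          (rule bounded_times_integrable[OF pm pb bounded_integrable[OF pm pb]], rule bounded_times_integrable[OF vm vb bounded_integrable[OF vm vb]])
      have "psi r - 2 * a1 r + a2 r = (\<integral>w. v w * v w - 2 * (p w * v w) + p w * p w \<partial>M)"
        unfolding a using pi by simp
      also have "\<dots> = (\<integral>w. (p w - v w)\<^sup>2 \<partial>M)"
        by (rule Bochner_Integration.integral_cong) (auto simp: power2_eq_square algebra_simps)
      also have "\<dots> \<le> C1\<^sup>2 * (\<epsilon> * ?e)"
      proof -
        have "\<bar>\<integral>w. (p w - v w)\<^sup>2 \<partial>M\<bar> \<le> (C1 * ?e\<^sup>2)\<^sup>2"
        proof (rule bounded_integral)
          show "(\<lambda>w. (p w - v w)\<^sup>2) \<in> borel_measurable M" using pm vm by simp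
          show "\<bar>(p w - v w)\<^sup>2\<bar> \<le> (C1 * ?e\<^sup>2)\<^sup>2" for w
            using power_mono[OF pv abs_ge_zero, of w 2] by simp
        qed
        also have "\<dots> = C1\<^sup>2 * (\<epsilon> * ?e)" unfolding sc(6)[symmetric] by (simp add: power_mult_distrib flip: power_mult)
        finally show ?thesis by linarith
      qed
      finally have D: "psi r - 2 * a1 r + a2 r \<le> C1\<^sup>2 * (\<epsilon> * ?e)" .
      have "a2 r - psi r = (\<integral>w. p w * p w - v w * v w \<partial>M)" unfolding a using pi by simp
      moreover have "\<bar>\<integral>w. p w * p w - v w * v w \<partial>M\<bar> \<le> 2 * (C1 * ?e\<^sup>2)"
        by (rule bounded_integral) (use pm vm in \<open>simp, intro product_diff_le pb vb pv\<close>)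
      ultimately have "\<bar>a2 r - psi r\<bar> \<le> 2 * (C1 * ?e\<^sup>2)" by simp
      also have "\<dots> \<le> 2 * (C1 * ?e)" by (intro mult_left_mono sc(4) C1) simp
      finally have Q: "\<bar>a2 r - psi r\<bar> \<le> 2 * (C1 * ?e)" .
      have z: "0 \<le> \<zeta> r" "\<zeta> r \<le> K" using zeta_nonneg zeta_le r by auto
      have am: "0 \<le> alpha \<mu> r" "alpha \<mu> r \<le> 1" by (rule alpha_nonneg[OF mu] alpha_le_1[OF mu])+
      have da: "\<bar>alpha \<nu> r - alpha \<mu> r\<bar> \<le> 1"
        using am alpha_nonneg[OF nu, of r] alpha_le_1[OF nu, of r] by linarith
      have zam: "0 \<le> \<zeta> r * alpha \<mu> r" "\<zeta> r * alpha \<mu> r \<le> K * 1" using mult_mono[OF z(2) am(2)] z am K_ge_1 by auto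
      have T1: "\<zeta> r * alpha \<mu> r * (psi r - 2 * a1 r + a2 r) \<le> K * (C1\<^sup>2 * (\<epsilon> * ?e))"
      proof -
        have "\<zeta> r * alpha \<mu> r * (psi r - 2 * a1 r + a2 r) \<le> \<zeta> r * alpha \<mu> r * (C1\<^sup>2 * (\<epsilon> * ?e))" by (rule mult_left_mono[OF D zam(1)])
        also have "\<dots> \<le> K * 1 * (C1\<^sup>2 * (\<epsilon> * ?e))" by (rule mult_right_mono[OF zam(2)]) (use e01 in simp)
        finally show ?thesis by simp
      qed
      have "\<bar>\<zeta> r * (alpha \<nu> r - alpha \<mu> r) * (a2 r - psi r)\<bar> \<le> K * 1 * (2 * (C1 * ?e))"
        unfolding abs_mult using z da Q K_ge_1 by (intro mult_mono) auto
      then have "\<zeta> r * (alpha \<nu> r - alpha \<mu> r) * (a2 r - psi r) \<le> 2 * K * (C1 * ?e)" by simp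
      then have T2: "\<epsilon> * (\<zeta> r * (alpha \<nu> r - alpha \<mu> r) * (a2 r - psi r)) \<le> \<epsilon> * (2 * K * (C1 * ?e))" using e01(1) by (rule mult_left_mono)
      \<comment> \<open>The part with the weight of \<mu> is the mean of a perfect square; the rest
        carries the factor \<epsilon>, with \<open>a2\<close> split into \<open>psi\<close> and a
        small difference.\<close>
      have "2 * ?G r = \<zeta> r * alpha \<mu> r * (psi r - 2 * a1 r + a2 r) + \<epsilon> * (\<zeta> r * (alpha \<nu> r - alpha \<mu> r) * (a2 r - psi r)) + \<epsilon> * ?V r"
        unfolding a\<kappa> by (simp add: algebra_simps add_divide_distrib diff_divide_distrib)
      also have "\<dots> \<le> K * (C1\<^sup>2 * (\<epsilon> * ?e)) + \<epsilon> * (2 * K * (C1 * ?e)) + \<epsilon> * ?V r"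
        by (intro add_right_mono add_mono T1 T2)
      also have "\<dots> = 2 * (\<epsilon> / 2 * (?V r + C0 * ?e))" unfolding C0_def by (simp add: algebra_simps)
      finally show ?thesis by (rule mult_left_le_imp_le) simp
    qed
    have "0 \<le> (LBINT r:{0..1}. \<epsilon> / 2 * (?V r + C0 * ?e))"
      by (rule order_trans[OF G0 LBINT_mono[OF bG bdd_meas_mult[OF bdd_meas_const bdd_meas_add[OF bV bdd_meas_const]] order_refl order_refl pt]])
    also have "\<dots> = \<epsilon> / 2 * ((LBINT r:{0..1}. ?V r) + (LBINT r:{0..1::real}. C0 * ?e))"
      using set_integral_add(2)[OF bi[OF bV] bi[OF bdd_meas_const]] by simp
    also have "(LBINT r:{0..1::real}. C0 * ?e) = C0 * ?e" using LBINT_const[of 0 1 "C0 * ?e"] by simp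
    finally show ?thesis using e by (simp add: zero_le_mult_iff)
  qed
  show ?thesis
  proof (rule tendsto_lowerbound[of "\<lambda>\<epsilon>. (LBINT r:{0..1}. ?V r) + C0 * root 3 \<epsilon>" _ "at_right 0"])
    have "((\<lambda>\<epsilon>. (LBINT r:{0..1}. ?V r) + C0 * root 3 \<epsilon>) \<longlongrightarrow> (LBINT r:{0..1}. ?V r) + C0 * root 3 0) (at_right 0)"
      by (intro tendsto_intros)
    then show "((\<lambda>\<epsilon>. (LBINT r:{0..1}. ?V r) + C0 * root 3 \<epsilon>) \<longlongrightarrow> (LBINT r:{0..1}. ?V r)) (at_right 0)" by simp
    show "\<forall>\<^sub>F \<epsilon> in at_right 0. 0 \<le> (LBINT r:{0..1}. ?V r) + C0 * root 3 \<epsilon>"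
      unfolding eventually_at_right_field using key by (intro exI[of _ 1]) auto
  qed simp
qed

end

subsection \<open>Minimality on the support\<close>

lemma LBINT_pos:
  fixes g :: "real \<Rightarrow> real"
  assumes c: "continuous_on {0..1} g" and ab: "0 \<le> a" "a < b" "b \<le> 1"
    and g: "\<And>x. a \<le> x \<Longrightarrow> x \<le> b \<Longrightarrow> 0 \<le> g x" and x: "a \<le> x" "x \<le> b" "0 < g x"
  shows "0 < (LBINT s:{a..b}. g s)"
proof -
  have "(LBINT s:{a..b}. g s) = integral {a..b} g"
    by (rule set_borel_integral_eq_integral(2)[OF bdd_meas_integrable[OF bdd_meas_continuous[OF c] ab(1,3)]])
  moreover have "continuous_on {a..b} g" using ab by (intro continuous_on_subset[OF c]) auto
  then have "integral {a..b} g \<noteq> 0" using integral_eq_0_iff[of a b g] ab(2) g x by force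
  moreover have "0 \<le> (LBINT s:{a..b}. g s)" by (rule LBINT_nonneg[OF g])
  ultimately show ?thesis by linarith
qed

lemma continuous_on_pos_nbhd:
  fixes f :: "real \<Rightarrow> real"
  assumes "continuous_on S f" "x \<in> S" "0 < f x"
  obtains d where "0 < d" "\<And>y. y \<in> S \<Longrightarrow> \<bar>y - x\<bar> < d \<Longrightarrow> 0 < f y"
proof -
  obtain d where d: "0 < d" "\<And>y. y \<in> S \<Longrightarrow> dist y x < d \<Longrightarrow> dist (f y) (f x) < f x"
    using assms unfolding continuous_on_iff by blast
  show thesis
  proof (rule that[OF d(1)])
    fix y assume "y \<in> S" "\<bar>y - x\<bar> < d"
    then have "\<bar>f y - f x\<bar> < f x" using d(2)[of y] by (simp add: dist_real_def)
    then show "0 < f y" by linarith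
  qed
qed

context parisi_sde
begin

context
  assumes min: "\<And>\<nu>. \<nu> \<in> prob_measures_01 \<Longrightarrow> parisi_functional \<xi> h \<mu> \<le> parisi_functional \<xi> h \<nu>"
begin

abbreviation "g \<equiv> \<lambda>s. \<zeta> s * (psi s - s)"

definition "\<Gamma> q = (LBINT s:{q..1}. g s)"

lemma g_continuous: "continuous_on {0..1} g"
  by (intro continuous_intros zeta_cont psi_continuous)

lemma Gamma_diff: "0 \<le> a \<Longrightarrow> a \<le> b \<Longrightarrow> b \<le> 1 \<Longrightarrow> \<Gamma> a - \<Gamma> b = (LBINT s:{a..b}. g s)"
  unfolding \<Gamma>_def using LBINT_split[OF bdd_meas_continuous[OF g_continuous], of a b 1] by simp

lemma g_bound: "0 \<le> s \<Longrightarrow> s \<le> 1 \<Longrightarrow> \<bar>g s\<bar> \<le> K"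
proof -
  assume s: "0 \<le> s" "s \<le> 1"
  have "\<bar>psi s - s\<bar> \<le> 1" using psi_nonneg[of s] psi_le_1[OF s] s by linarith
  then have "\<bar>\<zeta> s\<bar> * \<bar>psi s - s\<bar> \<le> K * 1" using zeta_nonneg[OF s] zeta_le[OF s] K_ge_1 by (intro mult_mono) auto
  then show ?thesis by (simp add: abs_mult)
qed

text \<open>\<open>c\<close> is the \<mu>-average of \<Gamma>, written with \<alpha>; the average
  for the Dirac mass at s is \<Gamma> s, so the first variation says c \<le> \<Gamma> s. Hence
  \<Gamma> = c holds \<mu>-almost everywhere, and the Lipschitz constant K carries \<Gamma> \<le> c
  to every point of the support.\<close>

lemma support_minimizes:
  assumes q: "q \<in> support \<mu>" and s: "0 \<le> s" "s \<le> 1"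
  shows "\<Gamma> q \<le> \<Gamma> s"
proof -
  note q01 = support_subset[OF mu q]
  have bg: "bdd_meas g" by (rule bdd_meas_continuous[OF g_continuous])
  define c where "c = (LBINT r:{0..1}. alpha \<mu> r * g r)"
  have ge: "c \<le> \<Gamma> s" if s: "0 \<le> s" "s \<le> 1" for s
  proof -
    note R = return_prob_measures_01[OF s]
    note bi = bdd_meas_integrable[OF _ order_refl order_refl]
    have "0 \<le> (LBINT r:{0..1}. \<zeta> r * (alpha (return borel s) r - alpha \<mu> r) * (psi r - r))"
      by (rule first_variation[OF min R(1)])
    also have "\<dots> = (LBINT r:{0..1}. alpha (return borel s) r * g r - alpha \<mu> r * g r)" by (simp add: algebra_simps)
    also have "\<dots> = (LBINT r:{0..1}. alpha (return borel s) r * g r) - c"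
      unfolding c_def by (intro set_integral_diff(2) bi bdd_meas_mult[OF bdd_meas_alpha bg] mu R)
    also have "(LBINT r:{0..1}. alpha (return borel s) r * g r) = \<Gamma> s"
      unfolding \<Gamma>_def set_lebesgue_integral_def
      by (rule Bochner_Integration.integral_cong) (use R(2) s in \<open>auto simp: indicator_def\<close>)
    finally show ?thesis by simp
  qed
  interpret P: prob_space \<mu> by (rule prob_measures_01D[OF mu])
  obtain G where G: "integrable \<mu> G" "AE q in \<mu>. G q = (LBINT s:{q..1}. g s)" "(\<integral>q. G q \<partial>\<mu>) = (LBINT s:{0..1}. alpha \<mu> s * g s)"
    by (rule alpha_Fubini[OF mu bg]) (rule that)
  have "AE x in \<mu>. x \<in> {0..1}" by (rule P.AE_prob_1) (use prob_measures_01D(5)[OF mu] in simp)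
  then have "AE x in \<mu>. 0 \<le> G x - c"
    using G(2)
  proof eventually_elim
    fix x assume "x \<in> {0..1}" "G x = (LBINT s:{x..1}. g s)"
    then show "0 \<le> G x - c" using ge[of x] unfolding \<Gamma>_def by simp
  qed
  moreover have "(\<integral>x. G x - c \<partial>\<mu>) = 0" using G(1,3) P.prob_space unfolding c_def by simp
  ultimately have "AE x in \<mu>. G x - c = 0" using G(1) by (subst (asm) integral_nonneg_eq_0_iff_AE) auto
  then have "AE x in \<mu>. \<Gamma> x \<le> c"
    using G(2)
  proof eventually_elim
    fix x assume "G x - c = 0" "G x = (LBINT s:{x..1}. g s)"
    then show "\<Gamma> x \<le> c" unfolding \<Gamma>_def by simp
  qed
  then have "\<Gamma> q \<le> c"
  proof (rule support_eq_of_AE[OF mu q])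
    fix x :: real assume x: "0 \<le> x" "x \<le> 1"
    show "\<Gamma> q \<le> \<Gamma> x + K * \<bar>x - q\<bar>"
    proof (cases "x \<le> q")
      case True
      have "\<bar>LBINT s:{x..q}. g s\<bar> \<le> K * (q - x)" by (rule LBINT_bound[OF bg x(1) True q01(2)]) (use g_bound x q01 in auto)
      then show ?thesis using Gamma_diff[OF x(1) True q01(2)] True by (simp add: abs_le_iff)
    next
      case False
      then have qx: "q \<le> x" by simp
      have "\<bar>LBINT s:{q..x}. g s\<bar> \<le> K * (x - q)" by (rule LBINT_bound[OF bg q01(1) qx x(2)]) (use g_bound x q01 in auto)
      then show ?thesis using Gamma_diff[OF q01(1) qx x(2)] qx by (simp add: abs_le_iff)
    qed
  qed (use K_ge_1 in simp)
  also have "c \<le> \<Gamma> s" by (rule ge[OF s])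
  finally show ?thesis .
qed

text \<open>The contradiction shared by both conclusions: an excess of \<open>psi\<close> on (q,b]
  makes \<Gamma> strictly smaller at b than at q. Strictness comes from the endpoint b, where
  \<zeta> is positive since b > 0.\<close>

lemma no_excess_right:
  assumes q: "q \<in> support \<mu>" and b: "q < b" "b \<le> 1" and pos: "\<And>s. q < s \<Longrightarrow> s \<le> b \<Longrightarrow> s < psi s" and q0: "q \<le> psi q"
  shows False
proof -
  note q01 = support_subset[OF mu q]
  have "0 < (LBINT s:{q..b}. g s)"
  proof (rule LBINT_pos[OF g_continuous q01(1) b])
    fix x assume x: "q \<le> x" "x \<le> b"
    have "x \<le> psi x" using pos[of x] q0 x by (cases "x = q") auto
    then show "0 \<le> g x" using zeta_nonneg[of x] x q01 b by simp
  next
    show "0 < g b" using pos[of b] zeta_pos[of b] q01 b by simp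
  qed (use b in auto)
  then show False using support_minimizes[OF q, of b] Gamma_diff[of q b] q01 b by simp
qed

lemma psi_support:
  assumes q: "q \<in> support \<mu>"
  shows "psi q = q"
proof (rule antisym)
  note q01 = support_subset[OF mu q]
  show "psi q \<le> q"
  proof (rule ccontr)
    assume gt: "\<not> psi q \<le> q"
    \<comment> \<open>There is room on the right because \<open>psi\<close> is at most 1.\<close>
    then have q1: "q < 1" using psi_le_1[OF q01] by linarith
    obtain d where d: "0 < d" "\<And>y. y \<in> {0..1} \<Longrightarrow> \<bar>y - q\<bar> < d \<Longrightarrow> 0 < psi y - y"
    proof (rule continuous_on_pos_nbhd[of "{0..1}" "\<lambda>s. psi s - s" q])
      show "continuous_on {0..1} (\<lambda>s. psi s - s)" by (intro continuous_intros psi_continuous)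
    qed (use gt q01 that in auto)
    define b where "b = min 1 (q + d / 2)"
    have b: "q < b" "b \<le> 1" "b - q < d" using d(1) q1 unfolding b_def by auto
    show False
    proof (rule no_excess_right[OF q b(1,2)])
      fix s assume "q < s" "s \<le> b"
      then show "s < psi s" using d(2)[of s] b q01 by auto
    qed (use gt in simp)
  qed
  show "q \<le> psi q"
  proof (rule ccontr)
    assume lt: "\<not> q \<le> psi q"
    \<comment> \<open>There is room on the left, and \<zeta> is positive at q, because
      \<open>psi\<close> is nonnegative.\<close>
    then have q0: "0 < q" using psi_nonneg[of q] by linarith
    obtain d where d: "0 < d" "\<And>y. y \<in> {0..1} \<Longrightarrow> \<bar>y - q\<bar> < d \<Longrightarrow> 0 < y - psi y"
    proof (rule continuous_on_pos_nbhd[of "{0..1}" "\<lambda>s. s - psi s" q])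
      show "continuous_on {0..1} (\<lambda>s. s - psi s)" by (intro continuous_intros psi_continuous)
    qed (use lt q01 that in auto)
    define a where "a = max 0 (q - d / 2)"
    have a: "0 \<le> a" "a < q" "q - a < d" using d(1) q0 unfolding a_def by auto
    have "0 < (LBINT s:{a..q}. - g s)"
    proof (rule LBINT_pos[OF _ a(1,2) q01(2)])
      show "continuous_on {0..1} (\<lambda>s. - g s)" by (intro continuous_on_minus g_continuous)
      fix x assume x: "a \<le> x" "x \<le> q"
      have "0 < x - psi x" using d(2)[of x] x a q01 by auto
      then show "0 \<le> - g x" using mult_nonneg_nonneg[of "\<zeta> x" "x - psi x"] zeta_nonneg[of x] x q01 a by (simp add: algebra_simps)
    next
      show "0 < - g q" using mult_pos_pos[of "\<zeta> q" "q - psi q"] zeta_pos[OF q0 q01(2)] lt by (simp add: algebra_simps)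
    qed (use a in auto)
    then have "(LBINT s:{a..q}. g s) < 0" by (simp add: set_lebesgue_integral_def)
    then show False using support_minimizes[OF q, of a] Gamma_diff[of a q] q01 a by simp
  qed
qed

lemma dxx_support:
  assumes q: "q \<in> support \<mu>"
  shows "\<zeta> q * (\<integral>w. (dxx_Phi \<xi> \<mu> q (X q w))\<^sup>2 \<partial>M) \<le> 1"
proof (cases "q = 1")
  case True
  \<comment> \<open>The second derivative p satisfies p^2 \<le> p \<le> 1 - u^2, and the mean of the
    right-hand side is 1 - psi 1 = 0 at the support point 1.\<close>
  have "(\<integral>w. (dxx_Phi \<xi> \<mu> 1 (X 1 w))\<^sup>2 \<partial>M) \<le> (\<integral>w. 1 - (u 1 (X 1 w))\<^sup>2 \<partial>M)"
  proof (rule integral_mono)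
    have S: "smooth2 L (Phi \<xi> \<mu> 1) (u 1) (dxx_Phi \<xi> \<mu> 1)" by (rule Phi_smooth2[OF mu]) auto
    have b: "\<bar>(dxx_Phi \<xi> \<mu> 1 x)\<^sup>2\<bar> \<le> 1" for x using smooth2_bounds(2)[OF S, of x] by (simp add: abs_square_le_1)
    have "(\<lambda>w. dxx_Phi \<xi> \<mu> 1 (X 1 w)) \<in> borel_measurable M"
      by (rule comp_X_measurable0(2)[OF dxx_Phi_measurable[OF mu]]) auto
    then show "integrable M (\<lambda>w. (dxx_Phi \<xi> \<mu> 1 (X 1 w))\<^sup>2)" by (intro bounded_integrable[OF _ b]) simp
    show "integrable M (\<lambda>w. 1 - (u 1 (X 1 w))\<^sup>2)"
      using dx_X0_product_integrable[of 1 1] by (simp add: power2_eq_square)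
    fix w
    define p where "p = dxx_Phi \<xi> \<mu> 1 (X 1 w)"
    have p: "0 \<le> p" "p \<le> 1 - (u 1 (X 1 w))\<^sup>2" "p \<le> 1"
      using smooth2D(3,4)[OF S, of "X 1 w"] smooth2_bounds(2)[OF S, of "X 1 w"] unfolding p_def by auto
    have "p\<^sup>2 \<le> p" using mult_left_mono[OF p(3,1)] by (simp add: power2_eq_square)
    then show "(dxx_Phi \<xi> \<mu> 1 (X 1 w))\<^sup>2 \<le> 1 - (u 1 (X 1 w))\<^sup>2" using p(2) unfolding p_def by linarith
  qed
  also have "\<dots> = 1 - psi 1" unfolding psi_def using dx_X0_product_integrable[of 1 1] prob_space by (simp add: power2_eq_square)
  also have "\<dots> = 0" using psi_support[OF q] True by simp
  finally have "\<zeta> 1 * (\<integral>w. (dxx_Phi \<xi> \<mu> 1 (X 1 w))\<^sup>2 \<partial>M) \<le> 0" using zeta_nonneg[of 1] by (simp add: mult_le_0_iff)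
  then show ?thesis unfolding True by linarith
next
  case False
  note q01 = support_subset[OF mu q]
  have q1: "q < 1" using q01 False by simp
  define Z where "Z = (\<integral>w. (dxx_Phi \<xi> \<mu> q (X q w))\<^sup>2 \<partial>M)"
  have Z0: "0 \<le> Z" unfolding Z_def by simp
  show ?thesis
    unfolding Z_def[symmetric]
  proof (rule ccontr)
    define x where "x = \<zeta> q * Z"
    assume "\<not> \<zeta> q * Z \<le> 1"
    then have x: "1 < x" unfolding x_def by simp
    then have zq: "0 < \<zeta> q" using zeta_nonneg[OF q01] unfolding x_def by (cases "\<zeta> q = 0") auto
    \<comment> \<open>One factor 1 - \<eta> is spent on the continuity of \<zeta>, the other on
      \<open>square_lower\<close>. This value gives (1 - \<eta>)^2 x \<ge> 1 + (x - 1) / 2, which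
      keeps half of the excess.\<close>
    define \<eta> where "\<eta> = (x - 1) / (4 * x)"
    have \<eta>: "0 < \<eta>" "\<eta> < 1" "4 * (\<eta> * x) = x - 1" using x unfolding \<eta>_def by (auto simp: divide_less_eq)
    obtain C where C: "0 \<le> C" "\<And>q t \<eta>. 0 \<le> q \<and> q < t \<and> t \<le> 1 \<and> 0 < \<eta> \<Longrightarrow>
      (1 - \<eta>) * ((\<rho> t - \<rho> q) * (\<integral>w. (dxx_Phi \<xi> \<mu> q (X q w))\<^sup>2 \<partial>M)) - C * ((t - q) * root 3 (t - q)) / \<eta> \<le> psi t - psi q"
      using psi_increment_lower by (elim exE conjE) blast
    obtain d where d: "0 < d" "\<And>y. y \<in> {0..1} \<Longrightarrow> \<bar>y - q\<bar> < d \<Longrightarrow> 0 < \<zeta> y - (1 - \<eta>) * \<zeta> q"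
    proof (rule continuous_on_pos_nbhd[of "{0..1}" "\<lambda>s. \<zeta> s - (1 - \<eta>) * \<zeta> q" q])
      show "continuous_on {0..1} (\<lambda>s. \<zeta> s - (1 - \<eta>) * \<zeta> q)" by (intro continuous_intros zeta_cont)
      show "0 < \<zeta> q - (1 - \<eta>) * \<zeta> q" using mult_pos_pos[OF \<eta>(1) zq] by (simp add: algebra_simps)
    qed (use q01 that in auto)
    \<comment> \<open>The remaining half of the excess pays for the error term of
      \<open>psi_increment_lower\<close>.\<close>
    obtain e where e: "0 < e" "\<And>y. y \<in> UNIV \<Longrightarrow> \<bar>y - 0\<bar> < e \<Longrightarrow> 0 < (x - 1) / 2 - C * root 3 y / \<eta>"
    proof (rule continuous_on_pos_nbhd[of UNIV "\<lambda>y. (x - 1) / 2 - C * root 3 y / \<eta>" 0])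
      show "continuous_on UNIV (\<lambda>y. (x - 1) / 2 - C * root 3 y / \<eta>)" using \<eta> by (intro continuous_intros) auto
    qed (use x that in auto)
    define b where "b = min 1 (q + min (d / 2) (e / 2))"
    have b: "q < b" "b \<le> 1" "b - q < d" "b - q < e" using d(1) e(1) q1 unfolding b_def by auto
    show False
    proof (rule no_excess_right[OF q b(1,2)])
      fix s assume s: "q < s" "s \<le> b"
      have rho: "(s - q) * ((1 - \<eta>) * \<zeta> q) \<le> \<rho> s - \<rho> q"
      proof -
        have "(LBINT r:{q..s}. (1 - \<eta>) * \<zeta> q) \<le> (LBINT r:{q..s}. \<zeta> r)"
        proof (rule LBINT_mono)
          fix t assume t: "q \<le> t" "t \<le> s"
          have "0 < \<zeta> t - (1 - \<eta>) * \<zeta> q" by (rule d(2)) (use t s q01 b in auto)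
          then show "(1 - \<eta>) * \<zeta> q \<le> \<zeta> t" by simp
        qed (use s b q01 in auto)
        moreover have "(LBINT r:{q..s}. \<zeta> r) = \<rho> s - \<rho> q" by (rule LBINT_zeta) (use s b q01 in auto)
        moreover have "(LBINT r:{q..s}. (1 - \<eta>) * \<zeta> q) = (s - q) * ((1 - \<eta>) * \<zeta> q)" by (rule LBINT_const) (use s in simp)
        ultimately show ?thesis by (simp only:)
      qed
      have "(s - q) * (1 + (x - 1) / 2) \<le> (1 - \<eta>) * ((s - q) * ((1 - \<eta>) * \<zeta> q) * Z)"
      proof -
        have eq: "(1 - \<eta>) * ((s - q) * ((1 - \<eta>) * \<zeta> q) * Z) = (s - q) * ((1 - \<eta>)\<^sup>2 * x)"
          unfolding x_def by (simp add: power2_eq_square mult_ac)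
        have eq2: "(1 - \<eta>)\<^sup>2 * x = x - 2 * (\<eta> * x) + \<eta>\<^sup>2 * x" by (simp add: power2_eq_square algebra_simps)
        have "0 \<le> \<eta>\<^sup>2 * x" using x by simp
        then have "1 + (x - 1) / 2 \<le> (1 - \<eta>)\<^sup>2 * x" unfolding eq2 using \<eta>(3) by argo
        then show ?thesis unfolding eq by (rule mult_left_mono) (use s in simp)
      qed
      also have "\<dots> \<le> (1 - \<eta>) * ((\<rho> s - \<rho> q) * Z)"
        by (intro mult_left_mono mult_right_mono rho Z0) (use \<eta> in simp)
      finally have 1: "(s - q) * (1 + (x - 1) / 2) \<le> (1 - \<eta>) * ((\<rho> s - \<rho> q) * Z)" .
      have 2: "(1 - \<eta>) * ((\<rho> s - \<rho> q) * Z) - C * ((s - q) * root 3 (s - q)) / \<eta> \<le> psi s - q"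
        using C(2)[of q s \<eta>] q01 s b \<eta>(1) unfolding Z_def[symmetric] psi_support[OF q] by simp
      have "0 < (x - 1) / 2 - C * root 3 (s - q) / \<eta>" by (rule e(2)) (use s b in auto)
      then have "0 < (s - q) * ((x - 1) / 2 - C * root 3 (s - q) / \<eta>)" using s by simp
      also have "\<dots> = (s - q) * (1 + (x - 1) / 2) - C * ((s - q) * root 3 (s - q)) / \<eta> - (s - q)"
        by (simp add: algebra_simps)
      finally have 3: "0 < (s - q) * (1 + (x - 1) / 2) - C * ((s - q) * root 3 (s - q)) / \<eta> - (s - q)" .
      have "s' < p" if "a \<le> r" "r - c \<le> p - q'" "0 < a - c - (s' - q')" for a r c p q' s' :: real using that by linarith
      from this[OF 1 2 3] show "s < psi s" .
    qed (use psi_support[OF q] in simp)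
  qed
qed

end

end

subsection \<open>The mixture function\<close>

context
  fixes c :: "nat \<Rightarrow> real" and r :: real
  assumes conv: "\<And>x. norm x < r \<Longrightarrow> summable (\<lambda>n. c n * x ^ n)"
begin

lemma power_series_deriv:
  assumes "\<bar>x\<bar> < r"
  shows "deriv (\<lambda>x. \<Sum>n. c n * x ^ n) x = (\<Sum>n. diffs c n * x ^ n)"
  by (rule DERIV_imp_deriv[OF termdiffs_strong'[OF conv]]) (use assms in auto)

text \<open>The first derivative is identified with its series on a whole open interval, not only at
  x, which permits the second differentiation.\<close>

lemma power_series_deriv2:
  assumes "\<bar>x\<bar> < r"
  shows "(deriv (\<lambda>x. \<Sum>n. c n * x ^ n) has_real_derivative (\<Sum>n. diffs (diffs c) n * x ^ n)) (at x)"
proof (rule has_field_derivative_transform_within_open)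
  show "((\<lambda>x. \<Sum>n. diffs c n * x ^ n) has_real_derivative (\<Sum>n. diffs (diffs c) n * x ^ n)) (at x)"
    by (rule termdiffs_strong'[of r]) (use assms termdiff_converges[OF _ conv] in auto)
  show "open {- r<..<r}" by simp
  show "x \<in> {- r<..<r}" using assms by auto
  show "(\<Sum>n. diffs c n * y ^ n) = deriv (\<lambda>x. \<Sum>n. c n * x ^ n) y" if "y \<in> {- r<..<r}" for y
    using power_series_deriv[of y] that by (auto simp: abs_less_iff)
qed

end

text \<open>Padding with two zero coefficients removes the index shift, so that the theory of power
  series applies.\<close>

lemma mixture_eq_power_series:
  "mixture \<beta> \<gamma> = (\<lambda>s. \<Sum>p. (if p < 2 then 0 else \<beta>\<^sup>2 * (\<gamma> p)\<^sup>2) * s ^ p)"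
    (is "_ = (\<lambda>s. \<Sum>p. ?c p * s ^ p)") if "summable (\<lambda>p. 2 ^ p * (\<gamma> p)\<^sup>2)" for \<beta> :: real and \<gamma> :: "nat \<Rightarrow> real"
proof
  fix s
  have "(sums) (\<lambda>p. \<beta>\<^sup>2 * (\<gamma> (p + 2))\<^sup>2 * s ^ (p + 2)) = (sums) (\<lambda>p. ?c p * s ^ p)"
    using sums_iff_shift[of "\<lambda>p. ?c p * s ^ p" 2] by (simp add: fun_eq_iff numeral_2_eq_2)
  then show "mixture \<beta> \<gamma> s = (\<Sum>p. ?c p * s ^ p)" unfolding mixture_def suminf_def by (simp only:)
qed

text \<open>Summability of \<open>2 ^ p * (\<gamma> p)\<^sup>2\<close> gives convergence for |x| <
  2, so [0,1] lies inside the disc and the endpoint 1 is harmless. All coefficients of \<zeta> are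
  nonnegative and a nonzero \<gamma> p makes one positive, whence \<zeta> > 0 on (0,1].\<close>

lemma mixture_parisi_pde:
  assumes \<beta>: "\<beta> > 0" and \<gamma>: "\<forall>p\<ge>2. \<gamma> p \<ge> 0" "\<exists>p\<ge>2. \<gamma> p \<noteq> 0" and sm: "summable (\<lambda>p. 2 ^ p * (\<gamma> p)\<^sup>2)"
  obtains K where "parisi_pde (mixture \<beta> \<gamma>) K"
proof -
  define c where "c p = (if p < 2 then 0 else \<beta>\<^sup>2 * (\<gamma> p)\<^sup>2)" for p :: nat
  have mix: "mixture \<beta> \<gamma> = (\<lambda>s. \<Sum>p. c p * s ^ p)" unfolding c_def by (rule mixture_eq_power_series[OF sm])
  have "summable (\<lambda>p. c p * 2 ^ p)"
  proof (rule summable_comparison_test'[OF summable_mult[OF sm, of "\<beta>\<^sup>2"], of 0])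
    show "norm (c p * 2 ^ p) \<le> \<beta>\<^sup>2 * (2 ^ p * (\<gamma> p)\<^sup>2)" for p by (simp add: c_def abs_mult)
  qed
  then have conv: "summable (\<lambda>n. c n * x ^ n)" if "norm x < 2" for x
    by (rule powser_inside) (use that in simp)
  note conv1 = termdiff_converges[OF _ conv]
  have conv2: "summable (\<lambda>n. diffs (diffs c) n * x ^ n)" if "norm x < 2" for x
    by (rule termdiff_converges[OF that conv1])
  define z where "z x = (\<Sum>n. diffs (diffs c) n * x ^ n)" for x
  have d2: "(deriv (mixture \<beta> \<gamma>) has_real_derivative z x) (at x)" if "\<bar>x\<bar> < 2" for x
    unfolding mix z_def by (rule power_series_deriv2[OF conv that])
  then have zeta: "deriv (deriv (mixture \<beta> \<gamma>)) x = z x" if "\<bar>x\<bar> < 2" for x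
    using DERIV_imp_deriv that by blast
  have zc: "continuous_on {0..1} z"
    unfolding z_def by (intro continuous_at_imp_continuous_on ballI DERIV_isCont[OF termdiffs_strong'[OF conv2]]) auto
  have c0: "0 \<le> diffs (diffs c) n" for n unfolding diffs_def c_def by simp
  have nonneg: "0 \<le> z s" if "0 \<le> s" "s \<le> 1" for s
    unfolding z_def by (rule suminf_nonneg[OF conv2]) (use that c0 in auto)
  obtain k where k: "\<gamma> (2 + k) \<noteq> 0" using \<gamma>(2) le_Suc_ex by blast
  have ck: "0 < diffs (diffs c) k" using k \<beta> unfolding diffs_def c_def by simp
  have pos: "0 < z s" if "0 < s" "s \<le> 1" for s
    unfolding z_def by (rule suminf_pos2[OF conv2, of _ k]) (use that c0 ck in auto)
  obtain K where K: "\<And>s. s \<in> {0..1} \<Longrightarrow> z s \<le> K"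
    using continuous_attains_sup[OF compact_Icc _ zc] by fastforce
  show thesis
  proof (rule that)
    show "parisi_pde (mixture \<beta> \<gamma>) (max 1 K)"
    proof
      fix s :: real assume s: "0 \<le> s" "s \<le> 1"
      then show "(deriv (mixture \<beta> \<gamma>) has_real_derivative deriv (deriv (mixture \<beta> \<gamma>)) s) (at s)"
        using d2[of s] zeta[of s] by simp
      show "0 \<le> deriv (deriv (mixture \<beta> \<gamma>)) s" using zeta[of s] nonneg[of s] s by simp
      show "deriv (deriv (mixture \<beta> \<gamma>)) s \<le> max 1 K" using zeta[of s] K[of s] s by auto
    next
      fix s :: real assume s: "0 < s" "s \<le> 1"
      then show "0 < deriv (deriv (mixture \<beta> \<gamma>)) s" using zeta[of s] pos[of s] by simp
    next
      show "continuous_on {0..1} (deriv (deriv (mixture \<beta> \<gamma>)))"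
        by (rule continuous_on_eq[OF zc]) (use zeta in auto)
    qed simp
  qed
qed

theorem proposition1:
  fixes \<beta> h :: real
    and \<gamma> :: "nat \<Rightarrow> real"
    and \<xi> \<zeta> :: "real \<Rightarrow> real"
    and \<mu>\<^sub>P :: "real measure"
    and M :: "'a measure"
    and F :: "real \<Rightarrow> 'a measure"
    and B X :: "real \<Rightarrow> 'a \<Rightarrow> real"
  assumes "\<beta> > 0"
    and "\<forall>p\<ge>2. \<gamma> p \<ge> 0"
    and "\<exists>p\<ge>2. \<gamma> p \<noteq> 0"
    and "summable (\<lambda>p. 2 ^ p * (\<gamma> p)\<^sup>2)"
    and "\<xi> = mixture \<beta> \<gamma>"
    and "\<zeta> = deriv (deriv \<xi>)"
    and "is_parisi_measure \<xi> h \<mu>\<^sub>P"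
    and "prob_space M"
    and "usual_filtration M F"
    and "brownian_motion M F B"
    and "solves_parisi_sde M F B \<xi> h \<mu>\<^sub>P X"
  shows "\<forall>q\<in>support \<mu>\<^sub>P.
           (LINT \<omega>|M. (dx_Phi \<xi> \<mu>\<^sub>P q (X q \<omega>))\<^sup>2) = q \<and>
           \<zeta> q * (LINT \<omega>|M. (dxx_Phi \<xi> \<mu>\<^sub>P q (X q \<omega>))\<^sup>2) \<le> 1"
proof
  fix q assume q: "q \<in> support \<mu>\<^sub>P"
  obtain K where K: "parisi_pde \<xi> K"
    using mixture_parisi_pde[OF assms(1-4)] unfolding assms(5) .
  have mu: "\<mu>\<^sub>P \<in> prob_measures_01"
    using assms(7) unfolding is_parisi_measure_def is_arg_min_def by simp
  have min: "parisi_functional \<xi> h \<mu>\<^sub>P \<le> parisi_functional \<xi> h \<nu>"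
    if "\<nu> \<in> prob_measures_01" for \<nu>
    using assms(7) that unfolding is_parisi_measure_def is_arg_min_def by (auto simp: not_less)
  interpret prob_space M by (rule assms(8))
  interpret parisi_sde M F B \<xi> K \<mu>\<^sub>P h X
    by (intro parisi_sde.intro wiener_pde.intro wiener.intro wiener_axioms.intro parisi_sde_axioms.intro K assms(8-11)) (rule mu)
  show "(LINT \<omega>|M. (dx_Phi \<xi> \<mu>\<^sub>P q (X q \<omega>))\<^sup>2) = q \<and>
      \<zeta> q * (LINT \<omega>|M. (dxx_Phi \<xi> \<mu>\<^sub>P q (X q \<omega>))\<^sup>2) \<le> 1"
    using psi_support[OF min q] dxx_support[OF min q] unfolding assms(6) psi_def by simp
qed

end
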